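(* Let $\tilde{\mathbb{F}}_1\subset\mathbb{P}^7$, $\tilde{D_8}\subset\mathbb{P}^7$, $\tilde{D_7}\subset\mathbb{P}^6$, $\tilde{D_6}\subset\mathbb{P}^5$ be the linear projections, from a generic point of the ambient projective space, of the anticanonically embedded del Pezzo surfaces $\mathbb{F}_1\subset\mathbb{P}^8$, $D_8\subset\mathbb{P}^8$, $D_7\subset\mathbb{P}^7$, $D_6\subset\mathbb{P}^6$ respectively. Then: (1) The ideal of $\tilde{\mathbb{F}}_1$ in the homogeneous coordinate ring of $\mathbb{P}^7$ is generated by $11$ quadrics and one cubic. (2) The ideal of $\tilde{D_8}\subset\mathbb{P}^7$ is generated by $11$ quadrics. (3) The ideal of $\tilde{D_7}\subset\mathbb{P}^6$ is generated by $6$ quadrics and $3$ cubics. (4) The ideal of $\tilde{D_6}\subset\mathbb{P}^5$ is generated by $2$ quadrics and $7$ cubics.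
   Context: The ground field is $\mathbb{C}$. $D_i\subset\mathbb{P}^i$ for $i=6,7$ is the anticanonically embedded smooth del Pezzo surface of degree $i$; $D_8\subset\mathbb{P}^8$ is the double Veronese embedding of a smooth quadric surface ($\mathbb{P}^1\times\mathbb{P}^1$ embedded anticanonically); $\mathbb{F}_1\subset\mathbb{P}^8$ is the blow-up of $\mathbb{P}^2$ in one point embedded by the anticanonical system. The numbers of generators refer to a minimal set of homogeneous generators of the homogeneous (saturated) ideal. *)

theory Defs
  imports "HOL-Analysis.Analysis" "HOL-Library.Poly_Mapping"
begin

text \<open>
  The homogeneous coordinate ring of the complex projective space of dimension
  \<open>CARD('n) - 1\<close>: polynomials with complex coefficients in variables indexed by \<open>'n\<close>.
\<close>

type_synonym 'n mpoly = "('n \<Rightarrow>\<^sub>0 nat) \<Rightarrow>\<^sub>0 complex"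

definition const_scale :: "complex \<Rightarrow> 'n mpoly \<Rightarrow> 'n mpoly"
  where "const_scale c F = Poly_Mapping.single 0 c * F"

definition eval_poly :: "'n::finite mpoly \<Rightarrow> complex^'n \<Rightarrow> complex"
  where "eval_poly F x =
    (\<Sum>m\<in>Poly_Mapping.keys F. Poly_Mapping.lookup F m * (\<Prod>i\<in>UNIV. x $ i ^ Poly_Mapping.lookup m i))"

definition partial_deriv :: "'n \<Rightarrow> 'n mpoly \<Rightarrow> 'n mpoly"
  where "partial_deriv i F =
    (\<Sum>m\<in>Poly_Mapping.keys F. Poly_Mapping.single (m - Poly_Mapping.single i 1)
       (of_nat (Poly_Mapping.lookup m i) * Poly_Mapping.lookup F m))"

definition forms :: "nat \<Rightarrow> 'n::finite mpoly set"
  where "forms d = {F. \<forall>m\<in>Poly_Mapping.keys F. (\<Sum>i\<in>UNIV. Poly_Mapping.lookup m i) = d}"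

interpretation poly_ideal: module "(*) :: 'n mpoly \<Rightarrow> 'n mpoly \<Rightarrow> 'n mpoly"
  by unfold_locales (simp_all add: algebra_simps)

interpretation poly_vs: vector_space "const_scale :: complex \<Rightarrow> 'n mpoly \<Rightarrow> 'n mpoly"
proof
  fix a b :: complex and F G :: "'n mpoly"
  show "const_scale a (F + G) = const_scale a F + const_scale a G"
    unfolding const_scale_def by (rule distrib_left)
  show "const_scale (a + b) F = const_scale a F + const_scale b F"
    unfolding const_scale_def single_add by (rule distrib_right)
  show "const_scale a (const_scale b F) = const_scale (a * b) F"
    unfolding const_scale_def mult.assoc[symmetric] mult_single by simp
  show "const_scale 1 F = F"
    unfolding const_scale_def by simp
qed

text \<open>The ideal generated by a set is its span over the polynomial ring.\<close>

abbreviation ideal_gen :: "'n mpoly set \<Rightarrow> 'n mpoly set"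
  where "ideal_gen G \<equiv> poly_ideal.span G"

definition is_basis :: "('k \<Rightarrow> 'n mpoly) \<Rightarrow> 'n mpoly set \<Rightarrow> bool"
  where "is_basis f L \<longleftrightarrow> inj f \<and> poly_vs.independent (range f) \<and> poly_vs.span (range f) = L"


text \<open>
  A point of projective space is given by its nonzero vectors of homogeneous coordinates, and
  a subset of projective space by the set of all such vectors of all its points
  (a cone with the origin removed).
\<close>

definition proj_zeros :: "'n::finite mpoly set \<Rightarrow> (complex^'n) set"
  where "proj_zeros S = {x. x \<noteq> 0 \<and> (\<forall>F\<in>S. eval_poly F x = 0)}"

definition zariski_closed :: "(complex^'n::finite) set \<Rightarrow> bool"
  where "zariski_closed V \<longleftrightarrow> (\<exists>S. S \<subseteq> (\<Union>d. forms d) \<and> V = proj_zeros S)"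

definition generic_point :: "(complex^'n::finite \<Rightarrow> bool) \<Rightarrow> bool"
  where "generic_point P \<longleftrightarrow>
    (\<exists>V. zariski_closed V \<and> V \<noteq> {x. x \<noteq> 0} \<and> (\<forall>p. p \<noteq> 0 \<and> p \<notin> V \<longrightarrow> P p))"

text \<open>
  Since \<open>Y\<close> is a cone, this ideal is homogeneous; it is the saturated ideal of \<open>Y\<close>.
\<close>

definition vanishing_ideal :: "(complex^'n::finite) set \<Rightarrow> 'n mpoly set"
  where "vanishing_ideal Y = {F. \<forall>x\<in>Y. eval_poly F x = 0}"

text \<open>
  Image of \<open>A\<close> under the rational map \<open>z \<mapsto> (f\<^sub>0(z) : f\<^sub>1(z) : \<dots>)\<close>. The condition \<open>x \<noteq> 0\<close>
  discards the base points, where the map is not defined.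
\<close>

definition proj_image :: "('k::finite \<Rightarrow> 'm::finite mpoly) \<Rightarrow> (complex^'m) set \<Rightarrow> (complex^'k) set"
  where "proj_image f A = {x. x \<noteq> 0 \<and> (\<exists>z\<in>A. \<exists>c. x = c *s (\<chi> j. eval_poly (f j) z))}"

text \<open>
  The projection from \<open>p\<close> is the map given by the linear forms vanishing at \<open>p\<close>; a choice of
  basis \<open>l\<close> is a choice of coordinates on the target.
\<close>

definition is_projection_from ::
    "complex^'n::finite \<Rightarrow> (complex^'n) set \<Rightarrow> (complex^'k::finite) set \<Rightarrow> bool"
  where "is_projection_from p X Y \<longleftrightarrow>
    (\<exists>l. is_basis l {F \<in> forms 1. eval_poly F p = 0} \<and> Y = proj_image l X)"


text \<open>
  For at most three vectors independence means: nonzero, resp. distinct as points of the plane,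
  resp. not collinear. For at most five points this is the usual notion of general
  position (no condition on conics is needed).
\<close>

definition general_position :: "(complex^3) set \<Rightarrow> bool"
  where "general_position Z \<longleftrightarrow> (\<forall>S\<subseteq>Z. card S \<le> 3 \<longrightarrow> vec.independent S)"

text \<open>
  On the blow-up of the plane in the points \<open>Z\<close>, with exceptional curves \<open>E\<^sub>z\<close>, one has
  \<open>-K = 3H - \<Sum>z\<in>Z. E\<^sub>z\<close>, so the complete anticanonical system consists of the cubics
  through \<open>Z\<close>. The blow-up in \<open>9 - d\<close> points in general position is the
  del Pezzo surface of degree \<open>d\<close>; its anticanonical image is the closure of the
  image of the plane under these cubics. Used for \<open>d = 8\<close> (the surface \<open>F\<^sub>1\<close>) and
  \<open>d = 7, 6\<close>.
\<close>

definition anticanonical_blowup_plane :: "nat \<Rightarrow> (complex^'k::finite) set \<Rightarrow> bool"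
  where "anticanonical_blowup_plane d X \<longleftrightarrow>
    (\<exists>Z f. finite Z \<and> card Z + d = 9 \<and> general_position Z \<and>
       is_basis f {F \<in> forms 3. \<forall>z\<in>Z. eval_poly F z = 0} \<and>
       X = zariski_closed hull (proj_image f {z. z \<noteq> 0}))"

definition smooth_quadric :: "4 mpoly \<Rightarrow> bool"
  where "smooth_quadric q \<longleftrightarrow> q \<in> forms 2 \<and>
    (\<forall>x\<in>proj_zeros {q}. \<exists>i. eval_poly (partial_deriv i q) x \<noteq> 0)"

text \<open>
  The double Veronese embedding of the quadric surface \<open>q = 0\<close>, in the hyperplane
  of \<open>P\<^sup>9\<close> that it spans: the \<open>f j\<close> restrict to a basis of the quadratic forms modulo \<open>q\<close>.
\<close>

definition double_veronese_quadric :: "(complex^9) set \<Rightarrow> bool"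
  where "double_veronese_quadric X \<longleftrightarrow>
    (\<exists>q f. smooth_quadric q \<and> is_basis (case_option q f) (forms 2) \<and>
       X = proj_image f (proj_zeros {q}))"


text \<open>
  \<open>Q \<union> C\<close> is a minimal set of generators of \<open>I\<close>, with \<open>Q\<close> consisting of \<open>a\<close> quadrics and
  \<open>C\<close> of \<open>b\<close> cubics. (Minimality forces \<open>0 \<notin> Q \<union> C\<close>, so \<open>Q\<close> and \<open>C\<close> are disjoint.)
\<close>

definition minimally_generated_by_quadrics_cubics :: "'n::finite mpoly set \<Rightarrow> nat \<Rightarrow> nat \<Rightarrow> bool"
  where "minimally_generated_by_quadrics_cubics I a b \<longleftrightarrow>
    (\<exists>Q C. Q \<subseteq> forms 2 \<and> C \<subseteq> forms 3 \<and> finite Q \<and> finite C \<and> card Q = a \<and> card C = b \<and>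
       ideal_gen (Q \<union> C) = I \<and> (\<forall>G. G \<subset> Q \<union> C \<longrightarrow> ideal_gen G \<noteq> I))"

end

theory Submission imports Defs begin

text \<open>
  In suitable coordinates each of the four surfaces is the closure of the image of the torus under the
  monomials \<open>x\<^sup>m\<close>, where \<open>m\<close> runs through the lattice points of a reflexive polygon (a hexagon, a
  pentagon, a trapezoid and a square). Projecting from \<open>p\<close> replaces the monomials by a basis \<open>w i\<close> of the
  Laurent polynomials on the polygon whose coefficient vectors are annihilated by \<open>p\<close>. For generic \<open>p\<close>
  the products \<open>w i * w j\<close> still span the Laurent polynomials on the doubled polygon. Hence the
  dimensions of the graded pieces of the ideal are known, and exactness of the Koszul complex of the
  monomials carries over to the \<open>w i\<close> far enough to show that quadrics and cubics generate the ideal.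
  The number of cubics is bounded from above by semicontinuity: when \<open>p\<close> specialises to the
  monomial at the centre of the polygon, the count becomes one of connected components of a graph
  on lattice points. It is bounded from below by dimensions alone for the hexagon and by restricting
  the equations to a linear subspace that meets the surface in a rational curve (pentagon) or in
  three points of a line (trapezoid).
\<close>


text \<open>The obstacle is that the projected surface is not linearly normal: its linear forms miss
  one dimension of \<open>S 1\<close>, so exactness of the Koszul complex cannot be applied to them
  directly. The missing element is the centre monomial, which is 1. Rewriting a Koszul boundary of
  monomials in terms of the \<open>w i\<close> and 1 leaves a remainder that only pairs a
  \<open>w i\<close> with 1 and has smaller degree.

  The number of cubic generators is the codimension of \<open>U\<close>, the span of the products of
  variables with quadrics of the ideal, inside the cubics of the ideal. The space of all cubics
  modulo \<open>U\<close> is a cokernel depending polynomially on \<open>p\<close>, so its dimension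
  can only drop when \<open>p\<close> becomes generic. At the centre this cokernel is graded by the
  lattice, and its dimension is bounded by the number of points of the tripled polygon plus 7, 3, 1
  and 0. That it drops no further is the lower bound. It rests on classical facts about the
  sections: a rational quartic in projective 3-space needs three cubics besides its quadric, and
  three points of a line need one cubic. These sections come from conics apolar to \<open>p\<close>,
  where \<open>p\<close> is read as a functional on plane cubics.\<close>

abbreviation coef :: "('a \<Rightarrow>\<^sub>0 'b::zero) \<Rightarrow> 'a \<Rightarrow> 'b" where "coef \<equiv> Poly_Mapping.lookup"
abbreviation supp :: "('a \<Rightarrow>\<^sub>0 'b::zero) \<Rightarrow> 'a set" where "supp \<equiv> Poly_Mapping.keys"
abbreviation sgl :: "'a \<Rightarrow> 'b \<Rightarrow> ('a \<Rightarrow>\<^sub>0 'b::zero)" where "sgl \<equiv> Poly_Mapping.single"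

abbreviation mdeg :: "('n::finite \<Rightarrow>\<^sub>0 nat) \<Rightarrow> nat" where "mdeg m \<equiv> (\<Sum>i\<in>UNIV. coef m i)"

lemma mdeg_add: "mdeg (m + m') = mdeg m + mdeg m'"
  by (simp add: lookup_add sum.distrib)

lemma mdeg_single: "mdeg (sgl i k) = k"
proof -
  have "mdeg (sgl i k) = (\<Sum>j\<in>UNIV. if j = i then k else 0)"
    by (intro sum.cong) (auto simp: lookup_single when_def)
  then show ?thesis by simp
qed

lemma sum_single: "F = (\<Sum>m\<in>supp F. sgl m (coef F m))"
proof (rule poly_mapping_eqI)
  fix k
  have "coef (\<Sum>m\<in>supp F. sgl m (coef F m)) k = (\<Sum>m\<in>supp F. if m = k then coef F m else 0)"
    unfolding lookup_sum by (intro sum.cong) (auto simp: lookup_single when_def)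
  also have "\<dots> = coef F k"
    by (simp add: in_keys_iff)
  finally show "coef F k = coef (\<Sum>m\<in>supp F. sgl m (coef F m)) k" by simp
qed

lemma coef_single_mult:
  fixes F :: "'a::ab_group_add \<Rightarrow>\<^sub>0 complex"
  shows "coef (sgl u c * F) v = c * coef F (v - u)"
proof -
  have "coef (sgl u c * F) v = coef (\<Sum>m\<in>supp F. sgl (u + m) (c * coef F m)) v"
    by (subst (1) sum_single[of F]) (simp add: sum_distrib_left mult_single)
  also have "\<dots> = (\<Sum>m\<in>supp F. if m = v - u then c * coef F m else 0)"
    unfolding lookup_sum by (intro sum.cong) (auto simp: lookup_single when_def)
  also have "\<dots> = c * coef F (v - u)"
    by (auto simp: in_keys_iff)
  finally show ?thesis .
qed

section \<open>Substitution into polynomials\<close>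

definition var :: "'n \<Rightarrow> 'n mpoly" where "var i = sgl (sgl i 1) 1"

text \<open>With the coefficient map \<open>h\<close> as a parameter, one construction covers
  evaluation at complex points, substitution of polynomials and substitution of Laurent
  polynomials.\<close>

definition psubst :: "(complex \<Rightarrow> 'r) \<Rightarrow> ('n \<Rightarrow> 'r) \<Rightarrow> 'n::finite mpoly \<Rightarrow> 'r::comm_ring_1" where
  "psubst h x F = (\<Sum>m\<in>supp F. h (coef F m) * (\<Prod>i\<in>UNIV. x i ^ coef m i))"

lemma eval_poly_psubst: "eval_poly F x = psubst (\<lambda>c. c) (($) x) F"
  by (simp add: eval_poly_def psubst_def)

locale scalar_hom =
  fixes h :: "complex \<Rightarrow> 'r::comm_ring_1"
  assumes hom_add: "h (a + b) = h a + h b"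
    and hom_mult: "h (a * b) = h a * h b"
    and hom_one: "h 1 = 1"
begin

lemma hom_zero: "h 0 = 0"
  using hom_add[of 0 0] by simp

lemma hom_uminus: "h (- a) = - h a"
  using hom_add[of a "- a"] hom_zero by (simp add: minus_unique)

lemma psubst_superset:
  assumes "finite S" "supp F \<subseteq> S"
  shows "psubst h x F = (\<Sum>m\<in>S. h (coef F m) * (\<Prod>i\<in>UNIV. x i ^ coef m i))"
  unfolding psubst_def using assms
  by (intro sum.mono_neutral_left) (auto simp: in_keys_iff hom_zero)

lemma psubst_zero: "psubst h x 0 = 0"
  by (simp add: psubst_def)

lemma psubst_add: "psubst h x (F + G) = psubst h x F + psubst h x G"
proof -
  let ?S = "supp F \<union> supp G"
  have *: "supp (F + G) \<subseteq> ?S" by (rule keys_add)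
  show ?thesis
    using psubst_superset[of ?S F x] psubst_superset[of ?S G x] psubst_superset[OF _ *, of x]
    by (simp add: lookup_add hom_add distrib_right sum.distrib)
qed

lemma psubst_sum: "psubst h x (\<Sum>a\<in>A. F a) = (\<Sum>a\<in>A. psubst h x (F a))"
  by (induction A rule: infinite_finite_induct) (simp_all add: psubst_zero psubst_add)

lemma psubst_single: "psubst h x (sgl m c) = h c * (\<Prod>i\<in>UNIV. x i ^ coef m i)"
  by (simp add: psubst_def hom_zero)

lemma psubst_const: "psubst h x (sgl 0 c) = h c"
  by (simp add: psubst_single)

lemma psubst_one: "psubst h x 1 = 1"
  using psubst_const[of x 1] by (simp add: hom_one)

lemma psubst_uminus: "psubst h x (- F) = - psubst h x F"
  by (simp add: psubst_def hom_uminus sum_negf)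

lemma psubst_diff: "psubst h x (F - G) = psubst h x F - psubst h x G"
  using psubst_add[of x F "- G"] by (simp add: psubst_uminus)

lemma psubst_mult: "psubst h x (F * G) = psubst h x F * psubst h x G"
proof -
  have s: "psubst h x (sgl m c * sgl m' c') = psubst h x (sgl m c) * psubst h x (sgl m' c')" for m c m' c'
    by (simp add: mult_single psubst_single lookup_add power_add prod.distrib hom_mult mult_ac)
  have "F * G = (\<Sum>m\<in>supp F. \<Sum>m'\<in>supp G. sgl m (coef F m) * sgl m' (coef G m'))"
    by (subst (1) sum_single[of F], subst (1) sum_single[of G]) (simp add: sum_product)
  then have "psubst h x (F * G) =
    (\<Sum>m\<in>supp F. psubst h x (sgl m (coef F m))) * (\<Sum>m'\<in>supp G. psubst h x (sgl m' (coef G m')))"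
    by (simp add: psubst_sum s sum_product)
  then show ?thesis
    unfolding psubst_sum[symmetric] sum_single[symmetric] .
qed

lemma psubst_var: "psubst h x (var i) = x i"
proof -
  have "(\<Prod>j\<in>UNIV. x j ^ coef (sgl i 1) j) = (\<Prod>j\<in>UNIV. if j = i then x j else 1)"
    by (intro prod.cong) (auto simp: lookup_single when_def)
  then show ?thesis by (simp add: var_def psubst_single hom_one)
qed

lemma psubst_power: "psubst h x (F ^ k) = psubst h x F ^ k"
  by (induction k) (simp_all add: psubst_one psubst_mult)

lemma psubst_prod: "psubst h x (\<Prod>a\<in>A. F a) = (\<Prod>a\<in>A. psubst h x (F a))"
  by (induction A rule: infinite_finite_induct) (simp_all add: psubst_one psubst_mult)

lemma psubst_scale: "psubst h x (const_scale c F) = h c * psubst h x F"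
  by (simp add: const_scale_def psubst_mult psubst_const)

end

interpretation id_hom: scalar_hom "\<lambda>c::complex. c"
  by unfold_locales auto

interpretation const_hom: scalar_hom "\<lambda>c. sgl (0 :: 'a::comm_monoid_add) (c::complex)"
  by unfold_locales (auto simp: single_add mult_single)

abbreviation psub :: "('n::finite \<Rightarrow> 'm mpoly) \<Rightarrow> 'n mpoly \<Rightarrow> 'm::finite mpoly" where
  "psub \<equiv> psubst (\<lambda>c. sgl 0 c)"

lemma (in scalar_hom) psubst_psubst:
  "psubst h y (psub G F) = psubst h (\<lambda>i. psubst h y (G i)) F"
  unfolding psubst_def[of "sgl 0"] psubst_def[of h "\<lambda>i. psubst h y (G i)"]
  by (simp add: psubst_sum psubst_mult psubst_const psubst_prod psubst_power)

lemma nth_lambda: "($) (\<chi> i. f i) = f"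
  by (rule ext) simp

lemma eval_psub: "eval_poly (psub G F) y = eval_poly F (\<chi> i. eval_poly (G i) y)"
  by (simp add: eval_poly_psubst id_hom.psubst_psubst nth_lambda)

lemma single_eq_var_prod: "sgl m c = sgl 0 c * (\<Prod>i\<in>UNIV. var i ^ coef m i)" for m :: "'n::finite \<Rightarrow>\<^sub>0 nat"
proof -
  have p: "var i ^ k = sgl (sgl i k) 1" for i :: 'n and k
    by (induction k) (simp_all add: var_def mult_single single_add[symmetric])
  have q: "(\<Prod>i\<in>A. sgl (f i) (1::complex)) = sgl (\<Sum>i\<in>A. f i) 1" if "finite A" for A and f :: "'n \<Rightarrow> ('n \<Rightarrow>\<^sub>0 nat)"
    using that by induction (simp_all add: mult_single)
  have "(\<Sum>i\<in>UNIV. sgl i (coef m i)) = m"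
  proof (rule poly_mapping_eqI)
    fix k
    have "coef (\<Sum>i\<in>UNIV. sgl i (coef m i)) k = (\<Sum>i\<in>UNIV. if i = k then coef m i else 0)"
      unfolding lookup_sum by (intro sum.cong) (auto simp: lookup_single when_def)
    then show "coef (\<Sum>i\<in>UNIV. sgl i (coef m i)) k = coef m k" by simp
  qed
  then show ?thesis by (simp add: p q mult_single)
qed

lemma psub_var: "psub var F = F"
proof -
  have "psub var F = (\<Sum>m\<in>supp F. sgl m (coef F m))"
    unfolding psubst_def by (intro sum.cong refl) (simp add: single_eq_var_prod[symmetric])
  then show ?thesis by (simp add: sum_single[symmetric])
qed

section \<open>Forms\<close>

lemma forms_iff: "F \<in> forms n \<longleftrightarrow> (\<forall>m. coef F m \<noteq> 0 \<longrightarrow> mdeg m = n)"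
  by (auto simp: forms_def in_keys_iff)

lemma forms_zero: "0 \<in> forms n" by (simp add: forms_iff)

lemma forms_add: "F \<in> forms n \<Longrightarrow> G \<in> forms n \<Longrightarrow> F + G \<in> forms n"
  by (simp add: forms_iff lookup_add) (metis add_0)

lemma forms_diff: "F \<in> forms n \<Longrightarrow> G \<in> forms n \<Longrightarrow> F - G \<in> forms n"
  by (simp add: forms_iff lookup_minus) metis

lemma forms_sum: "(\<And>a. a \<in> A \<Longrightarrow> F a \<in> forms n) \<Longrightarrow> (\<Sum>a\<in>A. F a) \<in> forms n"
  by (induction A rule: infinite_finite_induct) (auto simp: forms_zero forms_add)

lemma forms_mult: "F \<in> forms n \<Longrightarrow> G \<in> forms k \<Longrightarrow> F * G \<in> forms (n + k)"
  using keys_mult[of F G] unfolding forms_def by (fastforce simp: mdeg_add)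

lemma forms_single: "sgl m c \<in> forms (mdeg m)"
  by (auto simp: forms_iff lookup_single when_def)

lemma forms_const: "sgl 0 c \<in> forms 0"
  using forms_single[of 0 c] by simp

lemma forms_var: "var i \<in> forms 1"
  unfolding var_def using forms_single[of "sgl i 1" 1] mdeg_single[of i 1] by metis

lemma forms_scale: "F \<in> forms n \<Longrightarrow> const_scale c F \<in> forms n"
  unfolding const_scale_def using forms_mult[OF forms_const, of F n c] by simp

lemma forms_var_mult: "F \<in> forms n \<Longrightarrow> var i * F \<in> forms (Suc n)"
  using forms_mult[OF forms_var, of F n i] by simp

lemma subspace_forms: "poly_vs.subspace (forms n)"
  by (intro poly_vs.subspaceI) (auto simp: forms_zero forms_add forms_scale)

lemma forms_one: "1 \<in> forms 0"
  using forms_const[of 1] by simp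

lemma forms_prod:
  "finite A \<Longrightarrow> (\<And>a. a \<in> A \<Longrightarrow> F a \<in> forms (d a)) \<Longrightarrow> (\<Prod>a\<in>A. F a) \<in> forms (\<Sum>a\<in>A. d a)"
  by (induction A rule: finite_induct) (auto simp: forms_one forms_mult)

lemma forms_power: "F \<in> forms d \<Longrightarrow> F ^ k \<in> forms (k * d)"
  by (induction k) (auto simp: forms_one forms_mult)

lemma psub_forms:
  assumes "F \<in> forms n" "\<And>i. G i \<in> forms d"
  shows "psub G F \<in> forms (n * d)"
proof -
  have "sgl 0 (coef F m) * (\<Prod>i\<in>UNIV. G i ^ coef m i) \<in> forms (n * d)" if "m \<in> supp F" for m
  proof -
    have "(\<Prod>i\<in>UNIV. G i ^ coef m i) \<in> forms (\<Sum>i\<in>UNIV. coef m i * d)"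
      by (intro forms_prod forms_power assms) auto
    moreover have "(\<Sum>i\<in>UNIV. coef m i * d) = n * d"
      using assms(1) that by (simp add: forms_def sum_distrib_right[symmetric])
    ultimately show ?thesis using forms_mult[OF forms_const, of _ "n * d" "coef F m"] by simp
  qed
  then show ?thesis unfolding psubst_def by (intro forms_sum)
qed

text \<open>Each monomial of positive degree is assigned one variable \<open>j m\<close> dividing
  it, and \<open>G i\<close> collects the monomials assigned to \<open>i\<close>. The splitting is
  not unique; the Koszul argument later exploits exactly this freedom.\<close>

lemma forms_Suc_decomp:
  assumes "F \<in> forms (Suc n)"
  obtains G where "\<And>i. G i \<in> forms n" "F = (\<Sum>i\<in>UNIV. var i * G i)"
proof -
  have "\<exists>i. coef m i \<noteq> 0" if "m \<in> supp F" for m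
    using assms that unfolding forms_def by (metis (mono_tags, lifting) mem_Collect_eq nat.distinct(1) sum.neutral)
  then obtain j where j: "\<And>m. m \<in> supp F \<Longrightarrow> coef m (j m) \<noteq> 0" by metis
  define G where "G i = (\<Sum>m\<in>{m\<in>supp F. j m = i}. sgl (m - sgl i 1) (coef F m))" for i
  have split: "sgl i 1 + (m - sgl i 1) = m" if "coef m i \<noteq> 0" for m :: "'a \<Rightarrow>\<^sub>0 nat" and i
    by (rule poly_mapping_eqI) (use that in \<open>auto simp: lookup_add lookup_minus lookup_single when_def\<close>)
  have "G i \<in> forms n" for i
    unfolding G_def
  proof (intro forms_sum)
    fix m assume "m \<in> {m\<in>supp F. j m = i}"
    then have m: "m \<in> supp F" "j m = i" by auto
    have "mdeg (sgl i 1 + (m - sgl i 1)) = Suc n"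
      using split[OF j[OF m(1)]] m assms unfolding forms_def by auto
    then have "mdeg (m - sgl i 1) = n" unfolding mdeg_add mdeg_single by simp
    then show "sgl (m - sgl i 1) (coef F m) \<in> forms n" using forms_single by metis
  qed
  moreover have "F = (\<Sum>i\<in>UNIV. var i * G i)"
  proof -
    have "(\<Sum>i\<in>UNIV. var i * G i) = (\<Sum>i\<in>UNIV. \<Sum>m\<in>{m\<in>supp F. j m = i}. sgl m (coef F m))"
      unfolding G_def sum_distrib_left var_def
      by (intro sum.cong refl) (use split j in \<open>auto simp: mult_single\<close>)
    also have "\<dots> = (\<Sum>m\<in>supp F. sgl m (coef F m))"
      by (subst sum.group) auto
    finally show ?thesis using sum_single[of F] by simp
  qed
  ultimately show ?thesis using that by blast
qed

lemma (in scalar_hom) psubst_homogeneous: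
  assumes "F \<in> forms n"
  shows "psubst h (\<lambda>i. c * x i) F = c ^ n * psubst h x F"
  unfolding psubst_def sum_distrib_left
proof (intro sum.cong refl)
  fix m assume "m \<in> supp F"
  then have "mdeg m = n" using assms by (simp add: forms_def)
  then show "h (coef F m) * (\<Prod>i\<in>UNIV. (c * x i) ^ coef m i) = c ^ n * (h (coef F m) * (\<Prod>i\<in>UNIV. x i ^ coef m i))"
    by (simp add: power_mult_distrib prod.distrib power_sum[symmetric] mult_ac)
qed

lemma eval_homogeneous: "F \<in> forms n \<Longrightarrow> eval_poly F (c *s x) = c ^ n * eval_poly F x"
  using id_hom.psubst_homogeneous[of F n c "($) x"] nth_lambda[of "\<lambda>i. c * x $ i"]
  by (simp add: eval_poly_psubst vector_scalar_mult_def)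

subsection \<open>Homogeneous components\<close>

definition hcomp :: "nat \<Rightarrow> 'n::finite mpoly \<Rightarrow> 'n mpoly" where
  "hcomp n F = (\<Sum>m\<in>{m\<in>supp F. mdeg m = n}. sgl m (coef F m))"

lemma coef_hcomp: "coef (hcomp n F) m = (if mdeg m = n then coef F m else 0)"
proof -
  have "coef (hcomp n F) m = (\<Sum>m'\<in>{m\<in>supp F. mdeg m = n}. if m' = m then coef F m' else 0)"
    unfolding hcomp_def lookup_sum by (intro sum.cong) (auto simp: lookup_single when_def)
  also have "\<dots> = (if mdeg m = n then coef F m else 0)"
    by (auto simp: in_keys_iff)
  finally show ?thesis .
qed

lemma hcomp_forms: "hcomp n F \<in> forms n"
  by (simp add: forms_iff coef_hcomp)

lemma hcomp_add: "hcomp n (F + G) = hcomp n F + hcomp n G"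
  by (rule poly_mapping_eqI) (simp add: coef_hcomp lookup_add)

lemma hcomp_zero: "hcomp n 0 = 0"
  by (rule poly_mapping_eqI) (simp add: coef_hcomp)

lemma hcomp_sum: "hcomp n (\<Sum>a\<in>A. F a) = (\<Sum>a\<in>A. hcomp n (F a))"
  by (induction A rule: infinite_finite_induct) (simp_all add: hcomp_add hcomp_zero)

lemma hcomp_of_form: "F \<in> forms k \<Longrightarrow> hcomp n F = (if n = k then F else 0)"
  by (rule poly_mapping_eqI) (auto simp: coef_hcomp forms_iff)

lemma hcomp_decomp:
  obtains N where "F = (\<Sum>n\<le>N. hcomp n F)"
proof -
  define N where "N = Max (mdeg ` supp F)"
  have "F = (\<Sum>n\<le>N. hcomp n F)"
  proof (rule poly_mapping_eqI)
    fix m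
    have "coef (\<Sum>n\<le>N. hcomp n F) m = (\<Sum>n\<le>N. if n = mdeg m then coef F m else 0)"
      unfolding lookup_sum coef_hcomp by (intro sum.cong) auto
    also have "\<dots> = coef F m"
    proof (cases "coef F m = 0")
      case False
      then have "mdeg m \<in> mdeg ` supp F" by (auto simp: in_keys_iff)
      then have "mdeg m \<le> N" unfolding N_def by (intro Max_ge) auto
      then show ?thesis by simp
    qed auto
    finally show "coef F m = coef (\<Sum>n\<le>N. hcomp n F) m" by simp
  qed
  then show ?thesis using that by blast
qed

lemma hcomp_mult:
  assumes "G \<in> forms k"
  shows "hcomp n (F * G) = (if k \<le> n then hcomp (n - k) F * G else 0)"
proof -
  obtain N where N: "F = (\<Sum>i\<le>N. hcomp i F)" by (rule hcomp_decomp)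
  \<comment> \<open>The upper limit is raised to at least \<open>n\<close>, so that the index
    \<open>n - k\<close> certainly occurs in the sum.\<close>
  define M where "M = max N n"
  have F: "F = (\<Sum>i\<le>M. hcomp i F)"
  proof (rule poly_mapping_eqI)
    fix m
    have *: "coef (\<Sum>i\<le>K. hcomp i F) m = (if mdeg m \<le> K then coef F m else 0)" for K
      unfolding lookup_sum coef_hcomp by simp
    show "coef F m = coef (\<Sum>i\<le>M. hcomp i F) m"
      using arg_cong[OF N, of "\<lambda>F. coef F m"] unfolding * M_def by (auto split: if_splits)
  qed
  have "hcomp n (F * G) = (\<Sum>i\<le>M. hcomp n (hcomp i F * G))"
    by (subst F) (simp add: sum_distrib_right hcomp_sum)
  also have "\<dots> = (\<Sum>i\<le>M. if i + k = n then hcomp i F * G else 0)"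
    using hcomp_of_form[OF forms_mult[OF hcomp_forms assms], of n _ F]
    by (intro sum.cong) auto
  also have "\<dots> = (if k \<le> n then hcomp (n - k) F * G else 0)"
  proof (cases "k \<le> n")
    case True
    have "(\<Sum>i\<le>M. if i + k = n then hcomp i F * G else 0) = (\<Sum>i\<le>M. if i = n - k then hcomp i F * G else 0)"
      using True by (intro sum.cong) auto
    then show ?thesis using True by (simp add: M_def)
  qed (auto intro: sum.neutral)
  finally show ?thesis .
qed

section \<open>Vanishing of polynomial functions\<close>

text \<open>Dedekind's argument: subtracting \<open>chi t b\<close> times the relation from its
  translate by \<open>b\<close> removes the term \<open>t\<close> and multiplies each other
  coefficient by \<open>chi s b - chi t b\<close>. It serves for monomials on affine space and for
  Laurent monomials on the torus.\<close>

lemma characters_independent: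
  fixes chi :: "'s \<Rightarrow> 'g \<Rightarrow> complex"
  assumes "finite S"
    and closed: "\<And>a b. a \<in> G \<Longrightarrow> b \<in> G \<Longrightarrow> mul a b \<in> G" and e: "e \<in> G"
    and mult: "\<And>s a b. a \<in> G \<Longrightarrow> b \<in> G \<Longrightarrow> chi s (mul a b) = chi s a * chi s b"
    and one: "\<And>s. chi s e = 1"
    and distinct: "\<And>s t. s \<noteq> t \<Longrightarrow> \<exists>a\<in>G. chi s a \<noteq> chi t a"
    and zero: "\<And>a. a \<in> G \<Longrightarrow> (\<Sum>s\<in>S. c s * chi s a) = 0"
    and "s \<in> S"
  shows "c s = 0"
  using assms(1) zero \<open>s \<in> S\<close>
proof (induction S arbitrary: c s rule: finite_induct)
  case (insert t S)
  have z: "c s * (chi s b - chi t b) = 0" if "s \<in> S" "b \<in> G" for s b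
  proof (rule insert.IH[of "\<lambda>s. c s * (chi s b - chi t b)", OF _ \<open>s \<in> S\<close>])
    fix a assume a: "a \<in> G"
    have "(\<Sum>s\<in>S. c s * (chi s b - chi t b) * chi s a) =
       (\<Sum>s\<in>insert t S. c s * chi s (mul b a)) - chi t b * (\<Sum>s\<in>insert t S. c s * chi s a)"
      using insert.hyps a that by (simp add: mult sum_distrib_left algebra_simps sum_subtractf)
    also have "\<dots> = 0" using insert.prems(1) closed a that by simp
    finally show "(\<Sum>s\<in>S. c s * (chi s b - chi t b) * chi s a) = 0" .
  qed
  have zS: "c s = 0" if "s \<in> S" for s
  proof -
    from insert.hyps that have "s \<noteq> t" by auto
    from distinct[OF this] z[OF that] show ?thesis by auto
  qed
  moreover have "c t = 0"
    using insert.prems(1)[OF e] insert.hyps zS by (simp add: one)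
  ultimately show ?case using insert.prems(2) by auto
qed simp

lemma eval_poly_eq_zero:
  fixes F :: "'n::finite mpoly"
  assumes "\<And>x. eval_poly F x = 0"
  shows "F = 0"
proof (rule poly_mapping_eqI)
  fix m
  define chi where "chi m x = (\<Prod>i\<in>UNIV. x $ i ^ coef m i)" for m :: "'n \<Rightarrow>\<^sub>0 nat" and x :: "complex^'n"
  have dist: "\<exists>a\<in>UNIV. chi s a \<noteq> chi t a" if "s \<noteq> t" for s t
  proof -
    from that obtain i where i: "coef s i \<noteq> coef t i" by (metis poly_mapping_eqI)
    \<comment> \<open>At the point with 2 in place \<open>i\<close> and 1 elsewhere only the
      exponent at \<open>i\<close> is visible, as a power of 2.\<close>
    have "chi m (\<chi> j. if j = i then 2 else 1) = 2 ^ coef m i" for m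
    proof -
      have "chi m (\<chi> j. if j = i then 2 else 1) = (\<Prod>j\<in>UNIV. if j = i then 2 ^ coef m j else 1)"
        unfolding chi_def by (intro prod.cong) auto
      then show ?thesis by simp
    qed
    moreover have "(2::complex) ^ coef s i \<noteq> 2 ^ coef t i"
    proof
      assume "(2::complex) ^ coef s i = 2 ^ coef t i"
      then have "norm ((2::complex) ^ coef s i) = norm ((2::complex) ^ coef t i)" by simp
      then have "(2::real) ^ coef s i = 2 ^ coef t i" by (simp add: norm_power)
      then show False using i by simp
    qed
    ultimately show ?thesis by (intro bexI[of _ "\<chi> j. if j = i then 2 else 1"]) (simp_all only: UNIV_I not_False_eq_True)
  qed
  have "coef F m = 0" if "m \<in> supp F"
  proof (rule characters_independent[where S = "supp F" and G = UNIV and c = "coef F" and chi = chi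
        and mul = "\<lambda>x y. \<chi> i. x $ i * y $ i" and e = "\<chi> i. 1"])
    show "(\<Sum>s\<in>supp F. coef F s * chi s a) = 0" for a
      using assms[of a] by (simp add: eval_poly_def chi_def)
    show "\<exists>a\<in>UNIV. chi s a \<noteq> chi t a" if "s \<noteq> t" for s t by (rule dist[OF that])
    show "m \<in> supp F" by (rule that)
  qed (simp_all add: chi_def power_mult_distrib prod.distrib)
  then show "coef F m = coef 0 m" by (auto simp: in_keys_iff)
qed

text \<open>Every genericity claim below is proved by exhibiting such a function that is nonzero at
  a single point.\<close>

definition polyfun :: "(complex^'n::finite \<Rightarrow> complex) \<Rightarrow> bool" where
  "polyfun g \<longleftrightarrow> (\<exists>F. g = eval_poly F)"

lemma polyfun_eval: "polyfun (eval_poly F)" by (auto simp: polyfun_def)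

lemma polyfun_const [intro]: "polyfun (\<lambda>x. c)"
  unfolding polyfun_def by (rule exI[of _ "sgl 0 c"]) (auto simp: eval_poly_psubst id_hom.psubst_const)

lemma polyfun_coord [intro]: "polyfun (\<lambda>x. x $ i)"
  unfolding polyfun_def by (rule exI[of _ "var i"]) (auto simp: eval_poly_psubst id_hom.psubst_var)

lemma polyfun_add [intro]: "polyfun f \<Longrightarrow> polyfun g \<Longrightarrow> polyfun (\<lambda>x. f x + g x)"
proof -
  assume "polyfun f" "polyfun g"
  then obtain F G where "f = eval_poly F" "g = eval_poly G" by (auto simp: polyfun_def)
  then show ?thesis unfolding polyfun_def
    by (intro exI[of _ "F + G"]) (auto simp: eval_poly_psubst id_hom.psubst_add)
qed

lemma polyfun_mult [intro]: "polyfun f \<Longrightarrow> polyfun g \<Longrightarrow> polyfun (\<lambda>x. f x * g x)"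
proof -
  assume "polyfun f" "polyfun g"
  then obtain F G where "f = eval_poly F" "g = eval_poly G" by (auto simp: polyfun_def)
  then show ?thesis unfolding polyfun_def
    by (intro exI[of _ "F * G"]) (auto simp: eval_poly_psubst id_hom.psubst_mult)
qed

lemma polyfun_uminus [intro]: "polyfun f \<Longrightarrow> polyfun (\<lambda>x. - f x)"
  using polyfun_mult[OF polyfun_const[of "-1"], of f] by simp

lemma polyfun_diff [intro]: "polyfun f \<Longrightarrow> polyfun g \<Longrightarrow> polyfun (\<lambda>x. f x - g x)"
  using polyfun_add[OF _ polyfun_uminus, of f g] by simp

lemma polyfun_sum [intro]: "(\<And>a. a \<in> A \<Longrightarrow> polyfun (f a)) \<Longrightarrow> polyfun (\<lambda>x. \<Sum>a\<in>A. f a x)"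
  by (induction A rule: infinite_finite_induct) auto

text \<open>Restricting to the line through two points reduces this to univariate polynomials.\<close>

lemma polyfun_mult_nonzero:
  fixes f g :: "complex^'n::finite \<Rightarrow> complex"
  assumes "polyfun f" "polyfun g" "f a \<noteq> 0" "g b \<noteq> 0"
  obtains x where "f x \<noteq> 0" "g x \<noteq> 0"
proof -
  have line: "\<exists>P. \<forall>t. f (\<chi> i. a $ i + t * (b $ i - a $ i)) = poly P t" if f: "polyfun f" for f
  proof -
    from f obtain F where "f = eval_poly F" by (auto simp: polyfun_def)
    then show ?thesis
      by (intro exI[of _ "\<Sum>m\<in>supp F. smult (coef F m) (\<Prod>i\<in>UNIV. [:a $ i, b $ i - a $ i:] ^ coef m i)"])
         (simp add: eval_poly_def poly_sum poly_prod)
  qed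
  obtain P where P: "\<And>t. f (\<chi> i. a $ i + t * (b $ i - a $ i)) = poly P t" using line[OF assms(1)] by blast
  obtain Q where Q: "\<And>t. g (\<chi> i. a $ i + t * (b $ i - a $ i)) = poly Q t" using line[OF assms(2)] by blast
  have "poly P 0 \<noteq> 0" using P[of 0] assms(3) by (simp add: vec_lambda_eta)
  moreover have "poly Q 1 \<noteq> 0" using Q[of 1] assms(4) by (simp add: vec_lambda_eta)
  ultimately have "P * Q \<noteq> 0" by auto
  then have "finite {t. poly (P * Q) t = 0}" by (rule poly_roots_finite)
  then obtain t where "poly (P * Q) t \<noteq> 0"
    using infinite_UNIV_char_0 by (metis (mono_tags, lifting) finite_subset mem_Collect_eq subsetI)
  then show ?thesis using that[of "\<chi> i. a $ i + t * (b $ i - a $ i)"] P Q by auto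
qed


section \<open>Dimensions of finitely spanned subspaces\<close>

locale vspace = vector_space scale
  for scale :: "'a::field \<Rightarrow> 'b::ab_group_add \<Rightarrow> 'b"
begin

text \<open>The polynomial rings have infinite dimension over the complex numbers, where
  \<open>dim\<close> carries no information; all dimension counts therefore take place inside sets
  with this property.\<close>

definition fin_spanned :: "'b set \<Rightarrow> bool" where
  "fin_spanned V \<longleftrightarrow> (\<exists>S. finite S \<and> V \<subseteq> local.span S)"

lemma fin_spanned_span: "finite S \<Longrightarrow> fin_spanned (local.span S)"
  by (auto simp: fin_spanned_def)

lemma fin_spanned_finite: "finite S \<Longrightarrow> fin_spanned S"
  using span_superset by (auto simp: fin_spanned_def)

lemma fin_spanned_subset: "fin_spanned V \<Longrightarrow> U \<subseteq> V \<Longrightarrow> fin_spanned U"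
  by (auto simp: fin_spanned_def)

lemma fin_spanned_Un:
  assumes "fin_spanned U" "fin_spanned V" shows "fin_spanned (local.span (U \<union> V))"
proof -
  from assms obtain S T where "finite S" "U \<subseteq> local.span S" "finite T" "V \<subseteq> local.span T"
    by (auto simp: fin_spanned_def)
  then have "finite (S \<union> T)" "U \<union> V \<subseteq> local.span (S \<union> T)"
    using span_mono[of S "S \<union> T"] span_mono[of T "S \<union> T"] by auto
  then have "finite (S \<union> T)" "local.span (U \<union> V) \<subseteq> local.span (S \<union> T)"
    by (auto simp only: span_minimal[OF _ subspace_span])
  then show ?thesis unfolding fin_spanned_def by blast
qed

lemma independent_card_le:
  assumes "fin_spanned V" "B \<subseteq> V" "local.independent B"
  shows "finite B \<and> card B \<le> local.dim V"
proof -
  obtain S where S: "finite S" "V \<subseteq> local.span S" using assms(1) by (auto simp: fin_spanned_def)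
  obtain C where C: "B \<subseteq> C" "C \<subseteq> V" "local.independent C" "V \<subseteq> local.span C"
    by (rule maximal_independent_subset_extend[OF assms(2,3)])
  have "finite C" using independent_span_bound[OF S(1) C(3)] C S by auto
  then show ?thesis using C basis_card_eq_dim[of C V] card_mono[of C B] finite_subset[of B C] by auto
qed

lemma extend_to_basis:
  assumes "fin_spanned V" "B \<subseteq> V" "local.independent B"
  obtains C where "finite B" "finite C" "B \<inter> C = {}" "C \<subseteq> V" "local.independent (B \<union> C)"
    "V \<subseteq> local.span (B \<union> C)" "local.dim V = card B + card C"
proof -
  obtain D where D: "B \<subseteq> D" "D \<subseteq> V" "local.independent D" "V \<subseteq> local.span D"
    by (rule maximal_independent_subset_extend[OF assms(2,3)])
  have fD: "finite D" using independent_card_le[OF assms(1) D(2,3)] by simp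
  have "card D = card B + card (D - B)"
    using fD D(1) by (metis card_Diff_subset card_mono finite_subset le_add_diff_inverse)
  then show ?thesis using that[of "D - B"] D fD basis_card_eq_dim[of D V]
    by (auto simp: Un_absorb1 finite_subset)
qed

lemma dim_mono_fin:
  assumes "fin_spanned W" "V \<subseteq> local.span W" shows "local.dim V \<le> local.dim W"
proof -
  obtain B where B: "B \<subseteq> W" "local.independent B" "W \<subseteq> local.span B" "card B = local.dim W" by (rule basis_exists)
  have "finite B" using independent_card_le[OF assms(1) B(1,2)] by simp
  moreover have "V \<subseteq> local.span B" using assms(2) B(3) span_minimal[of W "local.span B"] by auto
  ultimately show ?thesis using dim_le_card B(4) by metis
qed

lemma dim_Un_le:
  assumes "fin_spanned U" "fin_spanned V" shows "local.dim (local.span (U \<union> V)) \<le> local.dim U + local.dim V"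
proof -
  obtain A where A: "A \<subseteq> U" "local.independent A" "U \<subseteq> local.span A" "card A = local.dim U" by (rule basis_exists)
  obtain B where B: "B \<subseteq> V" "local.independent B" "V \<subseteq> local.span B" "card B = local.dim V" by (rule basis_exists)
  have "finite A" "finite B"
    using independent_card_le[OF assms(1) A(1,2)] independent_card_le[OF assms(2) B(1,2)] by auto
  moreover have "U \<union> V \<subseteq> local.span (A \<union> B)"
    using A(3) B(3) span_mono[of A "A \<union> B"] span_mono[of B "A \<union> B"] by auto
  then have "local.span (U \<union> V) \<subseteq> local.span (A \<union> B)"
    by (rule span_minimal[OF _ subspace_span])
  ultimately have "local.dim (local.span (U \<union> V)) \<le> card (A \<union> B)" by (intro dim_le_card) auto
  then show ?thesis using card_Un_le[of A B] A(4) B(4) by linarith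
qed

end

locale vspace_pair = vs1: vspace s1 + vs2: vspace s2
  for s1 :: "'a::field \<Rightarrow> 'b::ab_group_add \<Rightarrow> 'b" and s2 :: "'a \<Rightarrow> 'c::ab_group_add \<Rightarrow> 'c"
begin

sublocale vector_space_pair s1 s2 ..

lemma linear_image_in_span: "Vector_Spaces.linear s1 s2 f \<Longrightarrow> x \<in> vs1.span S \<Longrightarrow> f x \<in> vs2.span (f ` S)"
  using linear_span_image by blast

lemma fin_spanned_image:
  assumes "Vector_Spaces.linear s1 s2 f" "vs1.fin_spanned V" shows "vs2.fin_spanned (f ` V)"
proof -
  from assms(2) obtain S where "finite S" "V \<subseteq> vs1.span S" by (auto simp: vs1.fin_spanned_def)
  then show ?thesis
    using linear_image_in_span[OF assms(1)] unfolding vs2.fin_spanned_def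
    by (intro exI[of _ "f ` S"]) auto
qed

text \<open>A basis \<open>B\<close> of the kernel is extended by \<open>C\<close> to a basis of
  \<open>V\<close>; then \<open>f\<close> is injective on the span of \<open>C\<close> and maps it
  onto the image.\<close>

lemma rank_nullity:
  assumes f: "Vector_Spaces.linear s1 s2 f" and V: "vs1.subspace V" "vs1.fin_spanned V"
  shows "vs1.dim V = vs1.dim {x\<in>V. f x = 0} + vs2.dim (f ` V)"
proof -
  interpret f: Vector_Spaces.linear s1 s2 f by (rule f)
  let ?K = "{x\<in>V. f x = 0}"
  obtain B where B: "B \<subseteq> ?K" "vs1.independent B" "?K \<subseteq> vs1.span B" "card B = vs1.dim ?K"
    by (rule vs1.basis_exists)
  obtain C where C: "finite B" "finite C" "B \<inter> C = {}" "C \<subseteq> V" "vs1.independent (B \<union> C)"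
    "V \<subseteq> vs1.span (B \<union> C)" "vs1.dim V = card B + card C"
    using vs1.extend_to_basis[OF V(2) _ B(2)] B(1) by (metis (no_types, lifting) mem_Collect_eq subset_iff)
  interpret self: vspace_pair s1 s1 ..
  \<comment> \<open>The projection that kills \<open>B\<close> and fixes \<open>C\<close>: an
    element of the span of \<open>C\<close> in the kernel of \<open>f\<close> is fixed by
    \<open>g\<close> and killed by it, hence zero.\<close>
  obtain g where g: "Vector_Spaces.linear s1 s1 g" "\<forall>x\<in>B \<union> C. g x = (if x \<in> B then 0 else x)"
    using self.linear_independent_extend[OF C(5), of "\<lambda>x. if x \<in> B then 0 else x"] by blast
  interpret g: Vector_Spaces.linear s1 s1 g by (rule g)
  have gB: "g x = 0" if "x \<in> vs1.span B" for x
    using self.linear_eq_0_on_span[OF g(1) _ that] g(2) by auto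
  have gC: "g x = x" if "x \<in> vs1.span C" for x
  proof -
    have "g y = y" if "y \<in> C" for y using g(2) C(3) that by auto
    then show ?thesis using self.linear_eq_on_span[OF g(1) vs1.linear_id _ that] by simp
  qed
  have CV: "vs1.span C \<subseteq> V" using C(4) V(1) by (rule vs1.span_minimal)
  have inj: "inj_on f (vs1.span C)"
  proof (rule inj_onI)
    fix x y assume xy: "x \<in> vs1.span C" "y \<in> vs1.span C" "f x = f y"
    then have d: "x - y \<in> vs1.span C" by (intro vs1.span_diff)
    then have "x - y \<in> ?K" using CV xy(3) by (auto simp: f.diff)
    then have "g (x - y) = 0" using gB B(3) by blast
    then show "x = y" using gC[OF d] by simp
  qed
  have indC: "vs1.independent C" using C(5) vs1.independent_mono by blast
  have "vs2.independent (f ` C)"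
    using linear_independent_injective_image[OF f indC inj] .
  moreover have "f ` V \<subseteq> vs2.span (f ` C)"
  proof
    fix y assume "y \<in> f ` V"
    then obtain x where x: "x \<in> V" "y = f x" by auto
    then have "y \<in> vs2.span (f ` (B \<union> C))" using linear_image_in_span[OF f] C(6) by blast
    moreover have "f ` (B \<union> C) \<subseteq> vs2.span (f ` C)"
      using B(1) vs2.span_superset[of "f ` C"] vs2.span_zero by auto
    ultimately show "y \<in> vs2.span (f ` C)" by (metis vs2.span_minimal vs2.subspace_span subsetD)
  qed
  moreover have "card (f ` C) = card C"
    using inj vs1.span_superset by (meson card_image inj_on_subset)
  moreover have "f ` C \<subseteq> f ` V" using C(4) by auto
  ultimately have "vs2.dim (f ` V) = card C" using vs2.basis_card_eq_dim by metis
  then show ?thesis using C(7) B(4) by simp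
qed

end

context vspace
begin

text \<open>Rank and nullity for the projection \<open>g\<close> along \<open>N\<close>, restricted
  to \<open>U\<close>: its kernel is the intersection, and its image spans a complement of
  \<open>N\<close> in the sum.\<close>

lemma dim_sum_Int:
  assumes "local.subspace U" "local.subspace N" "fin_spanned U" "fin_spanned N"
  shows "local.dim U + local.dim N = local.dim (U \<inter> N) + local.dim (local.span (U \<union> N))"
proof -
  interpret self: vspace_pair scale scale ..
  obtain B where B: "B \<subseteq> N" "local.independent B" "N \<subseteq> local.span B" "card B = local.dim N" by (rule basis_exists)
  have "B \<subseteq> local.span (U \<union> N)" using B(1) span_superset by blast
  then obtain C where C: "finite B" "finite C" "B \<inter> C = {}" "C \<subseteq> local.span (U \<union> N)" "local.independent (B \<union> C)"
    "local.span (U \<union> N) \<subseteq> local.span (B \<union> C)" "local.dim (local.span (U \<union> N)) = card B + card C"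
    using extend_to_basis[OF fin_spanned_Un[OF assms(3,4)] _ B(2)] by metis
  obtain g where g: "Vector_Spaces.linear scale scale g" "\<forall>x\<in>B \<union> C. g x = (if x \<in> B then 0 else x)"
    using self.linear_independent_extend[OF C(5), of "\<lambda>x. if x \<in> B then 0 else x"] by blast
  interpret g: Vector_Spaces.linear scale scale g by (rule g)
  have gB: "g x = 0" if "x \<in> local.span B" for x
    using self.linear_eq_0_on_span[OF g(1) _ that] g(2) by auto
  have gC: "g x = x" if "x \<in> local.span C" for x
  proof -
    have "g y = y" if "y \<in> C" for y using g(2) C(3) that by auto
    then show ?thesis using self.linear_eq_on_span[OF g(1) linear_id _ that] by simp
  qed
  have sB: "local.span B = N" using B(1,3) assms(2) span_minimal by blast
  have split: "\<exists>b c. b \<in> N \<and> c \<in> local.span C \<and> x = b + c" if "x \<in> local.span (U \<union> N)" for x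
  proof -
    have "x \<in> local.span (B \<union> C)" using that C(6) by blast
    then show ?thesis unfolding span_Un sB by auto
  qed
  have ker: "{x\<in>U. g x = 0} = U \<inter> N"
  proof safe
    fix x assume x: "x \<in> U" "g x = 0"
    then obtain b c where bc: "b \<in> N" "c \<in> local.span C" "x = b + c"
      using split[of x] span_superset by blast
    then have "g x = c" using gB[of b] gC[of c] sB by (simp add: g.add)
    then show "x \<in> N" using bc x(2) by simp
  qed (use gB sB in auto)
  have img: "local.span (g ` U) = local.span C"
  proof
    show "local.span (g ` U) \<subseteq> local.span C"
    proof (rule span_minimal[OF _ subspace_span], clarify)
      fix x assume "x \<in> U"
      then obtain b c where bc: "b \<in> N" "c \<in> local.span C" "x = b + c"
        using split[of x] span_superset by blast
      then show "g x \<in> local.span C" using gB[of b] gC[of c] sB by (simp add: g.add)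
    qed
    show "local.span C \<subseteq> local.span (g ` U)"
    proof (rule span_minimal[OF _ subspace_span], clarify)
      fix x assume x: "x \<in> C"
      then have "x \<in> local.span (U \<union> N)" using C(4) by auto
      then obtain u n where un: "u \<in> U" "n \<in> N" "x = u + n"
        unfolding span_Un span_eq_iff[THEN iffD2, OF assms(1)] span_eq_iff[THEN iffD2, OF assms(2)] by blast
      have "x = g x" using gC[OF subsetD[OF span_superset x]] by simp
      also have "\<dots> = g u" using un gB[of n] sB by (simp add: g.add)
      finally show "x \<in> local.span (g ` U)" using un(1) span_base[of "g u" "g ` U"] by simp
    qed
  qed
  have "local.dim (g ` U) = card C"
    using img C(5) by (metis dim_span dim_eq_card_independent independent_mono sup_ge2)
  then show ?thesis
    using self.rank_nullity[OF g(1) assms(1,3)] ker C(7) B(4) by simp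
qed

end

context vspace_pair
begin

lemma subspace_preimage:
  assumes f: "Vector_Spaces.linear s1 s2 f" and V: "vs1.subspace V" and N: "vs2.subspace N"
  shows "vs1.subspace {x\<in>V. f x \<in> N}"
proof -
  interpret f: Vector_Spaces.linear s1 s2 f by (rule f)
  show ?thesis using V N unfolding vs1.subspace_def vs2.subspace_def
    by (auto simp: f.add f.scale f.zero)
qed

lemma dim_preimage:
  assumes f: "Vector_Spaces.linear s1 s2 f" and V: "vs1.subspace V" "vs1.fin_spanned V"
    and N: "vs2.subspace N" "vs2.fin_spanned N"
  shows "vs1.dim {x\<in>V. f x \<in> N} + vs2.dim (vs2.span (f ` V \<union> N)) = vs1.dim V + vs2.dim N"
proof -
  interpret f: Vector_Spaces.linear s1 s2 f by (rule f)
  let ?V = "{x\<in>V. f x \<in> N}"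
  have fV: "f ` ?V = f ` V \<inter> N" by auto
  have "?V \<subseteq> V" by auto
  then have 1: "vs1.dim ?V = vs1.dim {x\<in>?V. f x = 0} + vs2.dim (f ` V \<inter> N)"
    using rank_nullity[OF f subspace_preimage[OF f V(1) N(1)] vs1.fin_spanned_subset[OF V(2)]] fV by metis
  have "{x\<in>?V. f x = 0} = {x\<in>V. f x = 0}" using N(1) vs2.subspace_0 by auto
  moreover have "vs2.subspace (f ` V)" using f.subspace_image V(1) by blast
  ultimately show ?thesis
    using 1 rank_nullity[OF f V] vs2.dim_sum_Int[OF _ N(1) fin_spanned_image[OF f V(2)] N(2)] by simp
qed

end

section \<open>Genericity\<close>

text \<open>Gaussian elimination with polynomial entries. The rows \<open>v i\<close> span all
  vectors indexed by \<open>L\<close> when every unit vector is a combination of them; if this holds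
  at \<open>p0\<close>, it persists wherever the product \<open>g\<close> of the pivots is
  nonzero.\<close>

lemma semicontinuity_of_spanning:
  fixes v :: "'i \<Rightarrow> 'j \<Rightarrow> complex^'n::finite \<Rightarrow> complex"
  assumes "finite L" "finite I"
    and "\<And>i l. i \<in> I \<Longrightarrow> l \<in> L \<Longrightarrow> polyfun (v i l)"
    and "\<And>k. k \<in> L \<Longrightarrow> \<exists>c. \<forall>l\<in>L. (\<Sum>i\<in>I. c i * v i l p0) = (if l = k then 1 else 0)"
  shows "\<exists>g. polyfun g \<and> g p0 \<noteq> 0 \<and> (\<forall>p. g p \<noteq> 0 \<longrightarrow>
     (\<forall>k\<in>L. \<exists>c. \<forall>l\<in>L. (\<Sum>i\<in>I. c i * v i l p) = (if l = k then 1 else 0)))"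
  using assms(1,3,4)
proof (induction L arbitrary: v rule: finite_induct)
  case empty
  show ?case by (rule exI[of _ "\<lambda>x. 1"]) auto
next
  case (insert l0 L v)
  have "\<exists>i0\<in>I. v i0 l0 p0 \<noteq> 0"
  proof (rule ccontr)
    assume "\<not> (\<exists>i0\<in>I. v i0 l0 p0 \<noteq> 0)"
    then have "(\<Sum>i\<in>I. c i * v i l0 p0) = 0" for c by (intro sum.neutral) auto
    then show False using insert.prems(2)[of l0] by auto
  qed
  then obtain i0 where i0: "i0 \<in> I" "v i0 l0 p0 \<noteq> 0" by auto
  \<comment> \<open>The column \<open>l0\<close> is cleared with the pivot row \<open>i0\<close>
    without division, so that the entries stay polynomial in \<open>p\<close>.\<close>
  define w where "w i l p = v i0 l0 p * v i l p - v i l0 p * v i0 l p" for i l p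
  have sw: "(\<Sum>i\<in>I. c i * w i l p) = v i0 l0 p * (\<Sum>i\<in>I. c i * v i l p) - (\<Sum>i\<in>I. c i * v i l0 p) * v i0 l p" for c l p
    by (simp add: w_def sum_distrib_left sum_distrib_right algebra_simps sum_subtractf)
  have "\<exists>g. polyfun g \<and> g p0 \<noteq> 0 \<and> (\<forall>p. g p \<noteq> 0 \<longrightarrow>
     (\<forall>k\<in>L. \<exists>c. \<forall>l\<in>L. (\<Sum>i\<in>I. c i * w i l p) = (if l = k then 1 else 0)))"
  proof (rule insert.IH)
    show "polyfun (w i l)" if "i \<in> I" "l \<in> L" for i l
      unfolding w_def using insert.prems(1)[of i l] insert.prems(1)[of i l0] insert.prems(1)[of i0 l]
      insert.prems(1)[of i0 l0] that i0 by (intro polyfun_diff polyfun_mult) auto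
    fix k assume k: "k \<in> L"
    then obtain c where c: "\<forall>l\<in>insert l0 L. (\<Sum>i\<in>I. c i * v i l p0) = (if l = k then 1 else 0)"
      using insert.prems(2)[of k] by auto
    have "(\<Sum>i\<in>I. (c i / v i0 l0 p0) * w i l p0) = (if l = k then 1 else 0)" if "l \<in> L" for l
    proof -
      have "(\<Sum>i\<in>I. (c i / v i0 l0 p0) * w i l p0) = (\<Sum>i\<in>I. c i * w i l p0) / v i0 l0 p0"
        by (simp add: sum_divide_distrib)
      then show ?thesis using c that i0(2) k insert.hyps(2) by (auto simp: sw)
    qed
    then show "\<exists>c. \<forall>l\<in>L. (\<Sum>i\<in>I. c i * w i l p0) = (if l = k then 1 else 0)"
      by (intro exI[of _ "\<lambda>i. c i / v i0 l0 p0"] ballI)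
  qed
  then obtain g where g: "polyfun g" "g p0 \<noteq> 0"
    "\<And>p k. g p \<noteq> 0 \<Longrightarrow> k \<in> L \<Longrightarrow> \<exists>c. \<forall>l\<in>L. (\<Sum>i\<in>I. c i * w i l p) = (if l = k then 1 else 0)"
    by blast
  show ?case
  proof (intro exI[of _ "\<lambda>p. g p * v i0 l0 p"] conjI allI impI ballI)
    show "polyfun (\<lambda>p. g p * v i0 l0 p)" using g(1) insert.prems(1) i0(1) by auto
    show "g p0 * v i0 l0 p0 \<noteq> 0" using g(2) i0 by simp
    fix p k assume gp: "g p * v i0 l0 p \<noteq> 0" and k: "k \<in> insert l0 L"
    then have nz: "g p \<noteq> 0" "v i0 l0 p \<noteq> 0" by auto
    have sd: "(\<Sum>i\<in>I. (a i + (if i = i0 then b else 0)) * v i l p) = (\<Sum>i\<in>I. a i * v i l p) + b * v i0 l p" for a b l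
    proof -
      have "(\<Sum>i\<in>I. (if i = i0 then b else 0) * v i l p) = (\<Sum>i\<in>I. if i = i0 then b * v i l p else 0)"
        by (intro sum.cong) auto
      then show ?thesis using i0(1) \<open>finite I\<close> by (simp add: distrib_right sum.distrib)
    qed
    have kL: "\<exists>d. \<forall>l\<in>insert l0 L. (\<Sum>i\<in>I. d i * v i l p) = (if l = k' then 1 else 0)" if "k' \<in> L" for k'
    proof -
      obtain c where c: "\<forall>l\<in>L. (\<Sum>i\<in>I. c i * w i l p) = (if l = k' then 1 else 0)"
        using g(3)[OF nz(1) \<open>k' \<in> L\<close>] by (elim exE)
      \<comment> \<open>A combination of the reduced rows, rewritten in the original rows; the
        correction at \<open>i0\<close> makes its coordinate at \<open>l0\<close> vanish.\<close>
      define d where "d i = v i0 l0 p * c i + (if i = i0 then - (\<Sum>i\<in>I. c i * v i l0 p) else 0)" for i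
      have d: "(\<Sum>i\<in>I. d i * v i l p) = (\<Sum>i\<in>I. c i * w i l p)" for l
        unfolding d_def sd sw by (simp add: sum_distrib_left mult.assoc)
      have "(\<Sum>i\<in>I. d i * v i l0 p) = 0" unfolding d sw by simp
      moreover have "l0 \<noteq> k'" using insert.hyps(2) that by auto
      ultimately show ?thesis using c d by (intro exI[of _ d]) auto
    qed
    show "\<exists>c. \<forall>l\<in>insert l0 L. (\<Sum>i\<in>I. c i * v i l p) = (if l = k then 1 else 0)"
    proof (cases "k \<in> L")
      case False
      then have kl: "k = l0" using k by simp
      obtain D where D: "\<And>k' l. k' \<in> L \<Longrightarrow> l \<in> insert l0 L \<Longrightarrow> (\<Sum>i\<in>I. D k' i * v i l p) = (if l = k' then 1 else 0)"
        using kL by metis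
      \<comment> \<open>From the pivot row all its coordinates in \<open>L\<close> are subtracted by
        means of the unit vectors already obtained; only the pivot at \<open>l0\<close> is
        left.\<close>
      define e where "e i = (\<Sum>k'\<in>L. - v i0 k' p * D k' i) + (if i = i0 then 1 else 0)" for i
      have e: "(\<Sum>i\<in>I. e i * v i l p) = v i0 l p - (\<Sum>k'\<in>L. v i0 k' p * (\<Sum>i\<in>I. D k' i * v i l p))" for l
      proof -
        have "(\<Sum>i\<in>I. (\<Sum>k'\<in>L. - v i0 k' p * D k' i) * v i l p) = (\<Sum>i\<in>I. \<Sum>k'\<in>L. - (v i0 k' p * (D k' i * v i l p)))"
          by (simp add: sum_distrib_right mult.assoc)
        also have "\<dots> = (\<Sum>k'\<in>L. \<Sum>i\<in>I. - (v i0 k' p * (D k' i * v i l p)))" by (rule sum.swap)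
        also have "\<dots> = - (\<Sum>k'\<in>L. v i0 k' p * (\<Sum>i\<in>I. D k' i * v i l p))"
          by (simp add: sum_distrib_left sum_negf)
        finally show ?thesis unfolding e_def sd by simp
      qed
      have e0: "(\<Sum>i\<in>I. e i * v i l0 p) = v i0 l0 p"
        unfolding e using D insert.hyps by (auto intro!: sum.neutral)
      have eL: "(\<Sum>i\<in>I. e i * v i l p) = 0" if "l \<in> L" for l
      proof -
        have "(\<Sum>k'\<in>L. v i0 k' p * (\<Sum>i\<in>I. D k' i * v i l p)) = (\<Sum>k'\<in>L. if k' = l then v i0 k' p else 0)"
          using D that by (intro sum.cong) auto
        then show ?thesis unfolding e using that insert.hyps(1) by simp
      qed
      have "(\<Sum>i\<in>I. (e i / v i0 l0 p) * v i l p) = (\<Sum>i\<in>I. e i * v i l p) / v i0 l0 p" for l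
        by (simp add: sum_divide_distrib)
      then show ?thesis
        using e0 eL nz(2) kl insert.hyps(2) by (intro exI[of _ "\<lambda>i. e i / v i0 l0 p"]) auto
    qed (use kL in blast)
  qed
qed

text \<open>The polynomial \<open>g\<close> need not be homogeneous, so the exceptional set is the
  common zero set of its homogeneous components. Outside it, \<open>g\<close> is a nonzero
  polynomial on the line through 0 and \<open>p\<close>; some nonzero multiple of \<open>p\<close>
  is therefore good, and \<open>cone\<close> carries the property back to \<open>p\<close>.\<close>

lemma generic_pointI:
  fixes g :: "complex^'n::finite \<Rightarrow> complex"
  assumes "polyfun g" "g p0 \<noteq> 0" and P: "\<And>p. g p \<noteq> 0 \<Longrightarrow> P p"
    and cone: "\<And>c p. c \<noteq> 0 \<Longrightarrow> P (c *s p) \<Longrightarrow> P p"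
  shows "generic_point P"
proof -
  obtain F where F: "g = eval_poly F" using assms(1) by (auto simp: polyfun_def)
  obtain N where N: "F = (\<Sum>n\<le>N. hcomp n F)" by (rule hcomp_decomp)
  have ev: "g x = (\<Sum>n\<le>N. eval_poly (hcomp n F) x)" for x
    using arg_cong[OF N, of "\<lambda>F. eval_poly F x"] by (simp add: F eval_poly_psubst id_hom.psubst_sum)
  define V where "V = proj_zeros {hcomp n F |n. n \<le> N}"
  have "zariski_closed V"
    unfolding zariski_closed_def V_def
    by (intro exI[of _ "{hcomp n F |n. n \<le> N}"] conjI refl subsetI) (use hcomp_forms in auto)
  moreover have "V \<noteq> {x. x \<noteq> 0}"
  proof -
    \<comment> \<open>The point \<open>p0\<close> may be 0, so a nonzero point with \<open>g\<close>
      nonzero is found by also requiring a nonzero coordinate.\<close>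
    obtain i :: 'n where True by simp
    have "axis i (1::complex) $ i \<noteq> 0" by (simp add: axis_def)
    then obtain x where x: "g x \<noteq> 0" "x $ i \<noteq> 0"
      using polyfun_mult_nonzero[OF assms(1) polyfun_coord[of i] assms(2)] by blast
    have "x \<notin> V"
    proof
      assume "x \<in> V"
      then have "eval_poly (hcomp n F) x = 0" if "n \<le> N" for n
        using that by (auto simp: V_def proj_zeros_def)
      then show False using x(1) by (simp add: ev)
    qed
    moreover have "x \<noteq> 0" using x(2) by auto
    ultimately show ?thesis by auto
  qed
  moreover have "P p" if p: "p \<noteq> 0" "p \<notin> V" for p
  proof -
    obtain n where n: "n \<le> N" "eval_poly (hcomp n F) p \<noteq> 0"
      using p by (auto simp: V_def proj_zeros_def)
    define Q where "Q = (\<Sum>n\<le>N. monom (eval_poly (hcomp n F) p) n)"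
    have Qe: "poly Q t = g (t *s p)" for t
      by (simp add: Q_def ev poly_sum poly_monom eval_homogeneous[OF hcomp_forms] mult.commute)
    have "Polynomial.coeff Q n = eval_poly (hcomp n F) p"
      unfolding Q_def coeff_sum using n(1) by simp
    \<comment> \<open>The additional factor forces the parameter \<open>t\<close> to be
      nonzero.\<close>
    then have "Q * [:0, 1:] \<noteq> 0" using n(2) by auto
    then have "finite {t. poly (Q * [:0,1:]) t = 0}" by (rule poly_roots_finite)
    then obtain t where "poly (Q * [:0,1:]) t \<noteq> 0"
      using infinite_UNIV_char_0 by (metis (mono_tags, lifting) finite_subset mem_Collect_eq subsetI)
    then have "t \<noteq> 0" "g (t *s p) \<noteq> 0" by (auto simp: Qe)
    then show ?thesis using P cone by blast
  qed
  ultimately show ?thesis unfolding generic_point_def by blast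
qed


section \<open>Independence and spans of finite families\<close>

lemma (in vspace) family_independent:
  assumes "finite I" "\<And>c. (\<Sum>i\<in>I. scale (c i) (f i)) = 0 \<Longrightarrow> \<forall>i\<in>I. c i = 0"
  shows "inj_on f I \<and> local.independent (f ` I)"
proof
  show inj: "inj_on f I"
  proof (rule inj_onI, rule ccontr)
    fix i j assume ij: "i \<in> I" "j \<in> I" "f i = f j" "i \<noteq> j"
    define c where "c k = (if k = i then 1 else 0) - (if k = j then 1 else 0 :: 'a)" for k
    have "(\<Sum>k\<in>I. scale (c k) (f k)) =
      (\<Sum>k\<in>I. if k = i then f k else 0) - (\<Sum>k\<in>I. if k = j then f k else 0)"
      unfolding c_def scale_left_diff_distrib sum_subtractf
      by (intro arg_cong2[of _ _ _ _ "(-)"] sum.cong) auto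
    also have "\<dots> = 0" using ij assms(1) by simp
    finally have "c i = 0" using assms(2) ij(1) by blast
    then show False using ij(4) by (simp add: c_def)
  qed
  show "local.independent (f ` I)"
  proof (rule independent_if_scalars_zero)
    fix c x assume z: "(\<Sum>x\<in>f ` I. scale (c x) x) = 0" and x: "x \<in> f ` I"
    have "(\<Sum>i\<in>I. scale (c (f i)) (f i)) = 0"
      using z sum.reindex[OF inj, of "\<lambda>x. scale (c x) x"] by simp
    then have "\<forall>i\<in>I. c (f i) = 0" by (rule assms(2)[of "\<lambda>i. c (f i)"])
    then show "c x = 0" using x by auto
  qed (use assms(1) in auto)
qed

lemma (in vspace) family_independentD:
  assumes "finite I" "inj_on f I" "local.independent (f ` I)" "(\<Sum>i\<in>I. scale (c i) (f i)) = 0" "i \<in> I"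
  shows "c i = 0"
proof -
  have "(\<Sum>x\<in>f ` I. scale (c (the_inv_into I f x)) x) = (\<Sum>i\<in>I. scale (c i) (f i))"
    using sum.reindex[OF assms(2), of "\<lambda>x. scale (c (the_inv_into I f x)) x"]
    by (simp add: the_inv_into_f_f[OF assms(2)])
  then have "c (the_inv_into I f (f i)) = 0"
    using independentD[OF assms(3), of "f ` I" "\<lambda>x. c (the_inv_into I f x)" "f i"] assms by simp
  then show ?thesis by (simp add: the_inv_into_f_f[OF assms(2,5)])
qed

lemma (in vspace) span_family:
  assumes "finite I" "x \<in> local.span (f ` I)"
  obtains c where "x = (\<Sum>i\<in>I. scale (c i) (f i))"
proof -
  have "local.subspace {x. \<exists>c. x = (\<Sum>i\<in>I. scale (c i) (f i))}"
  proof (rule subspaceI)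
    show "0 \<in> {x. \<exists>c. x = (\<Sum>i\<in>I. scale (c i) (f i))}" by (auto intro: exI[of _ "\<lambda>_. 0"])
    fix x y c assume "x \<in> {x. \<exists>c. x = (\<Sum>i\<in>I. scale (c i) (f i))}" 
    then obtain a where a: "x = (\<Sum>i\<in>I. scale (a i) (f i))" by auto
    show "scale c x \<in> {x. \<exists>c. x = (\<Sum>i\<in>I. scale (c i) (f i))}"
      unfolding a by (auto simp: scale_sum_right intro: exI[of _ "\<lambda>i. c * a i"])
    assume "y \<in> {x. \<exists>c. x = (\<Sum>i\<in>I. scale (c i) (f i))}"
    then obtain b where b: "y = (\<Sum>i\<in>I. scale (b i) (f i))" by auto
    show "x + y \<in> {x. \<exists>c. x = (\<Sum>i\<in>I. scale (c i) (f i))}"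
      unfolding a b by (auto simp: scale_left_distrib sum.distrib intro: exI[of _ "\<lambda>i. a i + b i"])
  qed
  moreover have "f ` I \<subseteq> {x. \<exists>c. x = (\<Sum>i\<in>I. scale (c i) (f i))}"
  proof clarify
    fix k assume "k \<in> I"
    have "(\<Sum>i\<in>I. scale (if i = k then 1 else 0) (f i)) = (\<Sum>i\<in>I. if i = k then f i else 0)"
      by (intro sum.cong) auto
    then show "\<exists>c. f k = (\<Sum>i\<in>I. scale (c i) (f i))"
      using assms(1) \<open>k \<in> I\<close> by (intro exI[of _ "\<lambda>i. if i = k then 1 else 0"]) simp
  qed
  ultimately have "x \<in> {x. \<exists>c. x = (\<Sum>i\<in>I. scale (c i) (f i))}"
    using assms(2) span_minimal by blast
  then show ?thesis using that by blast
qed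

lemma (in vspace) sum_scale_in_span:
  "(\<And>i. i \<in> I \<Longrightarrow> f i \<in> local.span S) \<Longrightarrow> (\<Sum>i\<in>I. scale (c i) (f i)) \<in> local.span S"
  by (intro span_sum span_scale)

section \<open>The spaces of forms\<close>

interpretation pv: vspace "const_scale :: complex \<Rightarrow> 'n mpoly \<Rightarrow> 'n mpoly" ..

interpretation pp: vspace_pair "const_scale :: complex \<Rightarrow> 'n mpoly \<Rightarrow> 'n mpoly"
  "const_scale :: complex \<Rightarrow> 'm mpoly \<Rightarrow> 'm mpoly" ..

lemma coef_scale: "coef (const_scale c F) m = c * coef F m"
proof -
  have "const_scale c F = Poly_Mapping.map ((*) c) F"
    by (simp add: const_scale_def mult_map_scale_conv_mult)
  then show ?thesis by (simp add: Poly_Mapping.map.rep_eq when_def)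
qed

text \<open>Listing the variables turns exponents into lists of natural numbers with given length
  and sum, which are counted by stars and bars.\<close>

lemma card_monomials:
  "card {m :: 'n::finite \<Rightarrow>\<^sub>0 nat. mdeg m = n} = (n + CARD('n) - 1) choose n"
proof -
  obtain xs :: "'n list" where xs: "set xs = UNIV" "distinct xs"
    using finite_distinct_list[of "UNIV :: 'n set"] by auto
  have len: "length xs = CARD('n)" using xs distinct_card by metis
  let ?M = "{m :: 'n \<Rightarrow>\<^sub>0 nat. mdeg m = n}" and ?L = "{l :: nat list. size l = CARD('n) \<and> sum_list l = n}"
  let ?f = "\<lambda>m. map (coef m) xs"
  have sl: "sum_list (map (coef m) xs) = mdeg m" for m :: "'n \<Rightarrow>\<^sub>0 nat"
    using xs by (simp add: sum_list_distinct_conv_sum_set)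
  have "inj_on ?f ?M"
  proof (rule inj_onI)
    fix a b :: "'n \<Rightarrow>\<^sub>0 nat" assume "map (coef a) xs = map (coef b) xs"
    then have "coef a i = coef b i" for i using xs(1) by (metis UNIV_I map_eq_conv)
    then show "a = b" by (rule poly_mapping_eqI)
  qed
  moreover have "?f ` ?M = ?L"
  proof
    show "?f ` ?M \<subseteq> ?L" using sl len by auto
    show "?L \<subseteq> ?f ` ?M"
    proof
      fix l assume l: "l \<in> ?L"
      define g where "g i = l ! (THE k. k < length xs \<and> xs ! k = i)" for i
      define m where "m = Abs_poly_mapping g"
      have cm: "coef m = g" unfolding m_def by (rule Abs_poly_mapping_inverse) auto
      have "map (coef m) xs = l"
      proof (rule nth_equalityI)
        fix k assume k: "k < length (map (coef m) xs)"
        then have "(THE k'. k' < length xs \<and> xs ! k' = xs ! k) = k"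
          using xs(2) by (intro the_equality) (auto simp: nth_eq_iff_index_eq)
        then show "map (coef m) xs ! k = l ! k" using k by (simp add: cm g_def)
      qed (use l len in auto)
      then show "l \<in> ?f ` ?M" using l sl[of m] by (intro image_eqI[of _ _ m]) auto
    qed
  qed
  ultimately have "card ?M = card ?L" using card_image[of ?f ?M] by simp
  then show ?thesis by (simp add: card_length_sum_list)
qed

text \<open>Infinite sets have cardinality 0, so finiteness can be read off from the positive count
  in \<open>card_monomials\<close>.\<close>

lemma finite_monomials: "finite {m :: 'n::finite \<Rightarrow>\<^sub>0 nat. mdeg m = n}"
proof (cases "n = 0")
  case True
  have "m = 0" if "mdeg m = 0" for m :: "'n \<Rightarrow>\<^sub>0 nat"
    using that by (intro poly_mapping_eqI) simp
  then have "{m :: 'n \<Rightarrow>\<^sub>0 nat. mdeg m = n} \<subseteq> {0}" using True by auto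
  then show ?thesis by (rule finite_subset) simp
next
  case False
  have "CARD('n) \<ge> 1" using zero_less_card_finite[where 'a = 'n] by linarith
  then have "card {m :: 'n \<Rightarrow>\<^sub>0 nat. mdeg m = n} > 0"
    unfolding card_monomials by (subst zero_less_binomial_iff) linarith
  then show ?thesis by (rule card_ge_0_finite)
qed

lemma forms_basis:
  "(\<lambda>m. sgl m 1) ` {m. mdeg m = n} \<subseteq> forms n"
  "forms n \<subseteq> poly_vs.span ((\<lambda>m. sgl m 1) ` {m :: 'n::finite \<Rightarrow>\<^sub>0 nat. mdeg m = n})"
  "inj_on (\<lambda>m. sgl m (1::complex)) {m :: 'n::finite \<Rightarrow>\<^sub>0 nat. mdeg m = n} \<and>
   poly_vs.independent ((\<lambda>m. sgl m 1) ` {m :: 'n::finite \<Rightarrow>\<^sub>0 nat. mdeg m = n})"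
proof -
  show "(\<lambda>m. sgl m 1) ` {m. mdeg m = n} \<subseteq> forms n" using forms_single by auto
  show "forms n \<subseteq> poly_vs.span ((\<lambda>m. sgl m 1) ` {m :: 'n \<Rightarrow>\<^sub>0 nat. mdeg m = n})"
  proof
    fix F :: "'n mpoly" assume F: "F \<in> forms n"
    have eq: "F = (\<Sum>m\<in>supp F. const_scale (coef F m) (sgl m 1))"
      by (subst sum_single) (simp add: const_scale_def mult_single)
    have "sgl m 1 \<in> poly_vs.span ((\<lambda>m. sgl m 1) ` {m :: 'n \<Rightarrow>\<^sub>0 nat. mdeg m = n})"
      if "m \<in> supp F" for m using that F by (intro poly_vs.span_base) (auto simp: forms_def)
    then have "(\<Sum>m\<in>supp F. const_scale (coef F m) (sgl m 1)) \<in>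
        poly_vs.span ((\<lambda>m. sgl m 1) ` {m :: 'n \<Rightarrow>\<^sub>0 nat. mdeg m = n})"
      by (rule pv.sum_scale_in_span)
    then show "F \<in> poly_vs.span ((\<lambda>m. sgl m 1) ` {m :: 'n \<Rightarrow>\<^sub>0 nat. mdeg m = n})"
      by (simp only: eq[symmetric])
  qed
  show "inj_on (\<lambda>m. sgl m (1::complex)) {m :: 'n::finite \<Rightarrow>\<^sub>0 nat. mdeg m = n} \<and>
   poly_vs.independent ((\<lambda>m. sgl m 1) ` {m :: 'n::finite \<Rightarrow>\<^sub>0 nat. mdeg m = n})"
  proof (rule pv.family_independent[OF finite_monomials], rule ballI)
    fix c and k :: "'n \<Rightarrow>\<^sub>0 nat"
    assume z: "(\<Sum>m\<in>{m :: 'n \<Rightarrow>\<^sub>0 nat. mdeg m = n}. const_scale (c m) (sgl m 1)) = 0" and k: "k \<in> {m. mdeg m = n}"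
    have "coef (\<Sum>m\<in>{m :: 'n \<Rightarrow>\<^sub>0 nat. mdeg m = n}. const_scale (c m) (sgl m 1)) k =
        (\<Sum>m\<in>{m. mdeg m = n}. if m = k then c m else 0)"
      unfolding lookup_sum coef_scale by (intro sum.cong) (auto simp: lookup_single when_def)
    also have "\<dots> = c k" using k finite_monomials[where 'n = 'n and n = n] by (subst sum.delta) auto
    finally show "c k = 0" using z by simp
  qed
qed

lemma dim_forms: "poly_vs.dim (forms n :: 'n::finite mpoly set) = (n + CARD('n) - 1) choose n"
proof (rule poly_vs.dim_unique[OF forms_basis(1,2)])
  let ?M = "{m :: 'n \<Rightarrow>\<^sub>0 nat. mdeg m = n}"
  show "poly_vs.independent ((\<lambda>m. sgl m 1) ` ?M)" using forms_basis(3) by blast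
  have "inj_on (\<lambda>m. sgl m (1::complex)) ?M" using forms_basis(3) by blast
  from card_image[OF this] show "card ((\<lambda>m. sgl m (1::complex)) ` ?M) = (n + CARD('n) - 1) choose n"
    by (simp add: card_monomials)
qed

lemma fin_spanned_forms: "pv.fin_spanned (forms n :: 'n::finite mpoly set)"
  unfolding pv.fin_spanned_def using forms_basis(2) finite_monomials by blast

lemma linear_mpolyI:
  assumes "\<And>F G. f (F + G) = f F + f G" "\<And>c F. f (const_scale c F) = const_scale c (f F)"
  shows "Vector_Spaces.linear const_scale const_scale f"
  using assms by (auto simp: Vector_Spaces.linear_iff poly_vs.vector_space_axioms)

section \<open>Minimal generators\<close>

lemma form0: "F \<in> forms 0 \<Longrightarrow> F = sgl 0 (coef F 0)"
proof (rule poly_mapping_eqI)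
  fix m assume F: "F \<in> forms 0"
  have "m = 0" if "coef F m \<noteq> 0"
  proof -
    have "mdeg m = 0" using that F by (simp add: forms_iff)
    then show ?thesis by (intro poly_mapping_eqI) simp
  qed
  then show "coef F m = coef (sgl 0 (coef F 0)) m" by (auto simp: lookup_single when_def)
qed

text \<open>Applied to the quadrics of an ideal, this is the degree-three part of the ideal they
  generate; its codimension in all cubics of the ideal is the number of cubic generators.\<close>

definition var_multiples :: "'n::finite mpoly set \<Rightarrow> 'n mpoly set" where
  "var_multiples S = poly_vs.span {var i * F |i F. F \<in> S}"

lemma form1_mult:
  assumes "L \<in> forms 1" "F \<in> S" shows "L * F \<in> var_multiples S"
proof -
  from assms(1) have "L \<in> forms (Suc 0)" by simp
  then obtain G where G: "\<And>i. G i \<in> forms 0" "L = (\<Sum>i\<in>UNIV. var i * G i)"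
    by (rule forms_Suc_decomp) blast
  have "var i * G i * F = const_scale (coef (G i) 0) (var i * F)" for i
    using arg_cong[OF form0[OF G(1)], of "\<lambda>x. var i * x * F" i] unfolding const_scale_def by (simp only: mult_ac)
  then have "L * F = (\<Sum>i\<in>UNIV. const_scale (coef (G i) 0) (var i * F))"
    by (simp add: G(2) sum_distrib_right)
  moreover have "(\<Sum>i\<in>UNIV. const_scale (coef (G i) 0) (var i * F)) \<in> var_multiples S"
    unfolding var_multiples_def
    by (rule pv.sum_scale_in_span, rule poly_vs.span_base) (use assms(2) in blast)
  ultimately show ?thesis by simp
qed

lemma ideal_subspace: "poly_vs.subspace (ideal_gen G)"
  by (intro poly_vs.subspaceI)
     (auto simp: const_scale_def poly_ideal.span_zero poly_ideal.span_add poly_ideal.span_scale)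

lemma span_subset_ideal: "G \<subseteq> ideal_gen H \<Longrightarrow> poly_vs.span G \<subseteq> ideal_gen H"
  by (rule poly_vs.span_minimal[OF _ ideal_subspace])

text \<open>Graded Nakayama in elementary form: \<open>Q\<close> is a basis of the quadrics, and
  \<open>C\<close> completes a basis \<open>B\<close> of their multiples to a basis of the cubics.
  If a generator were redundant, comparing components of degree 2 or 3 would give a linear
  dependence in \<open>Q\<close> or in \<open>B \<union> C\<close>.\<close>

lemma minimal_generation:
  fixes I :: "'n::finite mpoly set"
  assumes add: "\<And>F G. F \<in> I \<Longrightarrow> G \<in> I \<Longrightarrow> F + G \<in> I" and zero: "0 \<in> I"
    and mult: "\<And>F G. F \<in> I \<Longrightarrow> G * F \<in> I"
    and comp: "\<And>F n. F \<in> I \<Longrightarrow> hcomp n F \<in> I"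
    and low: "\<And>F. F \<in> I \<Longrightarrow> F \<in> forms 0 \<or> F \<in> forms 1 \<Longrightarrow> F = 0"
    and gen: "\<And>n F. n \<ge> 3 \<Longrightarrow> F \<in> I \<Longrightarrow> F \<in> forms (Suc n) \<Longrightarrow> \<exists>G. (\<forall>i. G i \<in> I \<inter> forms n) \<and> F = (\<Sum>i\<in>UNIV. var i * G i)"
    and dim2: "poly_vs.dim (I \<inter> forms 2) = a"
    and dim3: "poly_vs.dim (I \<inter> forms 3) = poly_vs.dim (var_multiples (I \<inter> forms 2)) + b"
  shows "minimally_generated_by_quadrics_cubics I a b"
proof -
  let ?U = "var_multiples (I \<inter> forms 2)"
  have subI: "poly_vs.subspace I"
    using add zero mult by (intro poly_vs.subspaceI) (auto simp: const_scale_def)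
  have UI: "?U \<subseteq> I \<inter> forms 3"
    unfolding var_multiples_def
  proof (rule poly_vs.span_minimal)
    show "poly_vs.subspace (I \<inter> forms 3)"
      using subI subspace_forms by (rule poly_vs.subspace_inter)
    show "{var i * F |i F. F \<in> I \<inter> forms 2} \<subseteq> I \<inter> forms 3"
      using mult forms_var_mult[where n = 2] by (auto simp: numeral_3_eq_3)
  qed
  have fin: "pv.fin_spanned (I \<inter> forms n)" for n
    by (rule pv.fin_spanned_subset[OF fin_spanned_forms]) auto
  obtain Q where Q: "Q \<subseteq> I \<inter> forms 2" "poly_vs.independent Q" "I \<inter> forms 2 \<subseteq> poly_vs.span Q" "card Q = a"
    using poly_vs.basis_exists dim2 by metis
  have finQ: "finite Q" using pv.independent_card_le[OF fin Q(1,2)] by simp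
  obtain B where B: "B \<subseteq> ?U" "poly_vs.independent B" "?U \<subseteq> poly_vs.span B" "card B = poly_vs.dim ?U"
    by (rule poly_vs.basis_exists)
  have "B \<subseteq> I \<inter> forms 3" using B(1) UI by auto
  then obtain C where C: "finite B" "finite C" "B \<inter> C = {}" "C \<subseteq> I \<inter> forms 3" "poly_vs.independent (B \<union> C)"
    "I \<inter> forms 3 \<subseteq> poly_vs.span (B \<union> C)" "poly_vs.dim (I \<inter> forms 3) = card B + card C"
    using pv.extend_to_basis[OF fin _ B(2)] by metis
  have cardC: "card C = b" using C(7) B(4) dim3 by simp
  have QJ: "I \<inter> forms 2 \<subseteq> ideal_gen (Q \<union> C)"
    using Q(3) span_subset_ideal[of Q "Q \<union> C"] poly_ideal.span_superset[of "Q \<union> C"] by auto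
  have UJ: "?U \<subseteq> ideal_gen (Q \<union> C)"
    unfolding var_multiples_def using QJ by (intro span_subset_ideal) (auto intro: poly_ideal.span_scale)
  have J3: "I \<inter> forms 3 \<subseteq> ideal_gen (Q \<union> C)"
  proof -
    have "B \<union> C \<subseteq> ideal_gen (Q \<union> C)"
      using B(1) UJ poly_ideal.span_superset[of "Q \<union> C"] by auto
    then show ?thesis using C(6) span_subset_ideal by blast
  qed
  have J4: "I \<inter> forms (n + 3) \<subseteq> ideal_gen (Q \<union> C)" for n
  proof (induction n)
    case (Suc n)
    show ?case
    proof
      fix F assume "F \<in> I \<inter> forms (Suc n + 3)"
      then obtain G where G: "\<And>i. G i \<in> I \<inter> forms (n + 3)" "F = (\<Sum>i\<in>UNIV. var i * G i)"
        using gen[of "n + 3" F] by auto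
      then show "F \<in> ideal_gen (Q \<union> C)"
        using Suc by (auto intro!: poly_ideal.span_sum poly_ideal.span_scale)
    qed
  qed (use J3 in simp)
  have J: "hcomp n F \<in> ideal_gen (Q \<union> C)" if "F \<in> I" for n F
  proof -
    consider "n = 0" | "n = 1" | "n = 2" | k where "n = k + 3"
      by (metis One_nat_def Suc_1 add.commute le_add_diff_inverse2 not_less_eq_eq numeral_3_eq_3 le_SucE le_zero_eq)
    then show ?thesis
    proof cases
      case 1 then show ?thesis using low comp[OF that, of n] hcomp_forms[of n F] poly_ideal.span_zero by metis
    next
      case 2 then show ?thesis using low comp[OF that, of n] hcomp_forms[of n F] poly_ideal.span_zero by metis
    next
      case 3 then show ?thesis using QJ comp[OF that, of n] hcomp_forms[of n F] by auto
    next
      case (4 k) then show ?thesis using J4[of k] comp[OF that, of n] hcomp_forms[of n F] by auto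
    qed
  qed
  have "ideal_gen (Q \<union> C) = I"
  proof
    have "poly_ideal.subspace I" using add zero mult by (intro poly_ideal.subspaceI) auto
    then show "ideal_gen (Q \<union> C) \<subseteq> I"
      using Q(1) C(4) by (intro poly_ideal.span_minimal) auto
    show "I \<subseteq> ideal_gen (Q \<union> C)"
    proof
      fix F assume F: "F \<in> I"
      obtain N where N: "F = (\<Sum>n\<le>N. hcomp n F)" by (rule hcomp_decomp)
      have "(\<Sum>n\<le>N. hcomp n F) \<in> ideal_gen (Q \<union> C)" using J[OF F] by (intro poly_ideal.span_sum)
      then show "F \<in> ideal_gen (Q \<union> C)" using N by simp
    qed
  qed
  moreover have "ideal_gen G \<noteq> I" if G: "G \<subset> Q \<union> C" for G
  proof
    assume GI: "ideal_gen G = I"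
    from G obtain g where g: "g \<in> Q \<union> C" "g \<notin> G" by auto
    then have "g \<in> ideal_gen G" using Q(1) C(4) GI by auto
    then obtain t r where t: "finite t" "t \<subseteq> G" "g = (\<Sum>x\<in>t. r x * x)"
      unfolding poly_ideal.span_explicit by auto
    have sc: "hcomp 0 F * x = const_scale (coef (hcomp 0 F) 0) x" for F x :: "'n mpoly"
      using arg_cong[OF form0[OF hcomp_forms[of 0 F]], of "\<lambda>y. y * x"] by (simp only: const_scale_def)
    \<comment> \<open>In degree 2 only constant multiples of quadrics survive. In degree 3 these are
      constant multiples of cubics and linear multiples of quadrics; the latter lie in the span of
      \<open>B\<close>, even if the omitted generator is a quadric.\<close>
    have deg2: "hcomp 2 (r x * x) \<in> poly_vs.span (Q - {g})" and
         deg3: "hcomp 3 (r x * x) \<in> poly_vs.span (B \<union> (C - {g}))" if x: "x \<in> t" for x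
    proof -
      from x t(2) G g(2) have xg: "x \<noteq> g" "x \<in> Q \<or> x \<in> C" by auto
      then consider "x \<in> Q" | "x \<in> C" by blast
      then have "hcomp 2 (r x * x) \<in> poly_vs.span (Q - {g}) \<and> hcomp 3 (r x * x) \<in> poly_vs.span (B \<union> (C - {g}))"
      proof cases
        case 1
        then have x2: "x \<in> forms 2" "x \<in> I \<inter> forms 2" using Q(1) by auto
        have "hcomp 2 (r x * x) \<in> poly_vs.span (Q - {g})"
          using hcomp_mult[OF x2(1), of 2 "r x"] sc 1 xg(1) by (auto intro: poly_vs.span_scale poly_vs.span_base)
        moreover have "hcomp 3 (r x * x) = hcomp 1 (r x) * x"
          using hcomp_mult[OF x2(1), of 3 "r x"] by simp
        then have "hcomp 3 (r x * x) \<in> ?U" using form1_mult[OF hcomp_forms x2(2)] by simp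
        then have "hcomp 3 (r x * x) \<in> poly_vs.span (B \<union> (C - {g}))"
          using B(3) poly_vs.span_mono[of B "B \<union> (C - {g})"] by auto
        ultimately show ?thesis by simp
      next
        case 2
        then have x3: "x \<in> forms 3" using C(4) by auto
        have "hcomp 2 (r x * x) = 0" using hcomp_mult[OF x3, of 2 "r x"] by simp
        moreover have "hcomp 3 (r x * x) \<in> poly_vs.span (B \<union> (C - {g}))"
          using hcomp_mult[OF x3, of 3 "r x"] sc 2 xg(1) by (auto intro: poly_vs.span_scale poly_vs.span_base)
        ultimately show ?thesis by (simp add: poly_vs.span_zero)
      qed
      then show "hcomp 2 (r x * x) \<in> poly_vs.span (Q - {g})"
        "hcomp 3 (r x * x) \<in> poly_vs.span (B \<union> (C - {g}))" by auto
    qed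
    have d2: "hcomp 2 g \<in> poly_vs.span (Q - {g})"
      unfolding t(3) hcomp_sum using deg2 t(3) by (intro poly_vs.span_sum) auto
    have d3: "hcomp 3 g \<in> poly_vs.span (B \<union> (C - {g}))"
      unfolding t(3) hcomp_sum using deg3 t(3) by (intro poly_vs.span_sum) auto
    show False
    proof (cases "g \<in> Q")
      case True
      then have "hcomp 2 g = g" using Q(1) hcomp_of_form[of g 2 2] by auto
      then show False using d2 Q(2) True poly_vs.dependent_def by metis
    next
      case False
      then have gC: "g \<in> C" using g by auto
      then have "hcomp 3 g = g" using C(4) hcomp_of_form[of g 3 3] by auto
      moreover have "B \<union> (C - {g}) = B \<union> C - {g}" using gC C(3) by auto
      ultimately show False using d3 C(5) gC poly_vs.dependent_def by (metis UnCI)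
    qed
  qed
  ultimately show ?thesis
    unfolding minimally_generated_by_quadrics_cubics_def
    using Q(1,4) C(2,4) finQ cardC by (intro exI[of _ Q] exI[of _ C]) auto
qed


section \<open>Laurent polynomials and lattice polygons\<close>

text \<open>Keeps the index in \<open>lat 1\<close>, \<open>S 1\<close> and \<open>forms 1\<close>
  from being rewritten to \<open>Suc 0\<close>.\<close>

declare One_nat_def [simp del]

type_synonym laurent = "(int \<times> int) \<Rightarrow>\<^sub>0 complex"

abbreviation cst :: "complex \<Rightarrow> laurent" where "cst c \<equiv> sgl 0 c"
abbreviation mon :: "int \<times> int \<Rightarrow> laurent" where "mon u \<equiv> sgl u 1"

lemma cst_mult: "cst (a * b) = cst a * cst b" by (simp add: mult_single)
lemma cst_sum: "cst (\<Sum>a\<in>A. f a) = (\<Sum>a\<in>A. cst (f a))"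
  by (induction A rule: infinite_finite_induct) (simp_all add: single_add)

lemma coef_cst_mult: "coef (cst c * r) v = c * coef r v"
  by (simp add: coef_single_mult)

lemma coef_mon_mult: "coef (mon u * r) v = coef r (v - u)"
  by (simp add: coef_single_mult)

lemma laurent_sum:
  assumes "finite A" "supp r \<subseteq> A" shows "r = (\<Sum>u\<in>A. cst (coef r u) * mon u)"
proof -
  have "r = (\<Sum>u\<in>supp r. sgl u (coef r u))" by (rule sum_single)
  also have "\<dots> = (\<Sum>u\<in>A. sgl u (coef r u))"
    using assms by (intro sum.mono_neutral_left) (auto simp: in_keys_iff)
  finally show ?thesis by (simp add: mult_single)
qed

lemma eq_uminus_zero: "x = - x \<Longrightarrow> x = 0" for x :: "'a \<Rightarrow>\<^sub>0 complex"
proof (rule poly_mapping_eqI)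
  fix k assume "x = - x"
  then have "coef x k = coef (- x) k" by simp
  then show "coef x k = coef 0 k" by simp
qed

lemma antisym_sum_zero:
  fixes f :: "'i \<Rightarrow> 'i \<Rightarrow> ('a \<Rightarrow>\<^sub>0 complex)"
  assumes "\<And>i j. i \<in> A \<Longrightarrow> j \<in> A \<Longrightarrow> f i j = - f j i"
  shows "(\<Sum>i\<in>A. \<Sum>j\<in>A. f i j) = 0"
proof (rule eq_uminus_zero)
  have "(\<Sum>i\<in>A. \<Sum>j\<in>A. f i j) = (\<Sum>i\<in>A. \<Sum>j\<in>A. - f j i)"
    by (intro sum.cong refl assms)
  also have "\<dots> = - (\<Sum>i\<in>A. \<Sum>j\<in>A. f j i)" by (simp add: sum_negf)
  also have "(\<Sum>i\<in>A. \<Sum>j\<in>A. f j i) = (\<Sum>i\<in>A. \<Sum>j\<in>A. f i j)" by (rule sum.swap)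
  finally show "(\<Sum>i\<in>A. \<Sum>j\<in>A. f i j) = - (\<Sum>i\<in>A. \<Sum>j\<in>A. f i j)" .
qed

text \<open>\<open>y\<close> is a boundary in the Koszul complex of the monomials
  \<open>mon b\<close>: the antisymmetric matrix \<open>k\<close> is an element of the second
  exterior power with coefficients in the given set.\<close>

definition koszul :: "(int \<times> int) set \<Rightarrow> laurent set \<Rightarrow> (int \<times> int \<Rightarrow> laurent) \<Rightarrow> bool" where
  "koszul P S y \<longleftrightarrow> (\<exists>k. (\<forall>a b. k a b \<in> S) \<and> (\<forall>a b. k a b = - k b a) \<and>
     (\<forall>a\<in>P. y a = (\<Sum>b\<in>P. mon b * k a b)))"

text \<open>\<open>lat n\<close> stands for the lattice points of the \<open>n\<close>-fold polygon.
  \<open>lat_split\<close> makes the toric ring generated in degree one.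
  \<open>lat_connected\<close> is the vanishing of first Koszul homology in multidegree
  \<open>u\<close>: the vertices are the positions \<open>a\<close> where a term of that multidegree
  can stand, the edges are the available Koszul relations.\<close>

locale lattice_polygon =
  fixes lat :: "nat \<Rightarrow> (int \<times> int) set"
  assumes finite_lat: "finite (lat n)"
    and zero_lat: "0 \<in> lat n"
    and lat_add: "u \<in> lat n \<Longrightarrow> v \<in> lat 1 \<Longrightarrow> u + v \<in> lat (Suc n)"
    and lat_split: "u \<in> lat (Suc n) \<Longrightarrow> \<exists>v\<in>lat 1. u - v \<in> lat n"
    and lat_connected: "n \<ge> 1 \<Longrightarrow> a \<in> lat 1 \<Longrightarrow> b \<in> lat 1 \<Longrightarrow> u - a \<in> lat (Suc n) \<Longrightarrow> u - b \<in> lat (Suc n) \<Longrightarrow>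
       (\<lambda>a b. a \<in> lat 1 \<and> b \<in> lat 1 \<and> u - a - b \<in> lat n)\<^sup>*\<^sup>* a b"
begin

definition S :: "nat \<Rightarrow> laurent set" where "S n = {r. supp r \<subseteq> lat n}"

lemma S_iff: "r \<in> S n \<longleftrightarrow> (\<forall>u. coef r u \<noteq> 0 \<longrightarrow> u \<in> lat n)"
  by (auto simp: S_def in_keys_iff)

lemma S_zero: "0 \<in> S n" by (simp add: S_iff)
lemma S_add: "r \<in> S n \<Longrightarrow> s \<in> S n \<Longrightarrow> r + s \<in> S n"
  by (simp add: S_iff lookup_add) (metis add_0)
lemma S_uminus: "r \<in> S n \<Longrightarrow> - r \<in> S n" by (simp add: S_iff)
lemma S_diff: "r \<in> S n \<Longrightarrow> s \<in> S n \<Longrightarrow> r - s \<in> S n"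
  using S_add[of r n "- s"] S_uminus by simp
lemma S_sum: "(\<And>a. a \<in> A \<Longrightarrow> f a \<in> S n) \<Longrightarrow> (\<Sum>a\<in>A. f a) \<in> S n"
  by (induction A rule: infinite_finite_induct) (auto simp: S_zero S_add)
lemma S_cst: "r \<in> S n \<Longrightarrow> cst c * r \<in> S n" by (simp add: S_iff coef_cst_mult)
lemma S_mon: "u \<in> lat n \<Longrightarrow> mon u \<in> S n" by (auto simp: S_iff lookup_single when_def)

lemma S_expand: "r \<in> S n \<Longrightarrow> r = (\<Sum>u\<in>lat n. cst (coef r u) * mon u)"
  using laurent_sum finite_lat by (simp add: S_def)

lemma S_mult: assumes "r \<in> S 1" "s \<in> S n" shows "r * s \<in> S (Suc n)"
proof -
  have "r * s = (\<Sum>u\<in>lat 1. \<Sum>v\<in>lat n. cst (coef r u * coef s v) * mon (u + v))"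
    using arg_cong2[OF S_expand[OF assms(1)] S_expand[OF assms(2)], of "(*)"]
    by (simp add: sum_product mult_single)
  moreover have "u + v \<in> lat (Suc n)" if "u \<in> lat 1" "v \<in> lat n" for u v
    using lat_add[OF that(2,1)] by (simp add: add.commute)
  ultimately show ?thesis by (auto intro!: S_sum S_cst S_mon)
qed

lemma one_S: "1 \<in> S n" using S_mon[OF zero_lat, of n] by simp

lemma S_Suc: "r \<in> S n \<Longrightarrow> r \<in> S (Suc n)" using S_mult[OF one_S, of r n] by simp

lemma koszul_cong: "(\<And>a. a \<in> lat 1 \<Longrightarrow> y a = z a) \<Longrightarrow> koszul (lat 1) T y = koszul (lat 1) T z"
  by (simp add: koszul_def)

lemma koszul_zero: "koszul (lat 1) (S n) (\<lambda>a. 0)"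
  unfolding koszul_def by (intro exI[of _ "\<lambda>a b. 0"]) (simp add: S_zero)

lemma koszul_add:
  assumes "koszul (lat 1) (S n) y" "koszul (lat 1) (S n) z" shows "koszul (lat 1) (S n) (\<lambda>a. y a + z a)"
proof -
  obtain k where k: "\<And>a b. k a b \<in> S n" "\<And>a b. k a b = - k b a" "\<And>a. a \<in> lat 1 \<Longrightarrow> y a = (\<Sum>b\<in>lat 1. mon b * k a b)"
    using assms(1) unfolding koszul_def by blast
  obtain l where l: "\<And>a b. l a b \<in> S n" "\<And>a b. l a b = - l b a" "\<And>a. a \<in> lat 1 \<Longrightarrow> z a = (\<Sum>b\<in>lat 1. mon b * l a b)"
    using assms(2) unfolding koszul_def by blast
  have "k a b + l a b = - (k b a + l b a)" for a b using k(2)[of a b] l(2)[of a b] by simp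
  moreover have "y a + z a = (\<Sum>b\<in>lat 1. mon b * (k a b + l a b))" if "a \<in> lat 1" for a
    using k(3)[OF that] l(3)[OF that] by (simp add: distrib_left sum.distrib)
  moreover have "k a b + l a b \<in> S n" for a b by (intro S_add k l)
  ultimately show ?thesis unfolding koszul_def by (intro exI[of _ "\<lambda>a b. k a b + l a b"]) blast
qed

lemma koszul_cst:
  assumes "koszul (lat 1) (S n) y" shows "koszul (lat 1) (S n) (\<lambda>a. cst c * y a)"
proof -
  obtain k where k: "\<And>a b. k a b \<in> S n" "\<And>a b. k a b = - k b a" "\<And>a. a \<in> lat 1 \<Longrightarrow> y a = (\<Sum>b\<in>lat 1. mon b * k a b)"
    using assms(1) unfolding koszul_def by blast
  have "cst c * k a b = - (cst c * k b a)" for a b using arg_cong[OF k(2)[of a b], of "(*) (cst c)"] by simp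
  moreover have "cst c * y a = (\<Sum>b\<in>lat 1. mon b * (cst c * k a b))" if "a \<in> lat 1" for a
    using k(3)[OF that] by (simp add: sum_distrib_left mult.left_commute)
  moreover have "cst c * k a b \<in> S n" for a b by (intro S_cst k)
  ultimately show ?thesis unfolding koszul_def by (intro exI[of _ "\<lambda>a b. cst c * k a b"]) blast
qed

lemma koszul_sum:
  "finite A \<Longrightarrow> (\<And>i. i \<in> A \<Longrightarrow> koszul (lat 1) (S n) (y i)) \<Longrightarrow> koszul (lat 1) (S n) (\<lambda>a. \<Sum>i\<in>A. y i a)"
  by (induction A rule: finite_induct) (simp_all add: koszul_zero koszul_add)

text \<open>Exactness of the Koszul complex of the monomials is graded by the lattice; in each degree
  it is the connectedness assumption.\<close>

lemma koszul_exact: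
  assumes n: "n \<ge> 1" and y: "\<And>a. a \<in> lat 1 \<Longrightarrow> y a \<in> S (Suc n)"
    and zero: "(\<Sum>a\<in>lat 1. mon a * y a) = 0"
  shows "koszul (lat 1) (S n) y"
proof -
  define e where "e a v = (\<lambda>b. if b = a then mon v else 0)" for a v :: "int \<times> int"
  \<comment> \<open>Moving a term of multidegree \<open>u\<close> from position \<open>a\<close> to
    position \<open>b\<close> is the boundary of the antisymmetric matrix whose only entries are
    plus and minus \<open>mon (u - a - b)\<close>.\<close>
  have edge: "koszul (lat 1) (S n) (\<lambda>x. e a (u - a) x - e b (u - b) x)"
    if ab: "a \<in> lat 1" "b \<in> lat 1" "u - a - b \<in> lat n" for a b u
  proof (cases "a = b")
    case False
    let ?t = "mon (u - a - b)"
    define k where "k x z = (if x = a \<and> z = b then ?t else if x = b \<and> z = a then - ?t else 0)" for x z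
    have "e a (u - a) x - e b (u - b) x = (\<Sum>z\<in>lat 1. mon z * k x z)" if "x \<in> lat 1" for x
    proof -
      have "(\<Sum>z\<in>lat 1. mon z * k x z) =
        (\<Sum>z\<in>lat 1. if z = b then (if x = a then mon (u - a) else 0) else 0) -
        (\<Sum>z\<in>lat 1. if z = a then (if x = b then mon (u - b) else 0) else 0)"
        unfolding sum_subtractf[symmetric] using False
        by (intro sum.cong) (auto simp: k_def mult_single algebra_simps)
      then show ?thesis using ab finite_lat[of 1] by (simp add: e_def)
    qed
    moreover have "k x z = - k z x" for x z using False by (auto simp: k_def)
    moreover have "k x z \<in> S n" for x z using ab(3) by (auto simp: k_def S_zero S_uminus S_mon)
    ultimately show ?thesis unfolding koszul_def by blast
  qed (simp add: koszul_zero)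
  have path: "koszul (lat 1) (S n) (\<lambda>x. e a (u - a) x - e b (u - b) x)"
    if "(\<lambda>a b. a \<in> lat 1 \<and> b \<in> lat 1 \<and> u - a - b \<in> lat n)\<^sup>*\<^sup>* a b" for a b u
    using that
  proof (induction rule: rtranclp_induct)
    case base show ?case by (simp add: koszul_zero)
  next
    case (step b c)
    then show ?case using koszul_add[OF step.IH edge[of b c u]] by simp
  qed
  have "\<exists>r. u \<in> lat (Suc (Suc n)) \<longrightarrow> r \<in> lat 1 \<and> u - r \<in> lat (Suc n)" for u
    using lat_split[of u "Suc n"] by (metis (no_types))
  \<comment> \<open>One position \<open>r u\<close> is fixed in every multidegree; along paths of
    edges all terms of multidegree \<open>u\<close> are moved to it.\<close>
  then obtain r where r: "\<And>u. u \<in> lat (Suc (Suc n)) \<Longrightarrow> r u \<in> lat 1 \<and> u - r u \<in> lat (Suc n)" by metis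
  let ?L = "lat (Suc n)"
  define c where "c a v = coef (y a) v" for a v
  have y_exp: "y x = (\<Sum>a\<in>lat 1. \<Sum>v\<in>?L. cst (c a v) * e a v x)" if "x \<in> lat 1" for x
  proof -
    have "(\<Sum>a\<in>lat 1. \<Sum>v\<in>?L. cst (c a v) * e a v x) = (\<Sum>a\<in>lat 1. if a = x then y a else 0)"
    proof (intro sum.cong refl)
      fix a assume a: "a \<in> lat 1"
      show "(\<Sum>v\<in>?L. cst (c a v) * e a v x) = (if a = x then y a else 0)"
        using S_expand[OF y[OF a]] by (auto simp: e_def c_def)
    qed
    then show ?thesis using that finite_lat[of 1] by simp
  qed
  have avL: "a + v \<in> lat (Suc (Suc n))" if "a \<in> lat 1" "v \<in> ?L" for a v
    using lat_add[OF that(2,1)] by (simp add: add.commute)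
  \<comment> \<open>After the move the coefficient gathered at \<open>r u\<close> is the coefficient
    of \<open>u\<close> in the sum of the \<open>mon a * y a\<close>, hence zero.\<close>
  have rest: "(\<Sum>a\<in>lat 1. \<Sum>v\<in>?L. cst (c a v) * e (r (a + v)) (a + v - r (a + v)) x) = 0" for x
  proof -
    let ?f = "\<lambda>a u. cst (c a (u - a)) * e (r u) (u - r u) x"
    have c0: "c a v = 0" if "a \<in> lat 1" "v \<notin> ?L" for a v
      using y[OF that(1)] that(2) unfolding c_def S_iff by blast
    have "(\<Sum>a\<in>lat 1. \<Sum>v\<in>?L. cst (c a v) * e (r (a + v)) (a + v - r (a + v)) x) =
      (\<Sum>a\<in>lat 1. \<Sum>u\<in>lat (Suc (Suc n)). ?f a u)"
    proof (rule sum.cong[OF refl])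
      fix a assume a: "a \<in> lat 1"
      have "(\<Sum>v\<in>?L. ?f a (a + v)) = (\<Sum>u\<in>(+) a ` ?L. ?f a u)"
        by (subst sum.reindex) auto
      also have "\<dots> = (\<Sum>u\<in>lat (Suc (Suc n)). ?f a u)"
      proof (rule sum.mono_neutral_left[OF finite_lat])
        show "(+) a ` ?L \<subseteq> lat (Suc (Suc n))" using avL[OF a] by (rule image_subsetI)
        show "\<forall>u\<in>lat (Suc (Suc n)) - (+) a ` ?L. ?f a u = 0"
        proof
          fix u assume "u \<in> lat (Suc (Suc n)) - (+) a ` ?L"
          then have "u - a \<notin> ?L" by (metis DiffD2 add_diff_cancel_left' add_diff_eq image_eqI diff_add_cancel add.commute)
          then show "?f a u = 0" using c0[OF a] by simp
        qed
      qed
      finally show "(\<Sum>v\<in>?L. cst (c a v) * e (r (a + v)) (a + v - r (a + v)) x) = (\<Sum>u\<in>lat (Suc (Suc n)). ?f a u)"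
        by simp
    qed
    also have "\<dots> = (\<Sum>u\<in>lat (Suc (Suc n)). \<Sum>a\<in>lat 1. ?f a u)" by (rule sum.swap)
    also have "\<dots> = (\<Sum>u\<in>lat (Suc (Suc n)). cst (\<Sum>a\<in>lat 1. c a (u - a)) * e (r u) (u - r u) x)"
      by (simp add: cst_sum sum_distrib_right)
    also have "\<dots> = 0"
    proof (intro sum.neutral ballI)
      fix u
      have "(\<Sum>a\<in>lat 1. c a (u - a)) = coef (\<Sum>a\<in>lat 1. mon a * y a) u"
        by (simp add: lookup_sum coef_mon_mult c_def)
      then show "cst (\<Sum>a\<in>lat 1. c a (u - a)) * e (r u) (u - r u) x = 0" using zero by simp
    qed
    finally show ?thesis .
  qed
  have "koszul (lat 1) (S n) (\<lambda>x. \<Sum>a\<in>lat 1. \<Sum>v\<in>?L. cst (c a v) * (e a v x - e (r (a + v)) (a + v - r (a + v)) x))"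
  proof (intro koszul_sum finite_lat koszul_cst)
    fix a v assume av: "a \<in> lat 1" "v \<in> ?L"
    have "(\<lambda>a' b. a' \<in> lat 1 \<and> b \<in> lat 1 \<and> (a + v) - a' - b \<in> lat n)\<^sup>*\<^sup>* a (r (a + v))"
      using r[OF avL[OF av]] av by (intro lat_connected[OF n]) auto
    from path[OF this] show "koszul (lat 1) (S n) (\<lambda>x. e a v x - e (r (a + v)) (a + v - r (a + v)) x)" by simp
  qed
  moreover have "(\<Sum>a\<in>lat 1. \<Sum>v\<in>?L. cst (c a v) * (e a v x - e (r (a + v)) (a + v - r (a + v)) x)) = y x"
    if "x \<in> lat 1" for x
    using y_exp[OF that] rest[of x] by (simp add: right_diff_distrib sum_subtractf)
  ultimately show ?thesis by (subst koszul_cong[symmetric])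
qed

end

section \<open>Projected toric surfaces\<close>

abbreviation lsub :: "('k::finite \<Rightarrow> laurent) \<Rightarrow> 'k mpoly \<Rightarrow> laurent" where
  "lsub \<equiv> psubst cst"

text \<open>\<open>p\<close> is the centre of projection in toric coordinates, read as a functional
  on \<open>S 1\<close> and scaled to 1 on the centre monomial. The \<open>w i\<close> form a basis
  of its kernel, and \<open>a m\<close> holds the coordinates of \<open>mon m - cst (p m)\<close> in
  this basis.\<close>

locale toric_projection = lattice_polygon lat for lat +
  fixes p :: "int \<times> int \<Rightarrow> complex" and w :: "'k::finite \<Rightarrow> laurent" and a :: "int \<times> int \<Rightarrow> 'k \<Rightarrow> complex"
  assumes p0: "p 0 = 1"
    and w_S: "w i \<in> S 1"
    and w_p: "(\<Sum>m\<in>lat 1. coef (w i) m * p m) = 0"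
    and mon_repr: "m \<in> lat 1 \<Longrightarrow> mon m = (\<Sum>i\<in>UNIV. cst (a m i) * w i) + cst (p m)"
    and w_indep: "(\<Sum>i\<in>UNIV. cst (c i) * w i) = 0 \<Longrightarrow> c i = 0"
    and quadrics_onto: "u \<in> lat 2 \<Longrightarrow> \<exists>c. mon u = (\<Sum>i\<in>UNIV. \<Sum>j\<in>UNIV. cst (c i j) * (w i * w j))"
begin

lemma w_expand: "w i = (\<Sum>m\<in>lat 1. cst (coef (w i) m) * mon m)"
  by (rule S_expand[OF w_S])

text \<open>Inserting \<open>mon_repr\<close> into the expansion of \<open>w i\<close> by monomials
  gives \<open>w i\<close> in terms of the \<open>w j\<close>, because the constant term vanishes by
  \<open>w_p\<close>; independence then compares coefficients.\<close>

lemma dual: "(\<Sum>m\<in>lat 1. coef (w i) m * a m j) = (if i = j then 1 else 0)"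
proof -
  have "w i = (\<Sum>m\<in>lat 1. cst (coef (w i) m) * ((\<Sum>j\<in>UNIV. cst (a m j) * w j) + cst (p m)))"
    using w_expand[of i] mon_repr by simp
  also have "\<dots> = (\<Sum>m\<in>lat 1. \<Sum>j\<in>UNIV. cst (coef (w i) m * a m j) * w j) + cst (\<Sum>m\<in>lat 1. coef (w i) m * p m)"
    by (simp add: distrib_left sum.distrib sum_distrib_left cst_sum cst_mult mult.assoc)
  also have "(\<Sum>m\<in>lat 1. \<Sum>j\<in>UNIV. cst (coef (w i) m * a m j) * w j) =
     (\<Sum>j\<in>UNIV. cst (\<Sum>m\<in>lat 1. coef (w i) m * a m j) * w j)"
    by (subst sum.swap) (simp add: cst_sum sum_distrib_right)
  finally have "w i = (\<Sum>j\<in>UNIV. cst (\<Sum>m\<in>lat 1. coef (w i) m * a m j) * w j)" by (simp add: w_p)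
  moreover have "w i = (\<Sum>j\<in>UNIV. cst (if i = j then 1 else 0) * w j)"
  proof -
    have "(\<Sum>j\<in>UNIV. cst (if i = j then 1 else 0) * w j) = (\<Sum>j\<in>UNIV. if i = j then w j else 0)"
      by (intro sum.cong) auto
    then show ?thesis by simp
  qed
  ultimately have "(\<Sum>j\<in>UNIV. cst (\<Sum>m\<in>lat 1. coef (w i) m * a m j) * w j) -
      (\<Sum>j\<in>UNIV. cst (if i = j then 1 else 0) * w j) = 0" by simp
  then have "(\<Sum>j\<in>UNIV. cst ((\<Sum>m\<in>lat 1. coef (w i) m * a m j) - (if i = j then 1 else 0)) * w j) = 0"
    by (simp only: single_diff left_diff_distrib sum_subtractf)
  from w_indep[OF this, of j] show ?thesis by simp
qed

text \<open>Change of basis in the Koszul complex from the monomials to the \<open>w i\<close> and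
  1. The matrix \<open>l\<close> given by \<open>koszul_exact\<close> splits into a part
  \<open>k\<close> pairing two \<open>w\<close> and a part \<open>h\<close> pairing a
  \<open>w\<close> with 1. Antisymmetry makes \<open>h\<close> again a relation among the
  \<open>w\<close>, of degree one lower than \<open>y\<close>.\<close>

lemma koszul_step:
  assumes n: "n \<ge> 1" and y: "\<And>i. y i \<in> S (Suc n)" and zero: "(\<Sum>i\<in>UNIV. w i * y i) = 0"
  obtains k h where "\<And>i j. k i j \<in> S n" "\<And>i j. k i j = - k j i" "\<And>i. h i \<in> S n"
    "(\<Sum>i\<in>UNIV. w i * h i) = 0" "\<And>i. y i = (\<Sum>j\<in>UNIV. w j * k i j) + h i"
proof -
  \<comment> \<open>\<open>z\<close> is the relation \<open>y\<close> transported to the monomials;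
    that it has no component along 1 is \<open>pz\<close> below.\<close>
  define z where "z m = (\<Sum>i\<in>UNIV. cst (coef (w i) m) * y i)" for m
  have "(\<Sum>m\<in>lat 1. mon m * z m) = (\<Sum>m\<in>lat 1. \<Sum>i\<in>UNIV. (cst (coef (w i) m) * mon m) * y i)"
    by (simp add: z_def sum_distrib_left ac_simps)
  also have "\<dots> = (\<Sum>i\<in>UNIV. \<Sum>m\<in>lat 1. (cst (coef (w i) m) * mon m) * y i)" by (rule sum.swap)
  also have "\<dots> = (\<Sum>i\<in>UNIV. w i * y i)" by (simp add: sum_distrib_right[symmetric] w_expand[symmetric])
  finally have z0: "(\<Sum>m\<in>lat 1. mon m * z m) = 0" using zero by simp
  have "koszul (lat 1) (S n) z"
    by (rule koszul_exact[OF n _ z0]) (auto simp: z_def intro!: S_sum S_cst y)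
  then obtain l where l: "\<And>m m'. l m m' \<in> S n" "\<And>m m'. l m m' = - l m' m"
      "\<And>m. m \<in> lat 1 \<Longrightarrow> z m = (\<Sum>m'\<in>lat 1. mon m' * l m m')"
    unfolding koszul_def by blast
  define k where "k i j = (\<Sum>m\<in>lat 1. \<Sum>m'\<in>lat 1. cst (a m i * a m' j) * l m m')" for i j
  define h where "h i = (\<Sum>m\<in>lat 1. \<Sum>m'\<in>lat 1. cst (a m i * p m') * l m m')" for i
  have kS: "k i j \<in> S n" for i j unfolding k_def by (intro S_sum S_cst l)
  have hS: "h i \<in> S n" for i unfolding h_def by (intro S_sum S_cst l)
  have anti: "k i j = - k j i" for i j
  proof -
    have "k i j = (\<Sum>m\<in>lat 1. \<Sum>m'\<in>lat 1. - (cst (a m' j * a m i) * l m' m))"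
      unfolding k_def by (intro sum.cong refl) (metis l(2) mult.commute mult_minus_right)
    also have "\<dots> = - (\<Sum>m\<in>lat 1. \<Sum>m'\<in>lat 1. cst (a m' j * a m i) * l m' m)" by (simp add: sum_negf)
    also have "(\<Sum>m\<in>lat 1. \<Sum>m'\<in>lat 1. cst (a m' j * a m i) * l m' m) = k j i"
      unfolding k_def by (rule sum.swap)
    finally show ?thesis .
  qed
  have y_z: "y i = (\<Sum>m\<in>lat 1. cst (a m i) * z m)" for i
  proof -
    have "(\<Sum>m\<in>lat 1. cst (a m i) * z m) = (\<Sum>m\<in>lat 1. \<Sum>j\<in>UNIV. cst (coef (w j) m * a m i) * y j)"
      by (simp add: z_def sum_distrib_left cst_mult ac_simps)
    also have "\<dots> = (\<Sum>j\<in>UNIV. cst (\<Sum>m\<in>lat 1. coef (w j) m * a m i) * y j)"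
      by (subst sum.swap) (simp add: cst_sum sum_distrib_right)
    also have "\<dots> = (\<Sum>j\<in>UNIV. if j = i then y j else 0)"
      unfolding dual by (intro sum.cong) auto
    finally show ?thesis by simp
  qed
  have y_eq: "y i = (\<Sum>j\<in>UNIV. w j * k i j) + h i" for i
  proof -
    have "y i = (\<Sum>m\<in>lat 1. \<Sum>m'\<in>lat 1. cst (a m i) * (((\<Sum>j\<in>UNIV. cst (a m' j) * w j) + cst (p m')) * l m m'))"
      unfolding y_z by (simp add: l(3) sum_distrib_left mon_repr)
    also have "\<dots> = (\<Sum>m\<in>lat 1. \<Sum>m'\<in>lat 1. \<Sum>j\<in>UNIV. w j * (cst (a m i * a m' j) * l m m')) + h i"
      by (simp add: h_def distrib_left distrib_right sum.distrib sum_distrib_left sum_distrib_right cst_mult ac_simps)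
    also have "(\<Sum>m\<in>lat 1. \<Sum>m'\<in>lat 1. \<Sum>j\<in>UNIV. w j * (cst (a m i * a m' j) * l m m')) =
       (\<Sum>m\<in>lat 1. \<Sum>j\<in>UNIV. \<Sum>m'\<in>lat 1. w j * (cst (a m i * a m' j) * l m m'))"
      by (intro sum.cong refl) (rule sum.swap)
    also have "\<dots> = (\<Sum>j\<in>UNIV. \<Sum>m\<in>lat 1. \<Sum>m'\<in>lat 1. w j * (cst (a m i * a m' j) * l m m'))"
      by (rule sum.swap)
    also have "\<dots> = (\<Sum>j\<in>UNIV. w j * k i j)" by (simp add: k_def sum_distrib_left)
    finally show ?thesis .
  qed
  have pz: "(\<Sum>m\<in>lat 1. cst (p m) * z m) = 0"
  proof -
    have "(\<Sum>m\<in>lat 1. cst (p m) * z m) = (\<Sum>m\<in>lat 1. \<Sum>j\<in>UNIV. cst (coef (w j) m * p m) * y j)"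
      by (simp add: z_def sum_distrib_left cst_mult ac_simps)
    also have "\<dots> = (\<Sum>j\<in>UNIV. cst (\<Sum>m\<in>lat 1. coef (w j) m * p m) * y j)"
      by (subst sum.swap) (simp add: cst_sum sum_distrib_right)
    finally show ?thesis by (simp add: w_p)
  qed
  \<comment> \<open>After replacing the combinations of the \<open>w\<close> by
    \<open>mon m - cst (p m)\<close>, the terms with \<open>p m * p m'\<close> cancel by
    antisymmetry and the others add up to the combination of the \<open>z\<close> that vanishes by
    \<open>pz\<close>.\<close>
  have "(\<Sum>i\<in>UNIV. w i * h i) = (\<Sum>i\<in>UNIV. \<Sum>m\<in>lat 1. \<Sum>m'\<in>lat 1. (cst (a m i) * w i) * (cst (p m') * l m m'))"
    by (simp add: h_def sum_distrib_left cst_mult ac_simps)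
  also have "\<dots> = (\<Sum>m\<in>lat 1. \<Sum>i\<in>UNIV. \<Sum>m'\<in>lat 1. (cst (a m i) * w i) * (cst (p m') * l m m'))"
    by (rule sum.swap)
  also have "\<dots> = (\<Sum>m\<in>lat 1. \<Sum>m'\<in>lat 1. \<Sum>i\<in>UNIV. (cst (a m i) * w i) * (cst (p m') * l m m'))"
    by (intro sum.cong refl) (rule sum.swap)
  also have "\<dots> = (\<Sum>m\<in>lat 1. \<Sum>m'\<in>lat 1. (mon m - cst (p m)) * (cst (p m') * l m m'))"
    by (intro sum.cong refl) (simp add: mon_repr sum_distrib_right)
  also have "\<dots> = (\<Sum>m\<in>lat 1. \<Sum>m'\<in>lat 1. cst (p m') * (mon m * l m m')) -
      (\<Sum>m\<in>lat 1. \<Sum>m'\<in>lat 1. cst (p m * p m') * l m m')"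
    unfolding sum_subtractf[symmetric] by (intro sum.cong refl) (simp add: cst_mult algebra_simps)
  also have "(\<Sum>m\<in>lat 1. \<Sum>m'\<in>lat 1. cst (p m * p m') * l m m') = 0"
    by (rule antisym_sum_zero) (metis l(2) mult.commute mult_minus_right)
  also have "(\<Sum>m\<in>lat 1. \<Sum>m'\<in>lat 1. cst (p m') * (mon m * l m m')) =
      (\<Sum>m'\<in>lat 1. \<Sum>m\<in>lat 1. cst (p m') * (mon m * l m m'))" by (rule sum.swap)
  also have "\<dots> = (\<Sum>m'\<in>lat 1. - (cst (p m') * z m'))"
  proof (intro sum.cong refl)
    fix m' assume m': "m' \<in> lat 1"
    have "(\<Sum>m\<in>lat 1. cst (p m') * (mon m * l m m')) = (\<Sum>m\<in>lat 1. - (cst (p m') * (mon m * l m' m)))"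
      by (intro sum.cong refl) (metis l(2) mult_minus_right)
    then show "(\<Sum>m\<in>lat 1. cst (p m') * (mon m * l m m')) = - (cst (p m') * z m')"
      by (simp add: l(3)[OF m'] sum_distrib_left sum_negf)
  qed
  also have "\<dots> = 0" using pz by (simp add: sum_negf)
  finally have "(\<Sum>i\<in>UNIV. w i * h i) = 0" by simp
  then show ?thesis using that kS anti hS y_eq by blast
qed

text \<open>The second application of \<open>koszul_step\<close> leaves a remainder \<open>h\<close> of degree low enough to be
  multiplied by the expression of \<open>1\<close> (the square of the centre monomial) as a quadric in the \<open>w i\<close>.\<close>

lemma koszul_w:
  assumes n: "n \<ge> 2" and y: "\<And>i. y i \<in> S (Suc n)" and zero: "(\<Sum>i\<in>UNIV. w i * y i) = 0"
  obtains k where "\<And>i j. k i j \<in> S n" "\<And>i j. k i j = - k j i" "\<And>i. y i = (\<Sum>j\<in>UNIV. w j * k i j)"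
proof -
  have n1: "n \<ge> 1" using n by simp
  obtain n' where n': "n = Suc n'" "n' \<ge> 1" using n by (cases n) auto
  obtain k h where k: "\<And>i j. k i j \<in> S n" "\<And>i j. k i j = - k j i" "\<And>i. h i \<in> S n"
    "(\<Sum>i\<in>UNIV. w i * h i) = 0" "\<And>i. y i = (\<Sum>j\<in>UNIV. w j * k i j) + h i"
    by (rule koszul_step[OF n1 y zero]) (rule that)
  have hS: "h i \<in> S (Suc n')" for i using k(3) n'(1) by simp
  obtain k' h' where k': "\<And>i j. k' i j \<in> S n'" "\<And>i j. k' i j = - k' j i" "\<And>i. h' i \<in> S n'"
    "(\<Sum>i\<in>UNIV. w i * h' i) = 0" "\<And>i. h i = (\<Sum>j\<in>UNIV. w j * k' i j) + h' i"
    by (rule koszul_step[OF n'(2) hS k(4)]) (rule that)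
  obtain c where c: "mon 0 = (\<Sum>i\<in>UNIV. \<Sum>j\<in>UNIV. cst (c i j) * (w i * w j))"
    using quadrics_onto[OF zero_lat] by blast
  define q where "q j = (\<Sum>b\<in>UNIV. cst (c j b) * w b)" for j
  have qS: "q j \<in> S 1" for j unfolding q_def by (intro S_sum S_cst w_S)
  have q1: "(\<Sum>j\<in>UNIV. w j * q j) = 1"
    using c by (simp add: q_def sum_distrib_left ac_simps)
  \<comment> \<open>A contracting homotopy: since the \<open>w j * q j\<close> sum to 1 and the
    \<open>w j * h' j\<close> sum to 0, applying the Koszul differential to \<open>k2\<close>
    returns \<open>h'\<close>. The factor \<open>q\<close> costs one degree, which the second
    application of \<open>koszul_step\<close> has provided.\<close>
  define k2 where "k2 i j = q j * h' i - q i * h' j" for i j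
  have k2S: "k2 i j \<in> S n" for i j
    unfolding k2_def n'(1) by (intro S_diff S_mult qS k'(3))
  have h'_eq: "(\<Sum>j\<in>UNIV. w j * k2 i j) = h' i" for i
  proof -
    have "(\<Sum>j\<in>UNIV. w j * k2 i j) = (\<Sum>j\<in>UNIV. w j * q j) * h' i - q i * (\<Sum>j\<in>UNIV. w j * h' j)"
      by (simp add: k2_def right_diff_distrib sum_subtractf sum_distrib_left sum_distrib_right ac_simps)
    then show ?thesis by (simp add: q1 k'(4))
  qed
  show ?thesis
  proof (rule that[of "\<lambda>i j. k i j + k' i j + k2 i j"])
    show "k i j + k' i j + k2 i j \<in> S n" for i j
      using k(1) S_Suc[OF k'(1)] k2S n'(1) by (auto intro!: S_add)
    show "k i j + k' i j + k2 i j = - (k j i + k' j i + k2 j i)" for i j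
      using k(2)[of i j] k'(2)[of i j] by (simp add: k2_def)
    show "y i = (\<Sum>j\<in>UNIV. w j * (k i j + k' i j + k2 i j))" for i
      by (simp add: distrib_left sum.distrib h'_eq k(5)[of i] k'(5)[of i] add.assoc)
  qed
qed

lemma lsub_forms: "F \<in> forms n \<Longrightarrow> lsub w F \<in> S n"
proof (induction n arbitrary: F)
  case 0
  have "lsub w F = cst (coef F 0)" by (subst form0[OF 0]) (rule const_hom.psubst_const)
  then show ?case using S_cst[OF one_S, of "coef F 0" 0] by simp
next
  case (Suc n)
  obtain G where G: "\<And>i. G i \<in> forms n" "F = (\<Sum>i\<in>UNIV. var i * G i)"
    by (rule forms_Suc_decomp[OF Suc.prems]) blast
  have "lsub w F = (\<Sum>i\<in>UNIV. w i * lsub w (G i))"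
    by (simp add: G(2) const_hom.psubst_sum const_hom.psubst_mult const_hom.psubst_var)
  then show ?case using Suc.IH[OF G(1)] by (auto intro!: S_sum S_mult w_S)
qed

text \<open>Two points \<open>v\<close>, \<open>v'\<close> are split off \<open>u\<close> together,
  because the \<open>w\<close> reach all monomials only in degree 2. In the resulting quadric one
  factor \<open>w i\<close> becomes a variable, and the other is absorbed into an element of degree
  \<open>n + 2\<close>, which the induction hypothesis lifts.\<close>

lemma lsub_onto_mon: "u \<in> lat (n + 2) \<Longrightarrow> \<exists>F\<in>forms (n + 2). lsub w F = mon u"
proof (induction n arbitrary: u)
  case 0
  then have "u \<in> lat 2" by (simp only: add_0)
  from quadrics_onto[OF this] obtain c where c: "mon u = (\<Sum>i\<in>UNIV. \<Sum>j\<in>UNIV. cst (c i j) * (w i * w j))"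
    by blast
  let ?F = "\<Sum>i\<in>UNIV. \<Sum>j\<in>UNIV. sgl 0 (c i j) * (var i * var j)"
  have "sgl 0 x * (var i * var j) \<in> forms (0 + (1 + 1))" for x and i j :: 'k
    by (intro forms_mult forms_const forms_var)
  then have "?F \<in> forms (0 + 2)" by (intro forms_sum) (simp add: numeral_2_eq_2)
  moreover have "lsub w ?F = mon u"
    by (simp only: c const_hom.psubst_sum const_hom.psubst_mult const_hom.psubst_const const_hom.psubst_var)
  ultimately show ?case by blast
next
  case (Suc n)
  have "u \<in> lat (Suc (Suc (Suc n)))" using Suc.prems by simp
  from lat_split[OF this] obtain v where v: "v \<in> lat 1" "u - v \<in> lat (Suc (Suc n))" by blast
  from lat_split[OF v(2)] obtain v' where v': "v' \<in> lat 1" "u - v - v' \<in> lat (Suc n)" by blast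
  have "v + v' \<in> lat 2" using lat_add[OF v(1) v'(1)] by (simp add: numeral_2_eq_2)
  from quadrics_onto[OF this] obtain c where c: "mon (v + v') = (\<Sum>i\<in>UNIV. \<Sum>j\<in>UNIV. cst (c i j) * (w i * w j))"
    by blast
  have "w j * mon (u - v - v') \<in> S (n + 2)" for j
    using S_mult[OF w_S S_mon[OF v'(2)]] by simp
  note wS = this
  have "\<exists>F\<in>forms (n + 2). lsub w F = w j * mon (u - v - v')" for j
  proof -
    from wS have e: "w j * mon (u - v - v') = (\<Sum>x\<in>lat (n + 2). cst (coef (w j * mon (u - v - v')) x) * mon x)"
      by (rule S_expand)
    obtain F where F: "\<And>x. x \<in> lat (n + 2) \<Longrightarrow> F x \<in> forms (n + 2) \<and> lsub w (F x) = mon x"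
      using Suc.IH by metis
    let ?G = "\<Sum>x\<in>lat (n + 2). const_scale (coef (w j * mon (u - v - v')) x) (F x)"
    have "?G \<in> forms (n + 2)" using F by (intro forms_sum forms_scale) auto
    moreover have "lsub w ?G = w j * mon (u - v - v')"
      using F by (subst e) (simp add: const_hom.psubst_sum const_hom.psubst_scale)
    ultimately show ?thesis by blast
  qed
  then obtain F where F: "\<And>j. F j \<in> forms (n + 2)" "\<And>j. lsub w (F j) = w j * mon (u - v - v')" by metis
  let ?G = "\<Sum>i\<in>UNIV. \<Sum>j\<in>UNIV. const_scale (c i j) (var i * F j)"
  have "?G \<in> forms (Suc n + 2)"
    using forms_var_mult[OF F(1)] by (intro forms_sum forms_scale) simp
  moreover have "lsub w ?G = mon (v + v') * mon (u - v - v')"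
    unfolding c by (simp add: const_hom.psubst_sum const_hom.psubst_mult const_hom.psubst_scale
        const_hom.psubst_var F(2) sum_distrib_left sum_distrib_right ac_simps)
  moreover have "mon (v + v') * mon (u - v - v') = mon u" by (simp add: mult_single)
  ultimately show ?case by auto
qed

lemma lsub_onto:
  assumes "n \<ge> 2" "r \<in> S n" shows "\<exists>F\<in>forms n. lsub w F = r"
proof -
  obtain F where F: "\<And>x. x \<in> lat n \<Longrightarrow> F x \<in> forms n \<and> lsub w (F x) = mon x"
    using lsub_onto_mon[of _ "n - 2"] assms(1) by (metis le_add_diff_inverse2)
  have "(\<Sum>x\<in>lat n. const_scale (coef r x) (F x)) \<in> forms n"
    using F by (intro forms_sum forms_scale) auto
  moreover have "lsub w (\<Sum>x\<in>lat n. const_scale (coef r x) (F x)) = r"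
    using F by (subst S_expand[OF assms(2)]) (simp add: const_hom.psubst_sum const_hom.psubst_scale)
  ultimately show ?thesis by blast
qed

text \<open>The cofactors of the variables in \<open>F\<close> form a relation among the
  \<open>w\<close>, which is a Koszul boundary by \<open>koszul_w\<close>. Lifting the boundary to
  polynomials and subtracting it makes every cofactor vanish on the surface. The bound on
  \<open>n\<close> ensures that the boundary has degree at least 2, where lifts exist.\<close>

lemma generated_in_degree_three:
  assumes n: "n \<ge> 3" and F: "F \<in> forms (Suc n)" and zero: "lsub w F = 0"
  shows "\<exists>G. (\<forall>i. G i \<in> forms n \<and> lsub w (G i) = 0) \<and> F = (\<Sum>i\<in>UNIV. var i * G i)"
proof -
  obtain H where H: "\<And>i. H i \<in> forms n" "F = (\<Sum>i\<in>UNIV. var i * H i)"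
    by (rule forms_Suc_decomp[OF F]) blast
  obtain n' where n': "n = Suc n'" "n' \<ge> 2" using n by (cases n) auto
  have "(\<Sum>i\<in>UNIV. w i * lsub w (H i)) = 0"
    using zero by (simp add: H(2) const_hom.psubst_sum const_hom.psubst_mult const_hom.psubst_var)
  note zero' = this
  have HS: "lsub w (H i) \<in> S (Suc n')" for i using lsub_forms[OF H(1)] n'(1) by simp
  obtain k where k: "\<And>i j. k i j \<in> S n'" "\<And>i j. k i j = - k j i"
      "\<And>i. lsub w (H i) = (\<Sum>j\<in>UNIV. w j * k i j)"
    by (rule koszul_w[OF n'(2) HS zero']) (rule that)
  obtain L where L: "\<And>i j. L i j \<in> forms n'" "\<And>i j. lsub w (L i j) = k i j"
    using lsub_onto[OF n'(2) k(1)] by metis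
  \<comment> \<open>The lifts of an antisymmetric matrix need not be antisymmetric; after this
    correction the subtracted terms cancel identically in \<open>F\<close>.\<close>
  define K where "K i j = const_scale (1/2) (L i j - L j i)" for i j
  have KL: "lsub w (K i j) = k i j" for i j
  proof -
    have "lsub w (K i j) = cst (1/2) * (k i j - k j i)"
      by (simp add: K_def const_hom.psubst_scale const_hom.psubst_diff L(2))
    also have "\<dots> = cst (1/2) * k i j + cst (1/2) * k i j" using k(2)[of j i] by (simp add: algebra_simps)
    also have "\<dots> = cst (1/2 + 1/2) * k i j" by (simp only: single_add distrib_right)
    finally show ?thesis by simp
  qed
  have K_forms: "K i j \<in> forms n'" for i j unfolding K_def by (intro forms_scale forms_diff L)
  have K_anti: "K i j = - K j i" for i j
    by (simp add: K_def const_scale_def algebra_simps)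
  define G where "G i = H i - (\<Sum>j\<in>UNIV. var j * K i j)" for i
  have "G i \<in> forms n" for i
    unfolding G_def n'(1) using H(1) forms_var_mult[OF K_forms] n'(1) by (auto intro!: forms_diff forms_sum)
  moreover have "lsub w (G i) = 0" for i
    by (simp add: G_def const_hom.psubst_diff const_hom.psubst_sum const_hom.psubst_mult const_hom.psubst_var KL k(3))
  moreover have "(\<Sum>i\<in>UNIV. \<Sum>j\<in>UNIV. var i * (var j * K i j)) = 0"
    by (rule antisym_sum_zero) (metis K_anti mult.left_commute mult_minus_right)
  then have "F = (\<Sum>i\<in>UNIV. var i * G i)"
    by (simp add: G_def H(2) right_diff_distrib sum_subtractf sum_distrib_left)
  ultimately show ?thesis by (intro exI[of _ G] conjI allI)
qed

end


section \<open>Dimension counts for the ideal of the projected surface\<close>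

definition lscale :: "complex \<Rightarrow> laurent \<Rightarrow> laurent" where "lscale c r = cst c * r"

lemma vspace_lscale: "vspace lscale"
  by unfold_locales (auto simp: lscale_def distrib_left distrib_right single_add mult.assoc[symmetric] mult_single)

interpretation lv: vspace lscale by (rule vspace_lscale)

interpretation pl: vspace_pair "const_scale :: complex \<Rightarrow> 'n mpoly \<Rightarrow> 'n mpoly" lscale ..
interpretation lp: vspace_pair lscale "const_scale :: complex \<Rightarrow> 'n mpoly \<Rightarrow> 'n mpoly" ..
interpretation ll: vspace_pair lscale lscale ..

lemma linear_lsub: "Vector_Spaces.linear const_scale lscale (lsub w)"
  by (auto simp: Vector_Spaces.linear_iff poly_vs.vector_space_axioms lv.vector_space_axioms
      lscale_def const_hom.psubst_add const_hom.psubst_scale)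

lemma linear_psub: "Vector_Spaces.linear const_scale const_scale (psub G)"
  by (intro linear_mpolyI) (simp_all only: const_hom.psubst_add const_hom.psubst_scale, simp only: const_scale_def)

lemma monomials_independent:
  assumes "finite A" shows "inj_on mon A \<and> lv.independent (mon ` A)"
proof (rule lv.family_independent[OF assms], rule ballI)
  fix c u assume z: "(\<Sum>i\<in>A. lscale (c i) (mon i)) = 0" and u: "u \<in> A"
  have "coef (\<Sum>i\<in>A. lscale (c i) (mon i)) u = (\<Sum>i\<in>A. if i = u then c i else 0)"
    unfolding lookup_sum by (intro sum.cong) (auto simp: lscale_def mult_single lookup_single when_def)
  also have "\<dots> = c u" using u assms by (subst sum.delta) auto
  finally show "c u = 0" using z by simp
qed

lemma dim_var_multiples:
  fixes S :: "'n::finite mpoly set"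
  assumes "pv.fin_spanned S" shows "poly_vs.dim (var_multiples S) \<le> CARD('n) * poly_vs.dim S"
proof -
  obtain B where B: "B \<subseteq> S" "poly_vs.independent B" "S \<subseteq> poly_vs.span B" "card B = poly_vs.dim S"
    by (rule poly_vs.basis_exists)
  have fB: "finite B" using pv.independent_card_le[OF assms B(1,2)] by simp
  let ?T = "(\<lambda>(i, F). var i * F) ` (UNIV \<times> B)"
  have "var i * F \<in> poly_vs.span ?T" if "F \<in> S" for i F
  proof -
    have "F \<in> poly_vs.span B" using that B(3) by auto
    then have "F \<in> poly_vs.span ((\<lambda>x. x) ` B)" by simp
    then obtain c where Fc: "F = (\<Sum>b\<in>B. const_scale (c b) b)" by (rule pv.span_family[OF fB])
    have "var i * F = (\<Sum>b\<in>B. const_scale (c b) (var i * b))"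
      unfolding Fc sum_distrib_left const_scale_def by (simp only: mult.left_commute)
    moreover have "(\<Sum>b\<in>B. const_scale (c b) (var i * b)) \<in> poly_vs.span ?T"
      by (intro pv.sum_scale_in_span poly_vs.span_base) force
    ultimately show ?thesis by simp
  qed
  then have "var_multiples S \<subseteq> poly_vs.span ?T"
    unfolding var_multiples_def by (intro poly_vs.span_minimal) auto
  then have "poly_vs.dim (var_multiples S) \<le> card ?T" using fB by (intro poly_vs.dim_le_card) auto
  also have "\<dots> \<le> card (UNIV \<times> B :: ('n \<times> _) set)" by (rule card_image_le) (use fB in auto)
  finally show ?thesis using B(4) by (simp add: card_cartesian_product)
qed

definition boundary :: "(nat \<Rightarrow> (int \<times> int) set) \<Rightarrow> (int \<times> int) set" where
  "boundary lat = lat 1 - {0}"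

text \<open>The linear form \<open>x\<^sup>m\<close> corrected by the centre monomial so that it vanishes at \<open>p\<close>.\<close>

definition vlin :: "(int \<times> int \<Rightarrow> complex) \<Rightarrow> int \<times> int \<Rightarrow> laurent" where
  "vlin p m = cst (p 0) * mon m - cst (p m)"

text \<open>Phrased with the \<open>vlin\<close>, which depend on \<open>p\<close> alone and
  polynomially, instead of a chosen basis \<open>w\<close>; this is what makes semicontinuity
  applicable.\<close>

definition quad_gen :: "(nat \<Rightarrow> (int \<times> int) set) \<Rightarrow> (int \<times> int \<Rightarrow> complex) \<Rightarrow> bool" where
  "quad_gen lat p \<longleftrightarrow> (\<forall>u\<in>lat 2. \<exists>c. mon u =
     (\<Sum>m\<in>boundary lat. \<Sum>m'\<in>boundary lat. cst (c m m') * (vlin p m * vlin p m')))"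

abbreviation slot :: "'a \<Rightarrow> laurent \<Rightarrow> 'a \<Rightarrow> laurent" where
  "slot m r l \<equiv> (if l = m then r else 0)"

text \<open>The cubics modulo \<open>U\<close> are the tensor product of the linear forms with
  \<open>S 2\<close>, modulo the relations identifying \<open>m\<close> tensor \<open>m' m''\<close>
  with \<open>m'\<close> tensor \<open>m m''\<close>. A \<open>slot\<close> vector is such a tensor,
  and the classes of \<open>B\<close> are required to span the quotient.\<close>

definition cub_gen :: "(nat \<Rightarrow> (int \<times> int) set) \<Rightarrow> ((int \<times> int) \<times> (int \<times> int)) set \<Rightarrow> (int \<times> int \<Rightarrow> complex) \<Rightarrow> bool" where
  "cub_gen lat B p \<longleftrightarrow> (\<forall>k\<in>boundary lat. \<forall>u\<in>lat 2. \<exists>c d. \<forall>l\<in>boundary lat. slot k (mon u) l =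
     (\<Sum>m\<in>boundary lat. \<Sum>m'\<in>boundary lat. \<Sum>m''\<in>boundary lat. cst (c m m' m'') *
        (slot m (vlin p m' * vlin p m'') l - slot m' (vlin p m * vlin p m'') l)) +
     (\<Sum>b\<in>B. cst (d b) * slot (fst b) (mon (snd b)) l))"

lemma (in lattice_polygon) finite_boundary: "finite (boundary lat)"
  using finite_lat by (simp add: boundary_def)

text \<open>Substitution of Laurent polynomials forgets the degree, so that forms of different
  degrees could cancel; vanishing is therefore required of each homogeneous component.\<close>

definition (in toric_projection) I :: "'k mpoly set" where
  "I = {F. \<forall>n. lsub w (hcomp n F) = 0}"

context toric_projection
begin

lemma I_forms: "I \<inter> forms n = {F \<in> forms n. lsub w F = 0}"
proof -
  have "(\<forall>k. lsub w (hcomp k F) = 0) \<longleftrightarrow> lsub w F = 0" if "F \<in> forms n" for F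
    using hcomp_of_form[OF that] by (auto simp: const_hom.psubst_zero split: if_splits)
  then show ?thesis by (auto simp: I_def)
qed

lemma subspace_I: "poly_vs.subspace (I \<inter> forms n)"
proof -
  interpret f: Vector_Spaces.linear const_scale lscale "lsub w" by (rule linear_lsub)
  show ?thesis unfolding I_forms
    using subspace_forms[of n] unfolding poly_vs.subspace_def by (auto simp: f.add f.scale f.zero)
qed

lemma fin_I: "pv.fin_spanned (I \<inter> forms n)"
  by (rule pv.fin_spanned_subset[OF fin_spanned_forms]) auto

lemma S_span: "S n = lv.span (mon ` lat n)"
proof
  show "S n \<subseteq> lv.span (mon ` lat n)"
  proof
    fix r assume r: "r \<in> S n"
    have "(\<Sum>u\<in>lat n. lscale (coef r u) (mon u)) \<in> lv.span (mon ` lat n)"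
      by (intro lv.sum_scale_in_span lv.span_base) auto
    then show "r \<in> lv.span (mon ` lat n)" using S_expand[OF r] by (simp add: lscale_def)
  qed
  have "lv.subspace (S n)" by (intro lv.subspaceI) (auto simp: S_zero S_add lscale_def S_cst)
  then show "lv.span (mon ` lat n) \<subseteq> S n" by (intro lv.span_minimal) (auto simp: S_mon)
qed

lemma dim_S: "lv.dim (S n) = card (lat n)"
  using monomials_independent[OF finite_lat, of n] unfolding S_span
  by (simp add: lv.dim_eq_card_independent card_image)

lemma dim_I: assumes "n \<ge> 2"
  shows "poly_vs.dim (I \<inter> forms n) + card (lat n) = (n + CARD('k) - 1) choose n"
proof -
  have "lsub w ` forms n = S n" using lsub_onto[OF assms] lsub_forms by auto
  then show ?thesis
    using pl.rank_nullity[OF linear_lsub[of w] subspace_forms[of n] fin_spanned_forms]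
    by (simp add: dim_S dim_forms I_forms)
qed

abbreviation U :: "'k mpoly set" where "U \<equiv> var_multiples (I \<inter> forms 2)"

lemma U_sub: "U \<subseteq> I \<inter> forms 3"
  unfolding var_multiples_def
proof (rule poly_vs.span_minimal[OF _ subspace_I], clarify)
  fix i F assume F: "F \<in> I" "F \<in> forms 2"
  then have "lsub w F = 0" using I_forms by blast
  then have "lsub w (var i * F) = 0" by (simp add: const_hom.psubst_mult)
  moreover have "var i * F \<in> forms 3" using forms_var_mult[OF F(2)] by (simp add: numeral_3_eq_3 numeral_2_eq_2)
  ultimately show "var i * F \<in> I \<inter> forms 3" unfolding I_forms by simp
qed

text \<open>The linear forms on the target that restrict to the \<open>vlin\<close>. By
  \<open>V0\<close> and \<open>var_V\<close> those of boundary points replace the variables.\<close>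

definition V :: "int \<times> int \<Rightarrow> 'k mpoly" where "V m = (\<Sum>i\<in>UNIV. const_scale (a m i) (var i))"

lemma V_forms: "V m \<in> forms 1" unfolding V_def by (intro forms_sum forms_scale forms_var)

lemma lsub_V: "m \<in> lat 1 \<Longrightarrow> lsub w (V m) = vlin p m"
  using mon_repr[of m] by (simp add: V_def vlin_def p0 const_hom.psubst_sum const_hom.psubst_scale const_hom.psubst_var)

lemma V0: "V 0 = 0"
proof -
  have "(\<Sum>i\<in>UNIV. cst (a 0 i) * w i) = 0" using mon_repr[OF zero_lat] p0 by simp
  then have "a 0 i = 0" for i by (rule w_indep)
  then show ?thesis by (simp add: V_def const_scale_def)
qed

lemma var_V: "var i = (\<Sum>m\<in>boundary lat. const_scale (coef (w i) m) (V m))"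
proof -
  have "(\<Sum>m\<in>boundary lat. const_scale (coef (w i) m) (V m)) = (\<Sum>m\<in>lat 1. const_scale (coef (w i) m) (V m))"
    unfolding boundary_def using finite_lat zero_lat
    by (intro sum.mono_neutral_left) (auto simp: V0 const_scale_def)
  also have "\<dots> = (\<Sum>m\<in>lat 1. \<Sum>j\<in>UNIV. sgl 0 (coef (w i) m * a m j) * var j)"
    by (simp add: V_def const_scale_def sum_distrib_left mult_single mult.assoc[symmetric])
  also have "\<dots> = (\<Sum>j\<in>UNIV. \<Sum>m\<in>lat 1. sgl 0 (coef (w i) m * a m j) * var j)" by (rule sum.swap)
  also have "\<dots> = (\<Sum>j\<in>UNIV. const_scale (\<Sum>m\<in>lat 1. coef (w i) m * a m j) (var j))"
    unfolding poly_vs.scale_sum_left by (simp add: const_scale_def)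
  also have "\<dots> = (\<Sum>j\<in>UNIV. if i = j then var j else 0)"
    unfolding dual by (intro sum.cong) auto
  finally show ?thesis by simp
qed

text \<open>Quadrics modulo those of the ideal are \<open>S 2\<close>, so cubics modulo
  \<open>U\<close> are spanned by the products \<open>V k * E u\<close>, where \<open>E u\<close>
  lifts \<open>mon u\<close>; \<open>cub_gen\<close> reduces these to the ones in
  \<open>B\<close>.\<close>

lemma dim_U_lower:
  assumes B: "finite B" "B \<subseteq> boundary lat \<times> lat 2" and gen: "cub_gen lat B p"
  shows "(CARD('k) + 2) choose 3 \<le> poly_vs.dim U + card B"
proof -
  obtain E where E: "\<And>u. u \<in> lat 2 \<Longrightarrow> E u \<in> forms 2 \<and> lsub w (E u) = mon u"
    using lsub_onto_mon[of _ 0] by (metis add_0)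
  let ?X = "poly_vs.span (U \<union> (\<lambda>b. V (fst b) * E (snd b)) ` B)"
  have UX: "U \<subseteq> ?X" using poly_vs.span_superset by blast
  have bl: "m \<in> lat 1" if "m \<in> boundary lat" for m using that by (simp add: boundary_def)
  have step: "V k * E u \<in> ?X" if k: "k \<in> boundary lat" and u: "u \<in> lat 2" for k u
  proof -
    obtain c d where cd: "\<forall>l\<in>boundary lat. slot k (mon u) l =
       (\<Sum>m\<in>boundary lat. \<Sum>m'\<in>boundary lat. \<Sum>m''\<in>boundary lat. cst (c m m' m'') *
        (slot m (vlin p m' * vlin p m'') l - slot m' (vlin p m * vlin p m'') l)) +
       (\<Sum>b\<in>B. cst (d b) * slot (fst b) (mon (snd b)) l)"
      using bspec[OF bspec[OF gen[unfolded cub_gen_def] k] u] by (elim exE)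
    \<comment> \<open>The relation for \<open>(k, u)\<close> lifted to quadrics. Each
      \<open>Q l\<close> vanishes on the surface, so the sum of the \<open>V l * Q l\<close> lies in
      \<open>U\<close>; in that sum the Koszul terms cancel.\<close>
    define Q where "Q l = (if l = k then E u else 0) -
       (\<Sum>m\<in>boundary lat. \<Sum>m'\<in>boundary lat. \<Sum>m''\<in>boundary lat. const_scale (c m m' m'')
        ((if l = m then V m' * V m'' else 0) - (if l = m' then V m * V m'' else 0))) -
       (\<Sum>b\<in>B. const_scale (d b) (if l = fst b then E (snd b) else 0))" for l
    have VV: "V m * V m' \<in> forms 2" for m m'
      using forms_mult[OF V_forms V_forms] by (simp add: one_add_one)
    have Qf: "Q l \<in> forms 2" for l
      unfolding Q_def by (intro forms_diff forms_sum forms_scale) (use E[OF u] E B(2) in \<open>auto simp: VV forms_zero\<close>)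
    have Ql: "lsub w (Q l) = 0" if l: "l \<in> boundary lat" for l
    proof -
      have i: "lsub w (if P then x else 0) = (if P then lsub w x else 0)" for P x
        by (simp add: const_hom.psubst_zero)
      have "lsub w (Q l) = slot k (mon u) l -
       (\<Sum>m\<in>boundary lat. \<Sum>m'\<in>boundary lat. \<Sum>m''\<in>boundary lat. cst (c m m' m'') *
        (slot m (vlin p m' * vlin p m'') l - slot m' (vlin p m * vlin p m'') l)) -
       (\<Sum>b\<in>B. cst (d b) * slot (fst b) (mon (snd b)) l)"
        unfolding Q_def const_hom.psubst_diff const_hom.psubst_sum const_hom.psubst_scale const_hom.psubst_mult i
        using E[OF u] E B(2) by (intro arg_cong2[where f = "(-)"] sum.cong refl) (auto simp: lsub_V bl)
      then show ?thesis using bspec[OF cd l] by simp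
    qed
    have "(\<Sum>l\<in>boundary lat. V l * Q l) = V k * E u - (\<Sum>b\<in>B. const_scale (d b) (V (fst b) * E (snd b)))"
    proof -
      have s1: "(\<Sum>l\<in>boundary lat. V l * (if l = m then x else 0)) = V m * x" if "m \<in> boundary lat" for m x
      proof -
        have "(\<Sum>l\<in>boundary lat. V l * (if l = m then x else 0)) = (\<Sum>l\<in>boundary lat. if l = m then V l * x else 0)"
          by (intro sum.cong) auto
        then show ?thesis using that finite_boundary by simp
      qed
      have sw: "(\<Sum>l\<in>A. \<Sum>m\<in>A. \<Sum>m'\<in>A. \<Sum>m''\<in>A. f l m m' m'') =
          (\<Sum>m\<in>A. \<Sum>m'\<in>A. \<Sum>m''\<in>A. \<Sum>l\<in>A. f l m m' m'')"
        for f :: "int \<times> int \<Rightarrow> int \<times> int \<Rightarrow> int \<times> int \<Rightarrow> int \<times> int \<Rightarrow> 'k mpoly" and A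
        by (subst sum.swap, rule sum.cong[OF refl], subst sum.swap, rule sum.cong[OF refl], rule sum.swap)
      have s2: "(\<Sum>l\<in>boundary lat. V l * const_scale y (x l)) = const_scale y (\<Sum>l\<in>boundary lat. V l * x l)" for y x
        unfolding const_scale_def sum_distrib_left by (simp only: mult.left_commute)
      define Y where "Y l m m' m'' = const_scale (c m m' m'')
        ((if l = m then V m' * V m'' else 0) - (if l = m' then V m * V m'' else 0))" for l m m' m''
      define Z where "Z l b = const_scale (d b) (if l = fst b then E (snd b) else 0)" for l b
      have Ql: "V l * Q l = V l * (if l = k then E u else 0) -
         (\<Sum>m\<in>boundary lat. \<Sum>m'\<in>boundary lat. \<Sum>m''\<in>boundary lat. V l * Y l m m' m'') - (\<Sum>b\<in>B. V l * Z l b)" for l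
        unfolding Q_def Y_def[symmetric] Z_def[symmetric] by (simp add: right_diff_distrib sum_distrib_left)
      have Y0: "(\<Sum>l\<in>boundary lat. V l * Y l m m' m'') = 0" if "m \<in> boundary lat" "m' \<in> boundary lat" for m m' m''
        unfolding Y_def s2 right_diff_distrib[of "V _"] sum_subtractf s1[OF that(1)] s1[OF that(2)]
        by (simp add: const_scale_def mult.left_commute)
      have "(\<Sum>l\<in>boundary lat. \<Sum>m\<in>boundary lat. \<Sum>m'\<in>boundary lat. \<Sum>m''\<in>boundary lat. V l * Y l m m' m'') = 0"
        by (subst sw) (intro sum.neutral ballI Y0)
      moreover have "(\<Sum>l\<in>boundary lat. \<Sum>b\<in>B. V l * Z l b) = (\<Sum>b\<in>B. const_scale (d b) (V (fst b) * E (snd b)))"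
        unfolding sum.swap[of _ B "boundary lat"] Z_def s2 using B(2) by (intro sum.cong refl) (auto simp: s1)
      ultimately show ?thesis
        unfolding Ql sum_subtractf s1[OF k] by (simp only: diff_0_right)
    qed
    then have "V k * E u = (\<Sum>l\<in>boundary lat. V l * Q l) + (\<Sum>b\<in>B. const_scale (d b) (V (fst b) * E (snd b)))"
      by simp
    moreover have "(\<Sum>l\<in>boundary lat. V l * Q l) \<in> ?X"
      using Qf Ql UX by (intro poly_vs.span_sum subsetD[OF UX] form1_mult[OF V_forms]) (auto simp: I_forms)
    moreover have "(\<Sum>b\<in>B. const_scale (d b) (V (fst b) * E (snd b))) \<in> ?X"
      by (intro pv.sum_scale_in_span poly_vs.span_base) auto
    ultimately show ?thesis by (simp only: poly_vs.span_add)
  qed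
  have "forms 3 \<subseteq> ?X"
  proof
    fix F :: "'k mpoly" assume "F \<in> forms 3"
    then have "F \<in> forms (Suc 2)" by (simp add: numeral_3_eq_3 numeral_2_eq_2)
    then obtain H where H: "\<And>i. H i \<in> forms 2" "F = (\<Sum>i\<in>UNIV. var i * H i)"
      by (rule forms_Suc_decomp) blast
    define G where "G m = (\<Sum>i\<in>UNIV. const_scale (coef (w i) m) (H i))" for m
    have Gf: "G m \<in> forms 2" for m unfolding G_def by (intro forms_sum forms_scale H)
    have FG: "F = (\<Sum>m\<in>boundary lat. V m * G m)"
    proof -
      have "F = (\<Sum>i\<in>UNIV. \<Sum>m\<in>boundary lat. const_scale (coef (w i) m) (V m) * H i)"
        unfolding H(2) by (subst var_V) (simp add: sum_distrib_right)
      also have "\<dots> = (\<Sum>m\<in>boundary lat. \<Sum>i\<in>UNIV. const_scale (coef (w i) m) (V m) * H i)" by (rule sum.swap)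
      also have "\<dots> = (\<Sum>m\<in>boundary lat. V m * G m)"
        unfolding G_def sum_distrib_left const_scale_def by (simp only: mult_ac)
      finally show ?thesis .
    qed
    have "V m * G m \<in> ?X" if m: "m \<in> boundary lat" for m
    proof -
      define g where "g = lsub w (G m)"
      have gS: "g \<in> S 2" unfolding g_def by (rule lsub_forms[OF Gf])
      define R where "R = (\<Sum>u\<in>lat 2. const_scale (coef g u) (E u))"
      have "lsub w R = g"
        using S_expand[OF gS] E by (simp add: R_def const_hom.psubst_sum const_hom.psubst_scale)
      moreover have "R \<in> forms 2" unfolding R_def using E by (intro forms_sum forms_scale) auto
      ultimately have "G m - R \<in> I \<inter> forms 2"
        unfolding I_forms using Gf by (auto simp: forms_diff const_hom.psubst_diff g_def)
      then have "V m * (G m - R) \<in> ?X" using form1_mult[OF V_forms] UX by blast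
      moreover have "V m * R = (\<Sum>u\<in>lat 2. const_scale (coef g u) (V m * E u))"
        unfolding R_def sum_distrib_left const_scale_def by (simp only: mult.left_commute)
      moreover have "(\<Sum>u\<in>lat 2. const_scale (coef g u) (V m * E u)) \<in> ?X"
        by (intro pv.sum_scale_in_span step[OF m])
      ultimately have "V m * (G m - R) + V m * R \<in> ?X" by (simp only: poly_vs.span_add)
      then show ?thesis by (simp add: right_diff_distrib)
    qed
    then show "F \<in> ?X" unfolding FG by (intro poly_vs.span_sum)
  qed
  moreover have finU: "pv.fin_spanned U" by (rule pv.fin_spanned_subset[OF fin_I U_sub])
  moreover have finB: "pv.fin_spanned ((\<lambda>b. V (fst b) * E (snd b)) ` B)"
    using B(1) by (intro pv.fin_spanned_finite) auto
  ultimately have "poly_vs.dim (forms 3 :: 'k mpoly set) \<le> poly_vs.dim ?X"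
    by (intro pv.dim_mono_fin pv.fin_spanned_Un) (simp_all only: poly_vs.span_span)
  also have "\<dots> \<le> poly_vs.dim U + poly_vs.dim ((\<lambda>b. V (fst b) * E (snd b)) ` B)"
    by (rule pv.dim_Un_le[OF finU finB])
  also have "poly_vs.dim ((\<lambda>b. V (fst b) * E (snd b)) ` B) \<le> card ((\<lambda>b. V (fst b) * E (snd b)) ` B)"
    using B(1) by (intro poly_vs.dim_le_card') auto
  also have "\<dots> \<le> card B" using B(1) by (rule card_image_le)
  finally show ?thesis by (simp add: dim_forms add.commute)
qed

text \<open>The cubics of the ideal have codimension \<open>card (lat 3)\<close> among all cubics,
  and \<open>U\<close> has codimension at most \<open>card B\<close>. Hence at most
  \<open>card B - card (lat 3)\<close> cubic generators are needed, and \<open>low\<close> is the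
  opposite bound.\<close>

lemma minimally_generated:
  assumes B: "finite B" "B \<subseteq> boundary lat \<times> lat 2" "cub_gen lat B p"
    and a: "a' + card (lat 2) = (CARD('k) + 1) choose 2" and b: "card B \<le> b + card (lat 3)"
    and low: "poly_vs.dim U + b \<le> poly_vs.dim (I \<inter> forms 3)"
  shows "minimally_generated_by_quadrics_cubics I a' b"
proof (rule minimal_generation)
  show "0 \<in> I" by (simp add: I_def hcomp_zero const_hom.psubst_zero)
  show "F + G \<in> I" if "F \<in> I" "G \<in> I" for F G
    using that by (simp add: I_def hcomp_add const_hom.psubst_add)
  show "hcomp n F \<in> I" if "F \<in> I" for F n
    using that hcomp_of_form[OF hcomp_forms, of _ n F] by (simp add: I_def const_hom.psubst_zero)
  show "G * F \<in> I" if "F \<in> I" for F G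
  proof -
    have "lsub w (hcomp n (G * F)) = 0" for n
    proof -
      obtain N where N: "F = (\<Sum>k\<le>N. hcomp k F)" by (rule hcomp_decomp)
      have "hcomp n (G * F) = (\<Sum>k\<le>N. hcomp n (G * hcomp k F))"
        by (subst N) (simp add: sum_distrib_left hcomp_sum)
      then show ?thesis using that
        by (auto simp: hcomp_mult[OF hcomp_forms] I_def const_hom.psubst_sum const_hom.psubst_mult
            const_hom.psubst_zero intro!: sum.neutral)
    qed
    then show ?thesis by (simp add: I_def)
  qed
  show "F = 0" if F: "F \<in> I" "F \<in> forms 0 \<or> F \<in> forms 1" for F
  proof (cases "F \<in> forms 0")
    case True
    then have "lsub w F = 0" using F(1) I_forms by blast
    moreover have e: "F = sgl 0 (coef F 0)" by (rule form0[OF True])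
    then have "lsub w F = cst (coef F 0)" using const_hom.psubst_const by metis
    ultimately have "coef F 0 = 0" by (metis lookup_single_eq lookup_zero)
    then show ?thesis using e by (simp add: single_zero)
  next
    case False
    then have F1: "F \<in> forms 1" using F by auto
    then have z: "lsub w F = 0" using F(1) I_forms by blast
    from F1 have "F \<in> forms (Suc 0)" by (simp add: One_nat_def)
    then obtain G where G: "\<And>i. G i \<in> forms 0" "F = (\<Sum>i\<in>UNIV. var i * G i)"
      by (rule forms_Suc_decomp) blast
    have Gc: "G i = sgl 0 (coef (G i) 0)" for i by (rule form0[OF G(1)])
    have lG: "lsub w (G i) = cst (coef (G i) 0)" for i
      using arg_cong[OF Gc, of "lsub w" i] by (simp only: const_hom.psubst_const)
    have "(\<Sum>i\<in>UNIV. cst (coef (G i) 0) * w i) = 0"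
      using z unfolding G(2) by (simp add: const_hom.psubst_sum const_hom.psubst_mult const_hom.psubst_var lG mult.commute)
    then have "coef (G i) 0 = 0" for i by (rule w_indep)
    then have "G i = 0" for i using Gc[of i] by (simp add: single_zero)
    then show ?thesis by (simp add: G(2))
  qed
  show "\<exists>G. (\<forall>i. G i \<in> I \<inter> forms n) \<and> F = (\<Sum>i\<in>UNIV. var i * G i)"
    if "3 \<le> n" "F \<in> I" "F \<in> forms (Suc n)" for n F
  proof -
    have "lsub w F = 0" using that(2,3) I_forms by blast
    then show ?thesis using generated_in_degree_three[OF that(1,3)] unfolding I_forms by simp
  qed
  show "poly_vs.dim (I \<inter> forms 2) = a'"
  proof -
    have e: "2 + CARD('k) - 1 = CARD('k) + 1" by simp
    show ?thesis using dim_I[of 2] a unfolding e by simp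
  qed
  show "poly_vs.dim (I \<inter> forms 3) = poly_vs.dim U + b"
  proof -
    have e: "3 + CARD('k) - 1 = CARD('k) + 2" by simp
    show ?thesis using dim_I[of 3] dim_U_lower[OF B] b low unfolding e by simp
  qed
qed

lemma cubics_lower_trivial:
  assumes "poly_vs.dim (I \<inter> forms 2) * CARD('k) + b \<le> poly_vs.dim (I \<inter> forms 3)"
  shows "poly_vs.dim U + b \<le> poly_vs.dim (I \<inter> forms 3)"
  using dim_var_multiples[OF fin_I, of 2] assms by (simp add: mult.commute)

end


section \<open>The four polygons\<close>

text \<open>A polygon is given by the linear functionals of its edges; all of them are at lattice distance one
  from the centre.\<close>

definition mem :: "(int \<times> int) list \<Rightarrow> int \<times> int \<Rightarrow> int \<Rightarrow> bool" where
  "mem F u n = list_all (\<lambda>(a, b). a * fst u + b * snd u \<le> n) F"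

definition lat_of :: "(int \<times> int) list \<Rightarrow> nat \<Rightarrow> (int \<times> int) set" where
  "lat_of F n = {u. mem F u (int n)}"

text \<open>Connectedness in a form that can be evaluated: \<open>(x, y)\<close> is a hub of the
  graph of \<open>lat_connected\<close> in multidegree \<open>(i, j)\<close>, reached from every
  vertex \<open>(a, b)\<close> by at most two edges, the second option passing through
  \<open>(c, d)\<close>.\<close>

definition hub_check :: "(int \<times> int) list \<Rightarrow> (int \<times> int) list \<Rightarrow> int \<Rightarrow> (int \<times> int) list \<Rightarrow> bool" where
  "hub_check F P n U = list_all (\<lambda>(i, j). \<not> mem F (i, j) (n + 2) \<or> list_ex (\<lambda>(x, y). list_all (\<lambda>(a, b).
     \<not> mem F (i - a, j - b) (n + 1) \<or> (a = x \<and> b = y) \<or> mem F (i - a - x, j - b - y) n \<or>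
     list_ex (\<lambda>(c, d). mem F (i - a - c, j - b - d) n \<and> mem F (i - c - x, j - d - y) n) P) P) P) U"

definition split_check :: "(int \<times> int) list \<Rightarrow> (int \<times> int) list \<Rightarrow> int \<Rightarrow> (int \<times> int) list \<Rightarrow> bool" where
  "split_check F P n U = list_all (\<lambda>(i, j). \<not> mem F (i, j) (n + 1) \<or>
     list_ex (\<lambda>(x, y). mem F (i - x, j - y) n) P) U"

abbreviation box :: "int \<Rightarrow> (int \<times> int) list" where
  "box n \<equiv> List.product [- n .. n] [- n .. n]"

lemma mem_diff_iff: "mem F (u - v) n = mem F (fst u - fst v, snd u - snd v) n"
  by (simp add: mem_def)

lemma in_box_iff: "u \<in> set (box k) \<longleftrightarrow> \<bar>fst u\<bar> \<le> k \<and> \<bar>snd u\<bar> \<le> k"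
  by (cases u) auto

lemma mem_one_iff:
  assumes "\<And>u n. mem F u n \<Longrightarrow> \<bar>fst u\<bar> \<le> 2 * n \<and> \<bar>snd u\<bar> \<le> 2 * n"
    and "list_all (\<lambda>u. mem F u 1) P" "list_all (\<lambda>u. mem F u 1 \<longrightarrow> u \<in> set P) (box 2)"
  shows "mem F u 1 \<longleftrightarrow> u \<in> set P"
proof
  assume u: "mem F u 1"
  then have "u \<in> set (box 2)" using assms(1)[of u 1] unfolding in_box_iff by simp
  from bspec[OF assms(3)[unfolded list_all_iff] this] u show "u \<in> set P" by simp
qed (use assms(2) in \<open>simp add: list_all_iff\<close>)

text \<open>Large \<open>n\<close> is covered by a uniform argument (\<open>split2\<close>,
  \<open>hub3\<close>), small \<open>n\<close> by evaluation. The \<open>n\<close>-fold polygon lies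
  in the box of half-width \<open>2 * n\<close>; splitting in degrees 1, 2 and hubs in degrees 3, 4
  thus need the boxes 2, 4 and 6, 8.\<close>

locale polygon_data =
  fixes F P :: "(int \<times> int) list"
  assumes bounded: "\<And>u n. mem F u n \<Longrightarrow> \<bar>fst u\<bar> \<le> 2 * n \<and> \<bar>snd u\<bar> \<le> 2 * n"
    and split2: "\<And>i j n. n \<ge> 2 \<Longrightarrow> mem F (i, j) (n + 1) \<Longrightarrow> \<exists>(x, y)\<in>set P. mem F (i - x, j - y) n"
    and hub3: "\<And>i j n. n \<ge> 3 \<Longrightarrow> mem F (i, j) (n + 2) \<Longrightarrow> \<exists>(x, y)\<in>set P. \<forall>(a, b)\<in>set P.
       mem F (i - a, j - b) (n + 1) \<longrightarrow> (a = x \<and> b = y) \<or> mem F (i - a - x, j - b - y) n"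
    and small_pts: "list_all (\<lambda>u. mem F u 1) P" "list_all (\<lambda>u. mem F u 1 \<longrightarrow> u \<in> set P) (box 2)"
    and small: "split_check F P 0 (box 2)" "split_check F P 1 (box 4)"
      "hub_check F P 1 (box 6)" "hub_check F P 2 (box 8)"
begin

lemmas pts = mem_one_iff[OF bounded small_pts]

lemma in_box: "mem F u n \<Longrightarrow> 2 * n \<le> k \<Longrightarrow> u \<in> set (box k)"
  using bounded[of u n] unfolding in_box_iff by linarith

lemma lat1: "lat_of F 1 = set P"
  using pts by (auto simp: lat_of_def)

lemma split:
  assumes "n \<ge> 0" "mem F u (n + 1)" shows "\<exists>v\<in>set P. mem F (u - v) n"
proof -
  have "\<exists>(x, y)\<in>set P. mem F (fst u - x, snd u - y) n"
  proof (cases "n \<ge> 2")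
    case True then show ?thesis using split2[of n "fst u" "snd u"] assms(2) by simp
  next
    case False
    then consider "n = 0" | "n = 1" using assms(1) by linarith
    then show ?thesis
    proof cases
      case 1
      then have "u \<in> set (box 2)" using assms(2) in_box[of u 1 2] by (simp del: set_product)
      from bspec[OF small(1)[unfolded split_check_def list_all_iff] this] show ?thesis
        using 1 assms(2) by (cases u) (simp add: list_ex_iff)
    next
      case 2
      then have "u \<in> set (box 4)" using assms(2) in_box[of u 2 4] by (simp del: set_product)
      from bspec[OF small(2)[unfolded split_check_def list_all_iff] this] show ?thesis
        using 2 assms(2) by (cases u) (simp add: list_ex_iff)
    qed
  qed
  then obtain x y where "(x, y) \<in> set P" "mem F (fst u - x, snd u - y) n" by blast
  then show ?thesis by (intro bexI[of _ "(x, y)"]) (auto simp: mem_diff_iff)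
qed

lemma hub:
  assumes "n \<ge> 1" "mem F u (n + 2)"
  shows "\<exists>x\<in>set P. \<forall>a\<in>set P. mem F (u - a) (n + 1) \<longrightarrow> a = x \<or> mem F (u - a - x) n \<or>
     (\<exists>c\<in>set P. mem F (u - a - c) n \<and> mem F (u - c - x) n)"
proof -
  have "\<exists>(x, y)\<in>set P. \<forall>(a, b)\<in>set P. \<not> mem F (fst u - a, snd u - b) (n + 1) \<or> (a = x \<and> b = y) \<or>
      mem F (fst u - a - x, snd u - b - y) n \<or>
      (\<exists>(c, d)\<in>set P. mem F (fst u - a - c, snd u - b - d) n \<and> mem F (fst u - c - x, snd u - d - y) n)"
  proof (cases "n \<ge> 3")
    case True
    obtain x y where xy: "(x, y) \<in> set P" "\<forall>(a, b)\<in>set P. mem F (fst u - a, snd u - b) (n + 1) \<longrightarrow>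
        (a = x \<and> b = y) \<or> mem F (fst u - a - x, snd u - b - y) n"
      using hub3[OF True, of "fst u" "snd u"] assms(2) by auto
    then show ?thesis by (intro bexI[of _ "(x, y)"]) auto
  next
    case False
    then consider "n = 1" | "n = 2" using assms(1) by linarith
    then have "hub_check F P n (box (2 * n + 4))" using small(3,4) by cases auto
    note check = this
    have "u \<in> set (box (2 * n + 4))" by (rule in_box[OF assms(2)]) simp
    from bspec[OF check[unfolded hub_check_def list_all_iff list_ex_iff] this] show ?thesis
      using assms(2) by (simp add: split_beta)
  qed
  then obtain x where x: "x \<in> set P" "\<forall>a\<in>set P. \<not> mem F (fst u - fst a, snd u - snd a) (n + 1) \<or>
      (fst a = fst x \<and> snd a = snd x) \<or> mem F (fst u - fst a - fst x, snd u - snd a - snd x) n \<or>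
      (\<exists>c\<in>set P. mem F (fst u - fst a - fst c, snd u - snd a - snd c) n \<and>
         mem F (fst u - fst c - fst x, snd u - snd c - snd x) n)"
    unfolding split_beta by (elim bexE)
  show ?thesis
  proof (intro bexI[of _ x] ballI impI)
    fix a assume a: "a \<in> set P" "mem F (u - a) (n + 1)"
    from bspec[OF x(2) a(1)] a(2)
    show "a = x \<or> mem F (u - a - x) n \<or> (\<exists>c\<in>set P. mem F (u - a - c) n \<and> mem F (u - c - x) n)"
      by (simp add: mem_diff_iff[of F u] mem_diff_iff[of F "_ - _"] prod_eq_iff)
  qed (rule x(1))
qed

text \<open>For connectedness, both given points are joined to the hub, and the graph is
  undirected.\<close>

lemma lattice_polygon: "lattice_polygon (lat_of F)"
proof
  show "finite (lat_of F n)" for n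
  proof (rule finite_subset)
    show "lat_of F n \<subseteq> set (box (2 * int n))" using in_box by (auto simp: lat_of_def)
  qed simp
  show "0 \<in> lat_of F n" for n by (simp add: lat_of_def mem_def list_all_iff)
  show "u + v \<in> lat_of F (Suc n)" if "u \<in> lat_of F n" "v \<in> lat_of F 1" for u v n
    using that by (force simp: lat_of_def mem_def list_all_iff algebra_simps)
  show "\<exists>v\<in>lat_of F 1. u - v \<in> lat_of F n" if "u \<in> lat_of F (Suc n)" for u n
    using split[of "int n" u] that lat1 by (simp add: lat_of_def add.commute)
  show "(\<lambda>a b. a \<in> lat_of F 1 \<and> b \<in> lat_of F 1 \<and> u - a - b \<in> lat_of F n)\<^sup>*\<^sup>* a b"
    if n: "n \<ge> 1" and ab: "a \<in> lat_of F 1" "b \<in> lat_of F 1" "u - a \<in> lat_of F (Suc n)" "u - b \<in> lat_of F (Suc n)" for n a b u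
  proof -
    let ?R = "\<lambda>a b. a \<in> lat_of F 1 \<and> b \<in> lat_of F 1 \<and> u - a - b \<in> lat_of F n"
    have "mem F u (int n + 2)"
    proof -
      have "u - a + a \<in> lat_of F (Suc (Suc n))"
        using ab(1,3) by (force simp: lat_of_def mem_def list_all_iff algebra_simps)
      then show ?thesis by (simp add: lat_of_def add.commute)
    qed
    then obtain x where x: "x \<in> set P" "\<And>a. a \<in> set P \<Longrightarrow> mem F (u - a) (int n + 1) \<Longrightarrow> a = x \<or> mem F (u - a - x) (int n) \<or>
     (\<exists>c\<in>set P. mem F (u - a - c) (int n) \<and> mem F (u - c - x) (int n))"
      using hub[of "int n" u] n by auto
    have sym: "?R c d \<Longrightarrow> ?R d c" for c d by (simp add: algebra_simps)
    have to_hub: "?R\<^sup>*\<^sup>* a x" if a: "a \<in> lat_of F 1" "u - a \<in> lat_of F (Suc n)" for a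
    proof -
      have "mem F (u - a) (int n + 1)" using a(2) by (simp add: lat_of_def add.commute)
      with x(2)[of a] a(1) consider "a = x" | "?R a x" | c where "?R a c" "?R c x"
        using x(1) unfolding lat1 by (auto simp: lat_of_def)
      then show ?thesis by cases (auto intro: rtranclp.rtrancl_into_rtrancl)
    qed
    have "symp ?R" by (rule sympI) (rule sym)
    from sympD[OF symp_rtranclp[OF this] to_hub[OF ab(2,4)]] have "?R\<^sup>*\<^sup>* x b" .
    then show ?thesis using to_hub[OF ab(1,3)] by simp
  qed
qed

end

text \<open>The hexagon, the pentagon, the trapezoid and the square belong to the surfaces of degree 6, 7 and to
  the two surfaces of degree 8. The first three are the triangle with \<open>3\<close>, \<open>2\<close>, \<open>1\<close> corners cut off.\<close>

definition hexagon_edges :: "(int \<times> int) list" where "hexagon_edges = [(1,0),(-1,0),(0,1),(0,-1),(1,1),(-1,-1)]"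
definition pentagon_edges :: "(int \<times> int) list" where "pentagon_edges = [(-1,0),(0,1),(0,-1),(1,1),(-1,-1)]"
definition trapezoid_edges :: "(int \<times> int) list" where "trapezoid_edges = [(-1,0),(0,-1),(1,1),(-1,-1)]"
definition square_edges :: "(int \<times> int) list" where "square_edges = [(1,0),(-1,0),(0,1),(0,-1)]"

definition hexagon_pts :: "(int \<times> int) list" where
  "hexagon_pts = [(0,0),(1,0),(0,1),(-1,1),(-1,0),(0,-1),(1,-1)]"
definition pentagon_pts :: "(int \<times> int) list" where "pentagon_pts = (2,-1) # hexagon_pts"
definition trapezoid_pts :: "(int \<times> int) list" where "trapezoid_pts = (-1,2) # pentagon_pts"
definition square_pts :: "(int \<times> int) list" where "square_pts = (1,1) # (-1,-1) # hexagon_pts"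

lemmas polygon_defs = mem_def hexagon_edges_def pentagon_edges_def trapezoid_edges_def square_edges_def
  hexagon_pts_def pentagon_pts_def trapezoid_pts_def square_pts_def

lemma maximizer:
  fixes f :: "'a \<Rightarrow> int"
  assumes "finite A" "A \<noteq> {}" obtains x where "x \<in> A" "\<And>y. y \<in> A \<Longrightarrow> f y \<le> f x"
proof -
  have "Max (f ` A) \<in> f ` A" using assms by (intro Max_in) auto
  then obtain x where "x \<in> A" "f x = Max (f ` A)" by auto
  then show ?thesis using that assms(1) by (metis Max_ge finite_imageI imageI)
qed

text \<open>As hub serves the boundary point pointing most in the direction of \<open>(i, j)\<close>, with respect to
  the hexagonal inner product; the corners are weighted down by the factor \<open>5/6\<close>.\<close>

definition weight :: "int \<Rightarrow> int \<Rightarrow> int \<times> int \<Rightarrow> int" where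
  "weight i j x = (if x \<in> {(2,-1),(-1,2)} then 5 else 6) *
     (2 * i * fst x + i * snd x + j * fst x + 2 * j * snd x)"

text \<open>Comparing the \<open>weight\<close> of the maximising point with that of the other
  boundary points confines \<open>(i, j)\<close> to a cone. There the claims become linear
  arithmetic with the edge inequalities.\<close>

lemma hexagon: "polygon_data hexagon_edges hexagon_pts"
proof
  show "\<bar>fst u\<bar> \<le> 2 * n \<and> \<bar>snd u\<bar> \<le> 2 * n" if "mem hexagon_edges u n" for u n
    using that by (auto simp: polygon_defs)
  show "list_all (\<lambda>u. mem hexagon_edges u 1) hexagon_pts"
    "list_all (\<lambda>u. mem hexagon_edges u 1 \<longrightarrow> u \<in> set hexagon_pts) (box 2)" by code_simp+
  fix i j n :: int
  obtain x where x: "x \<in> set (tl hexagon_pts)" "\<And>y. y \<in> set (tl hexagon_pts) \<Longrightarrow> weight i j y \<le> weight i j x"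
    by (rule maximizer[of "set (tl hexagon_pts)" "weight i j"]) (auto simp: hexagon_pts_def)
  note w = x(2)[of "(1,0)"] x(2)[of "(0,1)"] x(2)[of "(-1,1)"] x(2)[of "(-1,0)"] x(2)[of "(0,-1)"] x(2)[of "(1,-1)"]
  have "x = (1,0) \<or> x = (0,1) \<or> x = (-1,1) \<or> x = (-1,0) \<or> x = (0,-1) \<or> x = (1,-1)"
    using x(1) by (simp add: hexagon_pts_def)
  then consider "x = (1,0)" | "x = (0,1)" | "x = (-1,1)" | "x = (-1,0)" | "x = (0,-1)" | "x = (1,-1)" by blast
  note cases = this
  have xP: "x \<in> set hexagon_pts"
    using cases by cases (simp_all add: polygon_defs)
  { assume n: "n \<ge> 2" "mem hexagon_edges (i, j) (n + 1)"
    from cases have "mem hexagon_edges (i - fst x, j - snd x) n"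
      by cases (use n w in \<open>simp_all add: polygon_defs weight_def\<close>)
    then show "\<exists>(x, y)\<in>set hexagon_pts. mem hexagon_edges (i - x, j - y) n"
      using xP by (intro bexI[of _ x]) (simp_all only: split_beta) }
  { assume n: "n \<ge> 3" "mem hexagon_edges (i, j) (n + 2)"
    from cases have "\<forall>(a, b)\<in>set hexagon_pts. mem hexagon_edges (i - a, j - b) (n + 1) \<longrightarrow>
        (a = fst x \<and> b = snd x) \<or> mem hexagon_edges (i - a - fst x, j - b - snd x) n"
      by cases (use n w in \<open>simp_all add: polygon_defs weight_def\<close>)
    then show "\<exists>(x, y)\<in>set hexagon_pts. \<forall>(a, b)\<in>set hexagon_pts. mem hexagon_edges (i - a, j - b) (n + 1) \<longrightarrow>
        (a = x \<and> b = y) \<or> mem hexagon_edges (i - a - x, j - b - y) n"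
      using xP by (intro bexI[of _ x]) (simp_all only: split_beta) }
  show "split_check hexagon_edges hexagon_pts 0 (box 2)" "split_check hexagon_edges hexagon_pts 1 (box 4)"
    "hub_check hexagon_edges hexagon_pts 1 (box 6)" "hub_check hexagon_edges hexagon_pts 2 (box 8)" by code_simp+
qed

lemma pentagon: "polygon_data pentagon_edges pentagon_pts"
proof
  show "\<bar>fst u\<bar> \<le> 2 * n \<and> \<bar>snd u\<bar> \<le> 2 * n" if "mem pentagon_edges u n" for u n
    using that by (auto simp: polygon_defs)
  show "list_all (\<lambda>u. mem pentagon_edges u 1) pentagon_pts"
    "list_all (\<lambda>u. mem pentagon_edges u 1 \<longrightarrow> u \<in> set pentagon_pts) (box 2)" by code_simp+
  fix i j n :: int
  let ?C = "set ((2,-1) # tl hexagon_pts)"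
  obtain x where x: "x \<in> ?C" "\<And>y. y \<in> ?C \<Longrightarrow> weight i j y \<le> weight i j x"
    by (rule maximizer[of ?C "weight i j"]) auto
  note w = x(2)[of "(2,-1)"] x(2)[of "(1,0)"] x(2)[of "(0,1)"] x(2)[of "(-1,1)"] x(2)[of "(-1,0)"] x(2)[of "(0,-1)"] x(2)[of "(1,-1)"]
  have "x = (2,-1) \<or> x = (1,0) \<or> x = (0,1) \<or> x = (-1,1) \<or> x = (-1,0) \<or> x = (0,-1) \<or> x = (1,-1)"
    using x(1) by (simp add: hexagon_pts_def)
  then consider "x = (2,-1)" | "x = (1,0)" | "x = (0,1)" | "x = (-1,1)" | "x = (-1,0)" | "x = (0,-1)" | "x = (1,-1)" by blast
  note cases = this
  have xP: "x \<in> set pentagon_pts"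
    using cases by cases (simp_all add: polygon_defs)
  { assume n: "n \<ge> 2" "mem pentagon_edges (i, j) (n + 1)"
    from cases have "mem pentagon_edges (i - fst x, j - snd x) n"
      by cases (use n w in \<open>simp_all add: polygon_defs weight_def\<close>)
    then show "\<exists>(x, y)\<in>set pentagon_pts. mem pentagon_edges (i - x, j - y) n"
      using xP by (intro bexI[of _ x]) (simp_all only: split_beta) }
  { assume n: "n \<ge> 3" "mem pentagon_edges (i, j) (n + 2)"
    from cases have "\<forall>(a, b)\<in>set pentagon_pts. mem pentagon_edges (i - a, j - b) (n + 1) \<longrightarrow>
        (a = fst x \<and> b = snd x) \<or> mem pentagon_edges (i - a - fst x, j - b - snd x) n"
      by cases (use n w in \<open>simp_all add: polygon_defs weight_def\<close>)
    then show "\<exists>(x, y)\<in>set pentagon_pts. \<forall>(a, b)\<in>set pentagon_pts. mem pentagon_edges (i - a, j - b) (n + 1) \<longrightarrow>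
        (a = x \<and> b = y) \<or> mem pentagon_edges (i - a - x, j - b - y) n"
      using xP by (intro bexI[of _ x]) (simp_all only: split_beta) }
  show "split_check pentagon_edges pentagon_pts 0 (box 2)" "split_check pentagon_edges pentagon_pts 1 (box 4)"
    "hub_check pentagon_edges pentagon_pts 1 (box 6)" "hub_check pentagon_edges pentagon_pts 2 (box 8)" by code_simp+
qed

lemma trapezoid: "polygon_data trapezoid_edges trapezoid_pts"
proof
  show "\<bar>fst u\<bar> \<le> 2 * n \<and> \<bar>snd u\<bar> \<le> 2 * n" if "mem trapezoid_edges u n" for u n
    using that by (auto simp: polygon_defs)
  show "list_all (\<lambda>u. mem trapezoid_edges u 1) trapezoid_pts"
    "list_all (\<lambda>u. mem trapezoid_edges u 1 \<longrightarrow> u \<in> set trapezoid_pts) (box 2)" by code_simp+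
  fix i j n :: int
  let ?C = "set ((-1,2) # (2,-1) # tl hexagon_pts)"
  obtain x where x: "x \<in> ?C" "\<And>y. y \<in> ?C \<Longrightarrow> weight i j y \<le> weight i j x"
    by (rule maximizer[of ?C "weight i j"]) auto
  note w = x(2)[of "(2,-1)"] x(2)[of "(-1,2)"] x(2)[of "(1,0)"] x(2)[of "(0,1)"] x(2)[of "(-1,1)"] x(2)[of "(-1,0)"] x(2)[of "(0,-1)"] x(2)[of "(1,-1)"]
  have "x = (-1,2) \<or> x = (2,-1) \<or> x = (1,0) \<or> x = (0,1) \<or> x = (-1,1) \<or> x = (-1,0) \<or> x = (0,-1) \<or> x = (1,-1)"
    using x(1) by (simp add: hexagon_pts_def)
  then consider "x = (-1,2)" | "x = (2,-1)" | "x = (1,0)" | "x = (0,1)" | "x = (-1,1)" | "x = (-1,0)" | "x = (0,-1)" | "x = (1,-1)" by blast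
  note cases = this
  have xP: "x \<in> set trapezoid_pts"
    using cases by cases (simp_all add: polygon_defs)
  { assume n: "n \<ge> 2" "mem trapezoid_edges (i, j) (n + 1)"
    from cases have "mem trapezoid_edges (i - fst x, j - snd x) n"
      by cases (use n w in \<open>simp_all add: polygon_defs weight_def\<close>)
    then show "\<exists>(x, y)\<in>set trapezoid_pts. mem trapezoid_edges (i - x, j - y) n"
      using xP by (intro bexI[of _ x]) (simp_all only: split_beta) }
  { assume n: "n \<ge> 3" "mem trapezoid_edges (i, j) (n + 2)"
    from cases have "\<forall>(a, b)\<in>set trapezoid_pts. mem trapezoid_edges (i - a, j - b) (n + 1) \<longrightarrow>
        (a = fst x \<and> b = snd x) \<or> mem trapezoid_edges (i - a - fst x, j - b - snd x) n"
      by cases (use n w in \<open>simp_all add: polygon_defs weight_def\<close>)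
    then show "\<exists>(x, y)\<in>set trapezoid_pts. \<forall>(a, b)\<in>set trapezoid_pts. mem trapezoid_edges (i - a, j - b) (n + 1) \<longrightarrow>
        (a = x \<and> b = y) \<or> mem trapezoid_edges (i - a - x, j - b - y) n"
      using xP by (intro bexI[of _ x]) (simp_all only: split_beta) }
  show "split_check trapezoid_edges trapezoid_pts 0 (box 2)" "split_check trapezoid_edges trapezoid_pts 1 (box 4)"
    "hub_check trapezoid_edges trapezoid_pts 1 (box 6)" "hub_check trapezoid_edges trapezoid_pts 2 (box 8)" by code_simp+
qed

lemma square: "polygon_data square_edges square_pts"
proof
  show bounded: "\<bar>fst u\<bar> \<le> 2 * n \<and> \<bar>snd u\<bar> \<le> 2 * n" if "mem square_edges u n" for u n
    using that by (auto simp: polygon_defs)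
  show small: "list_all (\<lambda>u. mem square_edges u 1) square_pts"
    "list_all (\<lambda>u. mem square_edges u 1 \<longrightarrow> u \<in> set square_pts) (box 2)" by code_simp+
  note pts = mem_one_iff[OF bounded small]
  fix i j n :: int
  \<comment> \<open>For the square the sign vector is the hub: it moves each nonzero coordinate one
    step towards 0.\<close>
  have x: "(sgn i, sgn j) \<in> set square_pts"
    by (subst pts[symmetric]) (auto simp: mem_def square_edges_def sgn_if)
  { assume "n \<ge> 2" "mem square_edges (i, j) (n + 1)"
    then have "mem square_edges (i - sgn i, j - sgn j) n" by (auto simp: mem_def square_edges_def sgn_if)
    then show "\<exists>(x, y)\<in>set square_pts. mem square_edges (i - x, j - y) n"
      using x by (intro bexI[of _ "(sgn i, sgn j)"]) auto }
  { assume n: "n \<ge> 3" "mem square_edges (i, j) (n + 2)"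
    have "mem square_edges (i - a - sgn i, j - b - sgn j) n"
      if "mem square_edges (a, b) 1" "mem square_edges (i - a, j - b) (n + 1)" for a b
      using n that by (auto simp: mem_def square_edges_def sgn_if)
    then show "\<exists>(x, y)\<in>set square_pts. \<forall>(a, b)\<in>set square_pts. mem square_edges (i - a, j - b) (n + 1) \<longrightarrow>
        (a = x \<and> b = y) \<or> mem square_edges (i - a - x, j - b - y) n"
      using x by (intro bexI[of _ "(sgn i, sgn j)"]) (auto simp: pts[symmetric]) }
  show "split_check square_edges square_pts 0 (box 2)" "split_check square_edges square_pts 1 (box 4)"
    "hub_check square_edges square_pts 1 (box 6)" "hub_check square_edges square_pts 2 (box 8)" by code_simp+
qed


section \<open>Generation for a generic centre of projection\<close>

lemma coef_vlin_mult: "coef (vlin p m * vlin p m') x =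
   p 0 * p 0 * (1 when x = m + m') - p 0 * p m' * (1 when x = m) - p m * p 0 * (1 when x = m') + p m * p m' * (1 when x = 0)"
  unfolding vlin_def left_diff_distrib right_diff_distrib
  by (simp add: mult_single lookup_minus lookup_add lookup_single when_def)

lemma vlin_scale: "vlin (\<lambda>m. c * p m) m = cst c * vlin p m"
  by (simp add: vlin_def right_diff_distrib mult_single mult.assoc[symmetric])

text \<open>\<open>vlin\<close> is linear in \<open>p\<close>, so the coefficients of the products
  are divided by \<open>c * c\<close>. This reconciles conditions polynomial in the centre of
  projection with the normalisation \<open>p 0 = 1\<close>.\<close>

lemma quad_gen_scale:
  assumes "quad_gen lat p" "c \<noteq> 0" shows "quad_gen lat (\<lambda>m. c * p m)"
  unfolding quad_gen_def
proof
  fix u assume "u \<in> lat 2"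
  then obtain d where d: "mon u = (\<Sum>m\<in>boundary lat. \<Sum>m'\<in>boundary lat. cst (d m m') * (vlin p m * vlin p m'))"
    using assms(1) unfolding quad_gen_def by blast
  have e: "cst x * (cst c * (cst c * y)) = cst (x * (c * c)) * y" for x y
    by (simp add: mult_single mult.assoc[symmetric])
  show "\<exists>d. mon u = (\<Sum>m\<in>boundary lat. \<Sum>m'\<in>boundary lat. cst (d m m') * (vlin (\<lambda>m. c * p m) m * vlin (\<lambda>m. c * p m) m'))"
    unfolding vlin_scale
    by (rule exI[of _ "\<lambda>m m'. d m m' / (c * c)"])
       (simp only: d mult.assoc mult.left_commute[of "vlin _ _" "cst _"] e, simp add: assms(2))
qed

lemma cub_gen_scale:
  assumes "cub_gen lat B p" "c \<noteq> 0" shows "cub_gen lat B (\<lambda>m. c * p m)"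
  unfolding cub_gen_def
proof (intro ballI)
  fix k u assume ku: "k \<in> boundary lat" "u \<in> lat 2"
  obtain d f where df: "\<forall>l\<in>boundary lat. slot k (mon u) l =
     (\<Sum>m\<in>boundary lat. \<Sum>m'\<in>boundary lat. \<Sum>m''\<in>boundary lat. cst (d m m' m'') *
        (slot m (vlin p m' * vlin p m'') l - slot m' (vlin p m * vlin p m'') l)) +
     (\<Sum>b\<in>B. cst (f b) * slot (fst b) (mon (snd b)) l)"
    using bspec[OF bspec[OF assms(1)[unfolded cub_gen_def] ku(1)] ku(2)] by (elim exE)
  have e: "cst (x / (c * c)) * (slot m (cst c * y1 * (cst c * y2)) l - slot m' (cst c * y3 * (cst c * y2)) l) =
      cst x * (slot m (y1 * y2) l - slot m' (y3 * y2) l)" for x m m' y1 y2 y3 and l :: "int \<times> int"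
  proof -
    have "cst c * y1 * (cst c * y2) = cst (c * c) * (y1 * y2)" for y1 y2
      by (simp add: cst_mult mult_ac)
    then have "slot m (cst c * y1 * (cst c * y2)) l - slot m' (cst c * y3 * (cst c * y2)) l =
       cst (c * c) * (slot m (y1 * y2) l - slot m' (y3 * y2) l)"
      by (simp add: right_diff_distrib)
    then show ?thesis using assms(2) by (simp add: mult.assoc[symmetric] mult_single)
  qed
  show "\<exists>d f. \<forall>l\<in>boundary lat. slot k (mon u) l =
     (\<Sum>m\<in>boundary lat. \<Sum>m'\<in>boundary lat. \<Sum>m''\<in>boundary lat. cst (d m m' m'') *
        (slot m (vlin (\<lambda>m. c * p m) m' * vlin (\<lambda>m. c * p m) m'') l - slot m' (vlin (\<lambda>m. c * p m) m * vlin (\<lambda>m. c * p m) m'') l)) +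
     (\<Sum>b\<in>B. cst (f b) * slot (fst b) (mon (snd b)) l)"
    unfolding vlin_scale
    by (rule exI[of _ "\<lambda>m m' m''. d m m' m'' / (c * c)"], rule exI[of _ f], simp only: e) (rule df)
qed

text \<open>At the centre monomial all the \<open>vlin\<close> are monomials, and the cubic relations move a term
  \<open>(k, u)\<close> to \<open>(k', u + k - k')\<close>. The function searches for a path of such moves into \<open>B\<close>.\<close>

fun reach :: "(int \<times> int) list \<Rightarrow> ((int \<times> int) \<times> (int \<times> int)) list \<Rightarrow> nat \<Rightarrow> int \<times> int \<Rightarrow> int \<times> int \<Rightarrow> bool" where
  "reach bd B 0 k u \<longleftrightarrow> (k, u) \<in> set B"
| "reach bd B (Suc d) k u \<longleftrightarrow> (k, u) \<in> set B \<or>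
     list_ex (\<lambda>k'. u - k' \<in> set bd \<and> reach bd B d k' (u + k - k')) bd"

context lattice_polygon
begin

lemma vlin_S: "m \<in> lat 1 \<Longrightarrow> vlin p m \<in> S 1"
  unfolding vlin_def using S_cst[OF one_S, of "p m" 1] by (intro S_diff S_cst S_mon) simp_all

lemma vlin_mult_S: "m \<in> boundary lat \<Longrightarrow> m' \<in> boundary lat \<Longrightarrow> vlin p m * vlin p m' \<in> S 2"
  using S_mult[OF vlin_S vlin_S, of m m' p p] by (simp add: boundary_def numeral_2_eq_2 One_nat_def)

text \<open>At \<open>p0\<close> the \<open>vlin\<close> of boundary points are the monomials
  themselves, and their products reach \<open>mon u\<close> as soon as \<open>u\<close> is a sum of
  two boundary points. Semicontinuity spreads this to generic \<open>p\<close>.\<close>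

lemma generic_quad_gen:
  fixes P :: "complex^'n::finite \<Rightarrow> int \<times> int \<Rightarrow> complex"
  assumes poly: "\<And>m. polyfun (\<lambda>p. P p m)" and P0: "P p0 = (\<lambda>m. 1 when m = 0)"
    and cover: "\<And>u. u \<in> lat 2 \<Longrightarrow> \<exists>m\<in>boundary lat. u - m \<in> boundary lat"
  shows "\<exists>g. polyfun g \<and> g p0 \<noteq> 0 \<and> (\<forall>p. g p \<noteq> 0 \<longrightarrow> quad_gen lat (P p))"
proof -
  let ?I = "boundary lat \<times> boundary lat"
  define v where "v i x p = coef (vlin (P p) (fst i) * vlin (P p) (snd i)) x" for i :: "(int \<times> int) \<times> (int \<times> int)" and x p
  have v_poly: "polyfun (v i x)" for i x
    unfolding v_def coef_vlin_mult
    by (intro polyfun_add polyfun_diff polyfun_mult poly polyfun_const)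
  have v0: "v i x p0 = (1 when x = fst i + snd i)" if "i \<in> ?I" for i x
    using that by (auto simp: v_def coef_vlin_mult P0 boundary_def when_def)
  have "\<exists>g. polyfun g \<and> g p0 \<noteq> 0 \<and> (\<forall>p. g p \<noteq> 0 \<longrightarrow>
     (\<forall>k\<in>lat 2. \<exists>c. \<forall>l\<in>lat 2. (\<Sum>i\<in>?I. c i * v i l p) = (if l = k then 1 else 0)))"
  proof (rule semicontinuity_of_spanning[where v = v, OF finite_lat finite_cartesian_product[OF finite_boundary finite_boundary] v_poly])
    fix u assume "u \<in> lat 2"
    then obtain m where m: "m \<in> boundary lat" "u - m \<in> boundary lat" using cover by blast
    define i0 where "i0 = (m, u - m)"
    have "(\<Sum>i\<in>?I. (if i = i0 then 1 else 0) * v i l p0) = (if l = u then 1 else 0)" for l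
    proof -
      have "(\<Sum>i\<in>?I. (if i = i0 then 1 else 0) * v i l p0) = (\<Sum>i\<in>?I. if i = i0 then v i l p0 else 0)"
        by (intro sum.cong) auto
      also have "\<dots> = v i0 l p0" using m finite_boundary by (subst sum.delta) (auto simp: i0_def)
      also have "\<dots> = (if l = u then 1 else 0)" using m by (subst v0) (auto simp: i0_def when_def)
      finally show ?thesis .
    qed
    then show "\<exists>c. \<forall>l\<in>lat 2. (\<Sum>i\<in>?I. c i * v i l p0) = (if l = u then 1 else 0)"
      by (intro exI[of _ "\<lambda>i. if i = i0 then 1 else 0"] ballI)
  qed
  then obtain g where g: "polyfun g" "g p0 \<noteq> 0" "\<And>p k. g p \<noteq> 0 \<Longrightarrow> k \<in> lat 2 \<Longrightarrow>
     \<exists>c. \<forall>l\<in>lat 2. (\<Sum>i\<in>?I. c i * v i l p) = (if l = k then 1 else 0)" by blast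
  show ?thesis
  proof (intro exI[of _ g] conjI g allI impI)
    fix p assume p: "g p \<noteq> 0"
    show "quad_gen lat (P p)" unfolding quad_gen_def
    proof
      fix u assume u: "u \<in> lat 2"
      obtain c where c: "\<forall>l\<in>lat 2. (\<Sum>i\<in>?I. c i * v i l p) = (if l = u then 1 else 0)"
        using g(3)[OF p u] by (elim exE)
      define r where "r = (\<Sum>m\<in>boundary lat. \<Sum>m'\<in>boundary lat. cst (c (m, m')) * (vlin (P p) m * vlin (P p) m'))"
      have rS: "r \<in> S 2" unfolding r_def by (intro S_sum S_cst vlin_mult_S)
      have "mon u = r"
      proof (rule poly_mapping_eqI)
        fix x
        have rx: "coef r x = (\<Sum>i\<in>?I. c i * v i x p)"
          by (simp add: r_def lookup_sum coef_cst_mult v_def sum.cartesian_product split_beta)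
        show "coef (mon u) x = coef r x"
        proof (cases "x \<in> lat 2")
          case True
          then show ?thesis unfolding rx using bspec[OF c True] by (auto simp: lookup_single when_def)
        next
          case False
          then have "coef r x = 0" using rS unfolding S_iff by blast
          then show ?thesis using False u by (auto simp: lookup_single when_def)
        qed
      qed
      then show "\<exists>c. mon u = (\<Sum>m\<in>boundary lat. \<Sum>m'\<in>boundary lat. cst (c m m') * (vlin (P p) m * vlin (P p) m'))"
        unfolding r_def by (rule exI[of _ "\<lambda>m m'. c (m, m')"])
    qed
  qed
qed

text \<open>At \<open>p0\<close> each relation is a difference of two unit vectors, so a path of
  moves telescopes to a relation between its starting pair and a root. Semicontinuity is then
  applied to relations (\<open>Inl\<close>) and roots (\<open>Inr\<close>) together.\<close>

lemma generic_cub_gen: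
  fixes P :: "complex^'n::finite \<Rightarrow> int \<times> int \<Rightarrow> complex"
  assumes poly: "\<And>m. polyfun (\<lambda>p. P p m)" and P0: "P p0 = (\<lambda>m. 1 when m = 0)"
    and bd: "set bd = boundary lat" and B: "set B \<subseteq> boundary lat \<times> lat 2"
    and reach: "\<And>k u. k \<in> boundary lat \<Longrightarrow> u \<in> lat 2 \<Longrightarrow> reach bd B n k u"
  shows "\<exists>g. polyfun g \<and> g p0 \<noteq> 0 \<and> (\<forall>p. g p \<noteq> 0 \<longrightarrow> cub_gen lat (set B) (P p))"
proof -
  let ?b = "boundary lat"
  let ?J = "?b \<times> ?b \<times> ?b"
  let ?I = "Inl ` ?J \<union> Inr ` set B :: ((int \<times> int) \<times> (int \<times> int) \<times> (int \<times> int) + (int \<times> int) \<times> (int \<times> int)) set"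
  let ?L = "?b \<times> lat 2"
  define r where "r p l i = (case i of
      Inl (m, m', m'') \<Rightarrow> slot m (vlin (P p) m' * vlin (P p) m'') l - slot m' (vlin (P p) m * vlin (P p) m'') l
    | Inr b \<Rightarrow> slot (fst b) (mon (snd b)) l)"
    for i :: "(int \<times> int) \<times> (int \<times> int) \<times> (int \<times> int) + (int \<times> int) \<times> (int \<times> int)" and l p
  define v where "v i x p = coef (r p (fst x) i) (snd x)" for i x p
  have fin: "finite ?I" "finite ?L" using finite_boundary finite_lat by auto
  have v_poly: "polyfun (v i x)" for i x
  proof (cases i)
    case (Inl t)
    obtain m m' m'' where t: "t = (m, m', m'')" by (cases t)
    have sl: "coef (slot m q l) y = (if l = m then coef q y else 0)" for m q l and y :: "int \<times> int" by simp
    have pif: "polyfun f \<Longrightarrow> polyfun (\<lambda>p. if C then f p else 0)" for C and f :: "complex^'n \<Rightarrow> complex"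
      by (cases C) auto
    show ?thesis unfolding v_def r_def Inl t
      by (simp only: sum.case prod.case lookup_minus sl coef_vlin_mult)
         (intro polyfun_diff pif polyfun_add polyfun_mult poly polyfun_const)
  next
    case (Inr b)
    show ?thesis unfolding v_def r_def Inr by (cases "fst x = fst b") (simp_all add: polyfun_const)
  qed
  have span: "\<exists>c. \<forall>x\<in>?L. (\<Sum>i\<in>?I. c i * v i x p0) = (if x = (k, u) then 1 else 0)"
    if "k \<in> ?b" "u \<in> lat 2" "reach bd B d k u" for d k u
    using that
  proof (induction d arbitrary: k u)
    have single: "(\<Sum>i\<in>?I. (if i = i0 then 1 else 0) * v i x p0) = v i0 x p0" if "i0 \<in> ?I" for i0 x
    proof -
      have "(\<Sum>i\<in>?I. (if i = i0 then 1 else 0) * v i x p0) = (\<Sum>i\<in>?I. if i = i0 then v i x p0 else 0)"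
        by (intro sum.cong) auto
      then show ?thesis using that fin(1) by simp
    qed
    have base: "\<exists>c. \<forall>x\<in>?L. (\<Sum>i\<in>?I. c i * v i x p0) = (if x = (k, u) then 1 else 0)" if "(k, u) \<in> set B" for k u
    proof -
      have i0: "Inr (k, u) \<in> ?I" using that by auto
      have "v (Inr (k, u)) x p0 = (if x = (k, u) then 1 else 0)" for x
        by (cases x) (auto simp: v_def r_def lookup_single when_def)
      then show ?thesis using single[OF i0] by (intro exI[of _ "\<lambda>i. if i = Inr (k, u) then 1 else 0"]) simp
    qed
    {
      case 0
      then show ?case using base by simp
    next
      case (Suc d)
      show ?case
      proof (cases "(k, u) \<in> set B")
        case False
        then obtain k' where k': "k' \<in> ?b" "u - k' \<in> ?b" "reach bd B d k' (u + k - k')"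
          using Suc.prems(3) by (auto simp: list_ex_iff bd)
        have "u + k - k' = (u - k') + k" by simp
        also have "\<dots> \<in> lat 2" using lat_add[of "u - k'" 1 k] k'(2) Suc.prems(1)
          by (simp add: boundary_def numeral_2_eq_2 One_nat_def)
        finally obtain c where c: "\<forall>x\<in>?L. (\<Sum>i\<in>?I. c i * v i x p0) = (if x = (k', u + k - k') then 1 else 0)"
          using Suc.IH[OF k'(1) _ k'(3)] by blast
        \<comment> \<open>The relation that performs the first move of the path, from
          \<open>(k, u)\<close> to \<open>(k', u + k - k')\<close>.\<close>
        define i0 :: "(int \<times> int) \<times> (int \<times> int) \<times> (int \<times> int) + (int \<times> int) \<times> (int \<times> int)"
          where "i0 = Inl (k, k', u - k')"
        have i0: "i0 \<in> ?I" using k' Suc.prems(1) by (auto simp: i0_def)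
        have cv: "coef (vlin (P p0) m * vlin (P p0) m') x = (1 when x = m + m')" if "m \<in> ?b" "m' \<in> ?b" for m m' x
          using that by (auto simp: coef_vlin_mult P0 boundary_def when_def)
        have vi0: "v i0 x p0 = (if x = (k, u) then 1 else 0) - (if x = (k', u + k - k') then 1 else 0)" for x
        proof -
          have sl: "coef (slot m q l) y = (if l = m then coef q y else 0)" for m q l and y :: "int \<times> int" by simp
          have "v i0 x p0 = (if fst x = k then 1 when snd x = k' + (u - k') else 0) -
              (if fst x = k' then 1 when snd x = k + (u - k') else 0)"
            unfolding v_def r_def i0_def sum.case prod.case lookup_minus sl
              cv[OF k'(1,2)] cv[OF Suc.prems(1) k'(2)] by (rule refl)
          also have "k' + (u - k') = u" by simp
          also have "k + (u - k') = u + k - k'" by simp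
          finally show ?thesis by (cases x) (simp add: when_def)
        qed
        have "(\<Sum>i\<in>?I. ((if i = i0 then 1 else 0) + c i) * v i x p0) = (if x = (k, u) then 1 else 0)" if "x \<in> ?L" for x
          unfolding distrib_right sum.distrib single[OF i0] vi0 bspec[OF c that] by simp
        then show ?thesis by (intro exI[of _ "\<lambda>i. (if i = i0 then 1 else 0) + c i"] ballI)
      qed (rule base)
    }
  qed
  have "\<exists>g. polyfun g \<and> g p0 \<noteq> 0 \<and> (\<forall>p. g p \<noteq> 0 \<longrightarrow>
     (\<forall>k\<in>?L. \<exists>c. \<forall>l\<in>?L. (\<Sum>i\<in>?I. c i * v i l p) = (if l = k then 1 else 0)))"
  proof (rule semicontinuity_of_spanning[where v = v, OF fin(2,1) v_poly])
    fix x assume "x \<in> ?L"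
    then have x: "fst x \<in> ?b" "snd x \<in> lat 2" by auto
    from span[OF x reach[OF x]]
    show "\<exists>c. \<forall>l\<in>?L. (\<Sum>i\<in>?I. c i * v i l p0) = (if l = x then 1 else 0)" by (simp only: prod.collapse)
  qed
  then obtain g where g: "polyfun g" "g p0 \<noteq> 0" "\<And>p k. g p \<noteq> 0 \<Longrightarrow> k \<in> ?L \<Longrightarrow>
     \<exists>c. \<forall>l\<in>?L. (\<Sum>i\<in>?I. c i * v i l p) = (if l = k then 1 else 0)" by blast
  show ?thesis
  proof (intro exI[of _ g] conjI g allI impI)
    fix p assume p: "g p \<noteq> 0"
    show "cub_gen lat (set B) (P p)" unfolding cub_gen_def
    proof (intro ballI)
      fix k u assume ku: "k \<in> ?b" "u \<in> lat 2"
      obtain c where c: "\<forall>l\<in>?L. (\<Sum>i\<in>?I. c i * v i l p) = (if l = (k, u) then 1 else 0)"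
        using g(3)[OF p, of "(k, u)"] ku by auto
      define s where "s l = (\<Sum>m\<in>?b. \<Sum>m'\<in>?b. \<Sum>m''\<in>?b. cst (c (Inl (m, m', m''))) *
        (slot m (vlin (P p) m' * vlin (P p) m'') l - slot m' (vlin (P p) m * vlin (P p) m'') l)) +
         (\<Sum>b\<in>set B. cst (c (Inr b)) * slot (fst b) (mon (snd b)) l)" for l
      have s_sum: "s l = (\<Sum>i\<in>?I. cst (c i) * r p l i)" for l
      proof -
        have "(\<Sum>i\<in>?I. cst (c i) * r p l i) = (\<Sum>i\<in>Inl ` ?J. cst (c i) * r p l i) + (\<Sum>i\<in>Inr ` set B. cst (c i) * r p l i)"
          using finite_boundary by (intro sum.union_disjoint) auto
        also have "\<dots> = (\<Sum>t\<in>?J. cst (c (Inl t)) * r p l (Inl t)) + (\<Sum>b\<in>set B. cst (c (Inr b)) * r p l (Inr b))"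
          by (simp add: sum.reindex)
        finally show ?thesis
          by (simp add: s_def r_def sum.cartesian_product split_beta)
      qed
      have sl: "slot m q l \<in> S 2" if "q \<in> S 2" for m q and l :: "int \<times> int" using that by (simp add: S_zero)
      have sS: "s l \<in> S 2" for l
        unfolding s_def by (intro S_add S_sum S_cst S_diff sl vlin_mult_S S_mon) (use B in auto)
      have "slot k (mon u) l = s l" if l: "l \<in> ?b" for l
      proof (rule poly_mapping_eqI)
        fix x
        have sx: "coef (s l) x = (\<Sum>i\<in>?I. c i * v i (l, x) p)"
          unfolding s_sum lookup_sum coef_cst_mult v_def by simp
        show "coef (slot k (mon u) l) x = coef (s l) x"
        proof (cases "x \<in> lat 2")
          case True
          then have "(l, x) \<in> ?L" using l by simp
          then show ?thesis unfolding sx using bspec[OF c] by (auto simp: lookup_single when_def)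
        next
          case False
          then have "coef (s l) x = 0" using sS unfolding S_iff by blast
          then show ?thesis using False ku by (auto simp: lookup_single when_def)
        qed
      qed
      then show "\<exists>c d. \<forall>l\<in>?b. slot k (mon u) l =
         (\<Sum>m\<in>?b. \<Sum>m'\<in>?b. \<Sum>m''\<in>?b. cst (c m m' m'') *
            (slot m (vlin (P p) m' * vlin (P p) m'') l - slot m' (vlin (P p) m * vlin (P p) m'') l)) +
         (\<Sum>b\<in>set B. cst (d b) * slot (fst b) (mon (snd b)) l)"
        unfolding s_def by (intro exI[of _ "\<lambda>m m' m''. c (Inl (m, m', m''))"] exI[of _ "\<lambda>b. c (Inr b)"] ballI)
    qed
  qed
qed

end

text \<open>The depth 2 means that every pair lies at most two moves away from a root. The box 4
  contains the doubled polygon.\<close>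

definition gen_check :: "(int \<times> int) list \<Rightarrow> (int \<times> int) list \<Rightarrow> ((int \<times> int) \<times> (int \<times> int)) list \<Rightarrow> bool" where
  "gen_check F bd B \<longleftrightarrow> list_all (\<lambda>(k, u). k \<in> set bd \<and> mem F u 2) B \<and>
     list_all (\<lambda>u. \<not> mem F u 2 \<or> list_ex (\<lambda>m. u - m \<in> set bd) bd) (box 4) \<and>
     list_all (\<lambda>u. \<not> mem F u 2 \<or> list_all (\<lambda>k. reach bd B 2 k u) bd) (box 4)"

lemma (in polygon_data) card_lat: "card (lat_of F n) = length (filter (\<lambda>u. mem F u (int n)) (box (2 * int n)))"
proof -
  have "lat_of F n = set (filter (\<lambda>u. mem F u (int n)) (box (2 * int n)))"
    using in_box unfolding lat_of_def by (auto simp del: set_product)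
  moreover have "distinct (filter (\<lambda>u. mem F u (int n)) (box (2 * int n)))"
    by (intro distinct_filter distinct_product) simp_all
  ultimately show ?thesis by (simp only: distinct_card)
qed

lemma (in polygon_data) generic_generation:
  fixes p :: "complex^'n::finite \<Rightarrow> int \<times> int \<Rightarrow> complex"
  assumes poly: "\<And>m. polyfun (\<lambda>x. p x m)" and p0: "p x0 = (\<lambda>m. 1 when m = 0)"
    and bd: "set bd = set P - {0}" and check: "gen_check F bd B"
  obtains g where "polyfun g" "g x0 \<noteq> 0" "\<And>x. g x \<noteq> 0 \<Longrightarrow> quad_gen (lat_of F) (p x)"
    "\<And>x. g x \<noteq> 0 \<Longrightarrow> cub_gen (lat_of F) (set B) (p x)"
    "finite (set B)" "set B \<subseteq> boundary (lat_of F) \<times> lat_of F 2"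
proof -
  interpret lattice_polygon "lat_of F" by (rule lattice_polygon)
  have b: "set bd = boundary (lat_of F)" using bd by (simp add: boundary_def lat1)
  have L2: "mem F u 2 \<longleftrightarrow> u \<in> lat_of F 2" for u by (simp add: lat_of_def)
  have box2: "u \<in> set (box 4)" if "u \<in> lat_of F 2" for u
    using that by (intro in_box[of u 2]) (simp_all add: L2)
  note c = check[unfolded gen_check_def list_all_iff list_ex_iff L2 b]
  have B: "set B \<subseteq> boundary (lat_of F) \<times> lat_of F 2" using conjunct1[OF c] by auto
  have cov: "\<exists>m\<in>boundary (lat_of F). u - m \<in> boundary (lat_of F)" if "u \<in> lat_of F 2" for u
    using bspec[OF conjunct1[OF conjunct2[OF c]] box2[OF that]] that by blast
  have rch: "reach bd B 2 k u" if "k \<in> boundary (lat_of F)" "u \<in> lat_of F 2" for k u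
    using bspec[OF conjunct2[OF conjunct2[OF c]] box2[OF that(2)]] that by blast
  obtain g where g: "polyfun g" "g x0 \<noteq> 0" "\<And>x. g x \<noteq> 0 \<Longrightarrow> quad_gen (lat_of F) (p x)"
    using generic_quad_gen[OF poly p0 cov] by blast
  obtain h where h: "polyfun h" "h x0 \<noteq> 0" "\<And>x. h x \<noteq> 0 \<Longrightarrow> cub_gen (lat_of F) (set B) (p x)"
    using generic_cub_gen[OF poly p0 b B rch] by blast
  show ?thesis
    by (rule that[of "\<lambda>x. g x * h x"]) (use g h B in auto)
qed

text \<open>Each list has one entry for every connected component, in every degree, of the graph of moves.\<close>

definition hexagon_roots :: "((int \<times> int) \<times> (int \<times> int)) list" where
  "hexagon_roots =
    map (Pair (-1,0)) [(-2,0), (-1,-1), (0,-2), (0,-1), (0,0), (1,-2), (2,-2)] @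
    map (Pair (-1,1)) [(-2,0), (-2,1), (-2,2), (-1,-1), (-1,0), (0,-2), (0,0)] @
    map (Pair (0,1)) [(-2,0), (-2,1), (-2,2), (-1,1), (-1,2), (0,-1), (0,0), (0,2), (1,0), (2,-2)] @
    map (Pair (1,0)) [(-2,2), (-1,0), (-1,2), (0,-2), (0,0), (0,1), (0,2), (1,-2), (1,-1), (1,0), (1,1), (2,-2), (2,-1), (2,0)] @
    map (Pair (0,-1)) [(0,-2), (0,0), (1,-2), (2,-2)] @
    map (Pair (1,-1)) [(0,0), (2,-2)]"

definition pentagon_roots :: "((int \<times> int) \<times> (int \<times> int)) list" where
  "pentagon_roots =
    map (Pair (-1,0)) [(-2,0), (-1,-1), (0,-2), (0,-1), (0,0), (1,-2)] @
    map (Pair (-1,1)) [(-2,0), (-2,1), (-2,2), (-1,-1), (-1,0), (0,-2), (0,0)] @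
    map (Pair (0,1)) [(-2,0), (-2,1), (-2,2), (-1,1), (-1,2), (0,0), (0,2), (1,-2), (2,0)] @
    map (Pair (1,0)) [(-2,2), (-1,-1), (-1,2), (0,0), (0,2), (1,0)] @
    map (Pair (0,-1)) [(0,-2), (1,-2), (2,-2)] @
    map (Pair (2,-1)) [(-2,1), (-1,-1), (-1,2), (0,0), (1,-2), (1,-1), (1,0), (1,1), (2,-2), (2,-1), (2,0), (3,-2), (3,-1), (4,-2)] @
    map (Pair (1,-1)) [(1,-1)]"

definition trapezoid_roots :: "((int \<times> int) \<times> (int \<times> int)) list" where
  "trapezoid_roots =
    map (Pair (-1,0)) [(-2,0), (-2,2), (-1,-1), (0,-2), (0,-1), (1,-2)] @
    map (Pair (-1,1)) [(-2,0), (-1,-1), (-1,1), (0,-2), (1,-1)] @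
    map (Pair (-1,2)) [(-2,1), (-2,2), (-2,3), (-2,4), (-1,-1), (-1,1), (-1,2), (-1,3), (0,0), (0,1), (0,2), (1,0), (1,1), (2,-2), (2,0), (3,-2)] @
    map (Pair (0,1)) [(-1,-1), (1,-2)] @
    map (Pair (1,0)) [(-2,1), (-1,-1), (0,1)] @
    map (Pair (0,-1)) [(0,-2), (1,-2), (2,-2)] @
    map (Pair (2,-1)) [(-2,2), (-1,-1), (0,0), (0,2), (1,-2), (1,-1), (1,0), (1,1), (2,-2), (2,-1), (2,0), (3,-2), (3,-1), (4,-2)] @
    map (Pair (1,-1)) [(1,-1)]"

definition square_roots :: "((int \<times> int) \<times> (int \<times> int)) list" where
  "square_roots =
    map (Pair (-1,-1)) [(-2,-2), (-2,-1), (-2,0), (-2,1), (-1,-2), (-1,-1), (-1,0), (-1,2), (0,-2), (0,-1), (0,0), (1,-2), (2,-1)] @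
    map (Pair (-1,1)) [(-2,0), (-2,1), (-2,2), (0,0), (0,2)] @
    map (Pair (-1,0)) [(-1,0), (0,0)] @
    map (Pair (0,1)) [(-2,1), (-2,2), (0,0), (0,1)] @
    map (Pair (1,1)) [(-2,1), (-1,2), (0,0), (0,1), (0,2), (1,-2), (1,0), (1,1), (1,2), (2,-1), (2,0), (2,1), (2,2)] @
    map (Pair (0,-1)) [(0,-1), (0,0), (2,-2)] @
    map (Pair (1,0)) [(-1,0), (0,0), (1,-2), (1,0), (2,-2)] @
    map (Pair (1,-1)) [(0,-2), (0,0), (2,-2), (2,0)]"

lemma hexagon_gen: "gen_check hexagon_edges (filter (\<lambda>u. u \<noteq> (0, 0)) hexagon_pts) hexagon_roots"
  by code_simp

lemma pentagon_gen: "gen_check pentagon_edges (filter (\<lambda>u. u \<noteq> (0, 0)) pentagon_pts) pentagon_roots"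
  by code_simp

lemma trapezoid_gen: "gen_check trapezoid_edges (filter (\<lambda>u. u \<noteq> (0, 0)) trapezoid_pts) trapezoid_roots"
  by code_simp

lemma square_gen: "gen_check square_edges (filter (\<lambda>u. u \<noteq> (0, 0)) square_pts) square_roots"
  by code_simp

text \<open>There are 44 = 37 + 7 roots: the surplus over the points of the tripled polygon is the
  number of cubics. In the next three lemmas the surplus is 46 - 43 = 3, 50 - 49 = 1 and 49 - 49 =
  0.\<close>

lemma hexagon_card: "card (lat_of hexagon_edges 2) = 19" "card (lat_of hexagon_edges 3) = 37" "card (set hexagon_roots) \<le> 44"
proof -
  have "length (filter (\<lambda>u. mem hexagon_edges u 2) (box 4)) = 19" "length (filter (\<lambda>u. mem hexagon_edges u 3) (box 6)) = 37"
    "length hexagon_roots = 44" by code_simp+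
  then show "card (lat_of hexagon_edges 2) = 19" "card (lat_of hexagon_edges 3) = 37" "card (set hexagon_roots) \<le> 44"
    using polygon_data.card_lat[OF hexagon, of 2] polygon_data.card_lat[OF hexagon, of 3] card_length[of hexagon_roots] by simp_all
qed

lemma pentagon_card: "card (lat_of pentagon_edges 2) = 22" "card (lat_of pentagon_edges 3) = 43" "card (set pentagon_roots) \<le> 46"
proof -
  have "length (filter (\<lambda>u. mem pentagon_edges u 2) (box 4)) = 22" "length (filter (\<lambda>u. mem pentagon_edges u 3) (box 6)) = 43"
    "length pentagon_roots = 46" by code_simp+
  then show "card (lat_of pentagon_edges 2) = 22" "card (lat_of pentagon_edges 3) = 43" "card (set pentagon_roots) \<le> 46"
    using polygon_data.card_lat[OF pentagon, of 2] polygon_data.card_lat[OF pentagon, of 3] card_length[of pentagon_roots] by simp_all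
qed

lemma trapezoid_card: "card (lat_of trapezoid_edges 2) = 25" "card (lat_of trapezoid_edges 3) = 49" "card (set trapezoid_roots) \<le> 50"
proof -
  have "length (filter (\<lambda>u. mem trapezoid_edges u 2) (box 4)) = 25" "length (filter (\<lambda>u. mem trapezoid_edges u 3) (box 6)) = 49"
    "length trapezoid_roots = 50" by code_simp+
  then show "card (lat_of trapezoid_edges 2) = 25" "card (lat_of trapezoid_edges 3) = 49" "card (set trapezoid_roots) \<le> 50"
    using polygon_data.card_lat[OF trapezoid, of 2] polygon_data.card_lat[OF trapezoid, of 3] card_length[of trapezoid_roots] by simp_all
qed

lemma square_card: "card (lat_of square_edges 2) = 25" "card (lat_of square_edges 3) = 49" "card (set square_roots) \<le> 49"
proof -
  have "length (filter (\<lambda>u. mem square_edges u 2) (box 4)) = 25" "length (filter (\<lambda>u. mem square_edges u 3) (box 6)) = 49"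
    "length square_roots = 49" by code_simp+
  then show "card (lat_of square_edges 2) = 25" "card (lat_of square_edges 3) = 49" "card (set square_roots) \<le> 49"
    using polygon_data.card_lat[OF square, of 2] polygon_data.card_lat[OF square, of 3] card_length[of square_roots] by simp_all
qed


section \<open>A lower bound for the number of cubics\<close>

context toric_projection
begin

text \<open>The linear forms in \<open>E\<close> cut out a linear subspace of the target, and \<open>N n\<close> is the part of degree
  \<open>n + 1\<close> of the ideal they generate on the surface. Restricting equations to this subspace
  bounds the number of cubic generators from below.\<close>

lemma cubics_lower:
  fixes E :: "laurent set"
  assumes E: "finite E" "E \<subseteq> S 1" "\<And>e. e \<in> E \<Longrightarrow> (\<Sum>m\<in>lat 1. coef e m * p m) = 0"
      "lv.independent E" "card E + CARD('r::finite) = CARD('k)"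
    and D: "finite D" "card D \<le> dN" "\<And>e x. e \<in> E \<Longrightarrow> x \<in> lat 1 \<Longrightarrow> e * mon x \<in> lv.span D"
    and C: "finite C" "card C \<le> c3"
      "\<And>x. x \<in> lat 3 \<Longrightarrow> mon x \<in> lv.span ({e * mon y |e y. e \<in> E \<and> y \<in> lat 2} \<union> C)"
    and num: "b + c3 + CARD('r) * (((CARD('r) + 1) choose 2) + dN - card (lat 2)) \<le> (CARD('r) + 2) choose 3"
  shows "poly_vs.dim U + b \<le> poly_vs.dim (I \<inter> forms 3)"
proof -
  have subS: "lv.subspace (S n)" for n unfolding S_span by (rule lv.subspace_span)
  have finS: "lv.fin_spanned (S n)" for n unfolding S_span using finite_lat by (intro lv.fin_spanned_span) auto
  define Wp where "Wp = {r \<in> S 1. (\<Sum>m\<in>lat 1. coef r m * p m) = 0}"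
  have Wp_span: "Wp \<subseteq> lv.span (range w)"
  proof
    fix r assume r: "r \<in> Wp"
    have "r = (\<Sum>m\<in>lat 1. cst (coef r m) * ((\<Sum>i\<in>UNIV. cst (a m i) * w i) + cst (p m)))"
      using S_expand[of r 1] r mon_repr by (simp add: Wp_def)
    also have "\<dots> = (\<Sum>m\<in>lat 1. \<Sum>i\<in>UNIV. cst (coef r m * a m i) * w i) + cst (\<Sum>m\<in>lat 1. coef r m * p m)"
      by (simp add: distrib_left sum.distrib sum_distrib_left cst_sum cst_mult mult.assoc)
    also have "(\<Sum>m\<in>lat 1. \<Sum>i\<in>UNIV. cst (coef r m * a m i) * w i) =
       (\<Sum>m\<in>lat 1. \<Sum>i\<in>UNIV. lscale (coef r m * a m i) (w i))" by (simp add: lscale_def)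
    finally have "r = (\<Sum>m\<in>lat 1. \<Sum>i\<in>UNIV. lscale (coef r m * a m i) (w i))" using r by (simp add: Wp_def)
    moreover have "(\<Sum>m\<in>lat 1. \<Sum>i\<in>UNIV. lscale (coef r m * a m i) (w i)) \<in> lv.span (range w)"
      by (intro lv.span_sum lv.sum_scale_in_span lv.span_base) auto
    ultimately show "r \<in> lv.span (range w)" by simp
  qed
  have w_Wp: "w i \<in> Wp" for i using w_S w_p by (simp add: Wp_def)
  have w_ind: "inj_on w UNIV \<and> lv.independent (range w)"
    by (rule lv.family_independent) (use w_indep in \<open>auto simp: lscale_def\<close>)
  have dimW: "lv.dim Wp = CARD('k)"
    using lv.dim_unique[of "range w" Wp] w_Wp Wp_span w_ind by (simp add: card_image image_subset_iff)
  have finW: "lv.fin_spanned Wp" by (rule lv.fin_spanned_subset[OF finS[of 1]]) (auto simp: Wp_def)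
  have EW: "E \<subseteq> Wp" using E(2,3) by (auto simp: Wp_def)
  obtain K where K: "finite E" "finite K" "E \<inter> K = {}" "K \<subseteq> Wp" "lv.independent (E \<union> K)"
      "Wp \<subseteq> lv.span (E \<union> K)" "lv.dim Wp = card E + card K"
    by (rule lv.extend_to_basis[OF finW EW E(4)])
  have "card K = CARD('r)" using K(7) dimW E(5) by simp
  \<comment> \<open>The complement \<open>K\<close> of \<open>E\<close> provides homogeneous
    coordinates on the linear subspace cut out by \<open>E\<close>.\<close>
  then obtain u :: "'r \<Rightarrow> laurent" where u: "bij_betw u UNIV K"
    using finite_same_card_bij[OF finite K(2)] by metis
  have uK: "u c \<in> K" for c using bij_betwE[OF u] by simp
  \<comment> \<open>Restriction of linear forms to the subspace.\<close>
  obtain lam :: "laurent \<Rightarrow> 'r mpoly" where lam: "Vector_Spaces.linear lscale const_scale lam"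
      "\<forall>x\<in>E \<union> K. lam x = (if x \<in> E then 0 else var (inv u x))"
    using lp.linear_independent_extend[OF K(5), of "\<lambda>x. if x \<in> E then 0 else var (inv u x)"] by blast
  interpret lam: Vector_Spaces.linear lscale const_scale lam by (rule lam(1))
  have lamE: "lam e = 0" if "e \<in> E" for e using lam(2) that by simp
  have lamu: "lam (u c) = var c" for c
  proof -
    have "inj u" using u by (simp add: bij_betw_def)
    then show ?thesis using lam(2) uK[of c] K(3) by auto
  qed
  have lam_forms: "lam x \<in> forms 1" if "x \<in> Wp" for x
  proof -
    have "lv.subspace {x. lam x \<in> forms 1}"
      by (intro lv.subspaceI) (auto simp: lam.zero lam.add lam.scale forms_zero forms_add forms_scale)
    moreover have "E \<union> K \<subseteq> {x. lam x \<in> forms 1}"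
    proof
      fix x assume "x \<in> E \<union> K"
      then consider "x \<in> E" | c where "x = u c" using u by (auto simp: bij_betw_def)
      then show "x \<in> {x. lam x \<in> forms 1}" by cases (auto simp: lamE lamu forms_zero forms_var)
    qed
    ultimately show ?thesis using lv.span_minimal K(6) that by blast
  qed
  interpret lu: Vector_Spaces.linear const_scale lscale "lsub u" by (rule linear_lsub)
  have lam_diff: "x - lsub u (lam x) \<in> lv.span E" if "x \<in> Wp" for x
  proof -
    have "lv.subspace {x. x - lsub u (lam x) \<in> lv.span E}"
    proof (intro lv.subspaceI)
      show "0 \<in> {x. x - lsub u (lam x) \<in> lv.span E}" by (simp add: lam.zero lu.zero lv.span_zero)
      fix x y c assume x: "x \<in> {x. x - lsub u (lam x) \<in> lv.span E}"
      have "lscale c x - lsub u (lam (lscale c x)) = lscale c (x - lsub u (lam x))"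
        by (simp add: lam.scale lu.scale lv.scale_right_diff_distrib)
      then show "lscale c x \<in> {x. x - lsub u (lam x) \<in> lv.span E}" using x by (simp add: lv.span_scale)
      assume y: "y \<in> {x. x - lsub u (lam x) \<in> lv.span E}"
      have "x + y - lsub u (lam (x + y)) = (x - lsub u (lam x)) + (y - lsub u (lam y))"
        by (simp add: lam.add lu.add)
      then show "x + y \<in> {x. x - lsub u (lam x) \<in> lv.span E}" using x y by (simp only: mem_Collect_eq lv.span_add)
    qed
    moreover have "E \<union> K \<subseteq> {x. x - lsub u (lam x) \<in> lv.span E}"
    proof
      fix x assume "x \<in> E \<union> K"
      then consider "x \<in> E" | c where "x = u c" using u by (auto simp: bij_betw_def)
      then show "x \<in> {x. x - lsub u (lam x) \<in> lv.span E}"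
        by cases (auto simp: lamE lamu lu.zero const_hom.psubst_var lv.span_base lv.span_zero)
    qed
    ultimately show ?thesis using lv.span_minimal K(6) that by blast
  qed
  define N where "N n = lv.span {e * mon y |e y. e \<in> E \<and> y \<in> lat n}" for n
  have subN: "lv.subspace (N n)" for n unfolding N_def by (rule lv.subspace_span)
  have N_mult: "e * s \<in> N n" if "e \<in> lv.span E" "s \<in> S n" for e s n
  proof -
    have "lv.subspace {e. e * s \<in> N n}"
      using subN[of n] unfolding lv.subspace_def by (auto simp: lscale_def distrib_right mult.assoc)
    moreover have "e * s \<in> N n" if e: "e \<in> E" for e
    proof -
      have "e * s = (\<Sum>x\<in>lat n. lscale (coef s x) (e * mon x))"
        using arg_cong[OF S_expand[OF \<open>s \<in> S n\<close>], of "(*) e"]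
        by (simp add: sum_distrib_left lscale_def mult_ac)
      moreover have "(\<Sum>x\<in>lat n. lscale (coef s x) (e * mon x)) \<in> N n"
        unfolding N_def using e by (intro lv.sum_scale_in_span lv.span_base) auto
      ultimately show ?thesis by simp
    qed
    ultimately show ?thesis using lv.span_minimal[of E "{e. e * s \<in> N n}"] that(1) by blast
  qed
  have N_up: "s * x \<in> N (Suc n)" if "x \<in> N n" "s \<in> S 1" for s x n
  proof -
    have "lv.subspace {x. s * x \<in> N (Suc n)}"
      using subN[of "Suc n"] unfolding lv.subspace_def by (auto simp: lscale_def distrib_left mult.left_commute[of s])
    moreover have "s * (e * mon y) \<in> N (Suc n)" if "e \<in> E" "y \<in> lat n" for e y
      using N_mult[OF lv.span_base[OF that(1)] S_mult[OF \<open>s \<in> S 1\<close> S_mon[OF that(2)]]]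
      by (simp add: mult.left_commute)
    ultimately show ?thesis
      using lv.span_minimal[of "{e * mon y |e y. e \<in> E \<and> y \<in> lat n}" "{x. s * x \<in> N (Suc n)}"] that(1)
      unfolding N_def[of n] by blast
  qed
  \<comment> \<open>\<open>w i\<close> restricted to the subspace and lifted back through the
    complement; it differs from \<open>w i\<close> by an element of the span of \<open>E\<close>.
    Hence substituting \<open>t\<close> for \<open>w\<close> changes values only within
    \<open>N\<close>.\<close>
  define t where "t i = lsub u (lam (w i))" for i
  have spanE: "lv.span E \<subseteq> S 1" by (rule lv.span_minimal[OF E(2) subS])
  have wt: "w i - t i \<in> lv.span E" for i unfolding t_def by (rule lam_diff[OF w_Wp])
  have tS: "t i \<in> S 1" for i using S_diff[OF w_S[of i] subsetD[OF spanE wt[of i]]] by simp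
  have diff: "lsub w F - lsub t F \<in> N n" if "F \<in> forms (Suc n)" for F n
    using that
  proof (induction n arbitrary: F)
    case 0
    obtain G where G: "\<And>i. G i \<in> forms 0" "F = (\<Sum>i\<in>UNIV. var i * G i)"
      by (rule forms_Suc_decomp[OF 0]) blast
    have Gc: "lsub x (G i) = cst (coef (G i) 0)" for x :: "'k \<Rightarrow> laurent" and i
      using arg_cong[OF form0[OF G(1)], of "lsub x" i] by (simp only: const_hom.psubst_const)
    have "lsub w F - lsub t F = (\<Sum>i\<in>UNIV. (w i - t i) * cst (coef (G i) 0))"
      by (simp add: G(2) const_hom.psubst_sum const_hom.psubst_mult const_hom.psubst_var Gc left_diff_distrib sum_subtractf)
    moreover have "(w i - t i) * cst (coef (G i) 0) \<in> N 0" for i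
      using N_mult[OF wt S_cst[OF one_S, of "coef (G i) 0" 0]] by simp
    ultimately show ?case by (simp only: lv.subspace_sum[OF subN])
  next
    case (Suc n)
    obtain G where G: "\<And>i. G i \<in> forms (Suc n)" "F = (\<Sum>i\<in>UNIV. var i * G i)"
      by (rule forms_Suc_decomp[OF Suc.prems]) blast
    have "lsub w F - lsub t F = (\<Sum>i\<in>UNIV. (w i - t i) * lsub w (G i) + t i * (lsub w (G i) - lsub t (G i)))"
      by (simp add: G(2) const_hom.psubst_sum const_hom.psubst_mult const_hom.psubst_var algebra_simps sum_subtractf sum.distrib)
    moreover have "(w i - t i) * lsub w (G i) + t i * (lsub w (G i) - lsub t (G i)) \<in> N (Suc n)" for i
      by (intro lv.subspace_add[OF subN] N_mult[OF wt] N_up[OF _ tS] lsub_forms Suc.IH G(1))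
    ultimately show ?case by (simp only: lv.subspace_sum[OF subN])
  qed
  \<comment> \<open>Restriction of polynomials from the target to the subspace;
    \<open>psub L\<close> is a section of it.\<close>
  define pi where "pi = (psub (\<lambda>i. lam (w i)) :: 'k mpoly \<Rightarrow> 'r mpoly)"
  have pi_t: "lsub u (pi F) = lsub t F" for F
    unfolding pi_def const_hom.psubst_psubst t_def by (rule refl)
  interpret pi: Vector_Spaces.linear const_scale const_scale pi unfolding pi_def by (rule linear_psub)
  have pi_mult: "pi (F * G) = pi F * pi G" for F G unfolding pi_def by (rule const_hom.psubst_mult)
  have pi_forms: "pi F \<in> forms n" if "F \<in> forms n" for F n
    unfolding pi_def using psub_forms[OF that, of "\<lambda>i. lam (w i)" 1] lam_forms[OF w_Wp] by simp
  have lift: "\<exists>L\<in>forms 1. lsub w L = x \<and> pi L = lam x" if "x \<in> Wp" for x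
  proof -
    have "x \<in> lv.span (w ` UNIV)" using that Wp_span by auto
    then obtain c where c: "x = (\<Sum>i\<in>UNIV. lscale (c i) (w i))" by (rule lv.span_family[OF finite])
    show ?thesis
    proof (intro bexI[of _ "\<Sum>i\<in>UNIV. const_scale (c i) (var i)"] conjI)
      show "lsub w (\<Sum>i\<in>UNIV. const_scale (c i) (var i)) = x"
        by (simp add: c const_hom.psubst_sum const_hom.psubst_scale const_hom.psubst_var lscale_def)
      show "pi (\<Sum>i\<in>UNIV. const_scale (c i) (var i)) = lam x"
        unfolding c pi.sum pi.scale lam.sum lam.scale by (simp add: pi_def const_hom.psubst_var)
    qed (intro forms_sum forms_scale forms_var)
  qed
  have "\<exists>L\<in>forms 1. lsub w L = u c \<and> pi L = var c" for c
    using lift[of "u c"] uK[of c] K(4) by (auto simp: lamu)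
  then obtain L where L: "\<And>c. L c \<in> forms 1" "\<And>c. lsub w (L c) = u c" "\<And>c. pi (L c) = var c" by metis
  have iota_w: "lsub w (psub L G) = lsub u G" for G by (simp add: const_hom.psubst_psubst L(2))
  have iota_pi: "pi (psub L G) = G" for G
    unfolding pi_def const_hom.psubst_psubst unfolding pi_def[symmetric] L(3) by (rule psub_var)
  \<comment> \<open>Forms on the subspace that vanish on its intersection with the surface, in the
    sense of the ideal generated by \<open>E\<close>. Restriction maps the quadrics of the ideal
    into \<open>G2\<close>, while the restricted cubics contain all of \<open>G3\<close>.\<close>
  define G2 G3 where "G2 = {G \<in> forms 2. lsub u G \<in> N 1}" and "G3 = {G \<in> forms 3. lsub u G \<in> N 2}"
  have suc: "forms 2 = (forms (Suc 1) :: 'k mpoly set)" "forms 3 = (forms (Suc 2) :: 'k mpoly set)"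
    by (simp_all add: numeral_2_eq_2 numeral_3_eq_3 One_nat_def)
  have piI2: "pi F \<in> G2" if "F \<in> I \<inter> forms 2" for F
  proof -
    from that have F: "F \<in> forms 2" "lsub w F = 0" unfolding I_forms by auto
    have "- (lsub w F - lsub t F) \<in> N 1"
      using diff[of F 1] F(1) unfolding suc by (intro lv.subspace_neg[OF subN])
    then show ?thesis using F pi_forms[OF F(1)] by (simp add: G2_def pi_t)
  qed
  have G3I: "G3 \<subseteq> pi ` (I \<inter> forms 3)"
  proof
    fix G assume G: "G \<in> G3"
    \<comment> \<open>Elements of \<open>N 2\<close> lift to cubics with zero restriction.
      Subtracting such a lift from \<open>psub L G\<close> yields an equation of the surface that
      still restricts to \<open>G\<close>.\<close>
    let ?A = "{x. \<exists>R\<in>forms 3. lsub w R = x \<and> pi R = 0}"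
    have "lv.subspace ?A"
    proof (intro lv.subspaceI)
      show "0 \<in> ?A" using forms_zero const_hom.psubst_zero pi.zero by blast
      fix x y c assume "x \<in> ?A"
      then obtain R where R: "R \<in> forms 3" "lsub w R = x" "pi R = 0" by auto
      show "lscale c x \<in> ?A"
        using R forms_scale[OF R(1), of c] by (auto intro!: bexI[of _ "const_scale c R"] simp: const_hom.psubst_scale lscale_def pi.scale)
      assume "y \<in> ?A"
      then obtain R' where R': "R' \<in> forms 3" "lsub w R' = y" "pi R' = 0" by auto
      show "x + y \<in> ?A"
        using R R' forms_add[OF R(1) R'(1)] by (auto intro!: bexI[of _ "R + R'"] simp: const_hom.psubst_add pi.add)
    qed
    moreover have "e * mon y \<in> ?A" if ey: "e \<in> E" "y \<in> lat 2" for e y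
    proof -
      obtain L where L: "L \<in> forms 1" "lsub w L = e" "pi L = 0"
        using lift[of e] EW ey(1) lamE[OF ey(1)] by auto
      obtain R where R: "R \<in> forms 2" "lsub w R = mon y" using lsub_onto[OF order_refl S_mon[OF ey(2)]] by blast
      have "L * R \<in> forms 3" using forms_mult[OF L(1) R(1)] by simp
      then show ?thesis using L R by (auto intro!: bexI[of _ "L * R"] simp: const_hom.psubst_mult pi_mult)
    qed
    ultimately have "N 2 \<subseteq> ?A" unfolding N_def by (intro lv.span_minimal) auto
    then obtain R where R: "R \<in> forms 3" "lsub w R = lsub u G" "pi R = 0" using G by (auto simp: G3_def)
    have "psub L G \<in> forms 3" using psub_forms[of G 3 L 1] L(1) G by (simp add: G3_def)
    then have "psub L G - R \<in> I \<inter> forms 3"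
      unfolding I_forms using R by (simp add: forms_diff const_hom.psubst_diff iota_w)
    moreover have "pi (psub L G - R) = G" by (simp add: pi.diff iota_pi R(3))
    ultimately show "G \<in> pi ` (I \<inter> forms 3)" by (metis image_eqI)
  qed
  have finN: "lv.fin_spanned (N n)" for n
  proof -
    have "{e * mon y |e y. e \<in> E \<and> y \<in> lat n} = (\<lambda>(e, y). e * mon y) ` (E \<times> lat n)" by auto
    then show ?thesis unfolding N_def using E(1) finite_lat by (intro lv.fin_spanned_span) auto
  qed
  have finimg: "lv.fin_spanned (lsub u ` forms n)" for n
    by (rule pl.fin_spanned_image[OF linear_lsub fin_spanned_forms])
  have ed: "2 + CARD('r) - 1 = CARD('r) + 1" "3 + CARD('r) - 1 = CARD('r) + 2" by simp_all
  have dimG2: "poly_vs.dim G2 + card (lat 2) \<le> ((CARD('r) + 1) choose 2) + dN"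
  proof -
    have "S 2 \<subseteq> lv.span (lsub u ` forms 2 \<union> N 1)"
    proof
      fix r assume "r \<in> S 2"
      then obtain F where F: "F \<in> forms 2" "lsub w F = r" using lsub_onto[OF order_refl] by blast
      have "r = lsub u (pi F) + (lsub w F - lsub t F)" by (simp add: pi_t F(2))
      moreover have "lsub u (pi F) \<in> lsub u ` forms 2" using pi_forms[OF F(1)] by auto
      moreover have "lsub w F - lsub t F \<in> N 1" using diff[of F 1] F(1) unfolding suc by simp
      ultimately show "r \<in> lv.span (lsub u ` forms 2 \<union> N 1)"
        by (metis UnI1 UnI2 lv.span_add lv.span_base)
    qed
    then have "card (lat 2) \<le> lv.dim (lv.span (lsub u ` forms 2 \<union> N 1))"
      using lv.dim_mono_fin[OF lv.fin_spanned_Un[OF finimg finN], of "S 2" 2 1] by (simp add: dim_S lv.span_span)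
    moreover have "lv.dim (N 1) \<le> dN"
    proof -
      have "N 1 \<subseteq> lv.span D" unfolding N_def using D(3) by (intro lv.span_minimal) auto
      then show ?thesis using lv.dim_le_card[OF _ D(1)] D(2) by (meson le_trans)
    qed
    ultimately show ?thesis
      using pl.dim_preimage[OF linear_lsub[of u] subspace_forms[of 2] fin_spanned_forms[of 2] subN[of 1] finN[of 1], folded G2_def]
      unfolding dim_forms ed by simp
  qed
  have dimG3: "(CARD('r) + 2) choose 3 \<le> poly_vs.dim G3 + c3"
  proof -
    have "lsub u G \<in> S 3" if "G \<in> forms 3" for G
    proof -
      have "lsub w (psub L G) \<in> S 3" using lsub_forms[OF psub_forms[OF that L(1)]] by simp
      then show ?thesis by (simp add: iota_w)
    qed
    moreover have "S 3 \<subseteq> lv.span (N 2 \<union> C)"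
    proof -
      have "{e * mon y |e y. e \<in> E \<and> y \<in> lat 2} \<union> C \<subseteq> lv.span (N 2 \<union> C)"
        unfolding N_def using lv.span_base[of _ "_ \<union> C"] lv.span_base[of _ "{e * mon y |e y. e \<in> E \<and> y \<in> lat 2}"] by blast
      then have "lv.span ({e * mon y |e y. e \<in> E \<and> y \<in> lat 2} \<union> C) \<subseteq> lv.span (N 2 \<union> C)"
        by (rule lv.span_minimal[OF _ lv.subspace_span])
      then show ?thesis unfolding S_span using C(3) by (intro lv.span_minimal[OF _ lv.subspace_span]) auto
    qed
    moreover have "N 2 \<subseteq> lv.span (N 2 \<union> C)" using lv.span_superset by blast
    ultimately have "lv.span (lsub u ` forms 3 \<union> N 2) \<subseteq> lv.span (N 2 \<union> C)"
      by (intro lv.span_minimal[OF _ lv.subspace_span]) blast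
    then have "lv.dim (lv.span (lsub u ` forms 3 \<union> N 2)) \<le> lv.dim (lv.span (N 2 \<union> C))"
      using lv.fin_spanned_Un[OF finN lv.fin_spanned_finite[OF C(1)]] by (intro lv.dim_mono_fin) (simp_all only: lv.span_span)
    also have "\<dots> \<le> lv.dim (N 2) + lv.dim C" by (rule lv.dim_Un_le[OF finN lv.fin_spanned_finite[OF C(1)]])
    also have "\<dots> \<le> lv.dim (N 2) + c3" using lv.dim_le_card'[OF C(1)] C(2) by simp
    finally have "lv.dim (lv.span (lsub u ` forms 3 \<union> N 2)) \<le> lv.dim (N 2) + c3" .
    then show ?thesis
      using pl.dim_preimage[OF linear_lsub[of u] subspace_forms[of 3] fin_spanned_forms[of 3] subN[of 2] finN[of 2], folded G3_def]
      unfolding dim_forms ed by simp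
  qed
  \<comment> \<open>The kernel of the restriction on \<open>U\<close> lies in that on the cubics of
    the ideal. So the codimension of \<open>U\<close> is at least \<open>dim G3\<close> minus the
    dimension of the restriction of \<open>U\<close>, which consists of multiples of
    \<open>G2\<close>.\<close>
  have dimU: "poly_vs.dim U = poly_vs.dim {x \<in> U. pi x = 0} + poly_vs.dim (pi ` U)"
    by (rule pp.rank_nullity[OF pi.linear_axioms _ pv.fin_spanned_subset[OF fin_I U_sub]])
       (simp add: var_multiples_def poly_vs.subspace_span)
  have dimI: "poly_vs.dim (I \<inter> forms 3) = poly_vs.dim {x \<in> I \<inter> forms 3. pi x = 0} + poly_vs.dim (pi ` (I \<inter> forms 3))"
    by (rule pp.rank_nullity[OF pi.linear_axioms subspace_I fin_I])
  have ker: "poly_vs.dim {x \<in> U. pi x = 0} \<le> poly_vs.dim {x \<in> I \<inter> forms 3. pi x = 0}"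
  proof (rule pv.dim_mono_fin)
    show "pv.fin_spanned {x \<in> I \<inter> forms 3. pi x = 0}" by (rule pv.fin_spanned_subset[OF fin_I]) auto
    show "{x \<in> U. pi x = 0} \<subseteq> poly_vs.span {x \<in> I \<inter> forms 3. pi x = 0}"
      using U_sub poly_vs.span_superset[of "{x \<in> I \<inter> forms 3. pi x = 0}"] by auto
  qed
  have img3: "poly_vs.dim G3 \<le> poly_vs.dim (pi ` (I \<inter> forms 3))"
    using subset_trans[OF G3I poly_vs.span_superset] by (rule pv.dim_mono_fin[OF pp.fin_spanned_image[OF pi.linear_axioms fin_I]])
  have piU: "pi ` U \<subseteq> var_multiples G2"
  proof -
    have "poly_vs.subspace {x. pi x \<in> var_multiples G2}"
      unfolding var_multiples_def by (intro poly_vs.subspaceI)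
        (auto simp: pi.zero pi.add pi.scale poly_vs.span_zero poly_vs.span_add poly_vs.span_scale)
    moreover have "pi (var i * F) \<in> var_multiples G2" if "F \<in> I \<inter> forms 2" for i F
      unfolding pi_mult using piI2[OF that] lam_forms[OF w_Wp[of i]]
      by (intro form1_mult) (simp_all add: pi_def const_hom.psubst_var)
    ultimately have "U \<subseteq> {x. pi x \<in> var_multiples G2}"
      unfolding var_multiples_def[of "I \<inter> forms 2"] by (intro poly_vs.span_minimal) auto
    then show ?thesis by auto
  qed
  have finG2: "pv.fin_spanned G2" by (rule pv.fin_spanned_subset[OF fin_spanned_forms[of 2]]) (auto simp: G2_def)
  have finVM: "pv.fin_spanned (var_multiples G2)"
  proof (rule pv.fin_spanned_subset[OF fin_spanned_forms[of 3]])
    show "var_multiples G2 \<subseteq> forms 3"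
      unfolding var_multiples_def
    proof (rule poly_vs.span_minimal[OF _ subspace_forms], clarify)
      fix i F assume "F \<in> G2"
      then show "var i * F \<in> forms 3" using forms_mult[OF forms_var, of F 2 i] by (simp add: G2_def)
    qed
  qed
  have "poly_vs.dim (pi ` U) \<le> poly_vs.dim (var_multiples G2)"
    by (rule pv.dim_mono_fin[OF finVM subset_trans[OF piU poly_vs.span_superset]])
  also have "\<dots> \<le> CARD('r) * poly_vs.dim G2" by (rule dim_var_multiples[OF finG2])
  also have "\<dots> \<le> CARD('r) * (((CARD('r) + 1) choose 2) + dN - card (lat 2))"
    using dimG2 by (intro mult_left_mono) simp_all
  finally have piU_le: "poly_vs.dim (pi ` U) \<le> CARD('r) * (((CARD('r) + 1) choose 2) + dN - card (lat 2))" .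
  have arith: "du = ku + pu \<Longrightarrow> di = ki + pj \<Longrightarrow> ku \<le> ki \<Longrightarrow> g3 \<le> pj \<Longrightarrow> c \<le> g3 + c3 \<Longrightarrow>
      b + c3 + x \<le> c \<Longrightarrow> pu \<le> x \<Longrightarrow> du + b \<le> di" for du ku pu di ki pj g3 c x :: nat
    by linarith
  show ?thesis by (rule arith[OF dimU dimI ker img3 dimG3 num piU_le])
qed

end


section \<open>Cramer's rule and reduction of monomials modulo a conic\<close>

definition det3 :: "complex \<Rightarrow> complex \<Rightarrow> complex \<Rightarrow> complex \<Rightarrow> complex \<Rightarrow> complex \<Rightarrow> complex \<Rightarrow> complex \<Rightarrow> complex \<Rightarrow> complex" where
  "det3 a b c a' b' c' a'' b'' c'' = a * (b' * c'' - c' * b'') - b * (a' * c'' - c' * a'') + c * (a' * b'' - b' * a'')"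

lemma cramer3:
  assumes nz: "det3 a b c a' b' c' a'' b'' c'' \<noteq> 0"
  obtains x y z where "a * x + b * y + c * z = r" "a' * x + b' * y + c' * z = r'" "a'' * x + b'' * y + c'' * z = r''"
    "x = det3 r b c r' b' c' r'' b'' c'' / det3 a b c a' b' c' a'' b'' c''"
proof
  let ?D = "det3 a b c a' b' c' a'' b'' c''"
  let ?x = "det3 r b c r' b' c' r'' b'' c''" and ?y = "det3 a r c a' r' c' a'' r'' c''" and ?z = "det3 a b r a' b' r' a'' b'' r''"
  have D: "u * (?x / ?D) + v * (?y / ?D) + s * (?z / ?D) = (u * ?x + v * ?y + s * ?z) / ?D" for u v s
    by (simp add: add_divide_distrib)
  have "a * ?x + b * ?y + c * ?z = r * ?D" "a' * ?x + b' * ?y + c' * ?z = r' * ?D" "a'' * ?x + b'' * ?y + c'' * ?z = r'' * ?D"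
    unfolding det3_def by algebra+
  then show "a * (?x / ?D) + b * (?y / ?D) + c * (?z / ?D) = r" "a' * (?x / ?D) + b' * (?y / ?D) + c' * (?z / ?D) = r'"
    "a'' * (?x / ?D) + b'' * (?y / ?D) + c'' * (?z / ?D) = r''"
    unfolding D using nz by simp_all
qed (rule refl)

text \<open>\<open>mon v\<close> times a fixed four-term polynomial, the equation of a conic in
  toric coordinates. Multiplication by a monomial only moves \<open>v\<close>, and every instance
  rewrites \<open>mon v\<close> by three shifted monomials.\<close>

definition shifted :: "(int \<times> int) \<times> (int \<times> int) \<times> (int \<times> int) \<Rightarrow> complex \<times> complex \<times> complex \<Rightarrow> int \<times> int \<Rightarrow> laurent" where
  "shifted = (\<lambda>(s, t, r) (c, d, e) v. mon v - cst c * mon (v + s) - cst d * mon (v + t) - cst e * mon (v + r))"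

lemma shifted_mult: "shifted q k v * mon x = shifted q k (v + x)"
  by (cases q; cases k) (simp add: shifted_def left_diff_distrib mult_single add_ac)

lemma shifted_reduce:
  "mon v = shifted (s, t, r) (c, d, e) v + lscale c (mon (v + s)) + lscale d (mon (v + t)) + lscale e (mon (v + r))"
  by (simp add: shifted_def lscale_def)

lemma coef_shifted: "coef (shifted (s, t, r) (c, d, e) v) x =
    (1 when v = x) - c * (1 when v + s = x) - d * (1 when v + t = x) - e * (1 when v + r = x)"
  by (simp add: shifted_def lookup_minus coef_cst_mult lookup_single)

context lattice_polygon
begin

lemma shifted_S: "v \<in> lat n \<Longrightarrow> v + s \<in> lat n \<Longrightarrow> v + t \<in> lat n \<Longrightarrow> v + r \<in> lat n \<Longrightarrow>
    shifted (s, t, r) (c, d, e) v \<in> S n"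
  by (simp add: shifted_def S_diff S_cst S_mon)

lemma shifted_p:
  assumes "v \<in> lat 1" "v + s \<in> lat 1" "v + t \<in> lat 1" "v + r \<in> lat 1"
  shows "(\<Sum>m\<in>lat 1. coef (shifted (s, t, r) (c, d, e) v) m * p m) =
    p v - c * p (v + s) - d * p (v + t) - e * p (v + r)"
proof -
  have d: "(\<Sum>m\<in>lat 1. y * (1 when x = m) * p m) = y * p x" if "x \<in> lat 1" for x y
  proof -
    have "(\<Sum>m\<in>lat 1. y * (1 when x = m) * p m) = (\<Sum>m\<in>lat 1. if x = m then y * p m else 0)"
      by (intro sum.cong) (auto simp: when_def)
    then show ?thesis using that finite_lat[of 1] by simp
  qed
  show ?thesis
    using d[OF assms(1), of 1] d[OF assms(2)] d[OF assms(3)] d[OF assms(4)]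
    by (simp add: coef_shifted left_diff_distrib sum_subtractf)
qed

end

lemma span_reduce:
  assumes "x \<in> lv.span T" "mon u = x + lscale c (mon u1) + lscale d (mon u2) + lscale e (mon u3)"
    "mon u1 \<in> lv.span T" "mon u2 \<in> lv.span T" "mon u3 \<in> lv.span T"
  shows "mon u \<in> lv.span T"
  unfolding assms(2) by (intro lv.span_add lv.span_scale assms)

subsection \<open>The pentagon\<close>

text \<open>In the homogeneous coordinates \<open>x, y, z\<close> of the plane blown up in \<open>(0:1:0)\<close> and \<open>(0:0:1)\<close>, the three elements of \<open>E\<close>
  below are the products of \<open>x, y, z\<close> with the conic \<open>yz - c x\<^sup>2 - d xy - e xz\<close> that is apolar to \<open>p\<close>.
  The linear subspace they cut out meets the surface in a rational quartic curve in \<open>P\<^sup>3\<close>.\<close>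

abbreviation "pentagon_shifts \<equiv> ((2,-1), (1,0), (1,-1)) :: (int \<times> int) \<times> (int \<times> int) \<times> (int \<times> int)"
abbreviation "pentagon_base \<equiv> [(0,0), (-1,1), (-1,0)] :: (int \<times> int) list"

text \<open>The determinant of the linear system for \<open>c, d, e\<close>; its rows express that
  the products of the conic with \<open>x\<close>, \<open>y\<close>, \<open>z\<close> are
  annihilated by \<open>p\<close>.\<close>

definition pentagon_det :: "(int \<times> int \<Rightarrow> complex) \<Rightarrow> complex" where
  "pentagon_det p = det3 (p (2,-1)) (p (1,0)) (p (1,-1)) (p (1,0)) (p (0,1)) (p (0,0)) (p (1,-1)) (p (0,0)) (p (0,-1))"

text \<open>The residual monomials, on the two edges that the shift \<open>(2,-1)\<close> crosses.
  Their number 13 = 3 * 4 + 1 is that of the sections cut out by cubics on a rational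
  quartic.\<close>

definition pentagon_C :: "(int \<times> int) list" where
  "pentagon_C = filter (\<lambda>u. mem pentagon_edges u 3 \<and> (snd u = -3 \<or> fst u + snd u = 3)) (box 6)"

definition pentagon_D :: "(int \<times> int) list" where
  "pentagon_D = remdups (concat (map (\<lambda>v. map (\<lambda>x. v + x) pentagon_pts) pentagon_base))"

lemma pentagon_checks:
  "length pentagon_C = 13" "length pentagon_D = 13"
  "list_all (\<lambda>u. \<not> mem pentagon_edges u 3 \<or> u \<in> set pentagon_C \<or>
     (list_ex (\<lambda>v. mem pentagon_edges (u - v) 2) pentagon_base \<and> mem pentagon_edges (u + (2,-1)) 3 \<and>
      mem pentagon_edges (u + (1,0)) 3 \<and> mem pentagon_edges (u + (1,-1)) 3)) (box 6)"
  "list_all (\<lambda>v. mem pentagon_edges v 1 \<and> mem pentagon_edges (v + (2,-1)) 1 \<and> mem pentagon_edges (v + (1,0)) 1 \<and>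
     mem pentagon_edges (v + (1,-1)) 1) pentagon_base"
  by code_simp+

text \<open>With the bounds 13 for \<open>N 1\<close> and 13 residual cubic monomials, at most 10 +
  13 - 22 = 1 quadric and at least 20 - 13 = 7 cubics vanish on the section. The 4 linear multiples
  of the quadric leave 7 - 4 = 3 cubics.\<close>

lemma pentagon_lower:
  fixes w :: "'k::finite \<Rightarrow> laurent"
  assumes tp: "toric_projection (lat_of pentagon_edges) p w a" and k: "CARD('k) = 7"
    and det: "pentagon_det p \<noteq> 0"
  shows "poly_vs.dim (var_multiples (toric_projection.I w \<inter> forms 2)) + 3 \<le> poly_vs.dim (toric_projection.I w \<inter> forms 3)"
proof -
  interpret polygon_data pentagon_edges pentagon_pts by (rule pentagon)
  interpret toric_projection "lat_of pentagon_edges" p w a by (rule tp)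
  let ?L = "lat_of pentagon_edges"
  obtain c d e where cde: "p (2,-1) * c + p (1,0) * d + p (1,-1) * e = p (0,0)"
      "p (1,0) * c + p (0,1) * d + p (0,0) * e = p (-1,1)" "p (1,-1) * c + p (0,0) * d + p (0,-1) * e = p (-1,0)"
    by (rule cramer3[OF det[unfolded pentagon_det_def]]) (rule that)
  define f where "f = shifted pentagon_shifts (c, d, e)"
  note base = pentagon_checks(4)[unfolded list_all_iff, rule_format]
  have fS: "f v \<in> S 1" if "v \<in> set pentagon_base" for v
    unfolding f_def using base[OF that] by (intro shifted_S) (simp_all add: lat_of_def)
  have fp: "(\<Sum>m\<in>?L 1. coef (f v) m * p m) = 0" if "v \<in> set pentagon_base" for v
  proof -
    have "(\<Sum>m\<in>?L 1. coef (f v) m * p m) = p v - c * p (v + (2,-1)) - d * p (v + (1,0)) - e * p (v + (1,-1))"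
      unfolding f_def using base[OF that] by (intro shifted_p) (simp_all add: lat_of_def)
    also have "\<dots> = 0" using that cde by (auto simp: algebra_simps)
    finally show ?thesis .
  qed
  have ind: "inj_on f (set pentagon_base) \<and> lv.independent (f ` set pentagon_base)"
  proof (rule lv.family_independent, simp)
    fix x assume z: "(\<Sum>i\<in>set pentagon_base. lscale (x i) (f i)) = 0"
    have "coef (\<Sum>i\<in>set pentagon_base. lscale (x i) (f i)) m = 0" for m using z by simp
    then have "x (0,0) * coef (f (0,0)) m + x (-1,1) * coef (f (-1,1)) m + x (-1,0) * coef (f (-1,0)) m = 0" for m
      by (simp add: lookup_add lscale_def coef_cst_mult add.assoc)
    \<comment> \<open>Read in this order, the coefficients form a triangular system: the first two
      monomials each occur in one element of \<open>E\<close> only.\<close>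
    from this[of "(-1,1)"] this[of "(-1,0)"] this[of "(0,0)"]
    show "\<forall>i\<in>set pentagon_base. x i = 0" by (simp add: f_def coef_shifted when_def)
  qed
  have in_span: "mon u \<in> lv.span ({x * mon y |x y. x \<in> f ` set pentagon_base \<and> y \<in> ?L 2} \<union> mon ` set pentagon_C)" (is "_ \<in> lv.span ?T")
    if "u \<in> ?L 3" for u
    using that
  \<comment> \<open>All three shifts increase the first coordinate, which is at most 6 in the
    tripled polygon.\<close>
  proof (induction "nat (6 - fst u)" arbitrary: u rule: less_induct)
    case less
    have u3: "mem pentagon_edges u 3" using less.prems by (simp add: lat_of_def)
    have box: "u \<in> set (box 6)" by (rule in_box[OF u3]) simp
    show ?case
    proof (cases "u \<in> set pentagon_C")
      case True then show ?thesis by (intro lv.span_base) auto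
    next
      case False
      then obtain v where v: "v \<in> set pentagon_base" "mem pentagon_edges (u - v) 2"
        and sh: "u + (2,-1) \<in> ?L 3" "u + (1,0) \<in> ?L 3" "u + (1,-1) \<in> ?L 3"
        using bspec[OF pentagon_checks(3)[unfolded list_all_iff list_ex_iff] box] u3 by (auto simp: lat_of_def)
      have "f u = f v * mon (u - v)" by (simp add: f_def shifted_mult)
      moreover have "u - v \<in> ?L 2" using v(2) by (simp add: lat_of_def)
      ultimately have "f u \<in> lv.span ?T" using v(1) by (intro lv.span_base) blast
      note red = span_reduce[OF this shifted_reduce[of u "(2,-1)" "(1,0)" "(1,-1)" c d e, folded f_def]]
      have "mem pentagon_edges (u + (1,0)) 3" using sh(2) by (simp add: lat_of_def)
      from bounded[OF this] have "fst u < 6" by simp linarith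
      then show ?thesis using red less.hyps[OF _ sh(1)] less.hyps[OF _ sh(2)] less.hyps[OF _ sh(3)] by simp
    qed
  qed
  have D: "f v * mon x \<in> lv.span (f ` set pentagon_D)" if "v \<in> set pentagon_base" "x \<in> ?L 1" for v x
    using that unfolding lat1 f_def shifted_mult by (intro lv.span_base imageI) (auto simp: pentagon_D_def)
  have cE: "card (f ` set pentagon_base) + CARD(4) = CARD('k)"
    using ind k by (simp add: card_image)
  show ?thesis
  proof (rule cubics_lower[where E = "f ` set pentagon_base" and D = "f ` set pentagon_D" and C = "mon ` set pentagon_C"
        and dN = 13 and ?c3.0 = 13, OF _ _ _ _ cE])
    show "card (f ` set pentagon_D) \<le> 13"
      using pentagon_checks(2) card_image_le[of "set pentagon_D" f] card_length[of pentagon_D] by simp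
    show "card (mon ` set pentagon_C) \<le> 13"
      using pentagon_checks(1) card_image_le[of "set pentagon_C" mon] card_length[of pentagon_C] by simp
    have "(5::nat) choose 2 = 10" "(6::nat) choose 3 = 20" by code_simp+
    then show "3 + 13 + CARD(4) * ((CARD(4) + 1 choose 2) + 13 - card (?L 2)) \<le> CARD(4) + 2 choose 3"
      by (simp add: pentagon_card)
  qed (use fS fp ind D in_span in auto)
qed

subsection \<open>The trapezoid\<close>

text \<open>In the homogeneous coordinates \<open>x, y, z\<close> of the plane blown up in \<open>(0:0:1)\<close>, the elements of \<open>E\<close> are the
  products of \<open>x, y, z\<close> with the two conics \<open>xz - Q(x, y)\<close> and \<open>yz - Q'(x, y)\<close> that are apolar to \<open>p\<close>. They cut out
  the line that meets the surface in the remaining three common points of the two conics, the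
  roots of the binary cubic \<open>xQ' - yQ\<close>.\<close>

abbreviation "trapezoid_shifts1 \<equiv> ((1,0), (0,1), (-1,2)) :: (int \<times> int) \<times> (int \<times> int) \<times> (int \<times> int)"
abbreviation "trapezoid_shifts2 \<equiv> ((2,-1), (1,0), (0,1)) :: (int \<times> int) \<times> (int \<times> int) \<times> (int \<times> int)"
abbreviation "trapezoid_base1 \<equiv> [(1,-1), (0,0), (0,-1)] :: (int \<times> int) list"
abbreviation "trapezoid_base2 \<equiv> [(0,0), (-1,1), (-1,0)] :: (int \<times> int) list"

text \<open>The conditions on \<open>Q\<close> and on \<open>Q'\<close> have the same matrix, since
  both are combinations of \<open>x^2\<close>, \<open>xy\<close>, \<open>y^2\<close> multiplied by
  \<open>x\<close>, \<open>y\<close>, \<open>z\<close>; only the right-hand sides differ.\<close>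

definition trapezoid_det :: "(int \<times> int \<Rightarrow> complex) \<Rightarrow> complex" where
  "trapezoid_det p = det3 (p (2,-1)) (p (1,0)) (p (0,1)) (p (1,0)) (p (0,1)) (p (-1,2)) (p (1,-1)) (p (0,0)) (p (-1,1))"

text \<open>Up to the factor \<open>trapezoid_det p\<close>, the coefficient of \<open>x\<^sup>3\<close> in the binary cubic.\<close>

definition trapezoid_lead :: "(int \<times> int \<Rightarrow> complex) \<Rightarrow> complex" where
  "trapezoid_lead p = det3 (p (0,0)) (p (1,0)) (p (0,1)) (p (-1,1)) (p (0,1)) (p (-1,2)) (p (-1,0)) (p (0,0)) (p (-1,1))"

definition trapezoid_D1 :: "(int \<times> int) list" where
  "trapezoid_D1 = remdups (concat (map (\<lambda>v. map (\<lambda>x. v + x) trapezoid_pts) trapezoid_base1))"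
definition trapezoid_L2 :: "(int \<times> int) list" where
  "trapezoid_L2 = remdups (concat (map (\<lambda>v. map (\<lambda>x. v + x) trapezoid_pts) trapezoid_base2))"
text \<open>The multiples of the second conic that remain after using the Koszul syzygy of the two
  conics. The total 14 + 8 = 22 is 25 minus the three points of the section.\<close>

definition trapezoid_D2 :: "(int \<times> int) list" where
  "trapezoid_D2 = filter (\<lambda>v. fst v = -2 \<or> fst v + snd v = 1) trapezoid_L2"

lemma trapezoid_checks:
  "length trapezoid_D1 = 14" "length trapezoid_D2 = 8"
  "list_all (\<lambda>v. fst v + snd v \<le> 1 \<and> (v \<in> set trapezoid_D2 \<or> (v + (1,0) \<in> set trapezoid_L2 \<and> v + (0,1) \<in> set trapezoid_L2 \<and>
     v + (-1,2) \<in> set trapezoid_L2 \<and> v \<in> set trapezoid_D1 \<and> v + (2,-1) \<in> set trapezoid_D1 \<and>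
     v + (1,0) \<in> set trapezoid_D1 \<and> v + (0,1) \<in> set trapezoid_D1))) trapezoid_L2"
  "list_all (\<lambda>u. \<not> mem trapezoid_edges u 3 \<or> fst u + snd u \<ge> 3 \<or>
     (list_ex (\<lambda>v. mem trapezoid_edges (u - v) 2) trapezoid_base1 \<and> mem trapezoid_edges (u + (1,0)) 3 \<and>
      mem trapezoid_edges (u + (0,1)) 3 \<and> mem trapezoid_edges (u + (-1,2)) 3) \<or>
     (list_ex (\<lambda>v. mem trapezoid_edges (u - v) 2) trapezoid_base2 \<and> mem trapezoid_edges (u + (2,-1)) 3 \<and>
      mem trapezoid_edges (u + (1,0)) 3 \<and> mem trapezoid_edges (u + (0,1)) 3)) (box 6)"
  "list_all (\<lambda>u. \<not> mem trapezoid_edges u 3 \<or> fst u + snd u \<noteq> 3 \<or> u \<in> set [(-3,6),(-2,5),(-1,4)] \<or>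
     (mem trapezoid_edges (u - (2,-1)) 2 \<and> mem trapezoid_edges (u - (2,-1) + (1,0)) 3 \<and>
      mem trapezoid_edges (u - (2,-1) + (0,1)) 3 \<and> mem trapezoid_edges (u - (2,-1) + (-1,2)) 3)) (box 6)"
  "list_all (\<lambda>v. mem trapezoid_edges v 1 \<and> mem trapezoid_edges (v + (1,0)) 1 \<and> mem trapezoid_edges (v + (0,1)) 1 \<and>
     mem trapezoid_edges (v + (-1,2)) 1) trapezoid_base1"
  "list_all (\<lambda>v. mem trapezoid_edges v 1 \<and> mem trapezoid_edges (v + (2,-1)) 1 \<and> mem trapezoid_edges (v + (1,0)) 1 \<and>
     mem trapezoid_edges (v + (0,1)) 1) trapezoid_base2"
  by code_simp+

text \<open>The linear section is a trisecant line. The bounds give 3 + 22 - 25 = 0 quadrics and at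
  least 4 - 3 = 1 cubic on the line through its three points; quadrics of the ideal thus restrict to
  zero, and the cubic cannot come from them.\<close>

lemma trapezoid_lower:
  fixes w :: "'k::finite \<Rightarrow> laurent"
  assumes tp: "toric_projection (lat_of trapezoid_edges) p w a" and k: "CARD('k) = 8"
    and det: "trapezoid_det p \<noteq> 0" and lead: "trapezoid_lead p \<noteq> 0"
  shows "poly_vs.dim (var_multiples (toric_projection.I w \<inter> forms 2)) + 1 \<le> poly_vs.dim (toric_projection.I w \<inter> forms 3)"
proof -
  interpret polygon_data trapezoid_edges trapezoid_pts by (rule trapezoid)
  interpret toric_projection "lat_of trapezoid_edges" p w a by (rule tp)
  let ?L = "lat_of trapezoid_edges"
  obtain c0 c1 c2 where c: "p (2,-1) * c0 + p (1,0) * c1 + p (0,1) * c2 = p (1,-1)"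
      "p (1,0) * c0 + p (0,1) * c1 + p (-1,2) * c2 = p (0,0)" "p (1,-1) * c0 + p (0,0) * c1 + p (-1,1) * c2 = p (0,-1)"
    by (rule cramer3[OF det[unfolded trapezoid_det_def]]) (rule that)
  obtain d0 d1 d2 where d: "p (2,-1) * d0 + p (1,0) * d1 + p (0,1) * d2 = p (0,0)"
      "p (1,0) * d0 + p (0,1) * d1 + p (-1,2) * d2 = p (-1,1)" "p (1,-1) * d0 + p (0,0) * d1 + p (-1,1) * d2 = p (-1,0)"
      "d0 = trapezoid_lead p / trapezoid_det p"
    by (rule cramer3[OF det[unfolded trapezoid_det_def], where r = "p (0,0)" and r' = "p (-1,1)" and r'' = "p (-1,0)",
          folded trapezoid_det_def trapezoid_lead_def]) (rule that)
  have d0: "d0 \<noteq> 0" using d(4) det lead by simp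
  define f where "f = shifted trapezoid_shifts1 (c0, c1, c2)"
  define g where "g = shifted trapezoid_shifts2 (d0, d1, d2)"
  note base1 = trapezoid_checks(6)[unfolded list_all_iff, rule_format]
  note base2 = trapezoid_checks(7)[unfolded list_all_iff, rule_format]
  \<comment> \<open>The tag keeps the two conics apart, since both base lists contain
    \<open>(0,0)\<close>.\<close>
  define h where "h = (\<lambda>(b, v). if b then f v else g v)"
  define J where "J = Pair True ` set trapezoid_base1 \<union> Pair False ` set trapezoid_base2"
  have fE: "f v \<in> h ` J" if "v \<in> set trapezoid_base1" for v
    using that unfolding J_def by (intro image_eqI[of _ _ "(True, v)"]) (auto simp: h_def)
  have gE: "g v \<in> h ` J" if "v \<in> set trapezoid_base2" for v
    using that unfolding J_def by (intro image_eqI[of _ _ "(False, v)"]) (auto simp: h_def)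
  have hJ: "\<exists>v. (v \<in> set trapezoid_base1 \<and> x = f v) \<or> (v \<in> set trapezoid_base2 \<and> x = g v)" if "x \<in> h ` J" for x
    using that by (auto simp: J_def h_def)
  have fS: "f v \<in> S 1" if "v \<in> set trapezoid_base1" for v
    unfolding f_def using base1[OF that] by (intro shifted_S) (simp_all add: lat_of_def)
  have gS: "g v \<in> S 1" if "v \<in> set trapezoid_base2" for v
    unfolding g_def using base2[OF that] by (intro shifted_S) (simp_all add: lat_of_def)
  have fp: "(\<Sum>m\<in>?L 1. coef (f v) m * p m) = 0" if "v \<in> set trapezoid_base1" for v
  proof -
    have "(\<Sum>m\<in>?L 1. coef (f v) m * p m) = p v - c0 * p (v + (1,0)) - c1 * p (v + (0,1)) - c2 * p (v + (-1,2))"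
      unfolding f_def using base1[OF that] by (intro shifted_p) (simp_all add: lat_of_def)
    also have "\<dots> = 0" using that c by (auto simp: algebra_simps)
    finally show ?thesis .
  qed
  have gp: "(\<Sum>m\<in>?L 1. coef (g v) m * p m) = 0" if "v \<in> set trapezoid_base2" for v
  proof -
    have "(\<Sum>m\<in>?L 1. coef (g v) m * p m) = p v - d0 * p (v + (2,-1)) - d1 * p (v + (1,0)) - d2 * p (v + (0,1))"
      unfolding g_def using base2[OF that] by (intro shifted_p) (simp_all add: lat_of_def)
    also have "\<dots> = 0" using that d(1-3) by (auto simp: algebra_simps)
    finally show ?thesis .
  qed
  have ind: "inj_on h J \<and> lv.independent (h ` J)"
  proof (rule lv.family_independent, simp add: J_def)
    fix x assume z: "(\<Sum>i\<in>J. lscale (x i) (h i)) = 0"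
    have "coef (\<Sum>i\<in>J. lscale (x i) (h i)) m = 0" for m using z by simp
    then have e: "x (True,(1,-1)) * coef (f (1,-1)) m + x (True,(0,0)) * coef (f (0,0)) m + x (True,(0,-1)) * coef (f (0,-1)) m +
       x (False,(0,0)) * coef (g (0,0)) m + x (False,(-1,1)) * coef (g (-1,1)) m + x (False,(-1,0)) * coef (g (-1,0)) m = 0" for m
      by (simp add: J_def h_def lookup_add lscale_def coef_cst_mult add_ac)
    note cs = f_def g_def coef_shifted when_def
    have 1: "x (True,(0,-1)) = 0" using e[of "(0,-1)"] by (simp add: cs)
    have 2: "x (False,(-1,0)) = 0" using e[of "(-1,0)"] by (simp add: cs)
    have 3: "x (True,(1,-1)) = 0" using e[of "(1,-1)"] 1 2 by (simp add: cs)
    have 4: "x (False,(-1,1)) = 0" using e[of "(-1,1)"] 1 2 by (simp add: cs)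
    \<comment> \<open>The two elements with base \<open>(0,0)\<close> share that monomial; the
      coefficient of \<open>(2,-1)\<close>, where \<open>d0\<close> enters, separates them.\<close>
    have 5: "x (False,(0,0)) = 0" using e[of "(2,-1)"] 1 2 3 4 d0 by (simp add: cs)
    have 6: "x (True,(0,0)) = 0" using e[of "(0,0)"] 1 2 3 4 5 by (simp add: cs)
    show "\<forall>i\<in>J. x i = 0" using 1 2 3 4 5 6 by (auto simp: J_def)
  qed
  let ?T = "{x * mon y |x y. x \<in> h ` J \<and> y \<in> ?L 2} \<union> mon ` set [(-3,6),(-2,5),(-1,4)]"
  have fT: "f u \<in> lv.span ?T" if "v \<in> set trapezoid_base1" "mem trapezoid_edges (u - v) 2" for u v
  proof -
    have "f u = f v * mon (u - v)" by (simp add: f_def shifted_mult)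
    moreover have "u - v \<in> ?L 2" using that by (simp add: lat_of_def)
    ultimately show ?thesis using fE[OF that(1)] by (intro lv.span_base) blast
  qed
  have gT: "g u \<in> lv.span ?T" if "v \<in> set trapezoid_base2" "mem trapezoid_edges (u - v) 2" for u v
  proof -
    have "g u = g v * mon (u - v)" by (simp add: g_def shifted_mult)
    moreover have "u - v \<in> ?L 2" using that by (simp add: lat_of_def)
    ultimately show ?thesis using gE[OF that(1)] by (intro lv.span_base) blast
  qed
  note f_red = shifted_reduce[of _ "(1,0)" "(0,1)" "(-1,2)" c0 c1 c2, folded f_def]
  note g_red = shifted_reduce[of _ "(2,-1)" "(1,0)" "(0,1)" d0 d1 d2, folded g_def]
  have edge: "mon u \<in> lv.span ?T" if "mem trapezoid_edges u 3" "fst u + snd u = 3" for u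
    using that
  proof (induction "nat (fst u + 6)" arbitrary: u rule: less_induct)
    case less
    have box: "u \<in> set (box 6)" by (rule in_box[OF less.prems(1)]) simp
    show ?case
    proof (cases "u \<in> set [(-3,6),(-2,5),(-1,4)]")
      case True then show ?thesis by (intro lv.span_base) blast
    next
      case False
      \<comment> \<open>Reducing \<open>mon y\<close> by both conics and comparing gives a multiple
        of the binary cubic. Its leading term \<open>d0 * mon u\<close> is thereby expressed by
        monomials with smaller first coordinate on the same edge; a cubic leaves three monomials
        unreduced.\<close>
      define y where "y = u - (2,-1)"
      have y: "mem trapezoid_edges y 2" "mem trapezoid_edges (y + (1,0)) 3" "mem trapezoid_edges (y + (0,1)) 3"
          "mem trapezoid_edges (y + (-1,2)) 3"
        using bspec[OF trapezoid_checks(5)[unfolded list_all_iff] box] less.prems False unfolding y_def by blast+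
      have uy: "u = y + (2,-1)" by (simp add: y_def)
      have fu: "- 6 \<le> fst y - 1" using bounded[OF y(4)] by simp linarith
      have IH: "mon (y + (1,0)) \<in> lv.span ?T" "mon (y + (0,1)) \<in> lv.span ?T" "mon (y + (-1,2)) \<in> lv.span ?T"
        using less.hyps[OF _ y(2)] less.hyps[OF _ y(3)] less.hyps[OF _ y(4)] less.prems(2) fu unfolding uy by simp_all
      have yT: "f y \<in> lv.span ?T" "g y \<in> lv.span ?T"
        using fT[of "(0,0)" y] gT[of "(0,0)" y] y(1) by (simp_all add: zero_prod_def[symmetric])
      have "f y + lscale c0 (mon (y + (1,0))) + lscale c1 (mon (y + (0,1))) + lscale c2 (mon (y + (-1,2))) =
          g y + lscale d0 (mon (y + (2,-1))) + lscale d1 (mon (y + (1,0))) + lscale d2 (mon (y + (0,1)))"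
        unfolding f_red[symmetric] g_red[symmetric] by (rule refl)
      then have "lscale d0 (mon u) = f y + lscale c0 (mon (y + (1,0))) + lscale c1 (mon (y + (0,1))) + lscale c2 (mon (y + (-1,2))) -
          g y - lscale d1 (mon (y + (1,0))) - lscale d2 (mon (y + (0,1)))"
        unfolding uy by (simp add: algebra_simps)
      also have "\<dots> \<in> lv.span ?T" by (intro lv.span_add lv.span_diff lv.span_scale yT IH)
      finally have "lscale (1 / d0) (lscale d0 (mon u)) \<in> lv.span ?T" by (rule lv.span_scale)
      then show ?thesis using d0 by simp
    qed
  qed
  have in_span: "mon u \<in> lv.span ?T" if "mem trapezoid_edges u 3" for u
    using that
  \<comment> \<open>Each shift trades a factor \<open>z\<close> for a factor \<open>x\<close> or
    \<open>y\<close>, until the edge of monomials without \<open>z\<close> is reached.\<close>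
  proof (induction "nat (3 - (fst u + snd u))" arbitrary: u rule: less_induct)
    case less
    have box: "u \<in> set (box 6)" by (rule in_box[OF less.prems(1)]) simp
    have le: "fst u + snd u \<le> 3" using less.prems by (simp add: polygon_defs)
    note chk = bspec[OF trapezoid_checks(4)[unfolded list_all_iff list_ex_iff] box]
    show ?case
    proof (cases "fst u + snd u = 3")
      case True then show ?thesis using edge less.prems by blast
    next
      case False
      then have lt: "fst u + snd u < 3" using le by simp
      consider v where "v \<in> set trapezoid_base1" "mem trapezoid_edges (u - v) 2" "mem trapezoid_edges (u + (1,0)) 3"
          "mem trapezoid_edges (u + (0,1)) 3" "mem trapezoid_edges (u + (-1,2)) 3"
        | v where "v \<in> set trapezoid_base2" "mem trapezoid_edges (u - v) 2" "mem trapezoid_edges (u + (2,-1)) 3"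
          "mem trapezoid_edges (u + (1,0)) 3" "mem trapezoid_edges (u + (0,1)) 3"
        using chk less.prems lt by (meson not_le)
      then show ?thesis
      proof cases
        case (1 v)
        show ?thesis
          using span_reduce[OF fT[OF 1(1,2)] f_red] less.hyps[OF _ 1(3)] less.hyps[OF _ 1(4)] less.hyps[OF _ 1(5)] lt by simp
      next
        case (2 v)
        show ?thesis
          using span_reduce[OF gT[OF 2(1,2)] g_red] less.hyps[OF _ 2(3)] less.hyps[OF _ 2(4)] less.hyps[OF _ 2(5)] lt by simp
      qed
    qed
  qed
  let ?D = "f ` set trapezoid_D1 \<union> g ` set trapezoid_D2"
  have fD: "f v \<in> lv.span ?D" if "v \<in> set trapezoid_D1" for v using that by (intro lv.span_base) auto
  \<comment> \<open>The Koszul syzygy of the two conics: applying the first four-term polynomial to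
    \<open>g v\<close> and the second to \<open>f v\<close> gives the same product.\<close>
  have syzygy: "g v = lscale c0 (g (v + (1,0))) + lscale c1 (g (v + (0,1))) + lscale c2 (g (v + (-1,2))) +
      f v - lscale d0 (f (v + (2,-1))) - lscale d1 (f (v + (1,0))) - lscale d2 (f (v + (0,1)))" for v
    by (simp add: f_def g_def shifted_def lscale_def right_diff_distrib mult_single add.assoc) (simp add: algebra_simps)
  have gD: "g v \<in> lv.span ?D" if "v \<in> set trapezoid_L2" for v
    using that
  proof (induction "nat (1 - (fst v + snd v))" arbitrary: v rule: less_induct)
    case less
    note chk = bspec[OF trapezoid_checks(3)[unfolded list_all_iff] less.prems]
    show ?case
    proof (cases "v \<in> set trapezoid_D2")
      case True then show ?thesis by (intro lv.span_base) auto
    next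
      case False
      then have v: "v + (1,0) \<in> set trapezoid_L2" "v + (0,1) \<in> set trapezoid_L2" "v + (-1,2) \<in> set trapezoid_L2"
        "v \<in> set trapezoid_D1" "v + (2,-1) \<in> set trapezoid_D1" "v + (1,0) \<in> set trapezoid_D1" "v + (0,1) \<in> set trapezoid_D1"
        using chk by blast+
      have "fst v + snd v + 1 \<le> 1" using bspec[OF trapezoid_checks(3)[unfolded list_all_iff] v(1)] by simp
      then have IH: "g (v + (1,0)) \<in> lv.span ?D" "g (v + (0,1)) \<in> lv.span ?D" "g (v + (-1,2)) \<in> lv.span ?D"
        using less.hyps[OF _ v(1)] less.hyps[OF _ v(2)] less.hyps[OF _ v(3)] by simp_all
      show ?thesis
        by (subst syzygy) (intro lv.span_add lv.span_diff lv.span_scale IH fD v)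
    qed
  qed
  have D: "x * mon y \<in> lv.span ?D" if "x \<in> h ` J" "y \<in> ?L 1" for x y
  proof -
    from hJ[OF that(1)] consider v where "v \<in> set trapezoid_base1" "x = f v" | v where "v \<in> set trapezoid_base2" "x = g v" by blast
    then show ?thesis
    proof cases
      case (1 v)
      then have "v + y \<in> set trapezoid_D1" using that(2) unfolding lat1 trapezoid_D1_def by auto
      then show ?thesis using fD unfolding 1(2) f_def shifted_mult by blast
    next
      case (2 v)
      then have "v + y \<in> set trapezoid_L2" using that(2) unfolding lat1 trapezoid_L2_def by auto
      then show ?thesis using gD unfolding 2(2) g_def shifted_mult by blast
    qed
  qed
  have "card J = 6" by (simp add: J_def)
  then have cE: "card (h ` J) + CARD(2) = CARD('k)"
    using ind k by (simp add: card_image)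
  show ?thesis
  proof (rule cubics_lower[where E = "h ` J" and D = ?D and C = "mon ` set [(-3,6),(-2,5),(-1,4)]"
        and dN = 22 and ?c3.0 = 3, OF _ _ _ _ cE])
    show "card ?D \<le> 22"
      using card_Un_le[of "f ` set trapezoid_D1" "g ` set trapezoid_D2"] trapezoid_checks(1,2) card_image_le[of "set trapezoid_D1" f]
        card_image_le[of "set trapezoid_D2" g] card_length[of trapezoid_D1] card_length[of trapezoid_D2] by simp
    show "card (mon ` set [(-3,6),(-2,5),(-1,4)]) \<le> 3"
      by (rule order_trans[OF card_image_le]) simp_all
    have "(3::nat) choose 2 = 3" "(4::nat) choose 3 = 4" by code_simp+
    then show "1 + 3 + CARD(2) * ((CARD(2) + 1 choose 2) + 22 - card (?L 2)) \<le> CARD(2) + 2 choose 3"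
      by (simp add: trapezoid_card)
    show "mon x \<in> lv.span ?T" if "x \<in> ?L 3" for x using in_span[of x] that by (simp add: lat_of_def)
    show "h ` J \<subseteq> S 1"
    proof
      fix x assume "x \<in> h ` J"
      from hJ[OF this] show "x \<in> S 1" by (elim exE disjE conjE) (simp_all only: fS gS)
    qed
    show "(\<Sum>m\<in>?L 1. coef e m * p m) = 0" if "e \<in> h ` J" for e
      using hJ[OF that] by (elim exE disjE conjE) (simp_all only: fp gp)
    show "finite (h ` J)" by (simp add: J_def)
    show "lv.independent (h ` J)" using ind by blast
  qed (use D in auto)
qed


section \<open>Evaluation of Laurent polynomials on the torus\<close>

definition torus_char :: "complex \<times> complex \<Rightarrow> int \<times> int \<Rightarrow> complex" where
  "torus_char s u = fst s powi fst u * snd s powi snd u"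

definition torus :: "(complex \<times> complex) set" where "torus = {s. fst s \<noteq> 0 \<and> snd s \<noteq> 0}"

definition lev :: "complex \<times> complex \<Rightarrow> laurent \<Rightarrow> complex" where
  "lev s r = (\<Sum>u\<in>supp r. coef r u * torus_char s u)"

lemma torus_char_add: "s \<in> torus \<Longrightarrow> torus_char s (u + v) = torus_char s u * torus_char s v"
  by (simp add: torus_def torus_char_def power_int_add mult_ac)

lemma lev_superset: "finite A \<Longrightarrow> supp r \<subseteq> A \<Longrightarrow> lev s r = (\<Sum>u\<in>A. coef r u * torus_char s u)"
  unfolding lev_def by (intro sum.mono_neutral_left) (auto simp: in_keys_iff)

lemma lev_add: "lev s (q + r) = lev s q + lev s r"
  using lev_superset[of "supp q \<union> supp r" q s] lev_superset[of "supp q \<union> supp r" r s]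
    lev_superset[OF _ keys_add, of q r s]
  by (simp add: lookup_add distrib_right sum.distrib)

lemma lev_zero: "lev s 0 = 0" by (simp add: lev_def)

lemma lev_sum: "lev s (\<Sum>a\<in>A. f a) = (\<Sum>a\<in>A. lev s (f a))"
  by (induction A rule: infinite_finite_induct) (simp_all add: lev_zero lev_add)

lemma lev_single: "lev s (sgl u c) = c * torus_char s u"
  by (simp add: lev_def)

lemma lev_mult: assumes "s \<in> torus" shows "lev s (q * r) = lev s q * lev s r"
proof -
  have "q * r = (\<Sum>u\<in>supp q. \<Sum>v\<in>supp r. sgl u (coef q u) * sgl v (coef r v))"
    by (subst (1) sum_single[of q], subst (1) sum_single[of r]) (simp add: sum_product)
  then have "lev s (q * r) = (\<Sum>u\<in>supp q. \<Sum>v\<in>supp r. coef q u * coef r v * torus_char s (u + v))"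
    by (simp add: lev_sum mult_single lev_single)
  then show ?thesis by (simp add: lev_def sum_product torus_char_add[OF assms] mult_ac)
qed

lemma lev_power: "s \<in> torus \<Longrightarrow> lev s (r ^ k) = lev s r ^ k"
  by (induction k) (simp_all add: lev_mult lev_single[of s 0 1, simplified] torus_char_def)

lemma lev_prod: "s \<in> torus \<Longrightarrow> lev s (\<Prod>a\<in>A. f a) = (\<Prod>a\<in>A. lev s (f a))"
  by (induction A rule: infinite_finite_induct)
     (simp_all add: lev_mult lev_single[of s 0 1, simplified] torus_char_def)

lemma lev_lsub: "s \<in> torus \<Longrightarrow> lev s (lsub w F) = eval_poly F (\<chi> j. lev s (w j))"
  by (simp add: psubst_def eval_poly_def lev_sum lev_mult lev_prod lev_power lev_single torus_char_def)

lemma two_powi_inject: "(2::complex) powi a = 2 powi b \<Longrightarrow> a = b"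
proof -
  assume "(2::complex) powi a = 2 powi b"
  then have "norm ((2::complex) powi a) = norm ((2::complex) powi b)" by simp
  then have "(2::real) powi a = 2 powi b" by (simp add: norm_power_int)
  then have "(2::real) powr a = 2 powr b" by (simp add: powr_real_of_int')
  then show "a = b" using powr_inj[of 2 "real_of_int a" "real_of_int b"] by simp
qed

text \<open>Laurent monomials are distinct characters of the torus, already separated by the points
  \<open>(2, 1)\<close> and \<open>(1, 2)\<close>.\<close>

lemma lev_eq_zero:
  assumes "\<And>s. s \<in> torus \<Longrightarrow> lev s r = 0" shows "r = 0"
proof (rule poly_mapping_eqI)
  fix u
  have dist: "\<exists>a\<in>torus. torus_char a s \<noteq> torus_char a t" if "s \<noteq> t" for s t
  proof (cases "fst s = fst t")
    case False
    then show ?thesis using two_powi_inject by (intro bexI[of _ "(2, 1)"]) (auto simp: torus_def torus_char_def)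
  next
    case True
    then have "snd s \<noteq> snd t" using that by (simp add: prod_eq_iff)
    then show ?thesis using two_powi_inject by (intro bexI[of _ "(1, 2)"]) (auto simp: torus_def torus_char_def)
  qed
  have "coef r u = 0" if "u \<in> supp r"
  proof (rule characters_independent[where S = "supp r" and G = torus and c = "coef r" and chi = "\<lambda>u s. torus_char s u"
        and mul = "\<lambda>x y. (fst x * fst y, snd x * snd y)" and e = "(1, 1)"])
    show "\<exists>a\<in>torus. torus_char a s \<noteq> torus_char a t" if "s \<noteq> t" for s t by (rule dist[OF that])
    show "(\<Sum>s\<in>supp r. coef r s * torus_char a s) = 0" if "a \<in> torus" for a
      using assms[OF that] by (simp add: lev_def)
    show "u \<in> supp r" by (rule that)
  qed (simp_all add: torus_def torus_char_def power_int_mult_distrib)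
  then show "coef r u = coef 0 u" by (auto simp: in_keys_iff)
qed

section \<open>Toric models\<close>

text \<open>The surface \<open>X\<close> has the same equations as the closure of the image of the torus under the monomials in
  \<open>A\<close>, with respect to the basis \<open>al\<close> of the ambient space; \<open>ga\<close> is the dual basis.\<close>

definition toric_model :: "(int \<times> int) set \<Rightarrow> (complex^'n::finite) set \<Rightarrow> (int \<times> int \<Rightarrow> complex^'n) \<Rightarrow> (int \<times> int \<Rightarrow> complex^'n) \<Rightarrow> bool" where
  "toric_model A X al ga \<longleftrightarrow>
    (\<forall>v. v = (\<Sum>m\<in>A. (\<Sum>j\<in>UNIV. ga m $ j * v $ j) *s al m)) \<and>
    (\<forall>m\<in>A. \<forall>m'\<in>A. (\<Sum>j\<in>UNIV. ga m $ j * al m' $ j) = (if m = m' then 1 else 0)) \<and>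
    (\<forall>m. m \<notin> A \<longrightarrow> ga m = 0) \<and>
    (\<forall>k. \<forall>F\<in>forms k. (\<forall>x\<in>X. eval_poly F x = 0) \<longleftrightarrow>
      (\<forall>s\<in>torus. eval_poly F (\<Sum>m\<in>A. torus_char s m *s al m) = 0))"

lemma eval_sum: "eval_poly (\<Sum>a\<in>A. f a) x = (\<Sum>a\<in>A. eval_poly (f a) x)"
  by (simp add: eval_poly_psubst id_hom.psubst_sum)
lemma eval_scale: "eval_poly (const_scale c F) x = c * eval_poly F x"
  by (simp add: eval_poly_psubst id_hom.psubst_scale)
lemma eval_var: "eval_poly (var i) x = x $ i"
  by (simp add: eval_poly_psubst id_hom.psubst_var)

lemma eval_form1:
  assumes "F \<in> forms 1" obtains c where "\<And>x. eval_poly F x = (\<Sum>i\<in>UNIV. c i * x $ i)"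
proof -
  from assms have "F \<in> forms (Suc 0)" by (simp add: One_nat_def)
  then obtain G where G: "\<And>i. G i \<in> forms 0" "F = (\<Sum>i\<in>UNIV. var i * G i)"
    by (rule forms_Suc_decomp) blast
  have "eval_poly (G i) x = coef (G i) 0" for i x
    using arg_cong[OF form0[OF G(1)], of "\<lambda>F. eval_poly F x" i]
    by (simp only: eval_poly_psubst id_hom.psubst_const)
  then have "eval_poly F x = (\<Sum>i\<in>UNIV. coef (G i) 0 * x $ i)" for x
    by (simp add: G(2) eval_poly_psubst id_hom.psubst_sum id_hom.psubst_mult id_hom.psubst_var mult.commute)
  then show ?thesis by (rule that)
qed

lemma eval_form1_sum:
  assumes "F \<in> forms 1" shows "eval_poly F (\<Sum>a\<in>A. c a *s x a) = (\<Sum>a\<in>A. c a * eval_poly F (x a))"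
proof -
  obtain d where d: "\<And>x. eval_poly F x = (\<Sum>i\<in>UNIV. d i * x $ i)" using eval_form1[OF assms] by blast
  have "eval_poly F (\<Sum>a\<in>A. c a *s x a) = (\<Sum>i\<in>UNIV. \<Sum>a\<in>A. d i * (c a * x a $ i))"
    by (simp add: d sum_distrib_left)
  also have "\<dots> = (\<Sum>a\<in>A. \<Sum>i\<in>UNIV. d i * (c a * x a $ i))" by (rule sum.swap)
  finally show ?thesis by (simp add: d sum_distrib_left mult_ac)
qed

lemma sums_to_zero_all:
  fixes h :: "nat \<Rightarrow> complex"
  assumes "\<And>c. c \<noteq> 0 \<Longrightarrow> (\<Sum>n\<le>N. c ^ n * h n) = 0" and "n \<le> N"
  shows "h n = 0"
proof -
  define Q where "Q = (\<Sum>n\<le>N. monom (h n) n)"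
  have Qe: "poly Q t = (\<Sum>n\<le>N. t ^ n * h n)" for t
    by (simp add: Q_def poly_sum poly_monom mult.commute)
  have "Q = 0"
  proof (rule ccontr)
    assume "Q \<noteq> 0"
    then have "finite {t. poly Q t = 0}" by (rule poly_roots_finite)
    moreover have "UNIV - {0} \<subseteq> {t. poly Q t = 0}" using assms(1) Qe by auto
    ultimately have "finite (UNIV - {0 :: complex})" by (rule finite_subset[rotated])
    then show False using infinite_UNIV_char_0[where 'a = complex] by simp
  qed
  moreover have "Polynomial.coeff Q n = h n" unfolding Q_def coeff_sum using assms(2) by simp
  ultimately show ?thesis by simp
qed

text \<open>The point \<open>q\<close> is the centre of projection in toric coordinates, normalised at the centre of the polygon.\<close>

lemma toric_model_projection:
  fixes X :: "(complex^'n::finite) set" and l :: "'k::finite \<Rightarrow> 'n mpoly"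
  assumes lp: "lattice_polygon lat" and tm: "toric_model (lat 1) X al ga"
    and l: "is_basis l {F \<in> forms 1. eval_poly F p = 0}"
    and P: "P = (\<lambda>m. \<Sum>j\<in>UNIV. ga m $ j * p $ j)" and P0: "P 0 \<noteq> 0" and q: "q = (\<lambda>m. (1 / P 0) * P m)"
    and quad: "quad_gen lat q"
  obtains w a where "toric_projection lat q (w :: 'k \<Rightarrow> laurent) a"
    "vanishing_ideal (proj_image l X) = toric_projection.I w"
proof -
  interpret lattice_polygon lat by (rule lp)
  let ?A = "lat 1"
  have expand: "v = (\<Sum>m\<in>?A. (\<Sum>j\<in>UNIV. ga m $ j * v $ j) *s al m)" for v
    using tm unfolding toric_model_def by blast
  have dual: "(\<Sum>j\<in>UNIV. ga m $ j * al m' $ j) = (if m = m' then 1 else 0)" if "m \<in> ?A" "m' \<in> ?A" for m m'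
    using tm that unfolding toric_model_def by blast
  have vanish: "(\<forall>x\<in>X. eval_poly F x = 0) \<longleftrightarrow> (\<forall>s\<in>torus. eval_poly F (\<Sum>m\<in>?A. torus_char s m *s al m) = 0)"
    if "F \<in> forms k" for F k
    using tm that unfolding toric_model_def by blast
  have inj: "inj l" and ind: "poly_vs.independent (range l)"
    and span: "poly_vs.span (range l) = {F \<in> forms 1. eval_poly F p = 0}"
    using l by (auto simp: is_basis_def)
  have lf: "l j \<in> forms 1" and lp0: "eval_poly (l j) p = 0" for j
    using poly_vs.span_base[of "l j" "range l"] unfolding span by auto
  define w where "w j = (\<Sum>m\<in>?A. cst (eval_poly (l j) (al m)) * mon m)" for j
  have cw: "coef (w j) m = (if m \<in> ?A then eval_poly (l j) (al m) else 0)" for j m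
  proof -
    have "coef (w j) m = (\<Sum>m'\<in>?A. if m' = m then eval_poly (l j) (al m') else 0)"
      unfolding w_def lookup_sum coef_cst_mult by (intro sum.cong) (auto simp: lookup_single when_def)
    then show ?thesis using finite_lat[of 1] by simp
  qed
  have q0: "q 0 = 1" using P0 by (simp add: q)
  have ev_all: "eval_poly F x = (\<Sum>m\<in>?A. (\<Sum>j\<in>UNIV. ga m $ j * x $ j) * eval_poly F (al m))" if "F \<in> forms 1" for F x
    using eval_form1_sum[OF that, of "\<lambda>m. \<Sum>j\<in>UNIV. ga m $ j * x $ j" al ?A] expand[of x] by simp
  have "\<exists>c. mon m = (\<Sum>i\<in>UNIV. cst (c i) * w i) + cst (q m)" if m: "m \<in> ?A" for m
  proof -
    \<comment> \<open>The linear form with toric coordinates \<open>x m - q m * x 0\<close>; it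
      vanishes at \<open>p\<close> and hence is a combination of the \<open>l i\<close>.\<close>
    define F where "F = (\<Sum>j\<in>UNIV. const_scale (ga m $ j - q m * ga 0 $ j) (var j))"
    have evF: "eval_poly F x = (\<Sum>j\<in>UNIV. ga m $ j * x $ j) - q m * (\<Sum>j\<in>UNIV. ga 0 $ j * x $ j)" for x
      by (simp add: F_def eval_sum eval_scale eval_var left_diff_distrib sum_subtractf sum_distrib_left mult.assoc)
    have "F \<in> forms 1" unfolding F_def by (intro forms_sum forms_scale forms_var)
    moreover have "eval_poly F p = 0" using P0 by (simp add: evF P q)
    ultimately have "F \<in> poly_vs.span (l ` UNIV)" using span by auto
    then obtain c where c: "F = (\<Sum>i\<in>UNIV. const_scale (c i) (l i))" by (rule pv.span_family[OF finite])
    have "coef (mon m) x = coef ((\<Sum>i\<in>UNIV. cst (c i) * w i) + cst (q m)) x" for x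
    proof -
      have "coef (\<Sum>i\<in>UNIV. cst (c i) * w i) x = (if x \<in> ?A then eval_poly F (al x) else 0)"
        by (simp add: lookup_sum coef_cst_mult cw c eval_sum eval_scale)
      also have "\<dots> = (if x \<in> ?A then (if m = x then 1 else 0) - q m * (if 0 = x then 1 else 0) else 0)"
        using dual[OF m, of x] dual[OF zero_lat, of x] by (simp add: evF)
      finally show ?thesis using m zero_lat[of 1] by (auto simp: lookup_add lookup_single when_def)
    qed
    then have "mon m = (\<Sum>i\<in>UNIV. cst (c i) * w i) + cst (q m)" by (rule poly_mapping_eqI)
    then show ?thesis by blast
  qed
  then obtain a where a: "\<And>m. m \<in> ?A \<Longrightarrow> mon m = (\<Sum>i\<in>UNIV. cst (a m i) * w i) + cst (q m)" by metis
  have w_indep: "c i = 0" if z: "(\<Sum>i\<in>UNIV. cst (c i) * w i) = 0" for c i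
  proof -
    define F where "F = (\<Sum>i\<in>UNIV. const_scale (c i) (l i))"
    have Ff: "F \<in> forms 1" unfolding F_def by (intro forms_sum forms_scale lf)
    have "eval_poly F (al m) = 0" if "m \<in> ?A" for m
      using arg_cong[OF z, of "\<lambda>r. coef r m"] that
      by (simp add: F_def eval_sum eval_scale lookup_sum coef_cst_mult cw)
    then have "eval_poly F x = 0" for x using ev_all[OF Ff, of x] by simp
    then have "F = 0" by (rule eval_poly_eq_zero)
    then show ?thesis using pv.family_independentD[OF finite inj ind, of c i] by (simp add: F_def)
  qed
  have onto: "\<exists>c. mon u = (\<Sum>i\<in>UNIV. \<Sum>j\<in>UNIV. cst (c i j) * (w i * w j))" if u: "u \<in> lat 2" for u
  proof -
    obtain d where d: "mon u = (\<Sum>m\<in>boundary lat. \<Sum>m'\<in>boundary lat. cst (d m m') * (vlin q m * vlin q m'))"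
      using quad u unfolding quad_gen_def by blast
    have v: "vlin q m = (\<Sum>i\<in>UNIV. cst (a m i) * w i)" if "m \<in> boundary lat" for m
      using a[of m] that by (simp add: vlin_def q0 boundary_def)
    have "mon u = (\<Sum>m\<in>boundary lat. \<Sum>m'\<in>boundary lat. \<Sum>i\<in>UNIV. \<Sum>j\<in>UNIV. cst (d m m' * a m i * a m' j) * (w i * w j))"
      unfolding d by (intro sum.cong refl) (simp only: v sum_product, simp only: sum_distrib_left cst_mult, simp only: mult_ac)
    also have "\<dots> = (\<Sum>x\<in>boundary lat \<times> boundary lat. \<Sum>y\<in>UNIV \<times> UNIV. cst (d (fst x) (snd x) * a (fst x) (fst y) * a (snd x) (snd y)) * (w (fst y) * w (snd y)))"
      by (simp only: sum.cartesian_product' fst_conv snd_conv)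
    also have "\<dots> = (\<Sum>y\<in>UNIV \<times> UNIV. \<Sum>x\<in>boundary lat \<times> boundary lat. cst (d (fst x) (snd x) * a (fst x) (fst y) * a (snd x) (snd y)) * (w (fst y) * w (snd y)))"
      by (rule sum.swap)
    also have "\<dots> = (\<Sum>y\<in>UNIV \<times> UNIV. cst (\<Sum>x\<in>boundary lat \<times> boundary lat. d (fst x) (snd x) * a (fst x) (fst y) * a (snd x) (snd y)) * (w (fst y) * w (snd y)))"
      by (simp add: cst_sum sum_distrib_right)
    also have "\<dots> = (\<Sum>i\<in>UNIV. \<Sum>j\<in>UNIV. cst (\<Sum>x\<in>boundary lat \<times> boundary lat. d (fst x) (snd x) * a (fst x) i * a (snd x) j) * (w i * w j))"
      by (simp only: sum.cartesian_product' fst_conv snd_conv)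
    finally show ?thesis by (rule exI[of _ "\<lambda>i j. \<Sum>x\<in>boundary lat \<times> boundary lat. d (fst x) (snd x) * a (fst x) i * a (snd x) j"])
  qed
  have tp: "toric_projection lat q w a"
  proof
    show "q 0 = 1" by (rule q0)
    show "w i \<in> S 1" for i by (simp add: S_iff cw)
    show "(\<Sum>m\<in>?A. coef (w i) m * q m) = 0" for i
    proof -
      have "(\<Sum>m\<in>?A. coef (w i) m * q m) = (1 / P 0) * (\<Sum>m\<in>?A. P m * eval_poly (l i) (al m))"
        unfolding sum_distrib_left by (intro sum.cong refl) (simp add: cw q)
      then show ?thesis using ev_all[OF lf, of i p] lp0[of i] by (simp add: P)
    qed
  qed (use a w_indep onto in auto)
  interpret tp: toric_projection lat q w a by (rule tp)
  have L: "lev s (w j) = eval_poly (l j) (\<Sum>m\<in>?A. torus_char s m *s al m)" if "s \<in> torus" for s j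
    unfolding eval_form1_sum[OF lf] w_def
    by (simp add: lev_sum lev_mult[OF that] lev_single mult_ac) (simp add: torus_char_def)
  let ?l = "\<lambda>x. \<chi> j. eval_poly (l j) x"
  have key: "(\<forall>x\<in>X. eval_poly G (?l x) = 0) \<longleftrightarrow> lsub w G = 0" if G: "G \<in> forms k" for G k
  proof -
    have pf: "psub l G \<in> forms k" using psub_forms[OF G lf] by simp
    have "(\<forall>x\<in>X. eval_poly G (?l x) = 0) \<longleftrightarrow> (\<forall>s\<in>torus. eval_poly G (?l (\<Sum>m\<in>?A. torus_char s m *s al m)) = 0)"
      using vanish[OF pf] by (simp add: eval_psub)
    also have "\<dots> \<longleftrightarrow> (\<forall>s\<in>torus. lev s (lsub w G) = 0)" by (simp add: lev_lsub L)
    also have "\<dots> \<longleftrightarrow> lsub w G = 0" using lev_eq_zero[of "lsub w G"] by (auto simp: lev_zero)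
    finally show ?thesis .
  qed
  have "vanishing_ideal (proj_image l X) = tp.I"
  proof (intro set_eqI iffI)
    fix F assume F: "F \<in> tp.I"
    obtain N where N: "F = (\<Sum>n\<le>N. hcomp n F)" by (rule hcomp_decomp)
    have z: "eval_poly (hcomp n F) (?l x) = 0" if "x \<in> X" for n x
      using F key[OF hcomp_forms, of n F] that by (auto simp: tp.I_def)
    have "eval_poly F (c *s ?l x) = 0" if "x \<in> X" for c x
    proof -
      have "eval_poly F (c *s ?l x) = (\<Sum>n\<le>N. eval_poly (hcomp n F) (c *s ?l x))"
        using arg_cong[OF N, of "\<lambda>F. eval_poly F (c *s ?l x)"] by (simp only: eval_sum)
      then show ?thesis by (simp add: eval_homogeneous[OF hcomp_forms] z[OF that])
    qed
    then show "F \<in> vanishing_ideal (proj_image l X)" by (auto simp: vanishing_ideal_def proj_image_def)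
  next
    fix F assume F: "F \<in> vanishing_ideal (proj_image l X)"
    obtain N where N: "F = (\<Sum>n\<le>N. hcomp n F)" by (rule hcomp_decomp)
    have hN: "hcomp n F = 0" if "n > N" for n
      using arg_cong[OF N, of "hcomp n"] that by (simp add: hcomp_sum hcomp_of_form[OF hcomp_forms])
    have nz: "eval_poly (hcomp n F) (?l x) = 0" if x: "x \<in> X" "?l x \<noteq> 0" for n x
    proof (cases "n \<le> N")
      case True
      show ?thesis
      \<comment> \<open>All nonzero multiples of an image point belong to the cone, so the
        components vanish separately as coefficients of a polynomial in the scalar.\<close>
      proof (rule sums_to_zero_all[OF _ True])
        fix c :: complex assume c: "c \<noteq> 0"
        have "c *s ?l x \<in> proj_image l X" using x c by (auto simp: proj_image_def vector_mul_eq_0)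
        then have "eval_poly F (c *s ?l x) = 0" using F by (simp add: vanishing_ideal_def)
        then have "(\<Sum>n\<le>N. eval_poly (hcomp n F) (c *s ?l x)) = 0"
          using arg_cong[OF N, of "\<lambda>F. eval_poly F (c *s ?l x)"] by (simp only: eval_sum)
        then show "(\<Sum>n\<le>N. c ^ n * eval_poly (hcomp n F) (?l x)) = 0"
          by (simp add: eval_homogeneous[OF hcomp_forms])
      qed
    qed (simp add: hN eval_poly_def)
    \<comment> \<open>Points where all \<open>l j\<close> vanish are discarded by
      \<open>proj_image\<close>. They are treated as the zero multiple of a surviving image point,
      which is needed even in degree 0; without one all \<open>w j\<close> would be zero.\<close>
    have "\<exists>x\<in>X. ?l x \<noteq> 0"
    proof (rule ccontr)
      assume "\<not> (\<exists>x\<in>X. ?l x \<noteq> 0)"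
      then have "\<forall>x\<in>X. eval_poly (var j) (?l x) = 0" for j by (auto simp: eval_var vec_eq_iff)
      then have w0: "w j = 0" for j using key[OF forms_var, of j] by (simp add: const_hom.psubst_var)
      have "(1::complex) = 0" by (rule w_indep[of "\<lambda>_. 1"]) (simp add: w0)
      then show False by simp
    qed
    then obtain x0 where x0: "x0 \<in> X" "?l x0 \<noteq> 0" by blast
    have all0: "eval_poly (hcomp n F) (?l x) = 0" if x: "x \<in> X" for n x
    proof (cases "?l x = 0")
      case True
      then have lx: "?l x = 0 *s ?l x0" by simp
      show ?thesis unfolding lx eval_homogeneous[OF hcomp_forms] nz[OF x0] by simp
    qed (use nz x in blast)
    have "lsub w (hcomp n F) = 0" for n
      by (rule iffD1[OF key[OF hcomp_forms]]) (intro ballI all0)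
    then show "F \<in> tp.I" by (simp add: tp.I_def)
  qed
  then show ?thesis using that tp by blast
qed

text \<open>\<open>Q\<close> carries the further open conditions of a particular surface.
  \<open>Q_generic\<close> mentions only polynomial families \<open>P\<close> attaining all values
  on the polygon, so that the choice of coordinates stays hidden.\<close>

lemma toric_model_generic:
  fixes X :: "(complex^'n::finite) set"
  assumes pd: "polygon_data F P" and tm: "toric_model (lat_of F 1) X al ga"
    and bd: "set bd = set P - {0}" and check: "gen_check F bd B"
    and Q_generic: "\<And>P. (\<And>m. polyfun (\<lambda>x::complex^'n. P x m)) \<Longrightarrow> (\<And>q. \<exists>x. \<forall>m\<in>lat_of F 1. P x m = q m) \<Longrightarrow>
        \<exists>g x0. polyfun g \<and> g x0 \<noteq> 0 \<and> (\<forall>x. g x \<noteq> 0 \<longrightarrow> Q (P x))"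
    and Q_scale: "\<And>p c. Q p \<Longrightarrow> c \<noteq> 0 \<Longrightarrow> Q (\<lambda>m. c * p m)"
    and generated: "\<And>p (w :: 'k::finite \<Rightarrow> laurent) a. toric_projection (lat_of F) p w a \<Longrightarrow> finite (set B) \<Longrightarrow>
       set B \<subseteq> boundary (lat_of F) \<times> lat_of F 2 \<Longrightarrow> cub_gen (lat_of F) (set B) p \<Longrightarrow> Q p \<Longrightarrow>
       minimally_generated_by_quadrics_cubics (toric_projection.I w) a' b"
  shows "generic_point (\<lambda>p. \<forall>Y :: (complex^'k) set. is_projection_from p X Y \<longrightarrow>
             minimally_generated_by_quadrics_cubics (vanishing_ideal Y) a' b)"
proof -
  interpret polygon_data F P by (rule pd)
  interpret lattice_polygon "lat_of F" by (rule lattice_polygon)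
  let ?A = "lat_of F 1"
  define f where "f x m = (\<Sum>j\<in>UNIV. ga m $ j * x $ j)" for x m
  have dual: "(\<Sum>j\<in>UNIV. ga m $ j * al m' $ j) = (if m = m' then 1 else 0)" if "m \<in> ?A" "m' \<in> ?A" for m m'
    using tm that unfolding toric_model_def by blast
  have ga0: "ga m = 0" if "m \<notin> ?A" for m using tm that unfolding toric_model_def by blast
  have poly: "polyfun (\<lambda>x. f x m)" for m
    unfolding f_def by (intro polyfun_sum polyfun_mult polyfun_const polyfun_coord)
  \<comment> \<open>The point \<open>al 0\<close> is the coordinate point of the centre monomial,
    where the specialisation takes place.\<close>
  have f0: "f (al 0) = (\<lambda>m. 1 when m = 0)"
  proof
    fix m show "f (al 0) m = (1 when m = 0)"
      using dual[OF _ zero_lat, of m] ga0[of m] zero_lat[of 1] by (cases "m \<in> ?A") (auto simp: f_def when_def)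
  qed
  obtain g where g: "polyfun g" "g (al 0) \<noteq> 0" "\<And>x. g x \<noteq> 0 \<Longrightarrow> quad_gen (lat_of F) (f x)"
    "\<And>x. g x \<noteq> 0 \<Longrightarrow> cub_gen (lat_of F) (set B) (f x)"
    and B: "finite (set B)" "set B \<subseteq> boundary (lat_of F) \<times> lat_of F 2"
    by (rule generic_generation[OF poly f0 bd check]) (rule that)
  have "\<exists>x. \<forall>m\<in>?A. f x m = q m" for q
  proof (intro exI ballI)
    fix m assume m: "m \<in> ?A"
    have "f (\<Sum>m'\<in>?A. q m' *s al m') m = (\<Sum>j\<in>UNIV. \<Sum>m'\<in>?A. q m' * (ga m $ j * al m' $ j))"
      by (simp add: f_def sum_distrib_left mult.left_commute)
    also have "\<dots> = (\<Sum>m'\<in>?A. \<Sum>j\<in>UNIV. q m' * (ga m $ j * al m' $ j))" by (rule sum.swap)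
    also have "\<dots> = (\<Sum>m'\<in>?A. if m' = m then q m' else 0)"
      unfolding sum_distrib_left[symmetric] by (intro sum.cong refl) (use dual m in auto)
    finally show "f (\<Sum>m'\<in>?A. q m' *s al m') m = q m" using m finite_lat[of 1] by simp
  qed
  then obtain h x1 where h: "polyfun h" "h x1 \<noteq> 0" "\<And>x. h x \<noteq> 0 \<Longrightarrow> Q (f x)"
    using Q_generic[of f, OF poly] by blast
  \<comment> \<open>The factor \<open>f x 0\<close> allows the point to be normalised to 1 at the
    centre of the polygon.\<close>
  have gf: "polyfun (\<lambda>x. g x * f x 0)" by (intro polyfun_mult g(1) poly)
  have gf0: "g (al 0) * f (al 0) 0 \<noteq> 0" using g(2) f0 by simp
  obtain x2 where x2: "g x2 * f x2 0 \<noteq> 0" "h x2 \<noteq> 0"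
    using polyfun_mult_nonzero[OF gf h(1) gf0 h(2)] by blast
  show ?thesis
  proof (rule generic_pointI[where g = "\<lambda>x. g x * f x 0 * h x" and ?p0.0 = x2])
    show "polyfun (\<lambda>x. g x * f x 0 * h x)" by (intro polyfun_mult g(1) poly h(1))
    show "g x2 * f x2 0 * h x2 \<noteq> 0" using x2 by simp
    show "\<forall>Y :: (complex^'k) set. is_projection_from p X Y \<longrightarrow> minimally_generated_by_quadrics_cubics (vanishing_ideal Y) a' b"
      if gp: "g p * f p 0 * h p \<noteq> 0" for p
    proof (intro allI impI)
      fix Y :: "(complex^'k) set" assume "is_projection_from p X Y"
      then obtain l where l: "is_basis l {F \<in> forms 1. eval_poly F p = 0}" "Y = proj_image l X"
        unfolding is_projection_from_def by blast
      let ?q = "\<lambda>m. (1 / f p 0) * f p m"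
      have c: "1 / f p 0 \<noteq> 0" and f0: "f p 0 \<noteq> 0" using gp by auto
      have qg: "quad_gen (lat_of F) ?q" by (rule quad_gen_scale[OF g(3) c]) (use gp in auto)
      obtain w a where w: "toric_projection (lat_of F) ?q (w :: 'k \<Rightarrow> laurent) a"
        "vanishing_ideal (proj_image l X) = toric_projection.I w"
        by (rule toric_model_projection[where P = "f p" and q = ?q and l = l, OF lattice_polygon tm l(1) _ f0 refl qg])
          (rule ext, rule f_def, rule that)
      have "cub_gen (lat_of F) (set B) ?q" by (rule cub_gen_scale[OF g(4) c]) (use gp in auto)
      moreover have "Q ?q" by (rule Q_scale[OF h(3) c]) (use gp in auto)
      ultimately show "minimally_generated_by_quadrics_cubics (vanishing_ideal Y) a' b"
        unfolding l(2) w(2) by (intro generated[OF w(1) B])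
    qed
    show "\<forall>Y :: (complex^'k) set. is_projection_from p X Y \<longrightarrow> minimally_generated_by_quadrics_cubics (vanishing_ideal Y) a' b"
      if c: "c \<noteq> 0" and P: "\<forall>Y :: (complex^'k) set. is_projection_from (c *s p) X Y \<longrightarrow> minimally_generated_by_quadrics_cubics (vanishing_ideal Y) a' b"
      for c p
    proof -
      have "{F \<in> forms 1. eval_poly F (c *s p) = 0} = {F \<in> forms 1. eval_poly F p = 0}"
        using c by (auto simp: eval_homogeneous)
      then show ?thesis using P unfolding is_projection_from_def by simp
    qed
  qed
qed


text \<open>A parametrisation by polynomials \<open>h j\<close> with monomials \<open>ex u\<close>,
  which agree with the torus characters up to a common factor \<open>d\<close>. The vectors
  \<open>al u\<close> collect the coefficients of \<open>ex u\<close>; independence of the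
  \<open>h j\<close> and equality of the numbers make them a basis.\<close>

lemma toric_modelI:
  fixes X :: "(complex^'k::finite) set" and h :: "'k \<Rightarrow> 'm::finite mpoly" and ex :: "int \<times> int \<Rightarrow> ('m \<Rightarrow>\<^sub>0 nat)"
  assumes A: "finite A" "card A = CARD('k)" and u0: "0 \<in> A"
    and ex: "inj_on ex A" and supp: "\<And>j. supp (h j) \<subseteq> ex ` A"
    and ind: "\<And>c j. (\<Sum>j\<in>UNIV. const_scale (c j) (h j)) = 0 \<Longrightarrow> c j = 0"
    and to_torus: "\<And>z. (\<And>i. z $ i \<noteq> 0) \<Longrightarrow>
      \<exists>s\<in>torus. \<exists>d. d \<noteq> 0 \<and> (\<forall>u\<in>A. (\<Prod>i\<in>UNIV. z $ i ^ coef (ex u) i) = d * torus_char s u)"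
    and from_torus: "\<And>s. s \<in> torus \<Longrightarrow>
      \<exists>z. (\<forall>i. z $ i \<noteq> 0) \<and> (\<exists>d. d \<noteq> 0 \<and> (\<forall>u\<in>A. (\<Prod>i\<in>UNIV. z $ i ^ coef (ex u) i) = d * torus_char s u))"
    and sub: "\<And>z c. (\<And>i. z $ i \<noteq> 0) \<Longrightarrow> c \<noteq> 0 \<Longrightarrow> (\<chi> j. eval_poly (h j) z) \<noteq> 0 \<Longrightarrow>
      c *s (\<chi> j. eval_poly (h j) z) \<in> X"
    and dense: "\<And>k F x. F \<in> forms k \<Longrightarrow> (\<And>z. eval_poly F (\<chi> j. eval_poly (h j) z) = 0) \<Longrightarrow> x \<in> X \<Longrightarrow> eval_poly F x = 0"
  obtains al ga where "toric_model A X al ga"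
proof -
  define al where "al u = (\<chi> j. coef (h j) (ex u))" for u
  let ?h = "\<lambda>z. \<chi> j. eval_poly (h j) z"
  let ?x = "\<lambda>s. \<Sum>m\<in>A. torus_char s m *s al m"
  have evh: "?h z = (\<Sum>u\<in>A. (\<Prod>i\<in>UNIV. z $ i ^ coef (ex u) i) *s al u)" for z
  proof -
    have "eval_poly (h j) z = (\<Sum>m\<in>ex ` A. coef (h j) m * (\<Prod>i\<in>UNIV. z $ i ^ coef m i))" for j
      unfolding eval_poly_def by (rule sum.mono_neutral_left) (use A(1) supp in \<open>auto simp: in_keys_iff\<close>)
    then show ?thesis by (simp add: vec_eq_iff sum.reindex[OF ex] al_def mult.commute)
  qed
  have evs: "?h z = d *s ?x s" if "\<forall>u\<in>A. (\<Prod>i\<in>UNIV. z $ i ^ coef (ex u) i) = d * torus_char s u" for z d s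
    using that unfolding evh by (simp add: vec_eq_iff sum_distrib_left mult.assoc)
  obtain e where e: "bij_betw e (UNIV :: 'k set) A"
    using finite_same_card_bij[of "UNIV :: 'k set" A] A by auto
  \<comment> \<open>The square matrix of the coefficients; its inverse provides the dual basis
    \<open>ga\<close>.\<close>
  define M where "M = (\<chi> i j. al (e i) $ j)"
  have "v = 0" if "M *v v = 0" for v
  proof -
    have z: "(\<Sum>j\<in>UNIV. coef (h j) (ex u) * v $ j) = 0" if u: "u \<in> A" for u
    proof -
      obtain i where "u = e i" using u e by (auto simp: bij_betw_def)
      then show ?thesis using \<open>M *v v = 0\<close> by (auto simp: matrix_vector_mult_def M_def vec_eq_iff al_def)
    qed
    have "(\<Sum>j\<in>UNIV. const_scale (v $ j) (h j)) = 0"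
    proof (rule poly_mapping_eqI)
      fix m show "coef (\<Sum>j\<in>UNIV. const_scale (v $ j) (h j)) m = coef 0 m"
      proof (cases "m \<in> ex ` A")
        case True
        then show ?thesis using z by (auto simp: lookup_sum coef_scale mult.commute)
      next
        case False
        then have "coef (h j) m = 0" for j using supp[of j] by (auto simp: in_keys_iff)
        then show ?thesis by (simp add: lookup_sum coef_scale)
      qed
    qed
    then show ?thesis using ind by (simp add: vec_eq_iff)
  qed
  then obtain B where BM: "B ** M = mat 1" using matrix_left_invertible_ker[of M] by blast
  then have MB: "M ** B = mat 1" by (simp add: matrix_left_right_inverse)
  have BM': "(\<Sum>k\<in>UNIV. B $ j $ k * M $ k $ i) = (if j = i then 1 else 0)"
    and MB': "(\<Sum>k\<in>UNIV. M $ j $ k * B $ k $ i) = (if j = i then 1 else 0)" for i j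
    using arg_cong[OF BM, of "\<lambda>N. N $ j $ i"] arg_cong[OF MB, of "\<lambda>N. N $ j $ i"]
    by (simp_all add: matrix_matrix_mult_def mat_def)
  define ga where "ga u = (if u \<in> A then \<chi> j. B $ j $ inv_into UNIV e u else 0)" for u
  have inj: "inj e" and eA: "e i \<in> A" for i using e by (auto simp: bij_betw_def)
  have gae: "ga (e i) $ j = B $ j $ i" for i j using inj eA[of i] by (simp add: ga_def)
  have "v = (\<Sum>m\<in>A. (\<Sum>j\<in>UNIV. ga m $ j * v $ j) *s al m)" for v
  proof -
    have "(\<Sum>m\<in>A. (\<Sum>j\<in>UNIV. ga m $ j * v $ j) *s al m) $ i = v $ i" for i
    proof -
      have "(\<Sum>m\<in>A. (\<Sum>j\<in>UNIV. ga m $ j * v $ j) *s al m) $ i = (\<Sum>k\<in>UNIV. (\<Sum>j\<in>UNIV. B $ j $ k * v $ j) * M $ k $ i)"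
        by (simp add: sum.reindex_bij_betw[OF e, symmetric] gae M_def)
      also have "\<dots> = (\<Sum>k\<in>UNIV. \<Sum>j\<in>UNIV. v $ j * (B $ j $ k * M $ k $ i))"
        unfolding sum_distrib_right by (simp only: mult_ac)
      also have "\<dots> = (\<Sum>j\<in>UNIV. v $ j * (\<Sum>k\<in>UNIV. B $ j $ k * M $ k $ i))"
        unfolding sum_distrib_left by (rule sum.swap)
      finally show ?thesis by (simp add: BM' if_distrib cong: if_cong)
    qed
    then show ?thesis by (simp add: vec_eq_iff)
  qed
  moreover have dual: "(\<Sum>j\<in>UNIV. ga m $ j * al m' $ j) = (if m = m' then 1 else 0)" if m: "m \<in> A" "m' \<in> A" for m m'
  proof -
    obtain i i' where i: "m = e i" "m' = e i'" using m e by (auto simp: bij_betw_def)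
    have "(\<Sum>j\<in>UNIV. ga m $ j * al m' $ j) = (\<Sum>k\<in>UNIV. M $ i' $ k * B $ k $ i)"
      by (simp add: i gae M_def mult.commute)
    then show ?thesis using inj by (auto simp: MB' i inj_eq)
  qed
  moreover have "ga m = 0" if "m \<notin> A" for m using that by (simp add: ga_def)
  moreover have "(\<forall>x\<in>X. eval_poly F x = 0) \<longleftrightarrow> (\<forall>s\<in>torus. eval_poly F (?x s) = 0)" if F: "F \<in> forms k" for F k
  proof (intro iffI ballI)
    fix s assume X: "\<forall>x\<in>X. eval_poly F x = 0" and s: "s \<in> torus"
    obtain z d where z: "\<And>i. z $ i \<noteq> 0" "d \<noteq> 0"
      "\<forall>u\<in>A. (\<Prod>i\<in>UNIV. z $ i ^ coef (ex u) i) = d * torus_char s u" using from_torus[OF s] by blast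
    have "?x s \<noteq> 0"
    proof
      assume x0: "?x s = 0"
      have "(\<Sum>j\<in>UNIV. ga 0 $ j * ?x s $ j) = (\<Sum>j\<in>UNIV. \<Sum>m\<in>A. torus_char s m * (ga 0 $ j * al m $ j))"
        by (simp add: sum_distrib_left mult.left_commute)
      also have "\<dots> = (\<Sum>m\<in>A. \<Sum>j\<in>UNIV. torus_char s m * (ga 0 $ j * al m $ j))" by (rule sum.swap)
      also have "\<dots> = (\<Sum>m\<in>A. if m = 0 then torus_char s m else 0)"
        unfolding sum_distrib_left[symmetric] by (intro sum.cong refl) (use dual u0 in auto)
      also have "\<dots> = 1" using A(1) u0 by (simp add: torus_char_def)
      finally show False unfolding x0 by simp
    qed
    then have "(1 / d) *s ?h z \<in> X" using sub[OF z(1), of "1 / d"] z(2) by (simp add: evs[OF z(3)] vector_mul_eq_0)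
    then show "eval_poly F (?x s) = 0" using X z(2) by (auto simp: evs[OF z(3)])
  next
    fix x assume T: "\<forall>s\<in>torus. eval_poly F (?x s) = 0" and x: "x \<in> X"
    have van: "eval_poly F (?h z) = 0" if nz: "\<And>i. z $ i \<noteq> 0" for z
    proof -
      obtain s d where s: "s \<in> torus" "\<forall>u\<in>A. (\<Prod>i\<in>UNIV. z $ i ^ coef (ex u) i) = d * torus_char s u"
        using to_torus[OF nz] by blast
      show ?thesis unfolding evs[OF s(2)] eval_homogeneous[OF F] using T s(1) by simp
    qed
    have "eval_poly F (?h z) = 0" for z
    proof (rule ccontr)
      assume nz: "eval_poly F (?h z) \<noteq> 0"
      \<comment> \<open>A form vanishing at all parameters without zero coordinate vanishes at all
        parameters: otherwise it and the product of the coordinates would be nonzero at a common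
        point.\<close>
      have p1: "polyfun (eval_poly (psub h F))" by (rule polyfun_eval)
      have p2: "polyfun (eval_poly (\<Prod>i\<in>UNIV. var i :: 'm mpoly))" by (rule polyfun_eval)
      have ep: "eval_poly (\<Prod>i\<in>UNIV. var i) y = (\<Prod>i\<in>UNIV. y $ i)" for y :: "complex^'m"
        by (simp add: eval_poly_psubst id_hom.psubst_prod id_hom.psubst_var)
      have n1: "eval_poly (psub h F) z \<noteq> 0" using nz by (simp add: eval_psub)
      have n2: "eval_poly (\<Prod>i\<in>UNIV. var i :: 'm mpoly) (\<chi> i. 1) \<noteq> 0" unfolding ep by simp
      obtain y where y: "eval_poly (psub h F) y \<noteq> 0" "eval_poly (\<Prod>i\<in>UNIV. var i) y \<noteq> 0"
        by (rule polyfun_mult_nonzero[OF p1 p2 n1 n2]) 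
      have "y $ i \<noteq> 0" for i using y(2) by (simp add: ep)
      then show False using van[of y] y(1) by (simp add: eval_psub)
    qed
    then show "eval_poly F x = 0" by (rule dense[OF F _ x])
  qed
  ultimately have "toric_model A X al ga" unfolding toric_model_def by blast
  then show ?thesis by (rule that)
qed

section \<open>The blown-up plane\<close>

text \<open>Passing through a coordinate point thus means lacking the pure power of that coordinate,
  a corner of the triangle of exponents.\<close>

lemma eval_axis:
  assumes "F \<in> forms d" shows "eval_poly F (axis k 1) = coef F (sgl k d)"
proof -
  have "(\<Prod>i\<in>UNIV. (axis k 1 :: complex^'a) $ i ^ coef m i) = (if m = sgl k d then 1 else 0)" if m: "m \<in> supp F" for m
  proof (cases "\<forall>i. i \<noteq> k \<longrightarrow> coef m i = 0")
    case True
    have "mdeg m = coef m k" by (subst sum.remove[of _ k]) (use True in auto)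
    then have "coef m k = d" using assms m by (simp add: forms_def)
    then have "m = sgl k d" by (intro poly_mapping_eqI) (use True in \<open>auto simp: lookup_single when_def\<close>)
    then show ?thesis by (auto intro!: prod.neutral simp: axis_def lookup_single when_def)
  next
    case False
    then obtain i where i: "i \<noteq> k" "coef m i \<noteq> 0" by blast
    then have "m \<noteq> sgl k d" by (auto simp: lookup_single)
    moreover have "(\<Prod>i\<in>UNIV. (axis k 1 :: complex^'a) $ i ^ coef m i) = 0"
      by (rule prod_zero) (use i in \<open>auto intro!: bexI[of _ i] simp: axis_def\<close>)
    ultimately show ?thesis by simp
  qed
  then have "eval_poly F (axis k 1) = (\<Sum>m\<in>supp F. if m = sgl k d then coef F m else 0)"
    unfolding eval_poly_def by (intro sum.cong) auto
  then show ?thesis by (simp add: in_keys_iff)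
qed

text \<open>Cubic monomials centred at the product of the three coordinates, which corresponds to
  \<open>(0, 0)\<close>.\<close>

definition plane_exponent :: "int \<times> int \<Rightarrow> (3 \<Rightarrow>\<^sub>0 nat)" where
  "plane_exponent u = sgl 1 (nat (fst u + 1)) + sgl 2 (nat (snd u + 1)) + sgl 3 (nat (1 - fst u - snd u))"

definition in_plane_triangle :: "int \<times> int \<Rightarrow> bool" where
  "in_plane_triangle u \<longleftrightarrow> fst u \<ge> -1 \<and> snd u \<ge> -1 \<and> fst u + snd u \<le> 1"

lemma coef_plane_exponent:
  "coef (plane_exponent u) 1 = nat (fst u + 1)" "coef (plane_exponent u) 2 = nat (snd u + 1)"
  "coef (plane_exponent u) 3 = nat (1 - fst u - snd u)"
  by (simp_all add: plane_exponent_def lookup_add lookup_single when_def)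

lemma prod_3: "prod f (UNIV :: 3 set) = f 1 * f 2 * f 3"
  unfolding UNIV_3 by (simp add: ac_simps)

lemma monomial_plane_exponent:
  fixes z :: "complex^3"
  assumes "in_plane_triangle u" "z $ 1 \<noteq> 0" "z $ 2 \<noteq> 0" "z $ 3 \<noteq> 0"
  shows "(\<Prod>i\<in>UNIV. z $ i ^ coef (plane_exponent u) i) = z $ 1 * z $ 2 * z $ 3 * torus_char (z $ 1 / z $ 3, z $ 2 / z $ 3) u"
proof -
  have pw: "x ^ nat k = x powi k" if "k \<ge> 0" for x :: complex and k :: int using that by (simp add: power_int_def)
  have "(\<Prod>i\<in>UNIV. z $ i ^ coef (plane_exponent u) i)
      = z $ 1 powi (fst u + 1) * z $ 2 powi (snd u + 1) * z $ 3 powi (1 - fst u - snd u)"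
    using assms(1) by (simp add: prod_3 coef_plane_exponent pw in_plane_triangle_def)
  then show ?thesis using assms(2-)
    by (simp add: torus_char_def power_int_add power_int_diff power_int_divide_distrib field_simps)
qed

text \<open>In the new coordinates the points of \<open>Z\<close> become the coordinate points with
  indices in \<open>R\<close>.\<close>

lemma basis_through_points:
  fixes Z :: "(complex^3) set"
  assumes "vec.independent Z" "finite Z" "card R = card Z"
  obtains e :: "3 \<Rightarrow> complex^3" where "e ` R = Z" "\<And>w. \<exists>z. w = (\<Sum>k\<in>UNIV. z $ k *s e k)"
proof -
  let ?B = "vec.extend_basis Z"
  have ZB: "Z \<subseteq> ?B" by (rule vec.extend_basis_superset[OF assms(1)])
  have iB: "vec.independent ?B" by (rule vec.independent_extend_basis[OF assms(1)])
  have sB: "vec.span ?B = UNIV" by (rule vec.span_extend_basis[OF assms(1)])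
  have fB: "finite ?B" by (rule vec.finiteI_independent[OF iB])
  have "card ?B = vec.dim (UNIV :: (complex^3) set)"
    using vec.dim_eq_card_independent[OF iB] vec.dim_span[of ?B] sB by simp
  then have cB: "card ?B = 3" by (simp add: card_cart_basis)
  obtain g where g: "bij_betw g R Z" using finite_same_card_bij[of R Z] assms(2,3) by auto
  have "card (UNIV - R) = card (?B - Z)"
    using card_Diff_subset[OF assms(2) ZB] cB assms(3) by (simp add: card_Diff_subset)
  then obtain g' where g': "bij_betw g' (UNIV - R) (?B - Z)"
    using finite_same_card_bij[of "UNIV - R" "?B - Z"] fB by auto
  define e where "e k = (if k \<in> R then g k else g' k)" for k
  have eR: "bij_betw e R Z" using g by (rule bij_betw_cong[THEN iffD1, rotated]) (simp add: e_def)
  have eR': "bij_betw e (UNIV - R) (?B - Z)" using g' by (rule bij_betw_cong[THEN iffD1, rotated]) (simp add: e_def)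
  have "bij_betw e (R \<union> (UNIV - R)) (Z \<union> (?B - Z))" by (rule bij_betw_combine[OF eR eR']) auto
  moreover have "R \<union> (UNIV - R) = UNIV" "Z \<union> (?B - Z) = ?B" using ZB by auto
  ultimately have eB: "bij_betw e UNIV ?B" by simp
  have "\<exists>z. w = (\<Sum>k\<in>UNIV. z $ k *s e k)" for w
  proof -
    obtain u where "w = (\<Sum>v\<in>?B. u v *s v)" using vec.span_finite[OF fB] sB by (metis (no_types, lifting) UNIV_I imageE)
    then have "w = (\<Sum>k\<in>UNIV. (\<chi> k. u (e k)) $ k *s e k)" by (simp add: sum.reindex_bij_betw[OF eB, symmetric])
    then show ?thesis by (rule exI)
  qed
  moreover have "e ` R = Z" using eR by (simp add: bij_betw_def)
  ultimately show ?thesis by (intro that)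
qed

text \<open>After the change of coordinates the cubics through \<open>Z\<close> involve no pure
  cubes with index in \<open>R\<close>; by \<open>corners\<close> the other monomials have exponents
  in \<open>A\<close>.\<close>

lemma blowup_toric_model:
  fixes X :: "(complex^'k::finite) set" and R :: "3 set"
  assumes X: "anticanonical_blowup_plane d X"
    and A: "finite A" "card A = CARD('k)" "0 \<in> A" "\<And>u. u \<in> A \<Longrightarrow> in_plane_triangle u"
    and R: "card R + d = 9"
    and corners: "\<And>m. mdeg m = 3 \<Longrightarrow> (\<forall>k\<in>R. m \<noteq> sgl k 3) \<Longrightarrow> (int (coef m 1) - 1, int (coef m 2) - 1) \<in> A"
  obtains al ga where "toric_model A X al ga"
proof -
  obtain Z f where Z: "finite Z" "card Z + d = 9" "general_position Z"
    and f: "is_basis f {F \<in> forms 3. \<forall>z\<in>Z. eval_poly F z = 0}"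
    and Xf: "X = zariski_closed hull (proj_image f {z. z \<noteq> 0})"
    using X unfolding anticanonical_blowup_plane_def by blast
  have RZ: "card R = card Z" using R Z(2) by simp
  have "card R \<le> 3" using card_mono[of UNIV R] by simp
  \<comment> \<open>At most three points are blown up, so general position is plain linear
    independence.\<close>
  then have indZ: "vec.independent Z" using Z(3) RZ unfolding general_position_def by simp
  obtain e :: "3 \<Rightarrow> complex^3" where e: "e ` R = Z" "\<And>w. \<exists>z. w = (\<Sum>k\<in>UNIV. z $ k *s e k)"
    by (rule basis_through_points[OF indZ Z(1) RZ]) (rule that)
  have inj: "inj f" and ind: "poly_vs.independent (range f)"
    and span: "poly_vs.span (range f) = {F \<in> forms 3. \<forall>z\<in>Z. eval_poly F z = 0}"
    using f by (auto simp: is_basis_def)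
  have ff: "f j \<in> forms 3" and fZ: "z \<in> Z \<Longrightarrow> eval_poly (f j) z = 0" for j z
    using poly_vs.span_base[of "f j" "range f"] unfolding span by auto
  define G :: "3 \<Rightarrow> 3 mpoly" where "G i = (\<Sum>k\<in>UNIV. const_scale (e k $ i) (var k))" for i
  have G1: "G i \<in> forms 1" for i unfolding G_def by (intro forms_sum forms_scale forms_var)
  have Gev: "(\<chi> i. eval_poly (G i) z) = (\<Sum>k\<in>UNIV. z $ k *s e k)" for z
    by (simp add: G_def vec_eq_iff eval_sum eval_scale eval_var mult.commute)
  define h where "h j = psub G (f j)" for j
  have hf: "h j \<in> forms 3" for j using psub_forms[where F = "f j", OF ff G1] by (simp add: h_def)
  have hev: "eval_poly (h j) z = eval_poly (f j) (\<Sum>k\<in>UNIV. z $ k *s e k)" for j z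
    by (simp add: h_def eval_psub Gev)
  have hR: "coef (h j) (sgl k 3) = 0" if "k \<in> R" for j k
  proof -
    have "(\<Sum>l\<in>UNIV. axis k (1::complex) $ l *s e l) = (\<Sum>l\<in>UNIV. if l = k then e l else 0)"
      by (intro sum.cong refl) (auto simp: axis_def)
    then have "eval_poly (h j) (axis k 1) = eval_poly (f j) (e k)" by (simp add: hev)
    then show ?thesis using fZ[of "e k" j] e(1) that eval_axis[OF hf] by auto
  qed
  have supp: "supp (h j) \<subseteq> plane_exponent ` A" for j
  proof
    fix m assume m: "m \<in> supp (h j)"
    then have d3: "mdeg m = 3" using hf[of j] by (simp add: forms_def)
    have "(int (coef m 1) - 1, int (coef m 2) - 1) \<in> A"
      by (rule corners[OF d3]) (use m hR[of _ j] in \<open>auto simp: in_keys_iff\<close>)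
    moreover have "m = plane_exponent (int (coef m 1) - 1, int (coef m 2) - 1)"
    proof (rule poly_mapping_eqI)
      fix i :: 3
      have "coef m 1 + coef m 2 + coef m 3 = 3" using d3 by (simp add: sum_3)
      then show "coef m i = coef (plane_exponent (int (coef m 1) - 1, int (coef m 2) - 1)) i"
        using exhaust_3[of i] by (auto simp: coef_plane_exponent)
    qed
    ultimately show "m \<in> plane_exponent ` A" by (rule rev_image_eqI)
  qed
  have ex: "inj_on plane_exponent A"
  proof (rule inj_onI)
    fix u v assume uv: "u \<in> A" "v \<in> A" and "plane_exponent u = plane_exponent v"
    then have "nat (fst u + 1) = nat (fst v + 1)" "nat (snd u + 1) = nat (snd v + 1)"
      by (metis coef_plane_exponent(1), metis coef_plane_exponent(2))
    then show "u = v" using A(4)[OF uv(1)] A(4)[OF uv(2)] unfolding in_plane_triangle_def prod_eq_iff by arith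
  qed
  show ?thesis
  proof (rule toric_modelI[OF A(1,2,3) ex supp])
    show "c j = 0" if c: "(\<Sum>j\<in>UNIV. const_scale (c j) (h j)) = 0" for c j
    proof -
      have "eval_poly (\<Sum>j\<in>UNIV. const_scale (c j) (f j)) w = 0" for w
      proof -
        obtain z where "w = (\<Sum>k\<in>UNIV. z $ k *s e k)" using e(2) by blast
        then show ?thesis using arg_cong[OF c, of "\<lambda>F. eval_poly F z"] by (simp add: eval_sum eval_scale hev eval_poly_def[of 0])
      qed
      then have "(\<Sum>j\<in>UNIV. const_scale (c j) (f j)) = 0" by (rule eval_poly_eq_zero)
      then show ?thesis using pv.family_independentD[OF finite inj ind, of c j] by simp
    qed
    show "\<exists>s\<in>torus. \<exists>d. d \<noteq> 0 \<and> (\<forall>u\<in>A. (\<Prod>i\<in>UNIV. z $ i ^ coef (plane_exponent u) i) = d * torus_char s u)"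
      if z: "\<And>i. z $ i \<noteq> 0" for z :: "complex^3"
      using z by (intro bexI[of _ "(z $ 1 / z $ 3, z $ 2 / z $ 3)"] exI[of _ "z $ 1 * z $ 2 * z $ 3"])
        (auto simp: monomial_plane_exponent A(4) torus_def)
    show "\<exists>z. (\<forall>i. z $ i \<noteq> 0) \<and> (\<exists>d. d \<noteq> 0 \<and> (\<forall>u\<in>A. (\<Prod>i\<in>UNIV. z $ i ^ coef (plane_exponent u) i) = d * torus_char s u))"
      if s: "s \<in> torus" for s
    proof -
      define z :: "complex^3" where "z = vector [fst s, snd s, 1]"
      have "z $ i \<noteq> 0" for i using s exhaust_3[of i] by (auto simp: z_def torus_def)
      moreover have "(\<Prod>i\<in>UNIV. z $ i ^ coef (plane_exponent u) i) = (fst s * snd s) * torus_char s u" if "u \<in> A" for u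
        using monomial_plane_exponent[OF A(4)[OF that], of z] s by (simp add: z_def torus_def)
      ultimately show ?thesis using s by (intro exI[of _ z] conjI exI[of _ "fst s * snd s"]) (auto simp: torus_def)
    qed
    show "c *s (\<chi> j. eval_poly (h j) z) \<in> X" if "c \<noteq> 0" "(\<chi> j. eval_poly (h j) z) \<noteq> 0" for z c
    proof -
      let ?w = "\<Sum>k\<in>UNIV. z $ k *s e k"
      have "?w \<noteq> 0"
      proof
        assume w0: "?w = 0"
        have "eval_poly (f j) 0 = 0" for j using eval_homogeneous[OF ff, of j 0 0] by simp
        then have "(\<chi> j. eval_poly (h j) z) = 0" unfolding hev w0 by (simp add: vec_eq_iff)
        then show False using that(2) by simp
      qed
      then have "c *s (\<chi> j. eval_poly (h j) z) \<in> proj_image f {z. z \<noteq> 0}"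
        using that unfolding proj_image_def hev by (auto simp: vector_mul_eq_0)
      then show ?thesis unfolding Xf by (rule hull_inc)
    qed
    show "eval_poly F x = 0" if F: "F \<in> forms k" and 0: "\<And>z. eval_poly F (\<chi> j. eval_poly (h j) z) = 0" and x: "x \<in> X" for k F x
    proof -
      have "eval_poly F (\<chi> j. eval_poly (f j) w) = 0" for w
      proof -
        obtain z where "w = (\<Sum>k\<in>UNIV. z $ k *s e k)" using e(2) by blast
        then show ?thesis using 0[of z] by (simp add: hev)
      qed
      then have fF: "eval_poly F (c *s (\<chi> j. eval_poly (f j) w)) = 0" for c w
        by (simp only: eval_homogeneous[OF F] mult_zero_right)
      have "proj_image f {z. z \<noteq> 0} \<subseteq> proj_zeros {F}"
      proof
        fix y assume "y \<in> proj_image f {z. z \<noteq> 0}"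
        then obtain w c where "y \<noteq> 0" "y = c *s (\<chi> j. eval_poly (f j) w)" unfolding proj_image_def by blast
        then show "y \<in> proj_zeros {F}" using fF[of c w] by (simp only: proj_zeros_def mem_Collect_eq) simp
      qed
      moreover have "zariski_closed (proj_zeros {F})" unfolding zariski_closed_def by (intro exI[of _ "{F}"]) (use F in auto)
      ultimately have "X \<subseteq> proj_zeros {F}" unfolding Xf by (rule hull_minimal)
      then show ?thesis using x by (auto simp: proj_zeros_def)
    qed
  qed (rule that)
qed


section \<open>The quadric surface\<close>

lemma form2_expansion:
  assumes "F \<in> forms 2"
  obtains c where "F = (\<Sum>i\<in>UNIV. \<Sum>j\<in>UNIV. sgl 0 (c i j) * (var i * var j))"
proof -
  have "F \<in> forms (Suc 1)" using assms by (simp add: numeral_2_eq_2 One_nat_def)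
  then obtain G where G: "\<And>i. G i \<in> forms 1" "F = (\<Sum>i\<in>UNIV. var i * G i)"
    by (rule forms_Suc_decomp) (rule that)
  have "\<exists>d. G i = (\<Sum>j\<in>UNIV. var j * sgl 0 (d j))" for i
  proof -
    have "G i \<in> forms (Suc 0)" using G(1)[of i] by (simp add: One_nat_def)
    then obtain H where H: "\<And>j. H j \<in> forms 0" "G i = (\<Sum>j\<in>UNIV. var j * H j)"
      by (rule forms_Suc_decomp) (rule that)
    have "G i = (\<Sum>j\<in>UNIV. var j * sgl 0 (coef (H j) 0))"
      unfolding H(2) by (intro sum.cong refl arg_cong2[where f = "(*)"] form0[OF H(1)])
    then show ?thesis by (rule exI[of _ "\<lambda>j. coef (H j) 0"])
  qed
  then obtain d where d: "\<And>i. G i = (\<Sum>j\<in>UNIV. var j * sgl 0 (d i j))" by metis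
  have "F = (\<Sum>i\<in>UNIV. \<Sum>j\<in>UNIV. sgl 0 (d i j) * (var i * var j))"
    unfolding G(2) d sum_distrib_left by (simp only: mult_ac)
  then show ?thesis by (rule that)
qed

lemma eval_single: "eval_poly (sgl m c) x = c * (\<Prod>i\<in>UNIV. x $ i ^ coef m i)"
  by (simp add: eval_poly_psubst id_hom.psubst_single)

text \<open>Identifies the formal derivative with the analytic one, so that uniqueness of
  derivatives can relate smoothness to the bilinear form.\<close>

lemma eval_partial_deriv:
  fixes F :: "'n::finite mpoly" and x :: "complex^'n"
  shows "((\<lambda>t. eval_poly F (x + t *s axis i 1)) has_field_derivative eval_poly (partial_deriv i F) x) (at 0)"
proof -
  have "((\<lambda>t. \<Prod>l\<in>UNIV. (x + t *s axis i 1) $ l ^ coef m l) has_field_derivative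
      of_nat (coef m i) * (\<Prod>l\<in>UNIV. x $ l ^ coef (m - sgl i 1) l)) (at 0)" for m
  proof -
    let ?r = "\<Prod>l\<in>UNIV - {i}. x $ l ^ coef m l"
    have l: "(\<lambda>t. \<Prod>l\<in>UNIV. (x + t *s axis i 1) $ l ^ coef m l) = (\<lambda>t. (x $ i + t) ^ coef m i * ?r)"
      by (rule ext, subst prod.remove[of _ i]) (auto simp: axis_def intro!: prod.cong)
    \<comment> \<open>For exponent 0 the truncated subtraction gives 0 instead of -1; the factor
      \<open>of_nat (coef m i)\<close> then makes the term vanish.\<close>
    have r: "(\<Prod>l\<in>UNIV. x $ l ^ coef (m - sgl i 1) l) = x $ i ^ (coef m i - 1) * ?r"
      by (subst prod.remove[of _ i]) (auto simp: lookup_minus lookup_single when_def intro!: prod.cong)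
    show ?thesis unfolding l r
      by (auto intro!: derivative_eq_intros simp: One_nat_def)
  qed
  then have "((\<lambda>t. coef F m * (\<Prod>l\<in>UNIV. (x + t *s axis i 1) $ l ^ coef m l)) has_field_derivative
      coef F m * (of_nat (coef m i) * (\<Prod>l\<in>UNIV. x $ l ^ coef (m - sgl i 1) l))) (at 0)" for m
    by (rule DERIV_cmult)
  then have "((\<lambda>t. \<Sum>m\<in>supp F. coef F m * (\<Prod>l\<in>UNIV. (x + t *s axis i 1) $ l ^ coef m l)) has_field_derivative
      (\<Sum>m\<in>supp F. coef F m * (of_nat (coef m i) * (\<Prod>l\<in>UNIV. x $ l ^ coef (m - sgl i 1) l)))) (at 0)"
    by (rule DERIV_sum)
  moreover have "eval_poly (partial_deriv i F) x
      = (\<Sum>m\<in>supp F. coef F m * (of_nat (coef m i) * (\<Prod>l\<in>UNIV. x $ l ^ coef (m - sgl i 1) l)))"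
    unfolding partial_deriv_def eval_sum eval_single by (simp only: mult_ac)
  ultimately show ?thesis unfolding eval_poly_def by simp
qed

lemma quadratic_root:
  fixes a b c :: complex assumes "a \<noteq> 0" obtains t where "a * t ^ 2 + b * t + c = 0"
proof -
  define t where "t = (csqrt (b ^ 2 - 4 * a * c) - b) / (2 * a)"
  have "2 * a * t + b = csqrt (b ^ 2 - 4 * a * c)" using assms by (simp add: t_def)
  then have "(2 * a * t + b) ^ 2 = b ^ 2 - 4 * a * c" by simp
  then have "4 * a * (a * t ^ 2 + b * t + c) = 0" by algebra
  then show ?thesis using assms by (intro that[of t]) simp
qed

text \<open>Two hyperbolic planes are split off, spanned by \<open>e, f\<close> and by
  \<open>e', f'\<close>. Smoothness yields nondegeneracy only at zeros of \<open>q\<close>, so it is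
  invoked only at the isotropic vectors \<open>e\<close> and \<open>e'\<close>.\<close>

lemma hyperbolic_basis:
  fixes q :: "complex^4 \<Rightarrow> complex" and B :: "complex^4 \<Rightarrow> complex^4 \<Rightarrow> complex"
  assumes sym: "\<And>x y. B x y = B y x" and add: "\<And>x y z. B (x + y) z = B x z + B y z"
    and scale: "\<And>c x y. B (c *s x) y = c * B x y"
    and q_add: "\<And>x y. q (x + y) = q x + q y + B x y" and q_scale: "\<And>c x. q (c *s x) = c ^ 2 * q x"
    and nondeg: "\<And>x. x \<noteq> 0 \<Longrightarrow> q x = 0 \<Longrightarrow> \<exists>y. B x y \<noteq> 0"
  obtains b1 b2 b3 b4 :: "complex^4"
  where "\<And>a1 a2 a3 a4. q (a1 *s b1 + a2 *s b2 + a3 *s b3 + a4 *s b4) = a1 * a2 - a3 * a4"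
    "\<And>w. \<exists>y::complex^4. w = y $ 1 *s b1 + y $ 2 *s b2 + y $ 3 *s b3 + y $ 4 *s b4"
proof -
  have add': "B z (x + y) = B z x + B z y" and scale': "B y (c *s x) = c * B y x" for c x y z
    by (simp_all only: sym[of z "x + y"] sym[of z x] sym[of z y] sym[of y "c *s x"] sym[of y x] add scale)
  have diff: "B z (x - y) = B z x - B z y" for x y z
    using add'[of z "x - y" y] by simp
  have B0: "B 0 z = 0" for z using scale[of 0 0 z] by simp
  have Bq: "B x x = 2 * q x" for x
  proof -
    have "x + x = 2 *s x" by (simp add: vec_eq_iff)
    then show ?thesis using q_add[of x x] q_scale[of 2 x] by simp
  qed
  have not_span: "\<exists>x. x \<notin> vec.span {a, b, c}" for a b c :: "complex^4"
  proof (rule ccontr)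
    assume "\<not> ?thesis"
    then have "vec.dim (UNIV :: (complex^4) set) \<le> card {a, b, c}" by (intro vec.dim_le_card) auto
    also have "\<dots> \<le> 3" by (simp add: card_insert_if)
    finally show False by (simp add: card_cart_basis)
  qed
  have iso: "\<exists>a b. (a \<noteq> 0 \<or> b \<noteq> 0) \<and> q (a *s u + b *s v) = 0" for u v
  proof (cases "q v = 0")
    case True
    then show ?thesis by (intro exI[of _ 0] exI[of _ 1]) simp
  next
    case False
    then obtain t where "q v * t ^ 2 + B u v * t + q u = 0" by (rule quadratic_root)
    then show ?thesis by (intro exI[of _ 1] exI[of _ t]) (simp add: q_add q_scale scale' algebra_simps)
  qed
  \<comment> \<open>\<open>a\<close> fixes the pairing with \<open>e\<close>, and adding a multiple
    of the isotropic \<open>e\<close> then makes the vector isotropic without changing that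
    pairing.\<close>
  have partner: "\<exists>a b. q (a *s y + b *s e) = 0 \<and> B e (a *s y + b *s e) = c"
    if "q e = 0" "B e y \<noteq> 0" "c \<noteq> 0" for e y c
  proof -
    define a b where "a = c / B e y" and "b = - (a ^ 2 * q y) / c"
    have "a * B e y = c" "b * c = - (a ^ 2 * q y)" using that by (simp_all add: a_def b_def)
    moreover have "q (a *s y + b *s e) = a ^ 2 * q y + b * (a * B e y)"
      using that(1) by (simp add: q_add q_scale scale scale' sym[of y e] mult_ac)
    moreover have "B e (a *s y + b *s e) = a * B e y" using that(1) by (simp add: add' scale' Bq)
    ultimately show ?thesis by (intro exI[of _ a] exI[of _ b]) simp
  qed
  obtain a b :: complex where ab: "a \<noteq> 0 \<or> b \<noteq> 0" "q (a *s axis 1 1 + b *s axis 2 1) = 0"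
    using iso[of "axis 1 1" "axis 2 1"] by blast
  define e :: "complex^4" where "e = a *s axis 1 1 + b *s axis 2 1"
  have qe: "q e = 0" using ab(2) by (simp add: e_def)
  have e0: "e \<noteq> 0"
  proof
    assume "e = 0"
    then have "e $ 1 = 0" "e $ 2 = 0" by simp_all
    then show False using ab(1) by (simp add: e_def axis_def)
  qed
  obtain y where "B e y \<noteq> 0" using nondeg[OF e0 qe] by blast
  then obtain a' b' where "q (a' *s y + b' *s e) = 0 \<and> B e (a' *s y + b' *s e) = 1"
    using partner[OF qe, of y 1] by auto
  then obtain f where f: "q f = 0" "B e f = 1" by blast
  \<comment> \<open>Orthogonal projection onto the complement of the hyperbolic plane of
    \<open>e\<close> and \<open>f\<close>.\<close>
  define pr where "pr x = x - B x f *s e - B x e *s f" for x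
  have pr1: "B e (pr x) = 0" "B f (pr x) = 0" for x
    using f qe by (simp_all add: pr_def diff scale' Bq sym[of f e] sym[of e x] sym[of f x])
  have pr2: "x = pr x + B x f *s e + B x e *s f" for x by (simp add: pr_def vec_eq_iff)
  obtain x1 where x1: "x1 \<notin> vec.span {e, f, 0}" using not_span by blast
  define u where "u = pr x1"
  have u0: "u \<noteq> 0"
  proof
    assume "u = 0"
    then have "x1 = B x1 f *s e + B x1 e *s f" using pr2[of x1] by (simp add: u_def)
    moreover have "B x1 f *s e + B x1 e *s f \<in> vec.span {e, f, 0}"
      by (intro vec.span_add vec.span_scale vec.span_base) auto
    ultimately show False using x1 by simp
  qed
  \<comment> \<open>Outside the span of \<open>e\<close>, \<open>f\<close>, \<open>u\<close>, so
    that \<open>v\<close> is not a multiple of \<open>u\<close> and no nontrivial combination of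
    \<open>u\<close>, \<open>v\<close> is zero.\<close>
  obtain x2 where x2: "x2 \<notin> vec.span {e, f, u}" using not_span by blast
  define v where "v = pr x2"
  obtain a3 b3 where ab3: "a3 \<noteq> 0 \<or> b3 \<noteq> 0" "q (a3 *s u + b3 *s v) = 0" using iso by blast
  define e' where "e' = a3 *s u + b3 *s v"
  have qe': "q e' = 0" using ab3(2) by (simp add: e'_def)
  have e'0: "e' \<noteq> 0"
  proof
    assume z: "e' = 0"
    show False
    proof (cases "b3 = 0")
      case True
      then show ?thesis using z ab3(1) u0 by (simp add: e'_def vector_mul_eq_0)
    next
      case False
      have "v $ i = ((- a3 / b3) *s u) $ i" for i
        using arg_cong[OF z, of "\<lambda>w. w $ i"] False by (simp add: e'_def field_simps eq_neg_iff_add_eq_0 add.commute)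
      then have "v = (- a3 / b3) *s u" by (simp only: vec_eq_iff) blast
      then have "x2 = (- a3 / b3) *s u + B x2 f *s e + B x2 e *s f" using pr2[of x2] by (simp add: v_def)
      moreover have "(- a3 / b3) *s u + B x2 f *s e + B x2 e *s f \<in> vec.span {e, f, u}"
        by (intro vec.span_add vec.span_scale vec.span_base) auto
      ultimately show False using x2 by simp
    qed
  qed
  have ee': "B e e' = 0" "B f e' = 0" by (simp_all add: e'_def add' scale' u_def v_def pr1)
  obtain y' where y': "B e' y' \<noteq> 0" using nondeg[OF e'0 qe'] by blast
  have "B e' (pr y') = B e' y'" by (simp add: pr_def diff scale' sym[of e' e] sym[of e' f] ee')
  then obtain a4 b4 where ab4: "q (a4 *s pr y' + b4 *s e') = 0" "B e' (a4 *s pr y' + b4 *s e') = -1"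
    using partner[OF qe', of "pr y'" "-1"] y' by auto
  define f' where "f' = a4 *s pr y' + b4 *s e'"
  have f': "q f' = 0" "B e' f' = -1" using ab4 by (simp_all add: f'_def)
  have ef': "B e f' = 0" "B f f' = 0" by (simp_all add: f'_def add' scale' pr1 ee')
  note B_simps = f f' ee' ef' qe qe' sym[of f e] sym[of e' e] sym[of e' f] sym[of f' e] sym[of f' f] sym[of f' e']
  have q: "q (a1 *s e + a2 *s f + a3 *s e' + a4 *s f') = a1 * a2 - a3 * a4" for a1 a2 a3 a4
    by (simp add: q_add q_scale add scale scale' B_simps)
  \<comment> \<open>The matrix with the four vectors as columns; the pairings show that it is
    injective, hence surjective.\<close>
  define G :: "complex^4^4" where
    "G = (\<chi> i j. (if j = 1 then e else if j = 2 then f else if j = 3 then e' else f') $ i)"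
  have G: "G *v y = y $ 1 *s e + y $ 2 *s f + y $ 3 *s e' + y $ 4 *s f'" for y
    by (simp add: vec_eq_iff matrix_vector_mult_def G_def sum_4 mult.commute)
  have "y = 0" if y: "G *v y = 0" for y
  proof -
    have 0: "B (y $ 1 *s e + y $ 2 *s f + y $ 3 *s e' + y $ 4 *s f') z = 0" for z
      using y by (simp add: G B0)
    have "y $ 2 = 0" "y $ 1 = 0" "y $ 4 = 0" "y $ 3 = 0"
      using 0[of e] 0[of f] 0[of e'] 0[of f'] by (simp_all add: add scale B_simps Bq)
    then show ?thesis by (simp add: vec_eq_iff forall_4)
  qed
  then obtain G' where "G' ** G = mat 1" using matrix_left_invertible_ker[of G] by blast
  then have GG': "G ** G' = mat 1" by (simp add: matrix_left_right_inverse)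
  have "\<exists>y::complex^4. w = y $ 1 *s e + y $ 2 *s f + y $ 3 *s e' + y $ 4 *s f'" for w
  proof
    have "w = G *v (G' *v w)" by (simp add: matrix_vector_mul_assoc GG')
    then show "w = (G' *v w) $ 1 *s e + (G' *v w) $ 2 *s f + (G' *v w) $ 3 *s e' + (G' *v w) $ 4 *s f'"
      by (simp only: G)
  qed
  then show ?thesis by (rule that[OF q])
qed

text \<open>At a zero \<open>x\<close> of \<open>q\<close> the partial derivatives are the values of
  the polar form \<open>B\<close> on the unit vectors and \<open>x\<close>, so smoothness supplies
  the nondegeneracy needed.\<close>

lemma smooth_quadric_normal_form:
  assumes "smooth_quadric q"
  obtains b :: "4 \<Rightarrow> complex^4"
  where "\<And>y. eval_poly q (\<Sum>k\<in>UNIV. y $ k *s b k) = y $ 1 * y $ 2 - y $ 3 * y $ 4"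
    "\<And>w. \<exists>y. w = (\<Sum>k\<in>UNIV. y $ k *s b k)"
proof -
  have qf: "q \<in> forms 2" and smooth: "\<And>x. x \<noteq> 0 \<Longrightarrow> eval_poly q x = 0 \<Longrightarrow> \<exists>i. eval_poly (partial_deriv i q) x \<noteq> 0"
    using assms by (auto simp: smooth_quadric_def proj_zeros_def)
  obtain c where c: "q = (\<Sum>i\<in>UNIV. \<Sum>j\<in>UNIV. sgl 0 (c i j) * (var i * var j))" by (rule form2_expansion[OF qf])
  have qe: "eval_poly q x = (\<Sum>i\<in>UNIV. \<Sum>j\<in>UNIV. c i j * (x $ i * x $ j))" for x
    unfolding c eval_poly_psubst id_hom.psubst_sum id_hom.psubst_mult id_hom.psubst_const id_hom.psubst_var by (rule refl)
  define B where "B x y = (\<Sum>i\<in>UNIV. \<Sum>j\<in>UNIV. c i j * (x $ i * y $ j + y $ i * x $ j))" for x y :: "complex^4"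
  have add: "B (x + y) z = B x z + B y z" for x y z
    by (simp add: B_def sum.distrib[symmetric] algebra_simps)
  have scale: "B (s *s x) y = s * B x y" for s x y
    by (simp add: B_def sum_distrib_left algebra_simps)
  have sym: "B x y = B y x" for x y by (simp add: B_def add.commute)
  have q_add: "eval_poly q (x + y) = eval_poly q x + eval_poly q y + B x y" for x y
    by (simp add: B_def qe sum.distrib[symmetric] algebra_simps)
  have q_scale: "eval_poly q (s *s x) = s ^ 2 * eval_poly q x" for s x by (rule eval_homogeneous[OF qf])
  have nd: "\<exists>y. B x y \<noteq> 0" if x: "x \<noteq> 0" "eval_poly q x = 0" for x
  proof -
    obtain i where i: "eval_poly (partial_deriv i q) x \<noteq> 0" using smooth[OF x] by blast
    have "(\<lambda>t. eval_poly q (x + t *s axis i 1)) = (\<lambda>t. t ^ 2 * eval_poly q (axis i 1) + t * B (axis i 1) x)"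
      by (simp add: q_add q_scale x(2) sym[of x] scale)
    moreover have "((\<lambda>t. t ^ 2 * eval_poly q (axis i 1) + t * B (axis i 1) x) has_field_derivative B (axis i 1) x) (at 0)"
      by (auto intro!: derivative_eq_intros)
    ultimately have "eval_poly (partial_deriv i q) x = B (axis i 1) x"
      using DERIV_unique[OF eval_partial_deriv[of q x i]] by simp
    then show ?thesis using i sym[of x "axis i 1"] by (intro exI[of _ "axis i 1"]) simp
  qed
  show ?thesis
  proof (rule hyperbolic_basis[OF sym add scale q_add q_scale])
    show "\<exists>y. B x y \<noteq> 0" if "x \<noteq> 0" "eval_poly q x = 0" for x by (rule nd[OF that])
  next
    fix b1 b2 b3 b4 :: "complex^4"
    assume b: "\<And>a1 a2 a3 a4. eval_poly q (a1 *s b1 + a2 *s b2 + a3 *s b3 + a4 *s b4) = a1 * a2 - a3 * a4"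
      "\<And>w. \<exists>y::complex^4. w = y $ 1 *s b1 + y $ 2 *s b2 + y $ 3 *s b3 + y $ 4 *s b4"
    show thesis
      by (rule that[of "\<lambda>k. if k = 1 then b1 else if k = 2 then b2 else if k = 3 then b3 else b4"])
        (simp_all add: sum_4 b)
  qed
qed

text \<open>Coordinates 1, 2 belong to the first projective line and 3, 4 to the second; both
  \<open>y1 y2\<close> and \<open>y3 y4\<close> become the product of all four.\<close>

definition segre :: "4 \<Rightarrow> 4 mpoly" where
  "segre i = (if i = 1 then var 1 * var 3 else if i = 2 then var 2 * var 4
    else if i = 3 then var 1 * var 4 else var 2 * var 3)"

definition segre_point :: "complex^4 \<Rightarrow> complex^4" where
  "segre_point z = (\<chi> i. if i = 1 then z $ 1 * z $ 3 else if i = 2 then z $ 2 * z $ 4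
    else if i = 3 then z $ 1 * z $ 4 else z $ 2 * z $ 3)"

lemma segre_point_nth:
  "segre_point z $ 1 = z $ 1 * z $ 3" "segre_point z $ 2 = z $ 2 * z $ 4"
  "segre_point z $ 3 = z $ 1 * z $ 4" "segre_point z $ 4 = z $ 2 * z $ 3"
  by (simp_all add: segre_point_def)

lemma eval_segre: "(\<chi> i. eval_poly (segre i) z) = segre_point z"
  by (simp add: vec_eq_iff segre_def segre_point_def eval_poly_psubst id_hom.psubst_mult id_hom.psubst_var)

lemma segre_point_surj:
  assumes "y $ 1 * y $ 2 = y $ 3 * y $ 4" obtains z where "y = segre_point z"
proof -
  define v4 :: "complex \<Rightarrow> complex \<Rightarrow> complex \<Rightarrow> complex \<Rightarrow> complex^4" where
    "v4 a b c d = (\<chi> i. if i = 1 then a else if i = 2 then b else if i = 3 then c else d)" for a b c d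
  have v4: "v4 a b c d $ 1 = a" "v4 a b c d $ 2 = b" "v4 a b c d $ 3 = c" "v4 a b c d $ 4 = d" for a b c d
    by (simp_all add: v4_def)
  consider "y $ 1 \<noteq> 0" | "y $ 3 \<noteq> 0" | "y $ 1 = 0" "y $ 3 = 0" by blast
  then show ?thesis
  proof cases
    case 1
    then show ?thesis using assms
      by (intro that[of "v4 1 (y $ 4 / y $ 1) (y $ 1) (y $ 3)"]) (simp add: vec_eq_iff forall_4 segre_point_nth v4 field_simps)
  next
    case 2
    then show ?thesis using assms
      by (intro that[of "v4 1 (y $ 2 / y $ 3) (y $ 1) (y $ 3)"]) (simp add: vec_eq_iff forall_4 segre_point_nth v4 field_simps)
  next
    case 3
    then show ?thesis
      by (intro that[of "v4 0 1 (y $ 4) (y $ 2)"]) (simp add: vec_eq_iff forall_4 segre_point_nth v4)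
  qed
qed

text \<open>Test points with coordinates 0 and 1 force every coefficient relation except the one
  along the equation of the quadric.\<close>

lemma form2_vanishing_on_segre:
  assumes R: "R \<in> forms 2" and van: "\<And>z. eval_poly R (segre_point z) = 0"
  obtains r where "\<And>y. eval_poly R y = r * (y $ 1 * y $ 2 - y $ 3 * y $ 4)"
proof -
  obtain c where c: "R = (\<Sum>i\<in>UNIV. \<Sum>j\<in>UNIV. sgl 0 (c i j) * (var i * var j))" by (rule form2_expansion[OF R])
  have Re: "eval_poly R x = (\<Sum>i\<in>UNIV. \<Sum>j\<in>UNIV. c i j * (x $ i * x $ j))" for x
    unfolding c eval_poly_psubst id_hom.psubst_sum id_hom.psubst_mult id_hom.psubst_const id_hom.psubst_var by (rule refl)
  define v4 :: "complex \<Rightarrow> complex \<Rightarrow> complex \<Rightarrow> complex \<Rightarrow> complex^4" where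
    "v4 a b c d = (\<chi> i. if i = 1 then a else if i = 2 then b else if i = 3 then c else d)" for a b c d
  have v4: "v4 a b c d $ 1 = a" "v4 a b c d $ 2 = b" "v4 a b c d $ 3 = c" "v4 a b c d $ 4 = d" for a b c d
    by (simp_all add: v4_def)
  have e: "eval_poly R (segre_point (v4 a b c d)) = 0" for a b c d by (rule van)
  note ev = e[unfolded Re sum_4 segre_point_nth v4]
  have diag: "c 1 1 = 0" "c 2 2 = 0" "c 3 3 = 0" "c 4 4 = 0"
    using ev[of 1 1 0 0] ev[of 0 0 1 1] ev[of 1 0 0 1] ev[of 0 1 1 0] by simp_all
  have off: "c 3 1 = - c 1 3" "c 4 1 = - c 1 4" "c 3 2 = - c 2 3" "c 4 2 = - c 2 4"
    using ev[of 1 1 0 1] ev[of 1 1 1 0] ev[of 1 0 1 1] ev[of 0 1 1 1]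
    by (simp_all add: diag eq_neg_iff_add_eq_0 add.commute)
  have "c 1 2 + c 2 1 + c 3 4 + c 4 3 = 0"
    using ev[of 1 1 1 1] by (simp add: diag off algebra_simps)
  then have c43: "c 4 3 = - c 3 4 - c 1 2 - c 2 1" by algebra
  have "eval_poly R y = (c 1 2 + c 2 1) * (y $ 1 * y $ 2 - y $ 3 * y $ 4)" for y
    by (simp add: Re sum_4 diag off c43 algebra_simps)
  then show ?thesis by (rule that)
qed

text \<open>Monomials of bidegree (2, 2), centred at the product of the four coordinates.\<close>

definition quadric_exponent :: "int \<times> int \<Rightarrow> (4 \<Rightarrow>\<^sub>0 nat)" where
  "quadric_exponent u = sgl 1 (nat (fst u + 1)) + sgl 2 (nat (1 - fst u)) + sgl 3 (nat (snd u + 1)) + sgl 4 (nat (1 - snd u))"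

lemma coef_quadric_exponent:
  "coef (quadric_exponent u) 1 = nat (fst u + 1)" "coef (quadric_exponent u) 2 = nat (1 - fst u)"
  "coef (quadric_exponent u) 3 = nat (snd u + 1)" "coef (quadric_exponent u) 4 = nat (1 - snd u)"
  by (simp_all add: quadric_exponent_def lookup_add lookup_single when_def)

lemma psub_segre_bidegree:
  assumes "F \<in> forms 2" "coef (psub segre F) m \<noteq> 0"
  shows "coef m 1 + coef m 2 = 2 \<and> coef m 3 + coef m 4 = 2"
proof (rule ccontr)
  assume neg: "\<not> ?thesis"
  obtain c where c: "F = (\<Sum>i\<in>UNIV. \<Sum>j\<in>UNIV. sgl 0 (c i j) * (var i * var j))" by (rule form2_expansion[OF assms(1)])
  have "\<exists>s. segre i = sgl s 1 \<and> coef s 1 + coef s 2 = 1 \<and> coef s 3 + coef s 4 = 1" for i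
    unfolding segre_def var_def mult_single by (auto simp: lookup_add lookup_single when_def)
  then obtain s where s: "\<And>i. segre i = sgl (s i) 1" "\<And>i. coef (s i) 1 + coef (s i) 2 = 1" "\<And>i. coef (s i) 3 + coef (s i) 4 = 1"
    by metis
  have ne: "s i + s j \<noteq> m" for i j
    using neg s(2)[of i] s(2)[of j] s(3)[of i] s(3)[of j] by (auto simp: lookup_add)
  have "coef (sgl 0 (c i j) * (segre i * segre j)) m = 0" for i j
    using ne[of i j] by (simp add: s(1) mult_single lookup_single)
  then have "coef (psub segre F) m = 0"
    unfolding c const_hom.psubst_sum const_hom.psubst_mult const_hom.psubst_const const_hom.psubst_var lookup_sum by simp
  then show False using assms(2) by simp
qed

lemma prod_4: "prod f (UNIV :: 4 set) = f 1 * f 2 * f 3 * f 4"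
  unfolding UNIV_4 by (simp add: ac_simps)

lemma monomial_quadric_exponent:
  fixes z :: "complex^4"
  assumes "u \<in> {-1..1} \<times> {-1..1}" "\<And>i. z $ i \<noteq> 0"
  shows "(\<Prod>i\<in>UNIV. z $ i ^ coef (quadric_exponent u) i)
    = z $ 1 * z $ 2 * z $ 3 * z $ 4 * torus_char (z $ 1 / z $ 2, z $ 3 / z $ 4) u"
proof -
  have pw: "x ^ nat k = x powi k" if "k \<ge> 0" for x :: complex and k :: int using that by (simp add: power_int_def)
  have "(\<Prod>i\<in>UNIV. z $ i ^ coef (quadric_exponent u) i)
      = z $ 1 powi (fst u + 1) * z $ 2 powi (1 - fst u) * z $ 3 powi (snd u + 1) * z $ 4 powi (1 - snd u)"
    using assms(1) by (auto simp: prod_4 coef_quadric_exponent pw)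
  then show ?thesis using assms(2)
    by (simp add: torus_char_def power_int_add power_int_diff power_int_divide_distrib field_simps)
qed

text \<open>Composition with the Segre map turns quadratic forms into forms of bidegree (2, 2). A
  relation among the restricted \<open>f j\<close> is a multiple of \<open>q\<close>, which the
  basis \<open>q, f\<close> of all quadratic forms excludes.\<close>

lemma quadric_toric_model:
  fixes X :: "(complex^9) set"
  assumes X: "double_veronese_quadric X"
  obtains al ga where "toric_model ({-1..1} \<times> {-1..1}) X al ga"
proof -
  let ?A = "{-1..1} \<times> {-1..1} :: (int \<times> int) set"
  obtain q f where q: "smooth_quadric q" and f: "is_basis (case_option q f) (forms 2)"
    and Xf: "X = proj_image f (proj_zeros {q})"
    using X unfolding double_veronese_quadric_def by blast
  obtain b :: "4 \<Rightarrow> complex^4"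
    where bq: "\<And>y. eval_poly q (\<Sum>k\<in>UNIV. y $ k *s b k) = y $ 1 * y $ 2 - y $ 3 * y $ 4"
      and bs: "\<And>w. \<exists>y. w = (\<Sum>k\<in>UNIV. y $ k *s b k)"
    by (rule smooth_quadric_normal_form[OF q]) (rule that)
  have inj: "inj (case_option q f)" and ind: "poly_vs.independent (range (case_option q f))"
    and span: "poly_vs.span (range (case_option q f)) = forms 2"
    using f by (auto simp: is_basis_def)
  have "case_option q f (Some j) \<in> poly_vs.span (range (case_option q f))" for j
    by (intro poly_vs.span_base rangeI)
  then have ff: "f j \<in> forms 2" for j unfolding span by simp
  define G :: "4 \<Rightarrow> 4 mpoly" where "G i = (\<Sum>k\<in>UNIV. const_scale (b k $ i) (var k))" for i
  have G1: "G i \<in> forms 1" for i unfolding G_def by (intro forms_sum forms_scale forms_var)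
  have Gev: "(\<chi> i. eval_poly (G i) y) = (\<Sum>k\<in>UNIV. y $ k *s b k)" for y
    by (simp add: G_def vec_eq_iff eval_sum eval_scale eval_var mult.commute)
  define g where "g y = (\<Sum>k\<in>UNIV. y $ k *s b k)" for y
  have fG: "psub G (f j) \<in> forms 2" for j using psub_forms[where F = "f j", OF ff G1] by simp
  define h where "h j = psub segre (psub G (f j))" for j
  have hev: "eval_poly (h j) z = eval_poly (f j) (g (segre_point z))" for j z
    by (simp add: h_def eval_psub eval_segre Gev g_def)
  have supp: "supp (h j) \<subseteq> quadric_exponent ` ?A" for j
  proof
    fix m assume "m \<in> supp (h j)"
    then have m: "coef m 1 + coef m 2 = 2 \<and> coef m 3 + coef m 4 = 2"
      unfolding h_def by (intro psub_segre_bidegree[OF fG]) (simp add: in_keys_iff)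
    have "m = quadric_exponent (int (coef m 1) - 1, int (coef m 3) - 1)"
    proof (rule poly_mapping_eqI)
      fix i :: 4
      show "coef m i = coef (quadric_exponent (int (coef m 1) - 1, int (coef m 3) - 1)) i"
        using m exhaust_4[of i] by (auto simp: coef_quadric_exponent)
    qed
    moreover have "(int (coef m 1) - 1, int (coef m 3) - 1) \<in> ?A" using m by auto
    ultimately show "m \<in> quadric_exponent ` ?A" by (rule image_eqI)
  qed
  have ex: "inj_on quadric_exponent ?A"
  proof (rule inj_onI)
    fix u v assume uv: "u \<in> ?A" "v \<in> ?A" and "quadric_exponent u = quadric_exponent v"
    then have "nat (fst u + 1) = nat (fst v + 1)" "nat (snd u + 1) = nat (snd v + 1)"
      by (metis coef_quadric_exponent(1), metis coef_quadric_exponent(3))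
    moreover have "fst u \<ge> -1" "fst v \<ge> -1" "snd u \<ge> -1" "snd v \<ge> -1" using uv by auto
    ultimately show "u = v" unfolding prod_eq_iff by arith
  qed
  have A: "finite ?A" "card ?A = CARD(9)" "0 \<in> ?A" by (auto simp: zero_prod_def)
  show ?thesis
  proof (rule toric_modelI[OF A ex supp])
    show "c j = 0" if c: "(\<Sum>j\<in>UNIV. const_scale (c j) (h j)) = 0" for c j
    proof -
      let ?P = "\<Sum>j\<in>UNIV. const_scale (c j) (f j)"
      have "?P \<in> forms 2" by (intro forms_sum forms_scale ff)
      then have PG: "psub G ?P \<in> forms 2" using psub_forms[where F = ?P and n = 2, OF _ G1] by simp
      have Pev: "eval_poly (psub G ?P) y = (\<Sum>j\<in>UNIV. c j * eval_poly (f j) (g y))" for y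
        by (simp add: eval_psub Gev g_def eval_sum eval_scale)
      have Pz: "eval_poly (psub G ?P) (segre_point z) = 0" for z
        using arg_cong[OF c, of "\<lambda>F. eval_poly F z"] by (simp add: Pev eval_sum eval_scale hev eval_poly_def[of 0])
      obtain r where r0: "\<And>y. eval_poly (psub G ?P) y = r * (y $ 1 * y $ 2 - y $ 3 * y $ 4)"
        by (rule form2_vanishing_on_segre[OF PG Pz]) (rule that)
      have r: "(\<Sum>j\<in>UNIV. c j * eval_poly (f j) (g y)) = r * (y $ 1 * y $ 2 - y $ 3 * y $ 4)" for y
        using r0[of y] unfolding Pev .
      \<comment> \<open>\<open>None\<close> is the index of \<open>q\<close>; its coefficient
        \<open>- r\<close> cancels the multiple of the equation.\<close>
      let ?c = "case_option (- r) c"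
      have sum_opt: "(\<Sum>i\<in>UNIV. const_scale (?c i) (case_option q f i)) = const_scale (- r) q + ?P"
        by (simp add: UNIV_option_conv sum.reindex)
      have "eval_poly (const_scale (- r) q + ?P) w = 0" for w
      proof -
        obtain y where y: "w = g y" using bs unfolding g_def by blast
        have "eval_poly (const_scale (- r) q + ?P) w = - r * eval_poly q w + eval_poly ?P w"
          by (simp only: eval_poly_psubst id_hom.psubst_add id_hom.psubst_scale)
        also have "eval_poly q w = y $ 1 * y $ 2 - y $ 3 * y $ 4" unfolding y g_def by (rule bq)
        also have "eval_poly ?P w = r * (y $ 1 * y $ 2 - y $ 3 * y $ 4)"
          unfolding y r[symmetric] by (simp add: eval_sum eval_scale)
        finally show ?thesis by simp
      qed
      then have "const_scale (- r) q + ?P = 0" by (rule eval_poly_eq_zero)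
      then have "(\<Sum>i\<in>UNIV. const_scale (?c i) (case_option q f i)) = 0" using sum_opt by simp
      then have "?c (Some j) = 0" by (rule pv.family_independentD[OF finite inj ind]) simp
      then show ?thesis by simp
    qed
    show "\<exists>s\<in>torus. \<exists>d. d \<noteq> 0 \<and> (\<forall>u\<in>?A. (\<Prod>i\<in>UNIV. z $ i ^ coef (quadric_exponent u) i) = d * torus_char s u)"
      if z: "\<And>i. z $ i \<noteq> 0" for z :: "complex^4"
      by (intro bexI[of _ "(z $ 1 / z $ 2, z $ 3 / z $ 4)"] exI[of _ "z $ 1 * z $ 2 * z $ 3 * z $ 4"] conjI ballI
        monomial_quadric_exponent) (use z in \<open>auto simp: torus_def\<close>)
    show "\<exists>z. (\<forall>i. z $ i \<noteq> 0) \<and> (\<exists>d. d \<noteq> 0 \<and> (\<forall>u\<in>?A. (\<Prod>i\<in>UNIV. z $ i ^ coef (quadric_exponent u) i) = d * torus_char s u))"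
      if s: "s \<in> torus" for s
    proof -
      define z :: "complex^4" where "z = (\<chi> i. if i = 1 then fst s else if i = 3 then snd s else 1)"
      have zi: "z $ 1 = fst s" "z $ 2 = 1" "z $ 3 = snd s" "z $ 4 = 1" by (simp_all add: z_def)
      have z0: "z $ i \<noteq> 0" for i using s by (simp add: z_def torus_def)
      have "(\<Prod>i\<in>UNIV. z $ i ^ coef (quadric_exponent u) i) = (fst s * snd s) * torus_char s u" if "u \<in> ?A" for u
        using monomial_quadric_exponent[OF that z0] by (simp add: zi)
      then show ?thesis using s z0 by (intro exI[of _ z] conjI exI[of _ "fst s * snd s"]) (auto simp: torus_def)
    qed
    show "c *s (\<chi> j. eval_poly (h j) z) \<in> X" if "c \<noteq> 0" "(\<chi> j. eval_poly (h j) z) \<noteq> 0" for z c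
    proof -
      let ?w = "g (segre_point z)"
      have "?w \<noteq> 0"
      proof
        assume w0: "?w = 0"
        have "eval_poly (f j) 0 = 0" for j using eval_homogeneous[OF ff, of j 0 0] by simp
        then have "(\<chi> j. eval_poly (h j) z) = 0" unfolding hev w0 by (simp add: vec_eq_iff)
        then show False using that(2) by simp
      qed
      moreover have "eval_poly q ?w = 0" by (simp add: g_def bq segre_point_nth)
      ultimately have w: "?w \<in> proj_zeros {q}" by (simp add: proj_zeros_def)
      show ?thesis unfolding Xf proj_image_def
      proof (intro CollectI conjI bexI exI)
        show "c *s (\<chi> j. eval_poly (h j) z) \<noteq> 0" using that by (simp add: vector_mul_eq_0)
        show "c *s (\<chi> j. eval_poly (h j) z) = c *s (\<chi> j. eval_poly (f j) ?w)" by (simp only: hev)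
      qed (rule w)
    qed
    show "eval_poly F x = 0" if F: "F \<in> forms k" and 0: "\<And>z. eval_poly F (\<chi> j. eval_poly (h j) z) = 0" and x: "x \<in> X" for k F x
    proof -
      obtain w c where w: "w \<in> proj_zeros {q}" and xw: "x = c *s (\<chi> j. eval_poly (f j) w)"
        using x unfolding Xf proj_image_def by blast
      obtain y where y: "w = g y" using bs unfolding g_def by blast
      have "y $ 1 * y $ 2 = y $ 3 * y $ 4" using w by (simp add: proj_zeros_def y g_def bq)
      then obtain z where z: "y = segre_point z" by (rule segre_point_surj)
      have "eval_poly F (\<chi> j. eval_poly (f j) w) = 0" using 0[of z] unfolding hev y z .
      then show ?thesis by (simp only: xw eval_homogeneous[OF F] mult_zero_right)
    qed
  qed (rule that)
qed


section \<open>The four surfaces\<close>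

lemma cubic_exponent_cases:
  assumes "mdeg (m :: 3 \<Rightarrow>\<^sub>0 nat) = 3"
  defines "u \<equiv> (int (coef m 1) - 1, int (coef m 2) - 1)"
  shows "u \<in> set hexagon_pts \<or> m = sgl 1 3 \<and> u = (2, -1) \<or> m = sgl 2 3 \<and> u = (-1, 2) \<or> m = sgl 3 3"
proof -
  have s: "coef m 1 + coef m 2 + coef m 3 = 3" using assms(1) by (simp add: sum_3)
  have single: "m = sgl k 3" if "coef m k = 3" for k
  proof (rule poly_mapping_eqI)
    fix i show "coef m i = coef (sgl k 3) i"
      using s that exhaust_3[of i] exhaust_3[of k] by (auto simp: lookup_single when_def)
  qed
  have "coef m 1 = 0 \<or> coef m 1 = 1 \<or> coef m 1 = 2 \<or> coef m 1 = 3" "coef m 2 = 0 \<or> coef m 2 = 1 \<or> coef m 2 = 2 \<or> coef m 2 = 3"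
    using s by linarith+
  then show ?thesis
    using s single[of 1] single[of 2] single[of 3] by (elim disjE) (simp_all add: u_def hexagon_pts_def)
qed

lemma triangle_trapezoid: "u \<in> set trapezoid_pts \<Longrightarrow> in_plane_triangle u"
  by (auto simp: trapezoid_pts_def pentagon_pts_def hexagon_pts_def in_plane_triangle_def)

lemma set_filter_zero: "set (filter (\<lambda>u. u \<noteq> (0, 0)) P) = set P - {0 :: int \<times> int}"
  by (auto simp: zero_prod_def)

lemma trapezoid_model:
  fixes X :: "(complex^9) set"
  assumes "anticanonical_blowup_plane 8 X" obtains al ga where "toric_model (lat_of trapezoid_edges 1) X al ga"
proof (rule blowup_toric_model[OF assms, where R = "{3}" and A = "set trapezoid_pts"])
  show "(int (coef m 1) - 1, int (coef m 2) - 1) \<in> set trapezoid_pts" if "mdeg m = 3" "\<forall>k\<in>{3}. m \<noteq> sgl k 3" for m :: "3 \<Rightarrow>\<^sub>0 nat"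
    using cubic_exponent_cases[OF that(1)] that(2) by (auto simp: trapezoid_pts_def pentagon_pts_def)
  show "card (set trapezoid_pts) = CARD(9)" "0 \<in> set trapezoid_pts"
    by (simp_all add: trapezoid_pts_def pentagon_pts_def hexagon_pts_def zero_prod_def)
qed (use triangle_trapezoid that polygon_data.lat1[OF trapezoid] in auto)

lemma pentagon_model:
  fixes X :: "(complex^8) set"
  assumes "anticanonical_blowup_plane 7 X" obtains al ga where "toric_model (lat_of pentagon_edges 1) X al ga"
proof (rule blowup_toric_model[OF assms, where R = "{2, 3}" and A = "set pentagon_pts"])
  show "(int (coef m 1) - 1, int (coef m 2) - 1) \<in> set pentagon_pts" if "mdeg m = 3" "\<forall>k\<in>{2, 3}. m \<noteq> sgl k 3" for m :: "3 \<Rightarrow>\<^sub>0 nat"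
    using cubic_exponent_cases[OF that(1)] that(2) by (auto simp: pentagon_pts_def)
  show "card (set pentagon_pts) = CARD(8)" "0 \<in> set pentagon_pts"
    by (simp_all add: pentagon_pts_def hexagon_pts_def zero_prod_def)
  show "in_plane_triangle u" if "u \<in> set pentagon_pts" for u
    using that by (intro triangle_trapezoid) (simp add: trapezoid_pts_def)
qed (use that polygon_data.lat1[OF pentagon] in auto)

lemma hexagon_model:
  fixes X :: "(complex^7) set"
  assumes "anticanonical_blowup_plane 6 X" obtains al ga where "toric_model (lat_of hexagon_edges 1) X al ga"
proof (rule blowup_toric_model[OF assms, where R = "{1, 2, 3}" and A = "set hexagon_pts"])
  show "(int (coef m 1) - 1, int (coef m 2) - 1) \<in> set hexagon_pts" if "mdeg m = 3" "\<forall>k\<in>{1, 2, 3}. m \<noteq> sgl k 3" for m :: "3 \<Rightarrow>\<^sub>0 nat"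
    using cubic_exponent_cases[OF that(1)] that(2) by auto
  show "card (set hexagon_pts) = CARD(7)" "0 \<in> set hexagon_pts"
    by (simp_all add: hexagon_pts_def zero_prod_def)
  show "in_plane_triangle u" if "u \<in> set hexagon_pts" for u
    using that by (intro triangle_trapezoid) (simp add: trapezoid_pts_def pentagon_pts_def)
qed (use that polygon_data.lat1[OF hexagon] in auto)

lemma square_model:
  fixes X :: "(complex^9) set"
  assumes "double_veronese_quadric X" obtains al ga where "toric_model (lat_of square_edges 1) X al ga"
proof (rule quadric_toric_model[OF assms])
  have "{-1..1::int} = {-1, 0, 1}" by auto
  then have "set square_pts = {-1..1} \<times> {-1..1}" by (auto simp: square_pts_def hexagon_pts_def)
  then show thesis if "toric_model ({-1..1} \<times> {-1..1}) X al ga" for al ga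
    using that \<open>\<And>ga al. toric_model (lat_of square_edges 1) X al ga \<Longrightarrow> thesis\<close> polygon_data.lat1[OF square] by simp
qed

lemma choose_values: "(9::nat) choose 2 = 36" "(8::nat) choose 2 = 28" "(7::nat) choose 2 = 21" "(8::nat) choose 3 = 56"
  by code_simp+

lemma hexagon_case:
  fixes X :: "(complex^7) set"
  assumes "anticanonical_blowup_plane 6 X"
  shows "generic_point (\<lambda>p. \<forall>Y :: (complex^6) set. is_projection_from p X Y \<longrightarrow>
    minimally_generated_by_quadrics_cubics (vanishing_ideal Y) 2 7)"
proof -
  obtain al ga where tm: "toric_model (lat_of hexagon_edges 1) X al ga" by (rule hexagon_model[OF assms])
  show ?thesis
  proof (rule toric_model_generic[OF hexagon tm set_filter_zero hexagon_gen, where Q = "\<lambda>_. True"])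
    fix p and w :: "6 \<Rightarrow> laurent" and a
    assume tp: "toric_projection (lat_of hexagon_edges) p w a" and B: "finite (set hexagon_roots)"
      "set hexagon_roots \<subseteq> boundary (lat_of hexagon_edges) \<times> lat_of hexagon_edges 2"
      "cub_gen (lat_of hexagon_edges) (set hexagon_roots) p"
    interpret toric_projection "lat_of hexagon_edges" p w a by (rule tp)
    \<comment> \<open>21 - 19 = 2 and 56 - 37 = 19. The at most 6 * 2 = 12 products of a variable
      and a quadric leave at least 7 cubics.\<close>
    have "poly_vs.dim (I \<inter> forms 2) = 2" "poly_vs.dim (I \<inter> forms 3) = 19"
      using dim_I[of 2] dim_I[of 3] by (simp_all add: hexagon_card choose_values)
    then show "minimally_generated_by_quadrics_cubics I 2 7"
      by (intro minimally_generated[OF B] cubics_lower_trivial) (use hexagon_card choose_values in simp_all)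
  qed (auto intro: exI[of _ "\<lambda>_. 1"])
qed

lemma pentagon_case:
  fixes X :: "(complex^8) set"
  assumes "anticanonical_blowup_plane 7 X"
  shows "generic_point (\<lambda>p. \<forall>Y :: (complex^7) set. is_projection_from p X Y \<longrightarrow>
    minimally_generated_by_quadrics_cubics (vanishing_ideal Y) 6 3)"
proof -
  obtain al ga where tm: "toric_model (lat_of pentagon_edges 1) X al ga" by (rule pentagon_model[OF assms])
  show ?thesis
  proof (rule toric_model_generic[OF pentagon tm set_filter_zero pentagon_gen, where Q = "\<lambda>p. pentagon_det p \<noteq> 0"])
    fix P :: "complex^8 \<Rightarrow> int \<times> int \<Rightarrow> complex"
    assume poly: "\<And>m. polyfun (\<lambda>x. P x m)" and surj: "\<And>q. \<exists>x. \<forall>m\<in>lat_of pentagon_edges 1. P x m = q m"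
    \<comment> \<open>The three nonzero values are the diagonal entries of
      \<open>pentagon_det\<close>, which becomes the determinant of the identity.\<close>
    obtain x where "\<forall>m\<in>set pentagon_pts. P x m = (if m \<in> {(2,-1), (0,1), (0,-1)} then 1 else 0)"
      using surj[of "\<lambda>m. if m \<in> {(2,-1), (0,1), (0,-1)} then 1 else 0"] unfolding polygon_data.lat1[OF pentagon] by blast
    then have x: "pentagon_det (P x) \<noteq> 0"
      by (simp add: pentagon_pts_def hexagon_pts_def pentagon_det_def det3_def)
    have "polyfun (\<lambda>x. pentagon_det (P x))"
      unfolding pentagon_det_def det3_def by (intro polyfun_add polyfun_diff polyfun_mult poly)
    then show "\<exists>g x0. polyfun g \<and> g x0 \<noteq> 0 \<and> (\<forall>x. g x \<noteq> 0 \<longrightarrow> pentagon_det (P x) \<noteq> 0)"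
      using x by (intro exI[of _ "\<lambda>x. pentagon_det (P x)"] exI[of _ x]) simp
  next
    fix p :: "int \<times> int \<Rightarrow> complex" and c :: complex assume "pentagon_det p \<noteq> 0" "c \<noteq> 0"
    moreover have "pentagon_det (\<lambda>m. c * p m) = c ^ 3 * pentagon_det p"
      by (simp add: pentagon_det_def det3_def power3_eq_cube algebra_simps)
    ultimately show "pentagon_det (\<lambda>m. c * p m) \<noteq> 0" by simp
  next
    fix p and w :: "7 \<Rightarrow> laurent" and a
    assume tp: "toric_projection (lat_of pentagon_edges) p w a" and B: "finite (set pentagon_roots)"
      "set pentagon_roots \<subseteq> boundary (lat_of pentagon_edges) \<times> lat_of pentagon_edges 2"
      "cub_gen (lat_of pentagon_edges) (set pentagon_roots) p" and Q: "pentagon_det p \<noteq> 0"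
    interpret toric_projection "lat_of pentagon_edges" p w a by (rule tp)
    show "minimally_generated_by_quadrics_cubics I 6 3"
      by (intro minimally_generated[OF B] pentagon_lower[OF tp _ Q]) (use pentagon_card choose_values in simp_all)
  qed
qed

lemma trapezoid_case:
  fixes X :: "(complex^9) set"
  assumes "anticanonical_blowup_plane 8 X"
  shows "generic_point (\<lambda>p. \<forall>Y :: (complex^8) set. is_projection_from p X Y \<longrightarrow>
    minimally_generated_by_quadrics_cubics (vanishing_ideal Y) 11 1)"
proof -
  obtain al ga where tm: "toric_model (lat_of trapezoid_edges 1) X al ga" by (rule trapezoid_model[OF assms])
  show ?thesis
  proof (rule toric_model_generic[OF trapezoid tm set_filter_zero trapezoid_gen,
        where Q = "\<lambda>p. trapezoid_det p \<noteq> 0 \<and> trapezoid_lead p \<noteq> 0"])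
    fix P :: "complex^9 \<Rightarrow> int \<times> int \<Rightarrow> complex"
    assume poly: "\<And>m. polyfun (\<lambda>x. P x m)" and surj: "\<And>q. \<exists>x. \<forall>m\<in>lat_of trapezoid_edges 1. P x m = q m"
    \<comment> \<open>These values make the matrix of \<open>trapezoid_det\<close> triangular with 1
      on the diagonal.\<close>
    obtain x where "\<forall>m\<in>set trapezoid_pts. P x m = (if m \<in> {(2,-1), (0,1), (-1,1)} then 1 else 0)"
      using surj[of "\<lambda>m. if m \<in> {(2,-1), (0,1), (-1,1)} then 1 else 0"] unfolding polygon_data.lat1[OF trapezoid] by blast
    then have x: "trapezoid_det (P x) \<noteq> 0"
      by (simp add: trapezoid_pts_def pentagon_pts_def hexagon_pts_def trapezoid_det_def det3_def)
    \<comment> \<open>These values give the antidiagonal permutation matrix in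
      \<open>trapezoid_lead\<close>.\<close>
    obtain y where "\<forall>m\<in>set trapezoid_pts. P y m = (if m \<in> {(0,1), (-1,0)} then 1 else 0)"
      using surj[of "\<lambda>m. if m \<in> {(0,1), (-1,0)} then 1 else 0"] unfolding polygon_data.lat1[OF trapezoid] by blast
    then have y: "trapezoid_lead (P y) \<noteq> 0"
      by (simp add: trapezoid_pts_def pentagon_pts_def hexagon_pts_def trapezoid_lead_def det3_def)
    have pd: "polyfun (\<lambda>x. trapezoid_det (P x))" and pl: "polyfun (\<lambda>x. trapezoid_lead (P x))"
      unfolding trapezoid_det_def trapezoid_lead_def det3_def by (intro polyfun_add polyfun_diff polyfun_mult poly)+
    obtain z where "trapezoid_det (P z) \<noteq> 0" "trapezoid_lead (P z) \<noteq> 0"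
      by (rule polyfun_mult_nonzero[OF pd pl x y]) (rule that)
    then show "\<exists>g x0. polyfun g \<and> g x0 \<noteq> 0 \<and> (\<forall>x. g x \<noteq> 0 \<longrightarrow> trapezoid_det (P x) \<noteq> 0 \<and> trapezoid_lead (P x) \<noteq> 0)"
      using polyfun_mult[OF pd pl]
      by (intro exI[of _ "\<lambda>x. trapezoid_det (P x) * trapezoid_lead (P x)"] exI[of _ z]) simp
  next
    fix p :: "int \<times> int \<Rightarrow> complex" and c :: complex assume "trapezoid_det p \<noteq> 0 \<and> trapezoid_lead p \<noteq> 0" "c \<noteq> 0"
    moreover have "trapezoid_det (\<lambda>m. c * p m) = c ^ 3 * trapezoid_det p" "trapezoid_lead (\<lambda>m. c * p m) = c ^ 3 * trapezoid_lead p"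
      by (simp_all add: trapezoid_det_def trapezoid_lead_def det3_def power3_eq_cube algebra_simps)
    ultimately show "trapezoid_det (\<lambda>m. c * p m) \<noteq> 0 \<and> trapezoid_lead (\<lambda>m. c * p m) \<noteq> 0" by simp
  next
    fix p and w :: "8 \<Rightarrow> laurent" and a
    assume tp: "toric_projection (lat_of trapezoid_edges) p w a" and B: "finite (set trapezoid_roots)"
      "set trapezoid_roots \<subseteq> boundary (lat_of trapezoid_edges) \<times> lat_of trapezoid_edges 2"
      "cub_gen (lat_of trapezoid_edges) (set trapezoid_roots) p" and Q: "trapezoid_det p \<noteq> 0 \<and> trapezoid_lead p \<noteq> 0"
    interpret toric_projection "lat_of trapezoid_edges" p w a by (rule tp)
    show "minimally_generated_by_quadrics_cubics I 11 1"
      by (intro minimally_generated[OF B] trapezoid_lower[OF tp _ conjunct1[OF Q] conjunct2[OF Q]])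
        (use trapezoid_card choose_values in simp_all)
  qed
qed

lemma square_case:
  fixes X :: "(complex^9) set"
  assumes "double_veronese_quadric X"
  shows "generic_point (\<lambda>p. \<forall>Y :: (complex^8) set. is_projection_from p X Y \<longrightarrow>
    minimally_generated_by_quadrics_cubics (vanishing_ideal Y) 11 0)"
proof -
  obtain al ga where tm: "toric_model (lat_of square_edges 1) X al ga" by (rule square_model[OF assms])
  show ?thesis
  proof (rule toric_model_generic[OF square tm set_filter_zero square_gen, where Q = "\<lambda>_. True"])
    fix p and w :: "8 \<Rightarrow> laurent" and a
    assume tp: "toric_projection (lat_of square_edges) p w a" and B: "finite (set square_roots)"
      "set square_roots \<subseteq> boundary (lat_of square_edges) \<times> lat_of square_edges 2"
      "cub_gen (lat_of square_edges) (set square_roots) p"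
    interpret toric_projection "lat_of square_edges" p w a by (rule tp)
    show "minimally_generated_by_quadrics_cubics I 11 0"
      \<comment> \<open>With no cubics to find, the lower bound is just the inclusion of
        \<open>U\<close> in the cubics of the ideal.\<close>
      by (intro minimally_generated[OF B]) (use square_card choose_values pv.dim_mono_fin[OF fin_I subset_trans[OF U_sub poly_vs.span_superset]] in simp_all)
  qed (auto intro: exI[of _ "\<lambda>_. 1"])
qed

theorem proposition2p1:
  shows "(\<forall>F1 :: (complex^9) set. anticanonical_blowup_plane 8 F1 \<longrightarrow>
           generic_point (\<lambda>p. \<forall>Y :: (complex^8) set. is_projection_from p F1 Y \<longrightarrow>
             minimally_generated_by_quadrics_cubics (vanishing_ideal Y) 11 1)) \<and>
         (\<forall>D8 :: (complex^9) set. double_veronese_quadric D8 \<longrightarrow>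
           generic_point (\<lambda>p. \<forall>Y :: (complex^8) set. is_projection_from p D8 Y \<longrightarrow>
             minimally_generated_by_quadrics_cubics (vanishing_ideal Y) 11 0)) \<and>
         (\<forall>D7 :: (complex^8) set. anticanonical_blowup_plane 7 D7 \<longrightarrow>
           generic_point (\<lambda>p. \<forall>Y :: (complex^7) set. is_projection_from p D7 Y \<longrightarrow>
             minimally_generated_by_quadrics_cubics (vanishing_ideal Y) 6 3)) \<and>
         (\<forall>D6 :: (complex^7) set. anticanonical_blowup_plane 6 D6 \<longrightarrow>
           generic_point (\<lambda>p. \<forall>Y :: (complex^6) set. is_projection_from p D6 Y \<longrightarrow>
             minimally_generated_by_quadrics_cubics (vanishing_ideal Y) 2 7))"
  using trapezoid_case square_case pentagon_case hexagon_case by blast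

end
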